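(* Let $(M,\omega)$ be a compact connected Kähler manifold without boundary, of complex dimension $n$. Let $d\phi=d\phi(t)$, $t\in[0,1]$, be a smooth geodesic of the Dirichlet metric in the space $\mathcal{A}$ of Kähler one-forms, and let $t_0\in[0,1]$ be such that $\omega_{\phi(t_0)}$ has constant scalar curvature. Then the K-energy $\nu$ is convex along the geodesic at $t_0$, i.e. $$\frac{d^2}{dt^2}\Big|_{t=t_0}\nu(\phi(t))\ \ge\ 0 .$$
   Context: For $\phi\in C^\infty(M,\mathbb{R})$ put $\omega_\phi=\omega+i\partial\bar\partial\phi$; when $\omega_\phi>0$ let $g_\phi$ be the corresponding Kähler metric. $\mathcal{A}=\{d\phi:\phi\in C^\infty(M,\mathbb{R}),\ \omega_\phi>0\}$, with tangent spaces $\{d\psi:\psi\in C^\infty(M,\mathbb{R})\}$. The Dirichlet metric is $\langle d\psi,d\chi\rangle_{g_\phi}=\int_M(d\psi,d\chi)_{g_\phi}\frac{\omega_\phi^n}{n!}$ with $(d\psi,d\chi)_{g_\phi}=g_\phi^{i\bar j}(\psi_i\chi_{\bar j}+\psi_{\bar j}\chi_i)$. Write $\Delta_\phi f=g_\phi^{i\bar j}f_{i\bar j}$. Let $C[f]$ have components $C[f]_{a\bar b}=(\Delta_\phi f)g_{\phi,a\bar b}-f_{a\bar b}$, and for a real one-form $\alpha$ let $C[f]*\alpha=g_\phi^{a\bar b}C[f]_{a\bar k}\alpha_{\bar b}dz^{\bar k}+g_\phi^{a\bar b}C[f]_{k\bar b}\alpha_a dz^k$. Let $\pi_d$ be the Hodge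 projection (with respect to $g_\phi$) of real one-forms onto exact one-forms. The Levi-Civita covariant derivative of the Dirichlet metric is $D_td\psi=d\psi_t+\frac12\pi_d(C[\phi_t]*d\psi)$, and a smooth curve $d\phi(t)$ is a geodesic if $D_td\phi_t=0$. K-energy: let $S(\phi)=g_\phi^{i\bar j}R_{i\bar j}(g_\phi)$, with $R_{i\bar j}=-\partial_i\partial_{\bar j}\log\det g_\phi$, be the scalar curvature of $\omega_\phi$, and let $\underline S$ be its average with respect to $\omega_\phi^n$ (a constant depending only on the Kähler class). Let $f=f(\phi)$ be the zero-mean function with $\Delta_\phi f=S(\phi)-\underline S$. The K-energy $\nu$ is the functional on Kähler potentials whose variation along any smooth curve $\phi(t)$ is $$\frac{d}{dt}\nu(\phi(t))=\frac12\int_M(d\phi_t,df)_{g_\phi}\frac{\omega_\phi^n}{n!}=-\int_M\phi_t\,(S(\phi)-\underline S)\frac{\omega_\phi^n}{n!};$$ it is defined by integrating this along a path starting at a fixed base point, and is independent of the path. *)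

theory Defs
  imports "HOL-Analysis.Analysis"
begin

section \<open>Smooth functions on subsets of Euclidean spaces\<close>

text \<open>
  Derivatives are taken within \<open>S\<close>. The sets used below are open sets and products
  \<open>{0..1} \<times> W\<close> with \<open>W\<close> open; on these, derivatives within the set are unique, and on
  \<open>{0..1} \<times> W\<close> they are one-sided in the first variable at the two end points.
\<close>

fun Ck_on :: "nat \<Rightarrow> 'a::euclidean_space set \<Rightarrow> ('a \<Rightarrow> 'b::real_normed_vector) \<Rightarrow> bool" where
  "Ck_on 0 S f \<longleftrightarrow> continuous_on S f"
| "Ck_on (Suc k) S f \<longleftrightarrow>
     (\<exists>f'. (\<forall>x\<in>S. (f has_derivative f' x) (at x within S)) \<and> (\<forall>v. Ck_on k S (\<lambda>x. f' x v)))"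

definition smooth_on :: "'a::euclidean_space set \<Rightarrow> ('a \<Rightarrow> 'b::real_normed_vector) \<Rightarrow> bool" where
  "smooth_on S f \<longleftrightarrow> (\<forall>k. Ck_on k S f)"

text \<open>
  \<open>del i\<close> and \<open>delbar i\<close> are the Wirtinger operators \<open>(\<partial>/\<partial>x\<^sub>i \<mp> \<i> \<partial>/\<partial>y\<^sub>i) / 2\<close>.
\<close>

definition del :: "'n::finite \<Rightarrow> (complex^'n \<Rightarrow> complex) \<Rightarrow> complex^'n \<Rightarrow> complex" where
  "del i f z =
     (frechet_derivative f (at z) (axis i 1) - \<i> * frechet_derivative f (at z) (axis i \<i>)) / 2"

definition delbar :: "'n::finite \<Rightarrow> (complex^'n \<Rightarrow> complex) \<Rightarrow> complex^'n \<Rightarrow> complex" where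
  "delbar i f z =
     (frechet_derivative f (at z) (axis i 1) + \<i> * frechet_derivative f (at z) (axis i \<i>)) / 2"

definition holomorphic_map_on :: "(complex^'n::finite) set \<Rightarrow> (complex^'n \<Rightarrow> complex^'n) \<Rightarrow> bool" where
  "holomorphic_map_on S f \<longleftrightarrow>
     smooth_on S f \<and> (\<forall>z\<in>S. \<forall>i k. delbar i (\<lambda>w. f w $ k) z = 0)"


section \<open>Complex manifolds\<close>

text \<open>
  The manifold \<open>M\<close> is the whole type \<open>'a\<close>; its complex dimension \<open>n\<close> is \<open>CARD('n)\<close>.
  A chart is a pair of a domain and a coordinate map; the values of the coordinate map outside
  the domain are irrelevant.
\<close>

type_synonym ('a, 'n) chart = "'a set \<times> ('a \<Rightarrow> complex^'n)"

definition chart_range :: "('a, 'n::finite) chart \<Rightarrow> (complex^'n) set" where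
  "chart_range c = snd c ` fst c"

definition chart_inv :: "('a, 'n::finite) chart \<Rightarrow> complex^'n \<Rightarrow> 'a" where
  "chart_inv c = inv_into (fst c) (snd c)"

definition transition :: "('a, 'n::finite) chart \<Rightarrow> ('a, 'n) chart \<Rightarrow> complex^'n \<Rightarrow> complex^'n" where
  "transition c c' = snd c' \<circ> chart_inv c"

definition holomorphic_atlas :: "('a::topological_space, 'n::finite) chart set \<Rightarrow> bool" where
  "holomorphic_atlas A \<longleftrightarrow>
     (\<forall>c\<in>A. open (fst c) \<and> open (chart_range c) \<and>
        homeomorphism (fst c) (chart_range c) (snd c) (chart_inv c)) \<and>
     (\<Union>c\<in>A. fst c) = UNIV \<and>
     (\<forall>c\<in>A. \<forall>c'\<in>A. holomorphic_map_on (snd c ` (fst c \<inter> fst c')) (transition c c'))"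

text \<open>
  Tensors are given by their components in the charts of the atlas, as functions of the
  coordinates. A scalar computed from components does not depend on the chart; it is
  evaluated at a point by means of an arbitrary chart around that point.
\<close>

definition chart_at :: "('a, 'n::finite) chart set \<Rightarrow> 'a \<Rightarrow> ('a, 'n) chart" where
  "chart_at A p = (SOME c. c \<in> A \<and> p \<in> fst c)"

definition scalar_at ::
  "('a, 'n::finite) chart set \<Rightarrow> (('a, 'n) chart \<Rightarrow> complex^'n \<Rightarrow> complex) \<Rightarrow> 'a \<Rightarrow> complex" where
  "scalar_at A F p = F (chart_at A p) (snd (chart_at A p) p)"

definition smooth_function :: "('a, 'n::finite) chart set \<Rightarrow> ('a \<Rightarrow> real) \<Rightarrow> bool" where
  "smooth_function A u \<longleftrightarrow> (\<forall>c\<in>A. smooth_on (chart_range c) (\<lambda>z. u (chart_inv c z)))"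

definition local_rep :: "('a \<Rightarrow> real) \<Rightarrow> ('a, 'n::finite) chart \<Rightarrow> complex^'n \<Rightarrow> complex" where
  "local_rep u c = (\<lambda>z. complex_of_real (u (chart_inv c z)))"


section \<open>Kaehler forms\<close>

text \<open>
  A real (1,1)-form \<open>\<omega> = \<i> \<Sum>\<^sub>i\<^sub>,\<^sub>j g\<^sub>i\<^sub>j dz\<^sub>i \<and> cnj dz\<^sub>j\<close> and its Hermitian metric are both encoded by the
  components \<open>\<omega> c z $ i $ j = g\<^sub>i\<^sub>j\<close> (the second index is the barred one).
\<close>

type_synonym ('a, 'n) form11 = "('a, 'n) chart \<Rightarrow> complex^'n \<Rightarrow> complex^'n^'n"

definition real_form11 :: "('a, 'n::finite) chart set \<Rightarrow> ('a, 'n) form11 \<Rightarrow> bool" where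
  "real_form11 A \<omega> \<longleftrightarrow>
     (\<forall>c\<in>A. smooth_on (chart_range c) (\<omega> c)) \<and>
     (\<forall>c\<in>A. \<forall>z\<in>chart_range c. \<forall>i j. \<omega> c z $ j $ i = cnj (\<omega> c z $ i $ j)) \<and>
     (\<forall>c\<in>A. \<forall>c'\<in>A. \<forall>z\<in>snd c ` (fst c \<inter> fst c'). \<forall>i j.
        \<omega> c z $ i $ j =
          (\<Sum>k\<in>UNIV. \<Sum>l\<in>UNIV. del i (\<lambda>w. transition c c' w $ k) z *
             cnj (del j (\<lambda>w. transition c c' w $ l) z) * \<omega> c' (transition c c' z) $ k $ l))"

definition positive_form11 :: "('a, 'n::finite) chart set \<Rightarrow> ('a, 'n) form11 \<Rightarrow> bool" where
  "positive_form11 A \<omega> \<longleftrightarrow>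
     (\<forall>c\<in>A. \<forall>z\<in>chart_range c. \<forall>v. v \<noteq> 0 \<longrightarrow>
        Re (\<Sum>i\<in>UNIV. \<Sum>j\<in>UNIV. \<omega> c z $ i $ j * v $ i * cnj (v $ j)) > 0)"

text \<open>For a real (1,1)-form, \<open>d\<omega> = 0\<close> is equivalent to \<open>\<partial>\<omega> = 0\<close>, as \<open>\<omega>\<close> equals its conjugate.\<close>

definition closed_form11 :: "('a, 'n::finite) chart set \<Rightarrow> ('a, 'n) form11 \<Rightarrow> bool" where
  "closed_form11 A \<omega> \<longleftrightarrow>
     (\<forall>c\<in>A. \<forall>z\<in>chart_range c. \<forall>i j k.
        del k (\<lambda>w. \<omega> c w $ i $ j) z = del i (\<lambda>w. \<omega> c w $ k $ j) z)"

definition kahler_form :: "('a, 'n::finite) chart set \<Rightarrow> ('a, 'n) form11 \<Rightarrow> bool" where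
  "kahler_form A \<omega> \<longleftrightarrow> real_form11 A \<omega> \<and> positive_form11 A \<omega> \<and> closed_form11 A \<omega>"

definition ddbar :: "('a \<Rightarrow> real) \<Rightarrow> ('a, 'n::finite) form11" where
  "ddbar u c z = (\<chi> i j. del i (delbar j (local_rep u c)) z)"

definition kform :: "('a, 'n::finite) form11 \<Rightarrow> ('a \<Rightarrow> real) \<Rightarrow> ('a, 'n) form11" where
  "kform \<omega> \<phi> c z = \<omega> c z + ddbar \<phi> c z"

definition kahler_potentials ::
  "('a, 'n::finite) chart set \<Rightarrow> ('a, 'n) form11 \<Rightarrow> ('a \<Rightarrow> real) set" where
  "kahler_potentials A \<omega> = {\<phi>. smooth_function A \<phi> \<and> positive_form11 A (kform \<omega> \<phi>)}"

text \<open>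
  \<open>upper_metric g $ i $ j\<close> has upper indices \<open>i\<close> (unbarred) and \<open>j\<close> (barred) and is normalised by
  \<open>\<Sum>\<^sub>j upper_metric g $ i $ j * g $ k $ j = \<delta>\<^sub>i\<^sub>k\<close>; hence the transpose.
\<close>

definition upper_metric :: "complex^'n::finite^'n \<Rightarrow> complex^'n^'n" where
  "upper_metric g = transpose (matrix_inv g)"

text \<open>
  Integration against \<open>\<omega>\<^sup>n / n!\<close>. Since \<open>\<i> dz \<and> cnj dz = 2 dx \<and> dy\<close>, its density with respect
  to Lebesgue measure in a chart is \<open>2\<^sup>n det g\<close>.
\<close>

definition kahler_volume ::
  "('a::topological_space, 'n::finite) chart set \<Rightarrow> ('a, 'n) form11 \<Rightarrow> 'a measure" where
  "kahler_volume A g =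
     (THE \<mu>. sets \<mu> = sets borel \<and>
        (\<forall>c\<in>A. \<forall>B\<in>sets borel. B \<subseteq> fst c \<longrightarrow>
           emeasure \<mu> B =
             (\<integral>\<^sup>+ z \<in> snd c ` B. ennreal (2 ^ CARD('n) * Re (det (g c z))) \<partial>lborel)))"

definition laplacian ::
  "('a, 'n::finite) form11 \<Rightarrow> ('a \<Rightarrow> real) \<Rightarrow> ('a, 'n) chart \<Rightarrow> complex^'n \<Rightarrow> complex" where
  "laplacian g f c z =
     (\<Sum>i\<in>UNIV. \<Sum>j\<in>UNIV. upper_metric (g c z) $ i $ j * ddbar f c z $ i $ j)"

definition ricci :: "('a, 'n::finite) form11 \<Rightarrow> ('a, 'n) form11" where
  "ricci g c z =
     (\<chi> i j. - del i (delbar j (\<lambda>w. complex_of_real (ln (Re (det (g c w)))))) z)"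

definition scalar_curvature ::
  "('a, 'n::finite) chart set \<Rightarrow> ('a, 'n) form11 \<Rightarrow> 'a \<Rightarrow> real" where
  "scalar_curvature A g p =
     Re (scalar_at A
       (\<lambda>c z. \<Sum>i\<in>UNIV. \<Sum>j\<in>UNIV. upper_metric (g c z) $ i $ j * ricci g c z $ i $ j) p)"

definition average_scalar_curvature ::
  "('a::topological_space, 'n::finite) chart set \<Rightarrow> ('a, 'n) form11 \<Rightarrow> real" where
  "average_scalar_curvature A g =
     (\<integral>p. scalar_curvature A g p \<partial>kahler_volume A g) / measure (kahler_volume A g) UNIV"

definition constant_scalar_curvature ::
  "('a, 'n::finite) chart set \<Rightarrow> ('a, 'n) form11 \<Rightarrow> bool" where
  "constant_scalar_curvature A g \<longleftrightarrow> (\<exists>k. \<forall>p. scalar_curvature A g p = k)"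


section \<open>The Dirichlet metric\<close>

text \<open>
  A real one-form \<open>\<alpha> = \<Sum>\<^sub>k (\<alpha>\<^sub>k dz\<^sub>k + cnj \<alpha>\<^sub>k cnj dz\<^sub>k)\<close> is encoded by its components
  \<open>\<alpha> c z $ k = \<alpha>\<^sub>k\<close>; the components with barred indices are their complex conjugates.
\<close>

type_synonym ('a, 'n) form1 = "('a, 'n) chart \<Rightarrow> complex^'n \<Rightarrow> complex^'n"

definition dform :: "('a \<Rightarrow> real) \<Rightarrow> ('a, 'n::finite) form1" where
  "dform u c z = (\<chi> k. del k (local_rep u c) z)"

definition form_pairing ::
  "('a, 'n::finite) form11 \<Rightarrow> ('a, 'n) form1 \<Rightarrow> ('a, 'n) form1 \<Rightarrow> ('a, 'n) chart \<Rightarrow> complex^'n \<Rightarrow> complex" where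
  "form_pairing g \<alpha> \<beta> c z =
     (\<Sum>i\<in>UNIV. \<Sum>j\<in>UNIV. upper_metric (g c z) $ i $ j *
        (\<alpha> c z $ i * cnj (\<beta> c z $ j) + cnj (\<alpha> c z $ j) * \<beta> c z $ i))"

definition dirichlet_metric ::
  "('a::topological_space, 'n::finite) chart set \<Rightarrow> ('a, 'n) form11 \<Rightarrow> ('a, 'n) form1 \<Rightarrow> ('a, 'n) form1 \<Rightarrow> real" where
  "dirichlet_metric A g \<alpha> \<beta> =
     (\<integral>p. Re (scalar_at A (form_pairing g \<alpha> \<beta>) p) \<partial>kahler_volume A g)"

text \<open>
  The Hodge projection onto exact one-forms is the \<open>L\<^sup>2\<close>-orthogonal projection: \<open>\<alpha>\<close> is mapped to
  the exact form \<open>d\<psi>\<close> such that \<open>\<alpha> - d\<psi>\<close> is orthogonal to all exact forms. The potential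
  \<open>\<psi>\<close> is unique up to a constant.
\<close>

definition exact_projection ::
  "('a::topological_space, 'n::finite) chart set \<Rightarrow> ('a, 'n) form11 \<Rightarrow> ('a, 'n) form1 \<Rightarrow> ('a, 'n) form1" where
  "exact_projection A g \<alpha> =
     dform (SOME \<psi>. smooth_function A \<psi> \<and>
       (\<forall>\<eta>. smooth_function A \<eta> \<longrightarrow>
          dirichlet_metric A g (\<lambda>c z. \<alpha> c z - dform \<psi> c z) (dform \<eta>) = 0))"

definition C_tensor :: "('a, 'n::finite) form11 \<Rightarrow> ('a \<Rightarrow> real) \<Rightarrow> ('a, 'n) form11" where
  "C_tensor g f c z =
     (\<chi> a b. laplacian g f c z * g c z $ a $ b - ddbar f c z $ a $ b)"

text \<open>
  Only the \<open>dz\<^sub>k\<close>-components of \<open>C[f]*\<alpha>\<close> are given; as \<open>g\<close> and \<open>C[f]\<close> are Hermitian, the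
  \<open>cnj dz\<^sub>k\<close>-components are their conjugates.
\<close>

definition C_action ::
  "('a, 'n::finite) form11 \<Rightarrow> ('a \<Rightarrow> real) \<Rightarrow> ('a, 'n) form1 \<Rightarrow> ('a, 'n) form1" where
  "C_action g f \<alpha> c z =
     (\<chi> k. \<Sum>a\<in>UNIV. \<Sum>b\<in>UNIV.
        upper_metric (g c z) $ a $ b * C_tensor g f c z $ k $ b * \<alpha> c z $ a)"

definition time_deriv :: "(real \<Rightarrow> 'a \<Rightarrow> real) \<Rightarrow> real \<Rightarrow> 'a \<Rightarrow> real" where
  "time_deriv \<phi> t p = vector_derivative (\<lambda>s. \<phi> s p) (at t within {0..1})"

definition smooth_curve :: "('a, 'n::finite) chart set \<Rightarrow> (real \<Rightarrow> 'a \<Rightarrow> real) \<Rightarrow> bool" where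
  "smooth_curve A \<phi> \<longleftrightarrow>
     (\<forall>c\<in>A. smooth_on ({0..1} \<times> chart_range c) (\<lambda>(t, z). \<phi> t (chart_inv c z)))"

definition smooth_curve_in_potentials ::
  "('a, 'n::finite) chart set \<Rightarrow> ('a, 'n) form11 \<Rightarrow> (real \<Rightarrow> 'a \<Rightarrow> real) \<Rightarrow> bool" where
  "smooth_curve_in_potentials A \<omega> \<phi> \<longleftrightarrow>
     smooth_curve A \<phi> \<and> (\<forall>t\<in>{0..1}. \<phi> t \<in> kahler_potentials A \<omega>)"

definition covariant_derivative ::
  "('a::topological_space, 'n::finite) chart set \<Rightarrow> ('a, 'n) form11 \<Rightarrow> (real \<Rightarrow> 'a \<Rightarrow> real) \<Rightarrow>
     (real \<Rightarrow> 'a \<Rightarrow> real) \<Rightarrow> real \<Rightarrow> ('a, 'n) form1" where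
  "covariant_derivative A \<omega> \<phi> \<psi> t c z =
     dform (time_deriv \<psi> t) c z +
     (1/2) *\<^sub>R exact_projection A (kform \<omega> (\<phi> t))
       (C_action (kform \<omega> (\<phi> t)) (time_deriv \<phi> t) (dform (\<psi> t))) c z"

text \<open>
  The smooth curve \<open>d\<phi>(t)\<close> in the space of Kaehler one-forms is given by a smooth curve \<open>\<phi>\<close> of
  potentials; the condition below only depends on \<open>d\<phi>(t)\<close>.
\<close>

definition dirichlet_geodesic ::
  "('a::topological_space, 'n::finite) chart set \<Rightarrow> ('a, 'n) form11 \<Rightarrow> (real \<Rightarrow> 'a \<Rightarrow> real) \<Rightarrow> bool" where
  "dirichlet_geodesic A \<omega> \<phi> \<longleftrightarrow>
     smooth_curve_in_potentials A \<omega> \<phi> \<and>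
     (\<forall>t\<in>{0..1}. \<forall>c\<in>A. \<forall>z\<in>chart_range c. covariant_derivative A \<omega> \<phi> (time_deriv \<phi>) t c z = 0)"


section \<open>The K-energy\<close>

text \<open>
  The K-energy is characterised by its first variation along smooth curves of potentials, which
  determines it up to an additive constant (the choice of the base point).
\<close>

definition K_energy ::
  "('a::topological_space, 'n::finite) chart set \<Rightarrow> ('a, 'n) form11 \<Rightarrow> (('a \<Rightarrow> real) \<Rightarrow> real) \<Rightarrow> bool" where
  "K_energy A \<omega> \<nu> \<longleftrightarrow>
     (\<forall>\<phi>. smooth_curve_in_potentials A \<omega> \<phi> \<longrightarrow>
       (\<forall>t\<in>{0..1}.
          ((\<lambda>s. \<nu> (\<phi> s)) has_real_derivative
             - (\<integral>p. time_deriv \<phi> t p *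
                  (scalar_curvature A (kform \<omega> (\<phi> t)) p -
                   average_scalar_curvature A (kform \<omega> (\<phi> t)))
                \<partial>kahler_volume A (kform \<omega> (\<phi> t))))
          (at t within {0..1})))"

end

theory Submission
  imports Defs
begin

text \<open>Let \<open>\<psi> = \<phi>\<^sub>t\<close> at a time \<open>t\<^sub>0\<close> where \<open>S\<close> is constant. The first variation of the K-energy
vanishes there in every direction, so the second derivative is \<open>- \<integral> \<psi> S'\<close>, with no contribution of
the acceleration of the curve, and \<open>S' = - (\<Delta>\<^sup>2 \<psi> + \<langle>Ric, Hess \<psi>\<rangle>)\<close>.
Since \<open>g\<close>, the complex Hessian of \<open>\<psi>\<close> and \<open>Ric\<close> are closed (1,1)-forms and \<open>S\<close> is constant,
integration by parts and the Bochner formula for \<open>\<Delta> |\<partial> \<psi>|\<^sup>2\<close> give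
\<open>- \<integral> \<psi> S' = \<integral> |D \<psi>|\<^sup>2\<close>, where \<open>D \<psi>\<close> is the antiholomorphic derivative of the
(1,0)-gradient of \<open>\<psi>\<close>.\<close>

section \<open>Differential calculus on subsets of Euclidean spaces\<close>

text \<open>No connection is introduced. One divergence identity makes this possible: for a closed
  (1,1)-tensor \<alpha> and a function f, the field obtained from \<alpha> and the gradient of f has
  divergence <\<alpha>, Hess f> + <df, d tr \<alpha>>, because on a Kaehler manifold the derivatives
  of det g and of the inverse metric cancel. Applied to g, Hess \<psi> and Ric it supplies every
  integration by parts, and constancy of S, the trace of Ric, removes the second term in the last
  case. Two obstacles shape the rest. The curve lives on the closed interval \<open>{0..1}\<close>,
  so calculus is done within sets that contain boundary points, and time is treated as one more
  coordinate. The volume is a definite description over Borel measures, so it must be shown to exist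
  and to be unique, which requires the change of variables formula with the squared modulus of the
  complex Jacobian determinant. Test functions are differentiated only once in the integrations by
  parts, so partitions of unity of class C^1 suffice.\<close>

text \<open>Both open sets and products of \<open>{0..1}\<close> with open sets are good domains; the condition makes
  derivatives within the domain unique and mixed ones symmetric.\<close>

definition good_domain :: "'e::euclidean_space set \<Rightarrow> bool" where
  "good_domain S \<longleftrightarrow> S \<subseteq> closure (interior S) \<and>
     (\<forall>x\<in>S. \<forall>i\<in>Basis. \<forall>e>0. \<exists>d. 0 < \<bar>d\<bar> \<and> \<bar>d\<bar> < e \<and> x + d *\<^sub>R i \<in> S)"

definition dd :: "'e::euclidean_space set \<Rightarrow> 'e \<Rightarrow> ('e \<Rightarrow> 'b::real_normed_vector) \<Rightarrow> 'e \<Rightarrow> 'b" where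
  "dd S v f x = frechet_derivative f (at x within S) v"

lemma good_domain_open: fixes S :: "'e::euclidean_space set" assumes "open S" shows "good_domain S"
  unfolding good_domain_def
proof (intro conjI ballI allI impI)
  show "S \<subseteq> closure (interior S)"
    using assms by (simp add: closure_subset interior_open)
  fix x i :: 'e and e :: real assume x: "x \<in> S" and i: "i \<in> Basis" and e: "e > 0"
  obtain r where r: "r > 0" "ball x r \<subseteq> S" using assms x open_contains_ball by blast
  have "x + (min e r / 2) *\<^sub>R i \<in> ball x r" using r e i by (auto simp: dist_norm)
  then show "\<exists>d. 0 < \<bar>d\<bar> \<and> \<bar>d\<bar> < e \<and> x + d *\<^sub>R i \<in> S"
    using r e by (intro exI[of _ "min e r / 2"]) auto
qed

lemma good_domain_time: fixes W :: "'e::euclidean_space set" assumes "open W" shows "good_domain ({0..1::real} \<times> W)"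
  unfolding good_domain_def
proof (intro conjI ballI allI impI)
  show "{0..1::real} \<times> W \<subseteq> closure (interior ({0..1::real} \<times> W))"
    using assms closure_subset[of W] by (auto simp: interior_Times closure_Times interior_open)
  fix x i :: "real \<times> 'e" and e :: real
  assume x: "x \<in> {0..1} \<times> W" and i: "i \<in> Basis" and e: "e > 0"
  obtain t z where tz: "x = (t, z)" "0 \<le> t" "t \<le> 1" "z \<in> W" using x by auto
  have "i = (1, 0) \<or> (\<exists>j\<in>Basis. i = (0, j))" using i by (auto simp: Basis_prod_def)
  then show "\<exists>d. 0 < \<bar>d\<bar> \<and> \<bar>d\<bar> < e \<and> x + d *\<^sub>R i \<in> {0..1} \<times> W"
  proof
    assume i: "i = (1, 0)"
    show ?thesis
    \<comment> \<open>A time step of length at most 1/4 away from the nearer end stays in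
      \<open>{0..1}\<close>; the sign of \<open>d\<close> is left open in \<open>good_domain\<close>
      for this purpose.\<close>
    proof (cases "t < 1/2")
      case True
      then show ?thesis using tz e i by (intro exI[of _ "min e (1/2) / 2"]) auto
    next
      case False
      then show ?thesis using tz e i by (intro exI[of _ "- (min e (1/2) / 2)"]) auto
    qed
  next
    assume "\<exists>j\<in>Basis. i = (0, j)"
    then obtain j where j: "j \<in> Basis" "i = (0, j)" by auto
    from good_domain_open[OF assms] tz j e obtain d where "0 < \<bar>d\<bar>" "\<bar>d\<bar> < e" "z + d *\<^sub>R j \<in> W"
      unfolding good_domain_def by blast
    then show ?thesis using tz j by (intro exI[of _ d]) auto
  qed
qed

text \<open>The second clause of \<open>good_domain\<close> is the hypothesis of
  \<open>frechet_derivative_unique_within\<close>. By uniqueness the choice inside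
  \<open>frechet_derivative\<close> may be replaced by any derivative at hand; the computation rules
  for \<open>dd\<close> and \<open>cd\<close> rest on this.\<close>

lemma dd_eqI:
  assumes "good_domain S" "x \<in> S" "(f has_derivative f') (at x within S)"
  shows "dd S v f x = f' v"
proof -
  have "(f has_derivative frechet_derivative f (at x within S)) (at x within S)"
    using assms(3) frechet_derivative_works differentiableI by blast
  from frechet_derivative_unique_within[OF this assms(3)] assms(1,2) show ?thesis
    unfolding good_domain_def dd_def by simp
qed

lemma Ck_on_cong: "Ck_on k S f \<Longrightarrow> (\<And>x. x \<in> S \<Longrightarrow> f x = g x) \<Longrightarrow> Ck_on k S g"
proof (cases k)
  case (Suc m)
  assume "Ck_on k S f" "\<And>x. x \<in> S \<Longrightarrow> f x = g x"
  then show ?thesis unfolding Suc Ck_on.simps using has_derivative_transform by metis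
qed (use continuous_on_cong in force)

lemma smooth_on_cong: "smooth_on S f \<Longrightarrow> (\<And>x. x \<in> S \<Longrightarrow> f x = g x) \<Longrightarrow> smooth_on S g"
  unfolding smooth_on_def using Ck_on_cong by blast

text \<open>On a good domain the witness in \<open>Ck_on\<close> is forced, so the concrete
  \<open>dd\<close> can take its place; this is what allows derivatives to be iterated as
  functions.\<close>

lemma Ck_on_SucD:
  assumes "good_domain S" "Ck_on (Suc k) S f"
  shows "\<And>x. x \<in> S \<Longrightarrow> (f has_derivative (\<lambda>v. dd S v f x)) (at x within S)"
    "\<And>v. Ck_on k S (dd S v f)"
proof -
  obtain f' where f': "\<And>x. x \<in> S \<Longrightarrow> (f has_derivative f' x) (at x within S)"
     "\<And>v. Ck_on k S (\<lambda>x. f' x v)" using assms by auto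
  have eq: "dd S v f x = f' x v" if "x \<in> S" for x v using dd_eqI[OF assms(1) that f'(1)[OF that]] .
  show "(f has_derivative (\<lambda>v. dd S v f x)) (at x within S)" if "x \<in> S" for x
    using f'(1)[OF that] eq[OF that] by presburger
  show "Ck_on k S (dd S v f)" for v using Ck_on_cong[OF f'(2)] eq by metis
qed

lemma Ck_on_SucI:
  assumes "\<And>x. x \<in> S \<Longrightarrow> (f has_derivative f' x) (at x within S)" "\<And>v. Ck_on k S (\<lambda>x. f' x v)"
  shows "Ck_on (Suc k) S f"
  using assms by auto

lemma Ck_on_SucE:
  assumes "Ck_on (Suc k) S f"
  obtains f' where "\<And>x. x \<in> S \<Longrightarrow> (f has_derivative f' x) (at x within S)" "\<And>v. Ck_on k S (\<lambda>x. f' x v)"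
  using assms by auto

lemma Ck_on_Suc_imp: "Ck_on (Suc k) S f \<Longrightarrow> Ck_on k S f"
proof (induction k arbitrary: f)
  case 0
  then show ?case by (auto intro: has_derivative_continuous_on)
next
  case (Suc k)
  then obtain f' where "\<And>x. x \<in> S \<Longrightarrow> (f has_derivative f' x) (at x within S)"
     "\<And>v. Ck_on (Suc k) S (\<lambda>x. f' x v)" by auto
  then show ?case using Suc.IH by (intro Ck_on_SucI[of S f f']) auto
qed

lemma Ck_on_imp_continuous: "Ck_on k S f \<Longrightarrow> continuous_on S f"
  by (induction k) (auto intro: has_derivative_continuous_on)

lemma smooth_onD:
  assumes "good_domain S" "smooth_on S f"
  shows "\<And>x. x \<in> S \<Longrightarrow> (f has_derivative (\<lambda>v. dd S v f x)) (at x within S)"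
    "smooth_on S (dd S v f)"
  using assms Ck_on_SucD unfolding smooth_on_def by blast+

lemma smooth_on_continuous: "smooth_on S f \<Longrightarrow> continuous_on S f"
  unfolding smooth_on_def using Ck_on_imp_continuous by blast

text \<open>The two functions have the same set of derivatives within \<open>S\<close>, so the
  choice in \<open>frechet_derivative\<close> returns the same value, even where that set is
  empty.\<close>

lemma dd_cong:
  assumes "\<And>y. y \<in> S \<Longrightarrow> f y = g y" "x \<in> S" shows "dd S v f x = dd S v g x"
proof -
  have "\<And>f'. (f has_derivative f') (at x within S) \<longleftrightarrow> (g has_derivative f') (at x within S)"
    using has_derivative_transform[OF assms(2), of g f] has_derivative_transform[OF assms(2), of f g] assms(1)
    by auto
  then show ?thesis unfolding dd_def frechet_derivative_def by simp
qed

section \<open>Closure of C^k and smooth functions under algebraic operations\<close>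

lemma Ck_on_const [simp]: "Ck_on k S (\<lambda>x. c)"
proof (induction k arbitrary: c)
  case (Suc k)
  show ?case by (rule Ck_on_SucI[of _ _ "\<lambda>_ _. 0"]) (auto intro: Suc)
qed auto

lemma Ck_on_add: "Ck_on k S f \<Longrightarrow> Ck_on k S g \<Longrightarrow> Ck_on k S (\<lambda>x. f x + g x)"
proof (induction k arbitrary: f g)
  case (Suc k)
  obtain f' g' where "\<And>x. x \<in> S \<Longrightarrow> (f has_derivative f' x) (at x within S)" "\<And>v. Ck_on k S (\<lambda>x. f' x v)"
    "\<And>x. x \<in> S \<Longrightarrow> (g has_derivative g' x) (at x within S)" "\<And>v. Ck_on k S (\<lambda>x. g' x v)"
    using Suc.prems Ck_on_SucE by metis
  then show ?case using Suc.IH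
    by (intro Ck_on_SucI[of _ _ "\<lambda>x v. f' x v + g' x v"]) (auto intro!: derivative_intros)
qed (auto intro: continuous_intros)

lemma Ck_on_linear: "bounded_linear L \<Longrightarrow> Ck_on k S f \<Longrightarrow> Ck_on k S (\<lambda>x. L (f x))"
proof (induction k arbitrary: f)
  case (Suc k)
  obtain f' where f': "\<And>x. x \<in> S \<Longrightarrow> (f has_derivative f' x) (at x within S)" "\<And>v. Ck_on k S (\<lambda>x. f' x v)"
    using Suc.prems Ck_on_SucE by metis
  show ?case
    by (rule Ck_on_SucI[of _ _ "\<lambda>x v. L (f' x v)"])
       (use Suc f' in \<open>auto intro: bounded_linear.has_derivative\<close>)
qed (auto intro: bounded_linear.continuous_on)

lemma Ck_on_bilinear: "bounded_bilinear B \<Longrightarrow> Ck_on k S f \<Longrightarrow> Ck_on k S g \<Longrightarrow> Ck_on k S (\<lambda>x. B (f x) (g x))"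
proof (induction k arbitrary: f g)
  case (Suc k)
  have "Ck_on k S f" "Ck_on k S g" using Suc.prems Ck_on_Suc_imp by blast+
  moreover obtain f' g' where "\<And>x. x \<in> S \<Longrightarrow> (f has_derivative f' x) (at x within S)" "\<And>v. Ck_on k S (\<lambda>x. f' x v)"
    "\<And>x. x \<in> S \<Longrightarrow> (g has_derivative g' x) (at x within S)" "\<And>v. Ck_on k S (\<lambda>x. g' x v)"
    using Suc.prems Ck_on_SucE by metis
  ultimately show ?case using Suc.IH Suc.prems
    by (intro Ck_on_SucI[of _ _ "\<lambda>x v. B (f x) (g' x v) + B (f' x v) (g x)"])
       (auto intro!: bounded_bilinear.FDERIV Ck_on_add)
qed (auto intro: bounded_bilinear.continuous_on)

lemmas Ck_on_mult = Ck_on_bilinear[OF bounded_bilinear_mult]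
lemmas Ck_on_minus = Ck_on_linear[OF bounded_linear_minus[OF bounded_linear_ident]]

lemma Ck_on_sum: "(\<And>i. i \<in> I \<Longrightarrow> Ck_on k S (f i)) \<Longrightarrow> Ck_on k S (\<lambda>x. \<Sum>i\<in>I. f i x)"
  by (induction I rule: infinite_finite_induct) (auto intro: Ck_on_add)

lemma Ck_on_prod:
  fixes f :: "'i \<Rightarrow> 'e::euclidean_space \<Rightarrow> 'b::real_normed_field"
  shows "(\<And>i. i \<in> I \<Longrightarrow> Ck_on k S (f i)) \<Longrightarrow> Ck_on k S (\<lambda>x. \<Prod>i\<in>I. f i x)"
  by (induction I rule: infinite_finite_induct) (auto intro: Ck_on_mult)

text \<open>The derivative contains \<open>inverse (f x)\<close> itself, but only to order k, where
  the induction hypothesis supplies it.\<close>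

lemma Ck_on_inverse:
  fixes f :: "'e::euclidean_space \<Rightarrow> 'b::real_normed_field"
  assumes "\<And>x. x \<in> S \<Longrightarrow> f x \<noteq> 0"
  shows "Ck_on k S f \<Longrightarrow> Ck_on k S (\<lambda>x. inverse (f x))"
proof (induction k)
  case (Suc k)
  obtain f' where f': "\<And>x. x \<in> S \<Longrightarrow> (f has_derivative f' x) (at x within S)" "\<And>v. Ck_on k S (\<lambda>x. f' x v)"
    using Suc.prems Ck_on_SucE by metis
  have "Ck_on k S (\<lambda>x. inverse (f x))" using Suc Ck_on_Suc_imp by blast
  then show ?case using f' assms
    by (intro Ck_on_SucI[of _ _ "\<lambda>x v. - (inverse (f x) * f' x v * inverse (f x))"])
       (auto intro!: derivative_intros Ck_on_mult Ck_on_minus)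
qed (use assms in \<open>auto intro!: continuous_on_inverse\<close>)

text \<open>The derivative \<open>f' / f\<close> no longer contains the logarithm, so
  \<open>Ck_on_inverse\<close> settles the step and a case distinction replaces induction.\<close>

lemma Ck_on_ln:
  fixes f :: "'e::euclidean_space \<Rightarrow> real"
  assumes "\<And>x. x \<in> S \<Longrightarrow> f x > 0"
  shows "Ck_on k S f \<Longrightarrow> Ck_on k S (\<lambda>x. ln (f x))"
proof (cases k)
  case (Suc m)
  assume k: "Ck_on k S f"
  obtain f' where f': "\<And>x. x \<in> S \<Longrightarrow> (f has_derivative f' x) (at x within S)" "\<And>v. Ck_on m S (\<lambda>x. f' x v)"
    using k Suc Ck_on_SucE by metis
  have nz: "f x \<noteq> 0" if "x \<in> S" for x using assms[OF that] by simp
  have "Ck_on m S (\<lambda>x. inverse (f x))" by (rule Ck_on_inverse[OF nz Ck_on_Suc_imp[OF k[unfolded Suc]]])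
  then show ?thesis unfolding Suc using f' assms
    by (intro Ck_on_SucI[of _ _ "\<lambda>x v. f' x v * inverse (f x)"])
       (auto intro!: derivative_eq_intros Ck_on_mult simp: divide_inverse mult.commute)
next
  case 0
  assume "Ck_on k S f"
  then show ?thesis using 0 by (auto intro!: continuous_intros dest: assms)
qed

lemma smooth_on_const [simp]: "smooth_on S (\<lambda>x. c)" by (simp add: smooth_on_def)
lemma smooth_on_linear: "bounded_linear L \<Longrightarrow> smooth_on S f \<Longrightarrow> smooth_on S (\<lambda>x. L (f x))"
  by (simp add: smooth_on_def Ck_on_linear)
lemma smooth_on_add: "smooth_on S f \<Longrightarrow> smooth_on S g \<Longrightarrow> smooth_on S (\<lambda>x. f x + g x)"
  by (simp add: smooth_on_def Ck_on_add)
lemma smooth_on_minus: "smooth_on S f \<Longrightarrow> smooth_on S (\<lambda>x. - f x)"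
  by (simp add: smooth_on_def Ck_on_minus)
lemma smooth_on_diff: "smooth_on S f \<Longrightarrow> smooth_on S g \<Longrightarrow> smooth_on S (\<lambda>x. f x - g x)"
  using smooth_on_add[OF _ smooth_on_minus] by fastforce
lemma smooth_on_mult:
  fixes f :: "'e::euclidean_space \<Rightarrow> 'b::real_normed_algebra"
  shows "smooth_on S f \<Longrightarrow> smooth_on S g \<Longrightarrow> smooth_on S (\<lambda>x. f x * g x)"
  by (simp add: smooth_on_def Ck_on_mult)
lemma smooth_on_sum: "(\<And>i. i \<in> I \<Longrightarrow> smooth_on S (f i)) \<Longrightarrow> smooth_on S (\<lambda>x. \<Sum>i\<in>I. f i x)"
  by (simp add: smooth_on_def Ck_on_sum)
lemma smooth_on_prod:
  fixes f :: "'i \<Rightarrow> 'e::euclidean_space \<Rightarrow> 'b::real_normed_field"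
  shows "(\<And>i. i \<in> I \<Longrightarrow> smooth_on S (f i)) \<Longrightarrow> smooth_on S (\<lambda>x. \<Prod>i\<in>I. f i x)"
  by (simp add: smooth_on_def Ck_on_prod)
lemma smooth_on_inverse:
  fixes f :: "'e::euclidean_space \<Rightarrow> 'b::real_normed_field"
  shows "smooth_on S f \<Longrightarrow> (\<And>x. x \<in> S \<Longrightarrow> f x \<noteq> 0) \<Longrightarrow> smooth_on S (\<lambda>x. inverse (f x))"
  by (simp add: smooth_on_def Ck_on_inverse)
lemma smooth_on_divide:
  fixes f :: "'e::euclidean_space \<Rightarrow> 'b::real_normed_field"
  shows "smooth_on S f \<Longrightarrow> smooth_on S g \<Longrightarrow> (\<And>x. x \<in> S \<Longrightarrow> g x \<noteq> 0) \<Longrightarrow> smooth_on S (\<lambda>x. f x / g x)"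
  by (simp add: divide_inverse smooth_on_mult smooth_on_inverse)
lemma smooth_on_ln:
  fixes f :: "'e::euclidean_space \<Rightarrow> real"
  shows "smooth_on S f \<Longrightarrow> (\<And>x. x \<in> S \<Longrightarrow> f x > 0) \<Longrightarrow> smooth_on S (\<lambda>x. ln (f x))"
  by (simp add: smooth_on_def Ck_on_ln)

lemmas smooth_on_cnj = smooth_on_linear[OF bounded_linear_cnj]
  and smooth_on_of_real = smooth_on_linear[OF bounded_linear_of_real]
  and smooth_on_Re = smooth_on_linear[OF bounded_linear_Re]
  and smooth_on_Im = smooth_on_linear[OF bounded_linear_Im]
  and smooth_on_nth = smooth_on_linear[OF bounded_linear_vec_nth]

lemmas smooth_intros = smooth_on_const smooth_on_add smooth_on_minus smooth_on_diff smooth_on_mult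
  smooth_on_sum smooth_on_prod smooth_on_cnj smooth_on_of_real smooth_on_Re smooth_on_Im smooth_on_nth

section \<open>Symmetry of second derivatives\<close>

lemma mixed_partials_interior:
  fixes f :: "'e::euclidean_space \<Rightarrow> real"
  assumes U: "open U" "x \<in> U"
    and f: "\<And>y. y \<in> U \<Longrightarrow> (f has_derivative D y) (at y)"
    and v: "\<And>y. y \<in> U \<Longrightarrow> ((\<lambda>y. D y v) has_derivative Dv y) (at y)"
    and w: "\<And>y. y \<in> U \<Longrightarrow> ((\<lambda>y. D y w) has_derivative Dw y) (at y)"
    and cv: "continuous_on U (\<lambda>y. Dv y w)" and cw: "continuous_on U (\<lambda>y. Dw y v)"
  shows "Dv x w = Dw x v"
proof -
  have line: "((\<lambda>s. F (y + s *\<^sub>R a)) has_real_derivative F' (y + s *\<^sub>R a) a) (at s)"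
    if "y + s *\<^sub>R a \<in> U" "\<And>y. y \<in> U \<Longrightarrow> (F has_derivative F' y) (at y)"
    for F :: "'e \<Rightarrow> real" and F' y s a
  proof -
    have "((\<lambda>s. F (y + s *\<^sub>R a)) has_derivative (\<lambda>h. F' (y + s *\<^sub>R a) (h *\<^sub>R a))) (at s)"
      by (rule has_derivative_compose[of "\<lambda>s. y + s *\<^sub>R a" "\<lambda>h. h *\<^sub>R a" _ _ F "F' (y + s *\<^sub>R a)"])
         (auto intro!: derivative_eq_intros that)
    moreover have "F' (y + s *\<^sub>R a) (h *\<^sub>R a) = F' (y + s *\<^sub>R a) a * h" for h
      using linear_scale[OF has_derivative_linear[OF that(2)[OF that(1)]]] by simp
    ultimately show ?thesis by (simp add: has_field_derivative_def mult_commute_abs)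
  qed
  \<comment> \<open>The second difference is symmetric in \<open>v\<close> and \<open>w\<close>. The
    mean value theorem, first along \<open>v\<close> for the difference over two parallel segments
    and then along \<open>w\<close>, writes it as \<open>s * s\<close> times a mixed derivative at a
    point of the parallelogram; exchanging the directions gives the other mixed derivative.\<close>
  have key: "\<exists>a b. 0 < a \<and> a < s \<and> 0 < b \<and> b < s \<and>
      f (x + s *\<^sub>R v + s *\<^sub>R w) - f (x + s *\<^sub>R v) - f (x + s *\<^sub>R w) + f x = s * s * Dv (x + a *\<^sub>R v + b *\<^sub>R w) w"
    if s: "s > 0" and sub: "\<And>a b. 0 \<le> a \<Longrightarrow> a \<le> s \<Longrightarrow> 0 \<le> b \<Longrightarrow> b \<le> s \<Longrightarrow> x + a *\<^sub>R v + b *\<^sub>R w \<in> U"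
    and v: "\<And>y. y \<in> U \<Longrightarrow> ((\<lambda>y. D y v) has_derivative Dv y) (at y)" for s v w Dv
  proof -
    let ?G = "\<lambda>a. f ((x + s *\<^sub>R w) + a *\<^sub>R v) - f (x + a *\<^sub>R v)"
    have "\<exists>a>0. a < s \<and> ?G s - ?G 0 = (s - 0) * (D ((x + s *\<^sub>R w) + a *\<^sub>R v) v - D (x + a *\<^sub>R v) v)"
    proof (rule MVT2[OF s])
      fix a assume a: "0 \<le> a" "a \<le> s"
      have "(x + s *\<^sub>R w) + a *\<^sub>R v \<in> U" "x + a *\<^sub>R v \<in> U"
        using sub[of a s] sub[of a 0] a s by (auto simp: algebra_simps)
      then show "(?G has_real_derivative (D ((x + s *\<^sub>R w) + a *\<^sub>R v) v - D (x + a *\<^sub>R v) v)) (at a)"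
        by (intro DERIV_diff line f)
    qed
    then obtain a where a: "0 < a" "a < s"
      "?G s - ?G 0 = s * (D ((x + s *\<^sub>R w) + a *\<^sub>R v) v - D (x + a *\<^sub>R v) v)" by auto
    let ?H = "\<lambda>b. D ((x + a *\<^sub>R v) + b *\<^sub>R w) v"
    have "\<exists>b>0. b < s \<and> ?H s - ?H 0 = (s - 0) * Dv ((x + a *\<^sub>R v) + b *\<^sub>R w) w"
    proof (rule MVT2[OF s])
      fix b assume b: "0 \<le> b" "b \<le> s"
      show "(?H has_real_derivative Dv ((x + a *\<^sub>R v) + b *\<^sub>R w) w) (at b)"
        using a b by (intro line[of "x + a *\<^sub>R v" b w "\<lambda>y. D y v" Dv] v) (auto intro!: sub)
    qed
    then obtain b where b: "0 < b" "b < s" "?H s - ?H 0 = s * Dv ((x + a *\<^sub>R v) + b *\<^sub>R w) w" by auto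
    show ?thesis using a b by (intro exI[of _ a] exI[of _ b]) (auto simp: algebra_simps)
  qed
  show ?thesis
  proof (rule ccontr)
    assume neq: "Dv x w \<noteq> Dw x v"
    define e where "e = dist (Dv x w) (Dw x v) / 2"
    have e: "e > 0" using neq by (simp add: e_def)
    have "\<exists>d>0. \<forall>y. dist y x < d \<longrightarrow> y \<in> U \<and> dist (Dv y w) (Dv x w) < e \<and> dist (Dw y v) (Dw x v) < e"
    proof -
      obtain r where r: "r > 0" "ball x r \<subseteq> U" using U open_contains_ball by blast
      obtain d1 where d1: "d1 > 0" "\<And>y. y \<in> U \<Longrightarrow> dist y x < d1 \<Longrightarrow> dist (Dv y w) (Dv x w) < e"
        using cv U e unfolding continuous_on_iff by metis
      obtain d2 where d2: "d2 > 0" "\<And>y. y \<in> U \<Longrightarrow> dist y x < d2 \<Longrightarrow> dist (Dw y v) (Dw x v) < e"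
        using cw U e unfolding continuous_on_iff by metis
      show ?thesis using r d1 d2 by (intro exI[of _ "min r (min d1 d2)"]) (auto simp: dist_commute subset_iff)
    qed
    then obtain d where d: "d > 0" "\<And>y. dist y x < d \<Longrightarrow> y \<in> U"
       "\<And>y. dist y x < d \<Longrightarrow> dist (Dv y w) (Dv x w) < e" "\<And>y. dist y x < d \<Longrightarrow> dist (Dw y v) (Dw x v) < e" by auto
    \<comment> \<open>\<open>s\<close> is small enough that the whole parallelogram lies within
      distance \<open>d\<close> of \<open>x\<close>; the summand 1 covers the case
      \<open>v = w = 0\<close>.\<close>
    define s where "s = d / (2 * (norm v + norm w + 1))"
    have s: "s > 0" using d by (simp add: s_def add_nonneg_pos)
    have near: "dist (x + a *\<^sub>R v + b *\<^sub>R w) x < d" if "0 \<le> a" "a \<le> s" "0 \<le> b" "b \<le> s" for a b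
    proof -
      have "dist (x + a *\<^sub>R v + b *\<^sub>R w) x = norm (a *\<^sub>R v + b *\<^sub>R w)" by (simp add: dist_norm add.assoc)
      also have "\<dots> \<le> a * norm v + b * norm w" using that by (intro order.trans[OF norm_triangle_ineq]) simp
      also have "\<dots> \<le> s * norm v + s * norm w" using that by (intro add_mono mult_right_mono) auto
      also have "\<dots> < s * (norm v + norm w + 1) * 2" using s
        by (simp add: algebra_simps add_nonneg_pos add_pos_nonneg)
      also have "\<dots> = d"
      proof -
        have "norm v + norm w + 1 > 0" by (simp add: add_nonneg_pos)
        then show ?thesis by (simp add: s_def field_simps)
      qed
      finally show ?thesis .
    qed
    obtain a b where ab: "0 < a" "a < s" "0 < b" "b < s"
      "f (x + s *\<^sub>R v + s *\<^sub>R w) - f (x + s *\<^sub>R v) - f (x + s *\<^sub>R w) + f x = s * s * Dv (x + a *\<^sub>R v + b *\<^sub>R w) w"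
      using key[OF s _ v, of w] near d(2) by blast
    have sub': "x + a *\<^sub>R w + b *\<^sub>R v \<in> U" if "0 \<le> a" "a \<le> s" "0 \<le> b" "b \<le> s" for a b
      using near[of b a] d(2) that by (auto simp: algebra_simps)
    obtain a' b' where ab': "0 < a'" "a' < s" "0 < b'" "b' < s"
      "f (x + s *\<^sub>R w + s *\<^sub>R v) - f (x + s *\<^sub>R w) - f (x + s *\<^sub>R v) + f x = s * s * Dw (x + a' *\<^sub>R w + b' *\<^sub>R v) v"
      using key[OF s sub' w] by blast
    have "f (x + s *\<^sub>R w + s *\<^sub>R v) = f (x + s *\<^sub>R v + s *\<^sub>R w)" by (simp add: algebra_simps)
    then have "s * s * Dv (x + a *\<^sub>R v + b *\<^sub>R w) w = s * s * Dw (x + a' *\<^sub>R w + b' *\<^sub>R v) v"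
      using ab(5) ab'(5) by linarith
    then have eq: "Dv (x + a *\<^sub>R v + b *\<^sub>R w) w = Dw (x + a' *\<^sub>R w + b' *\<^sub>R v) v" using s by simp
    have "dist (Dv (x + a *\<^sub>R v + b *\<^sub>R w) w) (Dv x w) < e" using ab by (intro d near) auto
    moreover have "dist (Dw (x + a' *\<^sub>R w + b' *\<^sub>R v) v) (Dw x v) < e"
      using near[of b' a'] ab' by (intro d) (auto simp: algebra_simps)
    ultimately show False using eq unfolding e_def
      by (metis dist_commute dist_triangle_half_r less_irrefl)
  qed
qed

lemma dd_linear_comp:
  assumes "good_domain S" "smooth_on S f" "x \<in> S" "bounded_linear L"
  shows "dd S v (\<lambda>x. L (f x)) x = L (dd S v f x)"
  by (rule dd_eqI[OF assms(1,3)]) (rule bounded_linear.has_derivative[OF assms(4) smooth_onD(1)[OF assms(1-3)]])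

text \<open>In the interior this is the classical theorem. Points of \<open>S\<close> are limits of
  interior points and both mixed derivatives are continuous on \<open>S\<close>, so the identity
  extends to the boundary, in particular to the end points of the time interval.\<close>

lemma dd_commute_real:
  fixes f :: "'e::euclidean_space \<Rightarrow> real"
  assumes S: "good_domain S" and f: "smooth_on S f" and x: "x \<in> S"
  shows "dd S v (dd S w f) x = dd S w (dd S v f) x"
proof -
  note sm = smooth_onD[OF S]
  have int: "dd S v (dd S w f) x = dd S w (dd S v f) x" if x: "x \<in> interior S" for x
  proof -
    have at: "y \<in> S" "at y within S = at y" if "y \<in> interior S" for y
      using that interior_subset at_within_interior[of y S] by auto
    show ?thesis
    proof (rule mixed_partials_interior[of "interior S" x f "\<lambda>y v. dd S v f y" w "\<lambda>y v. dd S v (dd S w f) y" v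
           "\<lambda>y w. dd S w (dd S v f) y"])
      show "(f has_derivative (\<lambda>v. dd S v f y)) (at y)" if "y \<in> interior S" for y
        using sm(1)[OF f, of y] at[OF that] by simp
      show "((\<lambda>y. dd S w f y) has_derivative (\<lambda>v. dd S v (dd S w f) y)) (at y)" if "y \<in> interior S" for y
        using sm(1)[OF sm(2)[OF f], of y] at[OF that] by simp
      show "((\<lambda>y. dd S v f y) has_derivative (\<lambda>w. dd S w (dd S v f) y)) (at y)" if "y \<in> interior S" for y
        using sm(1)[OF sm(2)[OF f], of y] at[OF that] by simp
    qed (use x in \<open>auto intro!: continuous_on_subset[OF smooth_on_continuous interior_subset] sm f\<close>)
  qed
  let ?d = "\<lambda>x. dd S v (dd S w f) x - dd S w (dd S v f) x"
  have c: "continuous_on S ?d" by (intro continuous_intros smooth_on_continuous sm f)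
  show ?thesis
  proof (rule ccontr)
    assume "\<not> ?thesis"
    then have "\<bar>?d x\<bar> > 0" by simp
    then obtain d where d: "d > 0" "\<And>y. y \<in> S \<Longrightarrow> dist y x < d \<Longrightarrow> dist (?d y) (?d x) < \<bar>?d x\<bar>"
      using c x unfolding continuous_on_iff by metis
    have "x \<in> closure (interior S)" using S x unfolding good_domain_def by auto
    then obtain y where "y \<in> interior S" "dist y x < d" using d(1) closure_approachable by blast
    with d(2)[of y] int[of y] interior_subset[of S] show False by (auto simp: dist_norm)
  qed
qed

text \<open>Split into real and imaginary part, since the mean value argument behind the real case
  is tied to real values.\<close>

lemma dd_commute:
  fixes f :: "'e::euclidean_space \<Rightarrow> complex"
  assumes S: "good_domain S" and f: "smooth_on S f" and x: "x \<in> S"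
  shows "dd S v (dd S w f) x = dd S w (dd S v f) x"
proof -
  have *: "L (dd S v (dd S w f) x) = L (dd S w (dd S v f) x)" if L: "bounded_linear L" for L :: "complex \<Rightarrow> real"
  proof -
    have eq: "dd S v (dd S w (\<lambda>x. L (f x))) x = L (dd S v (dd S w f) x)" for v w
    proof -
      have "dd S v (dd S w (\<lambda>x. L (f x))) x = dd S v (\<lambda>x. L (dd S w f x)) x"
        by (rule dd_cong[OF _ x]) (rule dd_linear_comp[OF S f _ L])
      also have "\<dots> = L (dd S v (dd S w f) x)"
        by (rule dd_linear_comp[OF S smooth_onD(2)[OF S f] x L])
      finally show ?thesis .
    qed
    show ?thesis using dd_commute_real[OF S smooth_on_linear[OF L f] x, of v w] unfolding eq .
  qed
  show ?thesis using *[OF bounded_linear_Re] *[OF bounded_linear_Im] by (rule complex_eqI)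
qed

section \<open>Matrices of functions\<close>

text \<open>The pair \<open>(p, q)\<close> stands for the complexified direction \<open>p + \<i> q\<close>.\<close>

definition cd :: "'e::euclidean_space set \<Rightarrow> 'e \<times> 'e \<Rightarrow> ('e \<Rightarrow> complex) \<Rightarrow> 'e \<Rightarrow> complex" where
  "cd S v f x = dd S (fst v) f x + \<i> * dd S (snd v) f x"

lemma cd_cong: "(\<And>y. y \<in> S \<Longrightarrow> f y = g y) \<Longrightarrow> x \<in> S \<Longrightarrow> cd S v f x = cd S v g x"
  unfolding cd_def using dd_cong by metis

lemma smooth_cd: "good_domain S \<Longrightarrow> smooth_on S f \<Longrightarrow> smooth_on S (cd S v f)"
  unfolding cd_def[abs_def] by (intro smooth_intros smooth_onD(2))

lemma cd_const: "good_domain S \<Longrightarrow> x \<in> S \<Longrightarrow> cd S v (\<lambda>x. c) x = 0"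
  unfolding cd_def using dd_eqI[of S x "\<lambda>_. c" "\<lambda>_. 0"] by simp

lemma cd_add:
  assumes "good_domain S" "smooth_on S f" "smooth_on S g" "x \<in> S"
  shows "cd S v (\<lambda>x. f x + g x) x = cd S v f x + cd S v g x"
  using dd_eqI[OF assms(1,4) has_derivative_add[OF smooth_onD(1) smooth_onD(1)], OF assms(1,2,4,1,3,4)]
  unfolding cd_def by (simp add: algebra_simps)

lemma cd_mult:
  assumes "good_domain S" "smooth_on S f" "smooth_on S g" "x \<in> S"
  shows "cd S v (\<lambda>x. f x * g x) x = f x * cd S v g x + cd S v f x * g x"
  using dd_eqI[OF assms(1,4) has_derivative_mult[OF smooth_onD(1) smooth_onD(1)], OF assms(1,2,4,1,3,4)]
  unfolding cd_def by (simp add: algebra_simps)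

lemma cd_minus: "good_domain S \<Longrightarrow> smooth_on S f \<Longrightarrow> x \<in> S \<Longrightarrow> cd S v (\<lambda>x. - f x) x = - cd S v f x"
  using dd_linear_comp[OF _ _ _ bounded_linear_minus[OF bounded_linear_ident], of S f x]
  unfolding cd_def by simp

lemma cd_sum:
  assumes "good_domain S" "finite I" "\<And>i. i \<in> I \<Longrightarrow> smooth_on S (f i)" "x \<in> S"
  shows "cd S v (\<lambda>x. \<Sum>i\<in>I. f i x) x = (\<Sum>i\<in>I. cd S v (f i) x)"
  using assms(2,3)
proof (induction I rule: finite_induct)
  case (insert i I)
  then show ?case using assms by (simp add: cd_add smooth_on_sum)
qed (simp add: cd_const assms)

lemma cd_diff: "good_domain S \<Longrightarrow> smooth_on S f \<Longrightarrow> smooth_on S g \<Longrightarrow> x \<in> S \<Longrightarrow>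
    cd S v (\<lambda>x. f x - g x) x = cd S v f x - cd S v g x"
  using cd_add[of S f "\<lambda>x. - g x" x v] cd_minus[of S g x v] smooth_on_minus[of S g] by simp

text \<open>Conjugation exchanges the complexified directions p + iq and p - iq, hence holomorphic
  and antiholomorphic derivatives.\<close>

lemma cd_cnj: "good_domain S \<Longrightarrow> smooth_on S f \<Longrightarrow> x \<in> S \<Longrightarrow>
    cd S (a, b) (\<lambda>x. cnj (f x)) x = cnj (cd S (a, - b) f x)"
  using dd_linear_comp[OF _ _ _ bounded_linear_cnj, of S f x]
    linear_neg[OF has_derivative_linear[OF smooth_onD(1)], of S f x b]
  unfolding cd_def by simp

lemma cd_commute:
  assumes S: "good_domain S" and f: "smooth_on S f" and x: "x \<in> S"
  shows "cd S v (cd S w f) x = cd S w (cd S v f) x"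
proof -
  have "dd S a (cd S w f) x = dd S a (dd S (fst w) f) x + \<i> * dd S a (dd S (snd w) f) x" for a w
  proof -
    have "dd S a (\<lambda>x. \<i> * dd S (snd w) f x) x = \<i> * dd S a (dd S (snd w) f) x"
      by (rule dd_linear_comp[OF S smooth_onD(2)[OF S f] x bounded_linear_mult_right])
    moreover have "dd S a (\<lambda>x. dd S (fst w) f x + \<i> * dd S (snd w) f x) x =
       dd S a (dd S (fst w) f) x + dd S a (\<lambda>x. \<i> * dd S (snd w) f x) x"
      by (rule dd_eqI[OF S x has_derivative_add[OF smooth_onD(1)[OF S _ x] smooth_onD(1)[OF S _ x]]])
        (intro smooth_intros smooth_onD(2) S f)+
    ultimately show ?thesis unfolding cd_def[abs_def] by simp
  qed
  then show ?thesis using dd_commute[OF S f x] unfolding cd_def[of S v "cd S w f"] cd_def[of S w "cd S v f"]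
    by (simp add: algebra_simps)
qed

section \<open>Derivatives of determinants and of inverse matrices\<close>

lemma det_has_derivative_mat_1:
  fixes M :: "'e::real_normed_vector \<Rightarrow> complex^'n::finite^'n"
  assumes M: "(M has_derivative M') (at x within S)" and 1: "M x = mat 1"
  shows "((\<lambda>y. det (M y)) has_derivative (\<lambda>v. \<Sum>i\<in>UNIV. M' v $ i $ i)) (at x within S)"
proof -
  let ?P = "{p. p permutes (UNIV :: 'n set)}"
  have comp: "((\<lambda>y. M y $ i $ j) has_derivative (\<lambda>v. M' v $ i $ j)) (at x within S)" for i j
    by (intro bounded_linear.has_derivative[OF bounded_linear_vec_nth] M)
  have "((\<lambda>y. \<Sum>p\<in>?P. of_int (sign p) * (\<Prod>i\<in>UNIV. M y $ i $ p i)) has_derivative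
     (\<lambda>v. \<Sum>p\<in>?P. of_int (sign p) * (\<Sum>i\<in>UNIV. M' v $ i $ p i * (\<Prod>j\<in>UNIV - {i}. M x $ j $ p j)))) (at x within S)"
    by (intro has_derivative_sum has_derivative_mult_right has_derivative_prod comp)
  moreover have "(\<Sum>p\<in>?P. of_int (sign p) * (\<Sum>i\<in>UNIV. M' v $ i $ p i * (\<Prod>j\<in>UNIV - {i}. M x $ j $ p j)))
      = (\<Sum>i\<in>UNIV. M' v $ i $ i)" for v
  proof -
    \<comment> \<open>A permutation other than the identity moves at least two indices, so after the
      factor \<open>i\<close> is removed the product still contains an off-diagonal entry of the
      identity matrix, a zero.\<close>
    have z: "(\<Prod>j\<in>UNIV - {i}. M x $ j $ p j) = 0" if "p \<in> ?P - {id}" for p i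
    proof -
      from that obtain k where k: "p k \<noteq> k" by fastforce
      have "\<exists>j. j \<noteq> i \<and> p j \<noteq> j"
      proof (rule ccontr)
        assume n: "\<not> ?thesis"
        then have "k = i" using k by blast
        have "p (p i) = p i" using n k \<open>k = i\<close> by auto
        then show False using that k \<open>k = i\<close> permutes_inj[of p UNIV] by (auto dest: injD)
      qed
      then obtain j where "j \<noteq> i" "p j \<noteq> j" by blast
      then show ?thesis unfolding 1 by (intro prod_zero bexI[of _ j]) (auto simp: mat_def)
    qed
    have "(\<Sum>p\<in>?P. of_int (sign p) * (\<Sum>i\<in>UNIV. M' v $ i $ p i * (\<Prod>j\<in>UNIV - {i}. M x $ j $ p j)))
      = (\<Sum>p\<in>{id}. of_int (sign p) * (\<Sum>i\<in>UNIV. M' v $ i $ p i * (\<Prod>j\<in>UNIV - {i}. M x $ j $ p j)))"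
      by (rule sum.mono_neutral_right) (auto simp: z permutes_id finite_permutations)
    also have "\<dots> = (\<Sum>i\<in>UNIV. M' v $ i $ i)"
      unfolding 1 by (simp add: sign_id mat_def)
    finally show ?thesis .
  qed
  ultimately show ?thesis unfolding det_def by simp
qed

lemma upper_metric_nth: "upper_metric g $ a $ b = matrix_inv g $ b $ a"
  by (simp add: upper_metric_def transpose_def)

lemma matrix_inv_left_right:
  fixes G :: "complex^'n::finite^'n"
  assumes "det G \<noteq> 0" shows "matrix_inv G ** G = mat 1" "G ** matrix_inv G = mat 1"
proof -
  have "\<exists>A'. G ** A' = mat 1 \<and> A' ** G = mat 1"
    using assms invertible_det_nz[of G] unfolding invertible_def by auto
  then have "G ** matrix_inv G = mat 1 \<and> matrix_inv G ** G = mat 1"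
    unfolding matrix_inv_def by (rule someI_ex)
  then show "matrix_inv G ** G = mat 1" "G ** matrix_inv G = mat 1" by auto
qed

lemma upper_metric_inverse:
  fixes G :: "complex^'n::finite^'n"
  assumes "det G \<noteq> 0"
  shows "(\<Sum>j\<in>UNIV. upper_metric G $ i $ j * G $ k $ j) = (if i = k then 1 else 0)"
    "(\<Sum>i\<in>UNIV. upper_metric G $ i $ j * G $ i $ k) = (if j = k then 1 else 0)"
proof -
  have "(G ** matrix_inv G) $ k $ i = (mat 1 :: complex^'n^'n) $ k $ i" "(matrix_inv G ** G) $ j $ k = (mat 1 :: complex^'n^'n) $ j $ k"
    using matrix_inv_left_right[OF assms] by auto
  then show "(\<Sum>j\<in>UNIV. upper_metric G $ i $ j * G $ k $ j) = (if i = k then 1 else 0)"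
    "(\<Sum>i\<in>UNIV. upper_metric G $ i $ j * G $ i $ k) = (if j = k then 1 else 0)"
    by (auto simp: matrix_matrix_mult_def upper_metric_nth mat_def mult.commute)
qed

text \<open>Jacobi's formula. Multiplication by the constant inverse of \<open>G x\<close> moves the
  base point to the identity matrix, where the derivative of the determinant is the trace.\<close>

lemma det_has_derivative:
  fixes G :: "'e::real_normed_vector \<Rightarrow> complex^'n::finite^'n"
  assumes G: "(G has_derivative G') (at x within S)" and nz: "det (G x) \<noteq> 0"
  shows "((\<lambda>y. det (G y)) has_derivative
     (\<lambda>v. det (G x) * (\<Sum>a\<in>UNIV. \<Sum>b\<in>UNIV. upper_metric (G x) $ a $ b * G' v $ a $ b))) (at x within S)"
proof -
  let ?I = "matrix_inv (G x)"
  have lin: "bounded_linear (\<lambda>A. ?I ** A)"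
    unfolding linear_conv_bounded_linear[symmetric]
    by (auto intro!: linearI simp: matrix_add_ldistrib matrix_matrix_mult_def vec_eq_iff distrib_left sum.distrib scaleR_sum_right)
  have "((\<lambda>y. det (?I ** G y)) has_derivative (\<lambda>v. \<Sum>i\<in>UNIV. (?I ** G' v) $ i $ i)) (at x within S)"
    by (intro det_has_derivative_mat_1 bounded_linear.has_derivative[OF lin] G matrix_inv_left_right nz)
  then have "((\<lambda>y. det (G x) * det (?I ** G y)) has_derivative (\<lambda>v. det (G x) * (\<Sum>i\<in>UNIV. (?I ** G' v) $ i $ i))) (at x within S)"
    by (intro derivative_intros)
  moreover have "det (G x) * det (?I ** G y) = det (G y)" for y
    by (simp add: det_mul[symmetric] matrix_mul_assoc matrix_inv_left_right nz matrix_mul_lid)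
  moreover have "(\<Sum>i\<in>UNIV. (?I ** G' v) $ i $ i) = (\<Sum>a\<in>UNIV. \<Sum>b\<in>UNIV. upper_metric (G x) $ a $ b * G' v $ a $ b)" for v
    unfolding upper_metric_nth matrix_matrix_mult_def by (subst sum.swap) simp
  ultimately show ?thesis by simp
qed

lemma smooth_on_det:
  fixes G :: "'e::euclidean_space \<Rightarrow> complex^'n::finite^'n"
  assumes "\<And>i j. smooth_on S (\<lambda>x. G x $ i $ j)"
  shows "smooth_on S (\<lambda>x. det (G x))"
  unfolding det_def by (intro smooth_intros assms)

text \<open>Cramer's rule presents an entry of the inverse as a quotient of two determinants, which
  are polynomials in the entries. In the proof \<open>?M x\<close> is \<open>G x\<close> with column
  \<open>j\<close> replaced by the \<open>i\<close>-th unit vector.\<close>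

lemma smooth_on_upper_metric:
  fixes G :: "'e::euclidean_space \<Rightarrow> complex^'n::finite^'n"
  assumes "\<And>i j. smooth_on S (\<lambda>x. G x $ i $ j)" "\<And>x. x \<in> S \<Longrightarrow> det (G x) \<noteq> 0"
  shows "smooth_on S (\<lambda>x. upper_metric (G x) $ i $ j)"
proof (rule smooth_on_cong)
  let ?M = "\<lambda>x. (\<chi> a b. if b = j then axis i 1 $ a else G x $ a $ b) :: complex^'n^'n"
  have "smooth_on S (\<lambda>x. ?M x $ a $ b)" for a b by (cases "b = j") (auto simp: assms)
  then show "smooth_on S (\<lambda>x. det (?M x) / det (G x))"
    using assms by (intro smooth_on_divide smooth_on_det) auto
  fix x assume x: "x \<in> S"
  let ?c = "\<chi> k. matrix_inv (G x) $ k $ i"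
  have "G x *v ?c = axis i 1"
  proof -
    have "(G x ** matrix_inv (G x)) $ a $ i = mat 1 $ a $ i" for a
      by (simp add: matrix_inv_left_right assms x)
    then show ?thesis
      by (simp add: vec_eq_iff matrix_vector_mult_def matrix_matrix_mult_def axis_def mat_def)
  qed
  then have "?c = (\<chi> k. det (\<chi> a b. if b = k then axis i 1 $ a else G x $ a $ b) / det (G x))"
    using cramer[OF assms(2)[OF x]] by blast
  then have "?c $ j = det (?M x) / det (G x)" by simp
  then show "det (?M x) / det (G x) = upper_metric (G x) $ i $ j" by (simp add: upper_metric_nth)
qed

section \<open>Positive Hermitian matrices\<close>

definition hermitian_pos :: "complex^'n::finite^'n \<Rightarrow> bool" where
  "hermitian_pos G \<longleftrightarrow> (\<forall>i j. G $ j $ i = cnj (G $ i $ j)) \<and>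
     (\<forall>v. v \<noteq> 0 \<longrightarrow> Re (\<Sum>i\<in>UNIV. \<Sum>j\<in>UNIV. G $ i $ j * v $ i * cnj (v $ j)) > 0)"

lemma hermitian_cnj: "hermitian_pos G \<Longrightarrow> cnj (G $ i $ j) = G $ j $ i"
  unfolding hermitian_pos_def by metis

lemma hermitian_pos_gt: "hermitian_pos G \<Longrightarrow> v \<noteq> 0 \<Longrightarrow> Re (\<Sum>i\<in>UNIV. \<Sum>j\<in>UNIV. G $ i $ j * v $ i * cnj (v $ j)) > 0"
  unfolding hermitian_pos_def by blast

lemma det_cnj: "det (\<chi> i j. cnj (G $ i $ j)) = cnj (det (G :: complex^'n::finite^'n))"
  unfolding det_def by simp

lemma hermitian_det_nz:
  assumes "hermitian_pos G" shows "det G \<noteq> 0"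
proof
  assume "det G = 0"
  \<comment> \<open>The form pairs the first index with \<open>v\<close> and the second with its
    conjugate, so it is a kernel vector of the transpose that makes it vanish.\<close>
  then have "det (transpose G) = 0" by simp
  then have "\<not> invertible (transpose G)" by (simp add: invertible_det_nz)
  then obtain v where v: "v \<noteq> 0" "transpose G *v v = 0"
    using matrix_left_invertible_ker[of "transpose G"] invertible_left_inverse by metis
  have "(\<Sum>i\<in>UNIV. \<Sum>j\<in>UNIV. G $ i $ j * v $ i * cnj (v $ j)) = (\<Sum>j\<in>UNIV. (transpose G *v v) $ j * cnj (v $ j))"
    by (subst sum.swap) (simp add: matrix_vector_mult_def transpose_def sum_distrib_right)
  also have "\<dots> = 0" unfolding v(2) by simp
  finally have "Re (\<Sum>i\<in>UNIV. \<Sum>j\<in>UNIV. G $ i $ j * v $ i * cnj (v $ j)) = 0" by (rule arg_cong[where f=Re, of _ 0, simplified])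
  moreover have "Re (\<Sum>i\<in>UNIV. \<Sum>j\<in>UNIV. G $ i $ j * v $ i * cnj (v $ j)) > 0"
    by (rule hermitian_pos_gt[OF assms v(1)])
  ultimately show False by (rule order.strict_implies_not_eq[THEN notE, rotated, OF sym])
qed

lemma hermitian_det_Im: assumes "hermitian_pos G" shows "Im (det G) = 0"
proof -
  have "transpose G = (\<chi> i j. cnj (G $ i $ j))"
    by (simp add: vec_eq_iff transpose_def hermitian_cnj[OF assms])
  then have "det G = cnj (det G)" using det_cnj[of G] by (metis det_transpose)
  then show ?thesis by (metis Reals_cnj_iff complex_is_Real_iff)
qed

lemma hermitian_pos_convex:
  assumes "hermitian_pos G" "hermitian_pos H" "0 \<le> t" "t \<le> 1"
  shows "hermitian_pos (\<chi> i j. of_real (1 - t) * G $ i $ j + of_real t * H $ i $ j)"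
  unfolding hermitian_pos_def
proof (intro conjI allI impI)
  show "(\<chi> i j. of_real (1 - t) * G $ i $ j + of_real t * H $ i $ j) $ j $ i =
    cnj ((\<chi> i j. of_real (1 - t) * G $ i $ j + of_real t * H $ i $ j) $ i $ j)" for i j
    by (simp add: hermitian_cnj assms)
  fix v :: "complex^'a" assume v: "v \<noteq> 0"
  let ?Q = "\<lambda>G. Re (\<Sum>i\<in>UNIV. \<Sum>j\<in>UNIV. G $ i $ j * v $ i * cnj (v $ j))"
  have "?Q (\<chi> i j. of_real (1 - t) * G $ i $ j + of_real t * H $ i $ j) = (1 - t) * ?Q G + t * ?Q H"
    by (simp add: algebra_simps sum.distrib sum_distrib_left sum_subtractf)
  moreover have "?Q G > 0" "?Q H > 0" using assms v by (intro hermitian_pos_gt; simp)+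
  moreover have "t = 0 \<or> t = 1 \<or> (0 < t \<and> 0 < 1 - t)" using assms by auto
  ultimately show "?Q (\<chi> i j. of_real (1 - t) * G $ i $ j + of_real t * H $ i $ j) > 0"
    by (auto simp: add_pos_pos)
qed

text \<open>On the segment from \<open>G\<close> to the identity all matrices are Hermitian and
  positive, so the determinant is real and never zero there. It equals 1 at the identity, and the
  intermediate value theorem excludes a change of sign.\<close>

lemma hermitian_det_pos:
  fixes G :: "complex^'n::finite^'n"
  assumes "hermitian_pos G" shows "Re (det G) > 0"
proof (rule ccontr)
  assume neg: "\<not> Re (det G) > 0"
  have I: "hermitian_pos (mat 1 :: complex^'n^'n)"
    unfolding hermitian_pos_def
  proof (intro conjI allI impI)
    fix v :: "complex^'n" assume "v \<noteq> 0"
    then obtain k where "v $ k \<noteq> 0" by (auto simp: vec_eq_iff)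
    then have "0 < (\<Sum>i\<in>UNIV. (cmod (v $ i))\<^sup>2)" by (intro sum_pos2[of _ k]) auto
    moreover have "(\<Sum>i\<in>UNIV. \<Sum>j\<in>UNIV. (mat 1 :: complex^'n^'n) $ i $ j * v $ i * cnj (v $ j)) = of_real (\<Sum>i\<in>UNIV. (cmod (v $ i))\<^sup>2)"
      by (simp add: mat_def if_distrib if_distribR sum.delta complex_norm_square[symmetric] cong: if_cong)
    ultimately show "Re (\<Sum>i\<in>UNIV. \<Sum>j\<in>UNIV. (mat 1 :: complex^'n^'n) $ i $ j * v $ i * cnj (v $ j)) > 0"
      by simp
  qed (simp add: mat_def)
  let ?H = "\<lambda>t::real. (\<chi> i j. of_real (1 - t) * G $ i $ j + of_real t * (mat 1 :: complex^'n^'n) $ i $ j)"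
  let ?f = "\<lambda>t. Re (det (?H t))"
  have H0: "?H 0 = G" and H1: "?H 1 = mat 1" by (auto simp: vec_eq_iff)
  have c: "continuous_on {0..1} ?f" unfolding det_def by (auto intro!: continuous_intros)
  have "\<exists>t\<ge>0. t \<le> 1 \<and> ?f t = 0"
    using neg H0 H1 by (intro IVT'[OF _ _ _ c]) auto
  then obtain t where t: "0 \<le> t" "t \<le> 1" "?f t = 0" by auto
  have "hermitian_pos (?H t)" using hermitian_pos_convex[OF assms I t(1,2)] .
  from hermitian_det_nz[OF this] hermitian_det_Im[OF this] t(3) show False
    unfolding complex_eq_iff by (simp only: zero_complex.sel simp_thms)
qed

lemma hermitian_pos_upper:
  fixes G :: "complex^'n::finite^'n"
  assumes G: "hermitian_pos G"
  shows "upper_metric G $ j $ i = cnj (upper_metric G $ i $ j)"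
proof -
  note nz = hermitian_det_nz[OF G]
  let ?K = "(\<chi> i j. cnj (matrix_inv G $ j $ i)) :: complex^'n^'n"
  have "?K ** G = mat 1"
  proof -
    have "(?K ** G) $ a $ b = cnj ((G ** matrix_inv G) $ b $ a)" for a b
      unfolding matrix_matrix_mult_def by (simp add: hermitian_cnj[OF G] mult.commute)
    then show ?thesis by (simp add: vec_eq_iff matrix_inv_left_right nz mat_def)
  qed
  then have "?K = matrix_inv G"
    by (metis matrix_inv_left_right(2)[OF nz] matrix_mul_assoc matrix_mul_lid matrix_mul_rid)
  then have "matrix_inv G $ i $ j = cnj (matrix_inv G $ j $ i)" by (metis vec_lambda_beta)
  then show ?thesis by (simp add: upper_metric_nth)
qed

text \<open>With \<open>?w\<close> obtained from \<open>v\<close> by raising its index,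
  \<open>v\<close> is \<open>G\<close> applied to \<open>?w\<close>, and the form of the inverse at
  \<open>v\<close> becomes the conjugate of the form of \<open>G\<close> at the conjugate of
  \<open>?w\<close>.\<close>

lemma hermitian_pos_upper_pos:
  fixes G :: "complex^'n::finite^'n"
  assumes G: "hermitian_pos G"
  shows "Re (\<Sum>i\<in>UNIV. \<Sum>j\<in>UNIV. upper_metric G $ i $ j * v $ i * cnj (v $ j)) \<ge> 0"
proof -
  note nz = hermitian_det_nz[OF G]
  let ?w = "\<chi> j. \<Sum>i\<in>UNIV. upper_metric G $ i $ j * v $ i"
  have v: "v $ k = (\<Sum>j\<in>UNIV. G $ k $ j * ?w $ j)" for k
  proof -
    have "(\<Sum>j\<in>UNIV. G $ k $ j * ?w $ j) = (\<Sum>i\<in>UNIV. (\<Sum>j\<in>UNIV. upper_metric G $ i $ j * G $ k $ j) * v $ i)"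
      by (simp add: sum_distrib_left sum_distrib_right mult_ac) (rule sum.swap)
    also have "\<dots> = v $ k" by (simp add: upper_metric_inverse nz if_distrib[of "\<lambda>a. a * _"] cong: if_cong)
    finally show ?thesis by simp
  qed
  have "(\<Sum>i\<in>UNIV. \<Sum>j\<in>UNIV. upper_metric G $ i $ j * v $ i * cnj (v $ j)) = (\<Sum>j\<in>UNIV. ?w $ j * cnj (v $ j))"
    by (subst sum.swap) (simp add: sum_distrib_right)
  also have "\<dots> = (\<Sum>j\<in>UNIV. \<Sum>k\<in>UNIV. ?w $ j * (G $ k $ j * cnj (?w $ k)))"
    by (subst v) (simp add: sum_distrib_left hermitian_cnj[OF G])
  also have "\<dots> = (\<Sum>j\<in>UNIV. \<Sum>k\<in>UNIV. cnj (G $ j $ k * cnj (?w $ j) * ?w $ k))"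
    by (simp add: hermitian_cnj[OF G] mult_ac)
  also have "\<dots> = (\<Sum>j\<in>UNIV. \<Sum>k\<in>UNIV. cnj (G $ j $ k * (\<chi> i. cnj (?w $ i)) $ j * cnj ((\<chi> i. cnj (?w $ i)) $ k)))"
    by simp
  also have "\<dots> = cnj (\<Sum>j\<in>UNIV. \<Sum>k\<in>UNIV. G $ j $ k * (\<chi> i. cnj (?w $ i)) $ j * cnj ((\<chi> i. cnj (?w $ i)) $ k))"
    by (simp only: cnj_sum)
  finally have "Re (\<Sum>i\<in>UNIV. \<Sum>j\<in>UNIV. upper_metric G $ i $ j * v $ i * cnj (v $ j)) = Re (\<Sum>j\<in>UNIV. \<Sum>k\<in>UNIV. G $ j $ k * (\<chi> i. cnj (?w $ i)) $ j * cnj ((\<chi> i. cnj (?w $ i)) $ k))"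
    by (simp only: cnj.sel)
  moreover have "0 \<le> Re (\<Sum>j\<in>UNIV. \<Sum>k\<in>UNIV. G $ j $ k * u $ j * cnj (u $ k))" for u :: "complex^'n"
  proof (cases "u = 0")
    case False
    then show ?thesis by (rule less_imp_le[OF hermitian_pos_gt[OF G]])
  qed simp
  ultimately show ?thesis by presburger
qed

section \<open>Kaehler metrics in coordinates\<close>

text \<open>A Cholesky factorisation by induction on the index set: subtracting the rank one matrix
  built from column \<open>a\<close> leaves the Schur complement \<open>H'\<close>, which is
  positive on the remaining indices. It serves to diagonalise the metric in the quadratic term of
  the Bochner formula.\<close>

lemma pos_def_sum_squares:
  fixes H :: "'i \<Rightarrow> 'i \<Rightarrow> complex"
  assumes "finite I" and herm: "\<And>i j. cnj (H i j) = H j i"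
    and pos: "\<And>v. (\<exists>i\<in>I. v i \<noteq> 0) \<Longrightarrow> Re (\<Sum>i\<in>I. \<Sum>j\<in>I. H i j * v i * cnj (v j)) > 0"
  shows "\<exists>c::'i \<Rightarrow> 'i \<Rightarrow> complex. \<forall>i\<in>I. \<forall>j\<in>I. H i j = (\<Sum>r\<in>I. c r i * cnj (c r j))"
  using assms
proof (induction I arbitrary: H rule: finite_induct)
  case (insert a I)
  note herm = insert.prems(1) and pos = insert.prems(2)
  define s where "s = Re (H a a)"
  have Haa: "H a a = of_real s" using herm[of a a] by (simp add: s_def complex_eq_iff)
  have s: "s > 0"
  proof -
    let ?v = "\<lambda>i. if i = a then 1 else 0 :: complex"
    have z: "(\<Sum>j\<in>I. H i j * ?v i * cnj (?v j)) = 0" "(\<Sum>i\<in>I. H i j * ?v i * cnj (?v j)) = 0"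
       "(\<Sum>i\<in>I. \<Sum>j\<in>I. H i j * ?v i * cnj (?v j)) = 0" for i j
      using insert.hyps by (auto intro!: sum.neutral)
    have "Re (\<Sum>i\<in>insert a I. \<Sum>j\<in>insert a I. H i j * ?v i * cnj (?v j)) > 0" by (rule pos) auto
    then show ?thesis using insert.hyps unfolding sum.insert[OF insert.hyps] sum.distrib z s_def by simp
  qed
  define c0 where "c0 i = H i a / of_real (sqrt s)" for i
  have cc: "c0 i * cnj (c0 j) = H i a * H a j / of_real s" for i j
  proof -
    have "of_real (sqrt s) * of_real (sqrt s) = (of_real s :: complex)"
      using s by (simp flip: of_real_mult)
    then show ?thesis by (simp add: c0_def herm)
  qed
  define H' where "H' i j = H i j - c0 i * cnj (c0 j)" for i j
  have herm': "cnj (H' i j) = H' j i" for i j by (simp add: H'_def herm mult.commute)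
  have pos': "Re (\<Sum>i\<in>I. \<Sum>j\<in>I. H' i j * v i * cnj (v j)) > 0" if v: "\<exists>i\<in>I. v i \<noteq> 0" for v
  proof -
    \<comment> \<open>\<open>t\<close> is the value of the coordinate \<open>a\<close> that
      completes the square: the terms containing it cancel and the form of \<open>H\<close> at
      \<open>w\<close> becomes that of \<open>H'\<close> at \<open>v\<close>.\<close>
    define t where "t = - (\<Sum>i\<in>I. H i a * v i) / of_real s"
    define w where "w i = (if i = a then t else v i)" for i
    have wI: "w i = v i" if "i \<in> I" for i using that insert.hyps by (auto simp: w_def)
    have ct: "cnj t = - (\<Sum>i\<in>I. H a i * cnj (v i)) / of_real s" by (simp add: t_def herm)
    have "(\<Sum>i\<in>insert a I. \<Sum>j\<in>insert a I. H i j * w i * cnj (w j)) =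
      H a a * t * cnj t + (\<Sum>j\<in>I. H a j * t * cnj (v j)) + (\<Sum>i\<in>I. H i a * v i * cnj t) + (\<Sum>i\<in>I. \<Sum>j\<in>I. H i j * v i * cnj (v j))"
      using insert.hyps by (simp add: sum.distrib wI) (simp add: w_def)
    also have "(\<Sum>j\<in>I. H a j * t * cnj (v j)) = t * (\<Sum>j\<in>I. H a j * cnj (v j))"
      by (simp add: sum_distrib_left mult_ac)
    also have "\<dots> = - (of_real s * t * cnj t)" using s by (simp add: ct)
    also have "(\<Sum>i\<in>I. H i a * v i * cnj t) = - (of_real s * t * cnj t)"
    proof -
      have "(\<Sum>i\<in>I. H i a * v i * cnj t) = (\<Sum>i\<in>I. H i a * v i) * cnj t" by (simp only: sum_distrib_right)
      also have "(\<Sum>i\<in>I. H i a * v i) = - (of_real s * t)" using s by (simp add: t_def)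
      finally show ?thesis by simp
    qed
    also have "(\<Sum>i\<in>I. \<Sum>j\<in>I. H i j * v i * cnj (v j)) =
        (\<Sum>i\<in>I. \<Sum>j\<in>I. H' i j * v i * cnj (v j)) + (\<Sum>i\<in>I. \<Sum>j\<in>I. (H i a * v i) * (H a j * cnj (v j)) / of_real s)"
      unfolding sum.distrib[symmetric] by (intro sum.cong refl) (simp add: H'_def cc algebra_simps)
    also have "(\<Sum>i\<in>I. \<Sum>j\<in>I. (H i a * v i) * (H a j * cnj (v j)) / of_real s) = of_real s * t * cnj t"
    proof -
      have "(\<Sum>i\<in>I. \<Sum>j\<in>I. (H i a * v i) * (H a j * cnj (v j)) / of_real s) =
         (\<Sum>i\<in>I. H i a * v i) * (\<Sum>j\<in>I. H a j * cnj (v j)) / of_real s"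
        by (simp only: sum_product sum_divide_distrib)
      then show ?thesis unfolding ct using s by (simp add: t_def)
    qed
    finally have "(\<Sum>i\<in>insert a I. \<Sum>j\<in>insert a I. H i j * w i * cnj (w j)) = (\<Sum>i\<in>I. \<Sum>j\<in>I. H' i j * v i * cnj (v j))"
      by (simp add: Haa)
    moreover have "Re (\<Sum>i\<in>insert a I. \<Sum>j\<in>insert a I. H i j * w i * cnj (w j)) > 0"
      using v wI by (intro pos) auto
    ultimately show ?thesis by simp
  qed
  from insert.IH[OF herm' pos'] obtain c where c: "\<And>i j. i \<in> I \<Longrightarrow> j \<in> I \<Longrightarrow> H' i j = (\<Sum>r\<in>I. c r i * cnj (c r j))"
    by blast
  define d where "d r i = (if r = a then c0 i else if i = a then 0 else c r i)" for r i
  have "H i j = (\<Sum>r\<in>insert a I. d r i * cnj (d r j))" if "i \<in> insert a I" "j \<in> insert a I" for i j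
  proof -
    have ra: "r \<noteq> a" if "r \<in> I" for r using that insert.hyps by auto
    have sp: "(\<Sum>r\<in>insert a I. d r i * cnj (d r j)) = c0 i * cnj (c0 j) + (\<Sum>r\<in>I. d r i * cnj (d r j))"
      using insert.hyps by (simp add: d_def)
    show ?thesis
    proof (cases "i = a \<or> j = a")
      case True
      then have "(\<Sum>r\<in>I. d r i * cnj (d r j)) = 0" by (intro sum.neutral) (auto simp: d_def dest: ra)
      moreover have "c0 i * cnj (c0 j) = H i j" using True s by (auto simp: cc Haa)
      ultimately show ?thesis using sp by simp
    next
      case False
      then have "(\<Sum>r\<in>I. d r i * cnj (d r j)) = (\<Sum>r\<in>I. c r i * cnj (c r j))"
        by (intro sum.cong) (auto simp: d_def dest: ra)
      also have "\<dots> = H' i j" using c that False by auto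
      finally show ?thesis unfolding sp H'_def by simp
    qed
  qed
  then show ?case by blast
qed auto

lemma sum3_swap13: "(\<Sum>i\<in>A. \<Sum>j\<in>B. \<Sum>k\<in>C. f i j k) = (\<Sum>k\<in>C. \<Sum>j\<in>B. \<Sum>i\<in>A. f i j k)"
proof -
  have "(\<Sum>i\<in>A. \<Sum>j\<in>B. \<Sum>k\<in>C. f i j k) = (\<Sum>i\<in>A. \<Sum>k\<in>C. \<Sum>j\<in>B. f i j k)"
    by (intro sum.cong refl sum.swap)
  also have "\<dots> = (\<Sum>k\<in>C. \<Sum>i\<in>A. \<Sum>j\<in>B. f i j k)" by (rule sum.swap)
  also have "\<dots> = (\<Sum>k\<in>C. \<Sum>j\<in>B. \<Sum>i\<in>A. f i j k)" by (intro sum.cong refl sum.swap)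
  finally show ?thesis .
qed

lemma sum_rotate: "(\<Sum>i\<in>A. \<Sum>j\<in>B. \<Sum>k\<in>C. f i j k) = (\<Sum>j\<in>B. \<Sum>k\<in>C. \<Sum>i\<in>A. f i j k)"
  by (subst sum.swap) (intro sum.cong refl sum.swap)

lemma sum4_swap: "(\<Sum>i\<in>A. \<Sum>j\<in>B. \<Sum>k\<in>C. \<Sum>l\<in>D. f i j k l) = (\<Sum>k\<in>C. \<Sum>l\<in>D. \<Sum>i\<in>A. \<Sum>j\<in>B. f i j k l)"
proof -
  have "(\<Sum>i\<in>A. \<Sum>j\<in>B. \<Sum>k\<in>C. \<Sum>l\<in>D. f i j k l) = (\<Sum>i\<in>A. \<Sum>k\<in>C. \<Sum>l\<in>D. \<Sum>j\<in>B. f i j k l)"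
    by (intro sum.cong refl sum_rotate)
  also have "\<dots> = (\<Sum>k\<in>C. \<Sum>l\<in>D. \<Sum>i\<in>A. \<Sum>j\<in>B. f i j k l)" by (rule sum_rotate)
  finally show ?thesis .
qed

text \<open>The domain is an arbitrary good one so that the same computations serve twice: on a
  chart range for a single metric, and on \<open>{0..1}\<close> times a chart range for a curve of
  metrics, where one of the directions of differentiation is time.\<close>

locale metric_field =
  fixes S :: "'e::euclidean_space set" and G :: "'e \<Rightarrow> complex^'n::finite^'n"
  assumes good: "good_domain S" and smooth_g: "\<And>i j. smooth_on S (\<lambda>x. G x $ i $ j)"
    and herm: "\<And>x. x \<in> S \<Longrightarrow> hermitian_pos (G x)"
begin

abbreviation "g \<equiv> \<lambda>i j x. G x $ i $ j"
abbreviation "h \<equiv> \<lambda>i j x. upper_metric (G x) $ i $ j"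

lemma det_nz: "x \<in> S \<Longrightarrow> det (G x) \<noteq> 0" using hermitian_det_nz herm by blast

lemma smooth_h: "smooth_on S (h i j)" by (rule smooth_on_upper_metric[OF smooth_g det_nz])

lemma smooth_u: "smooth_on S (\<lambda>x. det (G x))" by (rule smooth_on_det[OF smooth_g])

lemma det_real: "x \<in> S \<Longrightarrow> det (G x) = of_real (Re (det (G x)))"
  using hermitian_det_Im[OF herm] by (simp add: complex_eq_iff)

lemma smooth_L: "smooth_on S (\<lambda>x. complex_of_real (ln (Re (det (G x)))))"
  by (intro smooth_on_of_real smooth_on_ln smooth_on_Re smooth_u hermitian_det_pos herm)

lemmas sm = smooth_intros smooth_cd[OF good] smooth_g smooth_h smooth_u smooth_L
lemmas cds = cd_add[OF good] cd_mult[OF good] cd_sum[OF good] cd_minus[OF good] cd_diff[OF good]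

lemma hg1: "x \<in> S \<Longrightarrow> (\<Sum>j\<in>UNIV. h i j x * g k j x) = (if i = k then 1 else 0)"
  by (rule upper_metric_inverse[OF det_nz])

lemma hg2: "x \<in> S \<Longrightarrow> (\<Sum>i\<in>UNIV. h i j x * g i k x) = (if j = k then 1 else 0)"
  by (rule upper_metric_inverse[OF det_nz])

lemma dh_g:
  assumes x: "x \<in> S"
  shows "(\<Sum>i\<in>UNIV. cd S v (h i j) x * g i k x) = - (\<Sum>i\<in>UNIV. h i j x * cd S v (g i k) x)"
proof -
  have "cd S v (\<lambda>x. \<Sum>i\<in>UNIV. h i j x * g i k x) x = cd S v (\<lambda>x. if j = k then 1 else 0) x"
    by (rule cd_cong[OF hg2 x])
  also have "\<dots> = 0" by (rule cd_const[OF good x])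
  finally show ?thesis using x by (simp add: cds sm sum.distrib add_eq_0_iff2)
qed

text \<open>The derivative of an inverse matrix, from \<open>dh_g\<close> contracted once more with
  \<open>h\<close>.\<close>

lemma cd_h:
  assumes x: "x \<in> S"
  shows "cd S v (h i j) x = - (\<Sum>a\<in>UNIV. \<Sum>b\<in>UNIV. h i b x * cd S v (g a b) x * h a j x)"
proof -
  have "(\<Sum>a\<in>UNIV. \<Sum>b\<in>UNIV. h i b x * cd S v (g a b) x * h a j x) =
     (\<Sum>b\<in>UNIV. h i b x * (\<Sum>a\<in>UNIV. h a j x * cd S v (g a b) x))"
    by (subst sum.swap) (simp add: sum_distrib_left mult_ac)
  also have "\<dots> = - (\<Sum>b\<in>UNIV. h i b x * (\<Sum>a\<in>UNIV. cd S v (h a j) x * g a b x))"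
    by (simp add: dh_g[OF x] sum_negf)
  also have "(\<Sum>b\<in>UNIV. h i b x * (\<Sum>a\<in>UNIV. cd S v (h a j) x * g a b x)) =
      (\<Sum>a\<in>UNIV. cd S v (h a j) x * (\<Sum>b\<in>UNIV. h i b x * g a b x))"
    by (simp add: sum_distrib_left mult_ac) (rule sum.swap)
  also have "\<dots> = cd S v (h i j) x"
    by (simp add: hg1[OF x] if_distrib[of "\<lambda>a. _ * a"] cong: if_cong)
  finally show ?thesis by simp
qed

lemma dd_u:
  assumes x: "x \<in> S"
  shows "dd S v (\<lambda>x. det (G x)) x = det (G x) * (\<Sum>a\<in>UNIV. \<Sum>b\<in>UNIV. h a b x * dd S v (g a b) x)"
proof -
  let ?G' = "\<lambda>v. (\<chi> a b. dd S v (g a b) x)"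
  have "(G has_derivative ?G') (at x within S)"
    unfolding has_derivative_componentwise_within[of G]
  proof
    fix b :: "complex^'n^'n" assume "b \<in> Basis"
    then obtain i j c where b: "b = axis i (axis j c)" by (auto simp: Basis_vec_def)
    have "((\<lambda>y. g i j y \<bullet> c) has_derivative (\<lambda>v. dd S v (g i j) x \<bullet> c)) (at x within S)"
      by (rule bounded_linear.has_derivative[OF bounded_linear_inner_left smooth_onD(1)[OF good smooth_g x]])
    then show "((\<lambda>y. G y \<bullet> b) has_derivative (\<lambda>v. ?G' v \<bullet> b)) (at x within S)"
      by (simp add: b inner_axis)
  qed
  from dd_eqI[OF good x det_has_derivative[OF this det_nz[OF x]]] show ?thesis by simp
qed

lemma cd_u:
  assumes x: "x \<in> S"
  shows "cd S v (\<lambda>x. det (G x)) x = det (G x) * (\<Sum>a\<in>UNIV. \<Sum>b\<in>UNIV. h a b x * cd S v (g a b) x)"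
  unfolding cd_def dd_u[OF x] by (simp add: algebra_simps sum.distrib sum_distrib_left)

text \<open>The determinant is real on all of \<open>S\<close>, so \<open>Re (det (G x))\<close> and
  \<open>det (G x)\<close> have the same derivatives, and the logarithmic derivative reduces to
  Jacobi's formula.\<close>

lemma cd_L:
  assumes x: "x \<in> S"
  shows "cd S v (\<lambda>x. complex_of_real (ln (Re (det (G x))))) x = (\<Sum>a\<in>UNIV. \<Sum>b\<in>UNIV. h a b x * cd S v (g a b) x)"
proof -
  let ?u = "\<lambda>x. det (G x)"
  have pos: "Re (det (G x)) > 0" using hermitian_det_pos[OF herm[OF x]] .
  have "dd S v (\<lambda>x. complex_of_real (ln (Re (?u x)))) x = dd S v ?u x / ?u x" for v
  proof -
    have der: "((\<lambda>x. Re (?u x)) has_derivative (\<lambda>v. Re (dd S v ?u x))) (at x within S)"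
      by (rule bounded_linear.has_derivative[OF bounded_linear_Re smooth_onD(1)[OF good smooth_u x]])
    have "((\<lambda>x. complex_of_real (ln (Re (?u x)))) has_derivative (\<lambda>v. complex_of_real (Re (dd S v ?u x) / Re (?u x)))) (at x within S)"
      using bounded_linear.has_derivative[of complex_of_real, OF bounded_linear_of_real has_derivative_ln[OF pos der]]
      by (simp add: divide_inverse mult.commute)
    from dd_eqI[OF good x this] have 1: "dd S v (\<lambda>x. complex_of_real (ln (Re (?u x)))) x = complex_of_real (Re (dd S v ?u x) / Re (?u x))" .
    have "dd S v ?u x = dd S v (\<lambda>x. complex_of_real (Re (?u x))) x" by (rule dd_cong[OF det_real x])
    also have "\<dots> = complex_of_real (Re (dd S v ?u x))"
      by (rule dd_eqI[OF good x bounded_linear.has_derivative[OF bounded_linear_of_real der]])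
    finally show ?thesis using 1 det_real[OF x] by (metis of_real_divide)
  qed
  then have "cd S v (\<lambda>x. complex_of_real (ln (Re (?u x)))) x = cd S v ?u x / ?u x"
    by (simp add: cd_def add_divide_distrib)
  then show ?thesis using det_nz[OF x] by (simp add: cd_u[OF x])
qed

end

text \<open>\<open>p\<close> and \<open>q\<close> are abstract directions:
  \<open>cd S (p k, q k)\<close> plays the role of the k-th holomorphic derivative, abbreviated
  \<open>P k\<close> below, and \<open>Q k\<close> that of its conjugate. The assumption
  \<open>closed\<close> says that the Kaehler form is annihilated by the holomorphic part of
  d.\<close>

locale kahler_field = metric_field S G
  for S :: "'e::euclidean_space set" and G :: "'e \<Rightarrow> complex^'n::finite^'n" +
  fixes p q :: "'n \<Rightarrow> 'e"
  assumes closed: "\<And>i j k x. x \<in> S \<Longrightarrow> cd S (p k, q k) (\<lambda>x. G x $ i $ j) x = cd S (p i, q i) (\<lambda>x. G x $ k $ j) x"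
begin

abbreviation "P \<equiv> \<lambda>i. cd S (p i, q i)"
abbreviation "Q \<equiv> \<lambda>i. cd S (p i, - q i)"

lemma g_cnj: "x \<in> S \<Longrightarrow> cnj (g i j x) = g j i x"
  using hermitian_cnj[OF herm] .

lemma h_cnj: "x \<in> S \<Longrightarrow> cnj (h i j x) = h j i x"
  by (rule hermitian_pos_upper[OF herm, symmetric])

lemma Q_cnj: "smooth_on S f \<Longrightarrow> x \<in> S \<Longrightarrow> Q i (\<lambda>x. cnj (f x)) x = cnj (P i f x)"
  using cd_cnj[OF good, of f x "p i" "- q i"] by simp

lemma P_cnj: "smooth_on S f \<Longrightarrow> x \<in> S \<Longrightarrow> P i (\<lambda>x. cnj (f x)) x = cnj (Q i f x)"
  using cd_cnj[OF good, of f x "p i" "q i"] by simp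

lemma closed_Q: assumes x: "x \<in> S" shows "Q k (g i j) x = Q j (g i k) x"
proof -
  have "Q k (g i j) x = cnj (P k (g j i) x)" for k j
  proof -
    have "Q k (g i j) x = Q k (\<lambda>x. cnj (g j i x)) x" by (rule cd_cong[OF _ x]) (simp add: g_cnj)
    then show ?thesis using Q_cnj[OF smooth_g x] by simp
  qed
  then show ?thesis using closed[OF x, of k j i] by simp
qed

text \<open>After the derivative of the inverse is expanded, both sides contain the derivative of
  \<open>g\<close> with two barred indices, in which it is symmetric by \<open>closed_Q\<close>;
  renaming summation indices exchanges \<open>i\<close> and \<open>j\<close>.\<close>

lemma h_Q_h:
  assumes x: "x \<in> S"
  shows "(\<Sum>l\<in>UNIV. h i l x * Q l (h j m) x) = (\<Sum>l\<in>UNIV. h j l x * Q l (h i m) x)"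
proof -
  have *: "(\<Sum>l\<in>UNIV. h i l x * Q l (h j m) x) =
     - (\<Sum>l\<in>UNIV. \<Sum>a\<in>UNIV. \<Sum>b\<in>UNIV. h i l x * h j b x * h a m x * Q l (g a b) x)" for i j
    by (simp add: cd_h[OF x] sum_distrib_left sum_negf mult_ac)
  have "(\<Sum>l\<in>UNIV. \<Sum>a\<in>UNIV. \<Sum>b\<in>UNIV. h i l x * h j b x * h a m x * Q l (g a b) x) =
     (\<Sum>l\<in>UNIV. \<Sum>a\<in>UNIV. \<Sum>b\<in>UNIV. h i b x * h j l x * h a m x * Q b (g a l) x)"
    by (rule sum3_swap13)
  also have "\<dots> = (\<Sum>l\<in>UNIV. \<Sum>a\<in>UNIV. \<Sum>b\<in>UNIV. h j l x * h i b x * h a m x * Q l (g a b) x)"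
    by (intro sum.cong refl) (simp add: closed_Q[OF x, of _ _ l for l] mult_ac)
  finally show ?thesis unfolding * by simp
qed

text \<open>The derivative of the determinant and that of the inverse metric produce the same
  contraction of derivatives of \<open>g\<close> with opposite signs, once \<open>closed_Q\<close>
  has exchanged two barred indices. This replaces all Christoffel symbols in later
  divergences.\<close>

lemma div_uh:
  assumes x: "x \<in> S"
  shows "(\<Sum>l\<in>UNIV. Q l (\<lambda>x. det (G x) * h i l x) x) = 0"
proof -
  have "(\<Sum>l\<in>UNIV. Q l (\<lambda>x. det (G x) * h i l x) x) =
     det (G x) * ((\<Sum>l\<in>UNIV. Q l (h i l) x) + (\<Sum>l\<in>UNIV. \<Sum>a\<in>UNIV. \<Sum>b\<in>UNIV. h i l x * h a b x * Q l (g a b) x))"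
    by (simp add: cds sm x cd_u sum.distrib sum_distrib_left sum_distrib_right algebra_simps)
  also have "(\<Sum>l\<in>UNIV. Q l (h i l) x) = - (\<Sum>l\<in>UNIV. \<Sum>a\<in>UNIV. \<Sum>b\<in>UNIV. h i b x * h a l x * Q l (g a b) x)"
    by (simp add: cd_h[OF x] sum_negf mult_ac)
  also have "(\<Sum>l\<in>UNIV. \<Sum>a\<in>UNIV. \<Sum>b\<in>UNIV. h i b x * h a l x * Q l (g a b) x) =
      (\<Sum>l\<in>UNIV. \<Sum>a\<in>UNIV. \<Sum>b\<in>UNIV. h i l x * h a b x * Q b (g a l) x)" by (rule sum3_swap13)
  also have "\<dots> = (\<Sum>l\<in>UNIV. \<Sum>a\<in>UNIV. \<Sum>b\<in>UNIV. h i l x * h a b x * Q l (g a b) x)"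
    by (intro sum.cong refl) (simp add: closed_Q[OF x, of _ _ l for l])
  finally show ?thesis by simp
qed

lemma div_vector:
  assumes x: "x \<in> S" and w: "\<And>i. smooth_on S (w i)"
  shows "(\<Sum>l\<in>UNIV. Q l (\<lambda>x. det (G x) * (\<Sum>i\<in>UNIV. h i l x * w i x)) x) =
    det (G x) * (\<Sum>i\<in>UNIV. \<Sum>l\<in>UNIV. h i l x * Q l (w i) x)"
proof -
  have "Q l (\<lambda>x. det (G x) * (\<Sum>i\<in>UNIV. h i l x * w i x)) x =
     (\<Sum>i\<in>UNIV. det (G x) * h i l x * Q l (w i) x + Q l (\<lambda>x. det (G x) * h i l x) x * w i x)" for l
  proof -
    have "Q l (\<lambda>x. det (G x) * (\<Sum>i\<in>UNIV. h i l x * w i x)) x = Q l (\<lambda>x. \<Sum>i\<in>UNIV. (det (G x) * h i l x) * w i x) x"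
      by (simp add: sum_distrib_left mult.assoc)
    also have "\<dots> = (\<Sum>i\<in>UNIV. Q l (\<lambda>x. (det (G x) * h i l x) * w i x) x)"
      by (intro cd_sum good x sm w finite)
    also have "\<dots> = (\<Sum>i\<in>UNIV. det (G x) * h i l x * Q l (w i) x + Q l (\<lambda>x. det (G x) * h i l x) x * w i x)"
      by (intro sum.cong refl cd_mult good x sm w)
    finally show ?thesis .
  qed
  then have "(\<Sum>l\<in>UNIV. Q l (\<lambda>x. det (G x) * (\<Sum>i\<in>UNIV. h i l x * w i x)) x) =
    (\<Sum>i\<in>UNIV. \<Sum>l\<in>UNIV. det (G x) * h i l x * Q l (w i) x) + (\<Sum>i\<in>UNIV. (\<Sum>l\<in>UNIV. Q l (\<lambda>x. det (G x) * h i l x) x) * w i x)"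
    unfolding sum_distrib_right sum.distrib[symmetric]
    by (simp only: sum.distrib) (intro arg_cong2[where f="(+)"] sum.swap)
  then show ?thesis by (simp add: div_uh[OF x] sum_distrib_left mult.assoc)
qed

text \<open>After \<open>div_vector\<close> the derivative falls on \<open>f\<close>, on
  \<open>\<alpha>\<close> or on the second factor \<open>h\<close>. Closedness of
  \<open>\<alpha>\<close> and, through \<open>h_Q_h\<close>, of the metric moves the last two
  contributions into positions where together they form the derivative of the trace of
  \<open>\<alpha>\<close>.\<close>

lemma div_form:
  assumes x: "x \<in> S" and \<alpha>: "\<And>i j. smooth_on S (\<alpha> i j)" and f: "\<And>i. smooth_on S (f i)"
    and cl: "\<And>i j k. Q k (\<alpha> i j) x = Q j (\<alpha> i k) x"
  shows "(\<Sum>l\<in>UNIV. Q l (\<lambda>x. det (G x) * (\<Sum>i\<in>UNIV. h i l x * (\<Sum>j\<in>UNIV. \<Sum>m\<in>UNIV. h j m x * \<alpha> i m x * f j x))) x) =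
    det (G x) * ((\<Sum>i\<in>UNIV. \<Sum>l\<in>UNIV. \<Sum>j\<in>UNIV. \<Sum>m\<in>UNIV. h i l x * h j m x * \<alpha> i m x * Q l (f j) x)
     + (\<Sum>j\<in>UNIV. \<Sum>m\<in>UNIV. h j m x * f j x * Q m (\<lambda>x. \<Sum>i\<in>UNIV. \<Sum>l\<in>UNIV. h i l x * \<alpha> i l x) x))"
proof -
  have 1: "(\<Sum>i\<in>UNIV. \<Sum>l\<in>UNIV. h i l x * Q l (\<lambda>x. \<Sum>j\<in>UNIV. \<Sum>m\<in>UNIV. h j m x * \<alpha> i m x * f j x) x) =
    (\<Sum>i\<in>UNIV. \<Sum>l\<in>UNIV. \<Sum>j\<in>UNIV. \<Sum>m\<in>UNIV. h i l x * h j m x * \<alpha> i m x * Q l (f j) x)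
    + ((\<Sum>i\<in>UNIV. \<Sum>l\<in>UNIV. \<Sum>j\<in>UNIV. \<Sum>m\<in>UNIV. h i l x * h j m x * Q l (\<alpha> i m) x * f j x)
    + (\<Sum>i\<in>UNIV. \<Sum>l\<in>UNIV. \<Sum>j\<in>UNIV. \<Sum>m\<in>UNIV. h i l x * Q l (h j m) x * \<alpha> i m x * f j x))"
    by (simp add: cds sm x \<alpha> f sum_distrib_left sum.distrib algebra_simps)
  have 2: "(\<Sum>i\<in>UNIV. \<Sum>l\<in>UNIV. \<Sum>j\<in>UNIV. \<Sum>m\<in>UNIV. h i l x * h j m x * Q l (\<alpha> i m) x * f j x)
     = (\<Sum>j\<in>UNIV. \<Sum>m\<in>UNIV. h j m x * f j x * (\<Sum>i\<in>UNIV. \<Sum>l\<in>UNIV. h i l x * Q m (\<alpha> i l) x))"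
    unfolding sum_distrib_left
    by (subst sum4_swap) (intro sum.cong refl, subst cl, simp add: mult_ac)
  have "(\<Sum>i\<in>UNIV. \<Sum>l\<in>UNIV. \<Sum>j\<in>UNIV. \<Sum>m\<in>UNIV. h i l x * Q l (h j m) x * \<alpha> i m x * f j x)
     = (\<Sum>i\<in>UNIV. \<Sum>j\<in>UNIV. \<Sum>m\<in>UNIV. (\<Sum>l\<in>UNIV. h i l x * Q l (h j m) x) * \<alpha> i m x * f j x)"
    unfolding sum_distrib_right by (intro sum.cong refl sum_rotate)
  also have "\<dots> = (\<Sum>i\<in>UNIV. \<Sum>j\<in>UNIV. \<Sum>m\<in>UNIV. \<Sum>l\<in>UNIV. h j l x * Q l (h i m) x * \<alpha> i m x * f j x)"
    by (subst h_Q_h[OF x]) (simp only: sum_distrib_right)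
  also have "\<dots> = (\<Sum>j\<in>UNIV. \<Sum>i\<in>UNIV. \<Sum>m\<in>UNIV. \<Sum>l\<in>UNIV. h j l x * Q l (h i m) x * \<alpha> i m x * f j x)"
    by (rule sum.swap)
  also have "\<dots> = (\<Sum>j\<in>UNIV. \<Sum>l\<in>UNIV. \<Sum>i\<in>UNIV. \<Sum>m\<in>UNIV. h j l x * Q l (h i m) x * \<alpha> i m x * f j x)"
    by (intro sum.cong refl sum_rotate[symmetric])
  also have "\<dots> = (\<Sum>j\<in>UNIV. \<Sum>m\<in>UNIV. h j m x * f j x * (\<Sum>i\<in>UNIV. \<Sum>l\<in>UNIV. Q m (h i l) x * \<alpha> i l x))"
    by (simp add: sum_distrib_left mult_ac)
  finally have 3: "(\<Sum>i\<in>UNIV. \<Sum>l\<in>UNIV. \<Sum>j\<in>UNIV. \<Sum>m\<in>UNIV. h i l x * Q l (h j m) x * \<alpha> i m x * f j x)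
     = (\<Sum>j\<in>UNIV. \<Sum>m\<in>UNIV. h j m x * f j x * (\<Sum>i\<in>UNIV. \<Sum>l\<in>UNIV. Q m (h i l) x * \<alpha> i l x))" .
  have 4: "Q m (\<lambda>x. \<Sum>i\<in>UNIV. \<Sum>l\<in>UNIV. h i l x * \<alpha> i l x) x =
     (\<Sum>i\<in>UNIV. \<Sum>l\<in>UNIV. h i l x * Q m (\<alpha> i l) x) + (\<Sum>i\<in>UNIV. \<Sum>l\<in>UNIV. Q m (h i l) x * \<alpha> i l x)" for m
    by (simp add: cds sm x \<alpha> sum.distrib)
  have 5: "smooth_on S (\<lambda>x. \<Sum>j\<in>UNIV. \<Sum>m\<in>UNIV. h j m x * \<alpha> i m x * f j x)" for i
    by (intro sm \<alpha> f)
  show ?thesis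
    unfolding div_vector[OF x 5] 1 2 3 4 by (simp add: sum.distrib algebra_simps)
qed

definition Lap where "Lap f x = (\<Sum>i\<in>UNIV. \<Sum>j\<in>UNIV. h i j x * P i (Q j f) x)"

definition Ric where "Ric i j x = - P i (Q j (\<lambda>x. complex_of_real (ln (Re (det (G x)))))) x"

lemma smooth_Lap: "smooth_on S f \<Longrightarrow> smooth_on S (Lap f)"
  unfolding Lap_def[abs_def] by (intro sm)

lemma Ric_eq:
  assumes x: "x \<in> S"
  shows "Ric k m x = - (\<Sum>a\<in>UNIV. \<Sum>b\<in>UNIV. h a b x * P k (Q m (g a b)) x + P k (h a b) x * Q m (g a b) x)"
proof -
  have "P k (Q m (\<lambda>x. complex_of_real (ln (Re (det (G x)))))) x = P k (\<lambda>x. \<Sum>a\<in>UNIV. \<Sum>b\<in>UNIV. h a b x * Q m (g a b) x) x"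
    by (rule cd_cong[OF cd_L x])
  then show ?thesis by (simp add: Ric_def cds sm x)
qed

end

section \<open>The Bochner formula for a real function\<close>

locale kahler_potential = kahler_field +
  fixes \<psi>
  assumes psi: "smooth_on S \<psi>" and psi_real: "\<And>x. x \<in> S \<Longrightarrow> cnj (\<psi> x) = \<psi> x"
begin

text \<open>\<open>X\<close> and \<open>Y\<close> are the components of the gradient of \<open>\<psi>\<close> and its conjugate, and \<open>A\<close> is the derivative
  of \<open>Y\<close> in the directions \<open>P\<close>, with the index lowered: the tensor of the Bochner formula.\<close>

definition Y where "Y m x = (\<Sum>j\<in>UNIV. h j m x * P j \<psi> x)"
definition X where "X k x = (\<Sum>m\<in>UNIV. h k m x * Q m \<psi> x)"
definition A where "A i k x = (\<Sum>m\<in>UNIV. g k m x * P i (Y m) x)"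

lemma smooth_Y: "smooth_on S (Y m)" unfolding Y_def[abs_def] by (intro sm psi)
lemma smooth_X: "smooth_on S (X m)" unfolding X_def[abs_def] by (intro sm psi)
lemma smooth_A: "smooth_on S (A i m)" unfolding A_def[abs_def] by (intro sm smooth_Y)

lemmas smp = sm psi smooth_Y smooth_X smooth_A smooth_Lap

lemma cnj_P_psi: assumes x: "x \<in> S" shows "cnj (P j \<psi> x) = Q j \<psi> x"
proof -
  have "Q j \<psi> x = Q j (\<lambda>x. cnj (\<psi> x)) x" by (rule cd_cong[OF _ x]) (simp add: psi_real)
  then show ?thesis using Q_cnj[OF psi x] by simp
qed

lemma cnj_Y: "x \<in> S \<Longrightarrow> Y m x = cnj (X m x)"
  by (simp add: Y_def X_def h_cnj cnj_P_psi[symmetric])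

lemma g_Y: assumes x: "x \<in> S" shows "(\<Sum>m\<in>UNIV. g k m x * Y m x) = P k \<psi> x"
proof -
  have "(\<Sum>m\<in>UNIV. g k m x * Y m x) = (\<Sum>j\<in>UNIV. (\<Sum>m\<in>UNIV. h j m x * g k m x) * P j \<psi> x)"
    unfolding Y_def sum_distrib_left sum_distrib_right by (subst sum.swap) (simp add: mult_ac)
  then show ?thesis by (simp add: hg1[OF x] if_distrib[of "\<lambda>a. a * _"] cong: if_cong)
qed

lemma g_X: assumes x: "x \<in> S" shows "(\<Sum>k\<in>UNIV. g k m x * X k x) = Q m \<psi> x"
proof -
  have "cnj (\<Sum>k\<in>UNIV. g m k x * Y k x) = Q m \<psi> x" by (simp only: g_Y[OF x] cnj_P_psi[OF x])
  then show ?thesis by (simp add: cnj_Y x g_cnj)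
qed

text \<open>Differentiate the relation \<open>g_Y\<close>, in which lowering the index of
  \<open>Y\<close> returns the differential of \<psi>; closedness brings the derivative of the
  metric to the form on the left.\<close>

lemma P_P_psi_Q: assumes x: "x \<in> S"
  shows "P i (Q l \<psi>) x - (\<Sum>m\<in>UNIV. Y m x * Q m (g i l) x) = (\<Sum>m\<in>UNIV. g i m x * Q l (Y m) x)"
proof -
  have "P i (Q l \<psi>) x = Q l (P i \<psi>) x" by (rule cd_commute[OF good psi x])
  also have "\<dots> = Q l (\<lambda>x. \<Sum>m\<in>UNIV. g i m x * Y m x) x" by (rule cd_cong[OF _ x]) (simp add: g_Y)
  also have "\<dots> = (\<Sum>m\<in>UNIV. g i m x * Q l (Y m) x) + (\<Sum>m\<in>UNIV. Q l (g i m) x * Y m x)"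
    by (simp add: cds smp x sum.distrib)
  also have "(\<Sum>m\<in>UNIV. Q l (g i m) x * Y m x) = (\<Sum>m\<in>UNIV. Y m x * Q m (g i l) x)"
    by (intro sum.cong refl) (simp add: closed_Q[OF x, of l])
  finally show ?thesis by simp
qed

text \<open>A Weitzenboeck identity: the trace of the antiholomorphic derivative of the
  (2,0)-Hessian is the differential of the Laplacian plus a Ricci term. Plain derivatives commute
  freely; the Ricci form appears because the second derivatives of the metric that are left over are
  those of \<open>Ric_eq\<close>.\<close>

lemma h_Q_A:
  assumes x: "x \<in> S"
  shows "(\<Sum>i\<in>UNIV. \<Sum>l\<in>UNIV. h i l x * Q l (A i k) x) = P k (Lap \<psi>) x + (\<Sum>m\<in>UNIV. Y m x * Ric k m x)"
proof -
  \<comment> \<open>In this form \<open>A\<close> is the covariant (2,0)-Hessian: the sum is the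
    Christoffel correction.\<close>
  have A_eq: "A i k y = P i (P k \<psi>) y - (\<Sum>m\<in>UNIV. P i (g k m) y * Y m y)" if y: "y \<in> S" for i y
  proof -
    have "P i (P k \<psi>) y = P i (\<lambda>x. \<Sum>m\<in>UNIV. g k m x * Y m x) y" by (rule cd_cong[OF _ y]) (simp add: g_Y)
    also have "\<dots> = A i k y + (\<Sum>m\<in>UNIV. P i (g k m) y * Y m y)"
      by (simp add: cds smp y sum.distrib A_def)
    finally show ?thesis by simp
  qed
  have c1: "Q l (P i (P k \<psi>)) x = P k (P i (Q l \<psi>)) x" for i l
  proof -
    have "Q l (P i (P k \<psi>)) x = Q l (P k (P i \<psi>)) x" by (rule cd_cong[OF cd_commute[OF good psi] x])
    also have "\<dots> = P k (Q l (P i \<psi>)) x" by (intro cd_commute good smp x)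
    also have "\<dots> = P k (P i (Q l \<psi>)) x" by (rule cd_cong[OF cd_commute[OF good psi] x])
    finally show ?thesis .
  qed
  \<comment> \<open>Closedness, used once for each type of index, brings the second derivatives of
    the metric into the position they have in \<open>Ric_eq\<close>.\<close>
  have c2: "Q l (P i (g k m)) x = P k (Q m (g i l)) x" for i l m
  proof -
    have "Q l (P i (g k m)) x = Q l (P k (g i m)) x" by (rule cd_cong[OF closed x])
    also have "\<dots> = P k (Q l (g i m)) x" by (intro cd_commute good smp x)
    also have "\<dots> = P k (Q m (g i l)) x" by (rule cd_cong[OF closed_Q x])
    finally show ?thesis .
  qed
  have QA: "Q l (A i k) x = P k (P i (Q l \<psi>)) x - (\<Sum>m\<in>UNIV. P k (g i m) x * Q l (Y m) x) - (\<Sum>m\<in>UNIV. Y m x * P k (Q m (g i l)) x)" for i l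
  proof -
    have "Q l (A i k) x = Q l (\<lambda>y. P i (P k \<psi>) y - (\<Sum>m\<in>UNIV. P i (g k m) y * Y m y)) x"
      by (rule cd_cong[OF A_eq x])
    also have "\<dots> = Q l (P i (P k \<psi>)) x - (\<Sum>m\<in>UNIV. P i (g k m) x * Q l (Y m) x) - (\<Sum>m\<in>UNIV. Q l (P i (g k m)) x * Y m x)"
      by (simp add: cds smp x sum.distrib)
    also have "\<dots> = P k (P i (Q l \<psi>)) x - (\<Sum>m\<in>UNIV. P k (g i m) x * Q l (Y m) x) - (\<Sum>m\<in>UNIV. P k (Q m (g i l)) x * Y m x)"
      by (simp only: c1 c2 closed[OF x, of _ k])
    finally show ?thesis by (simp add: mult.commute)
  qed
  have dhg: "(\<Sum>i\<in>UNIV. P k (h i l) x * g i m x) = - (\<Sum>i\<in>UNIV. h i l x * P k (g i m) x)" for l m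
    by (rule dh_g[OF x])
  have LHS: "(\<Sum>i\<in>UNIV. \<Sum>l\<in>UNIV. h i l x * Q l (A i k) x) =
     (\<Sum>i\<in>UNIV. \<Sum>l\<in>UNIV. h i l x * P k (P i (Q l \<psi>)) x)
    - (\<Sum>i\<in>UNIV. \<Sum>l\<in>UNIV. \<Sum>m\<in>UNIV. h i l x * P k (g i m) x * Q l (Y m) x)
    - (\<Sum>i\<in>UNIV. \<Sum>l\<in>UNIV. \<Sum>m\<in>UNIV. h i l x * Y m x * P k (Q m (g i l)) x)"
    by (simp add: QA algebra_simps sum_distrib_left sum.distrib sum_subtractf)
  have PL: "P k (Lap \<psi>) x = (\<Sum>i\<in>UNIV. \<Sum>l\<in>UNIV. h i l x * P k (P i (Q l \<psi>)) x) + (\<Sum>i\<in>UNIV. \<Sum>l\<in>UNIV. P k (h i l) x * P i (Q l \<psi>) x)"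
    unfolding Lap_def[abs_def] by (simp add: cds smp x sum.distrib)
  have YR: "(\<Sum>m\<in>UNIV. Y m x * Ric k m x) =
     - (\<Sum>i\<in>UNIV. \<Sum>l\<in>UNIV. \<Sum>m\<in>UNIV. h i l x * Y m x * P k (Q m (g i l)) x)
     - (\<Sum>i\<in>UNIV. \<Sum>l\<in>UNIV. \<Sum>m\<in>UNIV. P k (h i l) x * (Y m x * Q m (g i l) x))"
  proof -
    have "(\<Sum>m\<in>UNIV. Y m x * Ric k m x) = - (\<Sum>m\<in>UNIV. \<Sum>i\<in>UNIV. \<Sum>l\<in>UNIV. h i l x * Y m x * P k (Q m (g i l)) x) - (\<Sum>m\<in>UNIV. \<Sum>i\<in>UNIV. \<Sum>l\<in>UNIV. P k (h i l) x * (Y m x * Q m (g i l) x))"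
    proof -
      have "Y m x * Ric k m x = - (\<Sum>i\<in>UNIV. \<Sum>l\<in>UNIV. h i l x * Y m x * P k (Q m (g i l)) x) - (\<Sum>i\<in>UNIV. \<Sum>l\<in>UNIV. P k (h i l) x * (Y m x * Q m (g i l) x))" for m
        unfolding Ric_eq[OF x] by (simp add: sum_distrib_left sum.distrib right_diff_distrib mult_ac)
      then show ?thesis by (simp add: sum_subtractf sum_negf)
    qed
    also have "(\<Sum>m\<in>UNIV. \<Sum>i\<in>UNIV. \<Sum>l\<in>UNIV. h i l x * Y m x * P k (Q m (g i l)) x) = (\<Sum>i\<in>UNIV. \<Sum>l\<in>UNIV. \<Sum>m\<in>UNIV. h i l x * Y m x * P k (Q m (g i l)) x)" by (rule sum_rotate)
    also have "(\<Sum>m\<in>UNIV. \<Sum>i\<in>UNIV. \<Sum>l\<in>UNIV. P k (h i l) x * (Y m x * Q m (g i l) x)) = (\<Sum>i\<in>UNIV. \<Sum>l\<in>UNIV. \<Sum>m\<in>UNIV. P k (h i l) x * (Y m x * Q m (g i l) x))" by (rule sum_rotate)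
    finally show ?thesis .
  qed
  \<comment> \<open>What remains of \<open>PL\<close> and \<open>YR\<close> are the terms with
    derivatives of \<open>h\<close>; \<open>P_P_psi_Q\<close> and \<open>dhg\<close> turn their sum
    into the middle term of \<open>LHS\<close>.\<close>
  have "(\<Sum>i\<in>UNIV. \<Sum>l\<in>UNIV. P k (h i l) x * P i (Q l \<psi>) x) - (\<Sum>i\<in>UNIV. \<Sum>l\<in>UNIV. \<Sum>m\<in>UNIV. P k (h i l) x * (Y m x * Q m (g i l) x))
     = (\<Sum>i\<in>UNIV. \<Sum>l\<in>UNIV. P k (h i l) x * (P i (Q l \<psi>) x - (\<Sum>m\<in>UNIV. Y m x * Q m (g i l) x)))"
    by (simp add: right_diff_distrib sum_subtractf sum_distrib_left)
  also have "\<dots> = (\<Sum>i\<in>UNIV. \<Sum>l\<in>UNIV. \<Sum>m\<in>UNIV. P k (h i l) x * g i m x * Q l (Y m) x)"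
    by (simp add: P_P_psi_Q[OF x] sum_distrib_left mult.assoc)
  also have "\<dots> = (\<Sum>l\<in>UNIV. \<Sum>m\<in>UNIV. (\<Sum>i\<in>UNIV. P k (h i l) x * g i m x) * Q l (Y m) x)"
    unfolding sum_distrib_right by (rule sum_rotate)
  also have "\<dots> = - (\<Sum>l\<in>UNIV. \<Sum>m\<in>UNIV. \<Sum>i\<in>UNIV. h i l x * P k (g i m) x * Q l (Y m) x)"
    unfolding dhg by (simp add: sum_distrib_right sum_negf)
  also have "(\<Sum>l\<in>UNIV. \<Sum>m\<in>UNIV. \<Sum>i\<in>UNIV. h i l x * P k (g i m) x * Q l (Y m) x) =
     (\<Sum>i\<in>UNIV. \<Sum>l\<in>UNIV. \<Sum>m\<in>UNIV. h i l x * P k (g i m) x * Q l (Y m) x)"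
    by (rule sum_rotate[symmetric])
  finally show ?thesis unfolding LHS PL YR by (simp add: algebra_simps)
qed

text \<open>The squared length of the (1,0)-part of the differential of \<psi>, whose Laplacian the
  Bochner formula computes.\<close>

definition Gam where "Gam x = (\<Sum>j\<in>UNIV. \<Sum>m\<in>UNIV. h j m x * P j \<psi> x * Q m \<psi> x)"

lemma smooth_Gam: "smooth_on S Gam" unfolding Gam_def[abs_def] by (intro smp)

lemma Gam_eq: "Gam x = (\<Sum>m\<in>UNIV. Y m x * Q m \<psi> x)"
  unfolding Gam_def Y_def sum_distrib_right by (rule sum.swap)

text \<open>The sum is the squared norm of the antiholomorphic derivative of \<open>X\<close>: as
  \<psi> is real, \<open>P i (Y m)\<close> is the conjugate of \<open>Q i (X m)\<close>. Positivity
  in the vector index comes from writing the metric as a sum of squares, and in the derivative index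
  from the inverse metric.\<close>

lemma bochner_T:
  assumes x: "x \<in> S"
  shows "0 \<le> Re (\<Sum>i\<in>UNIV. \<Sum>l\<in>UNIV. h i l x * (\<Sum>k\<in>UNIV. A i k x * Q l (X k) x))"
proof -
  have Pos: "Re (\<Sum>i\<in>UNIV. \<Sum>j\<in>UNIV. G x $ i $ j * v i * cnj (v j)) > 0" if "\<exists>i\<in>UNIV. v i \<noteq> 0" for v
    using hermitian_pos_gt[OF herm[OF x], of "\<chi> i. v i"] that by (auto simp: vec_eq_iff)
  obtain c :: "'b \<Rightarrow> 'b \<Rightarrow> complex" where c: "\<And>i j. G x $ i $ j = (\<Sum>r\<in>UNIV. c r i * cnj (c r j))"
  proof -
    have "\<exists>c::'b \<Rightarrow> 'b \<Rightarrow> complex. \<forall>i\<in>UNIV. \<forall>j\<in>UNIV. G x $ i $ j = (\<Sum>r\<in>UNIV. c r i * cnj (c r j))"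
      by (rule pos_def_sum_squares[where H="\<lambda>i j. G x $ i $ j", OF finite hermitian_cnj[OF herm[OF x]]]) (erule Pos)
    then show ?thesis using that by blast
  qed
  have PY: "P i (Y m) x = cnj (Q i (X m) x)" for i m
  proof -
    have "P i (Y m) x = P i (\<lambda>x. cnj (X m x)) x" by (rule cd_cong[OF cnj_Y x])
    then show ?thesis using P_cnj[OF smooth_X x] by simp
  qed
  \<comment> \<open>\<open>w r\<close> collects the conjugated derivatives of the
    \<open>r\<close>-th component of \<open>X\<close> in the frame in which the metric is a sum of
    squares.\<close>
  define w where "w r = (\<chi> l. cnj (\<Sum>k\<in>UNIV. c r k * Q l (X k) x))" for r :: 'b
  have "(\<Sum>k\<in>UNIV. A i k x * Q l (X k) x) = (\<Sum>r\<in>UNIV. w r $ i * cnj (w r $ l))" for i l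
  proof -
    have "(\<Sum>k\<in>UNIV. A i k x * Q l (X k) x) = (\<Sum>k\<in>UNIV. \<Sum>m\<in>UNIV. \<Sum>r\<in>UNIV. c r k * cnj (c r m) * cnj (Q i (X m) x) * Q l (X k) x)"
      unfolding A_def PY c sum_distrib_right by (simp add: mult_ac)
    also have "\<dots> = (\<Sum>r\<in>UNIV. \<Sum>k\<in>UNIV. \<Sum>m\<in>UNIV. c r k * cnj (c r m) * cnj (Q i (X m) x) * Q l (X k) x)"
      by (rule sum_rotate[symmetric])
    also have "\<dots> = (\<Sum>r\<in>UNIV. (\<Sum>m\<in>UNIV. cnj (c r m) * cnj (Q i (X m) x)) * (\<Sum>k\<in>UNIV. c r k * Q l (X k) x))"
      unfolding sum_product
      by (rule sum.cong[OF refl], rule trans[OF sum.swap], rule sum.cong[OF refl], rule sum.cong[OF refl], simp add: mult_ac)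
    finally show ?thesis by (simp add: w_def)
  qed
  then have "(\<Sum>i\<in>UNIV. \<Sum>l\<in>UNIV. h i l x * (\<Sum>k\<in>UNIV. A i k x * Q l (X k) x)) =
     (\<Sum>i\<in>UNIV. \<Sum>l\<in>UNIV. \<Sum>r\<in>UNIV. h i l x * w r $ i * cnj (w r $ l))"
    by (simp add: sum_distrib_left mult_ac)
  also have "\<dots> = (\<Sum>r\<in>UNIV. \<Sum>i\<in>UNIV. \<Sum>l\<in>UNIV. h i l x * w r $ i * cnj (w r $ l))"
    by (rule sum_rotate[symmetric])
  finally have eq: "(\<Sum>i\<in>UNIV. \<Sum>l\<in>UNIV. h i l x * (\<Sum>k\<in>UNIV. A i k x * Q l (X k) x)) =
     (\<Sum>r\<in>UNIV. \<Sum>i\<in>UNIV. \<Sum>l\<in>UNIV. h i l x * w r $ i * cnj (w r $ l))" .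
  show ?thesis unfolding eq Re_sum[of "\<lambda>r. \<Sum>i\<in>UNIV. \<Sum>l\<in>UNIV. h i l x * w r $ i * cnj (w r $ l)"]
    by (rule sum_nonneg) (rule hermitian_pos_upper_pos[OF herm[OF x]])
qed

text \<open>The differential of \<open>Gam\<close> splits into \<open>w\<close>, where the
  derivative falls on \<open>Y\<close>, and \<open>v\<close>, where it falls on
  \<open>Q m \<psi>\<close>. The divergence of \<open>v\<close> is given by \<open>div_form\<close>
  for the complex Hessian; that of \<open>w\<close> is the nonnegative term of
  \<open>bochner_T\<close> plus \<open>X\<close> contracted with \<open>h_Q_A\<close>, which
  supplies \<open>?E\<close> and \<open>?R\<close>.\<close>

lemma bochner:
  assumes x: "x \<in> S"
  shows "0 \<le> Re (Lap Gam x
    - ((\<Sum>i\<in>UNIV. \<Sum>l\<in>UNIV. \<Sum>j\<in>UNIV. \<Sum>m\<in>UNIV. h i l x * h j m x * P i (Q m \<psi>) x * Q l (P j \<psi>) x)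
       + (\<Sum>j\<in>UNIV. \<Sum>m\<in>UNIV. h j m x * P j \<psi> x * Q m (Lap \<psi>) x))
    - (\<Sum>k\<in>UNIV. \<Sum>m\<in>UNIV. h k m x * P k (Lap \<psi>) x * Q m \<psi> x)
    - (\<Sum>i\<in>UNIV. \<Sum>l\<in>UNIV. \<Sum>j\<in>UNIV. \<Sum>m\<in>UNIV. h i l x * h j m x * Ric i m x * P j \<psi> x * Q l \<psi> x))"
    (is "0 \<le> Re (Lap Gam x - ?D - ?E - ?R)")
proof -
  let ?u = "\<lambda>x. det (G x)"
  define w where "w i x = (\<Sum>k\<in>UNIV. A i k x * X k x)" for i x
  define v where "v i x = (\<Sum>j\<in>UNIV. \<Sum>m\<in>UNIV. h j m x * P i (Q m \<psi>) x * P j \<psi> x)" for i x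
  have sw: "smooth_on S (w i)" and sv: "smooth_on S (v i)" for i
    unfolding w_def[abs_def] v_def[abs_def] by (intro smp)+
  have PG: "P i Gam y = w i y + v i y" if y: "y \<in> S" for i y
  proof -
    have "P i Gam y = P i (\<lambda>x. \<Sum>m\<in>UNIV. Y m x * Q m \<psi> x) y" by (rule cd_cong[OF Gam_eq y])
    also have "\<dots> = (\<Sum>m\<in>UNIV. P i (Y m) y * Q m \<psi> y) + (\<Sum>m\<in>UNIV. Y m y * P i (Q m \<psi>) y)"
      by (simp add: cds smp y sum.distrib)
    also have "(\<Sum>m\<in>UNIV. Y m y * P i (Q m \<psi>) y) = v i y"
      unfolding v_def Y_def sum_distrib_right by (subst sum.swap) (simp add: mult_ac)
    also have "(\<Sum>m\<in>UNIV. P i (Y m) y * Q m \<psi> y) = w i y"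
      unfolding w_def A_def g_X[OF y, symmetric] sum_distrib_left sum_distrib_right
      by (subst sum.swap) (simp add: mult_ac)
    finally show ?thesis .
  qed
  have "Lap Gam x = (\<Sum>i\<in>UNIV. \<Sum>l\<in>UNIV. h i l x * Q l (\<lambda>y. w i y + v i y) x)"
    unfolding Lap_def
  proof (intro sum.cong refl arg_cong2[where f="(*)"])
    fix i l
    have "P i (Q l Gam) x = Q l (P i Gam) x" by (rule cd_commute[OF good smooth_Gam x])
    also have "\<dots> = Q l (\<lambda>y. w i y + v i y) x" by (rule cd_cong[OF PG x])
    finally show "P i (Q l Gam) x = Q l (\<lambda>y. w i y + v i y) x" .
  qed
  also have "\<dots> = (\<Sum>i\<in>UNIV. \<Sum>l\<in>UNIV. h i l x * Q l (w i) x) + (\<Sum>i\<in>UNIV. \<Sum>l\<in>UNIV. h i l x * Q l (v i) x)"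
    by (simp add: cd_add[OF good sw sv x] distrib_left sum.distrib)
  also have "(\<Sum>i\<in>UNIV. \<Sum>l\<in>UNIV. h i l x * Q l (v i) x) = ?D"
  proof -
    have cl: "Q k (P i (Q j \<psi>)) x = Q j (P i (Q k \<psi>)) x" for i j k
    proof -
      have "Q k (P i (Q j \<psi>)) x = P i (Q k (Q j \<psi>)) x" for k j by (intro cd_commute good smp x)
      moreover have "P i (Q k (Q j \<psi>)) x = P i (Q j (Q k \<psi>)) x" by (rule cd_cong[OF cd_commute[OF good psi] x])
      ultimately show ?thesis by metis
    qed
    have "det (G x) * (\<Sum>i\<in>UNIV. \<Sum>l\<in>UNIV. h i l x * Q l (v i) x) = det (G x) * ?D"
      using div_vector[OF x sv] div_form[where \<alpha>="\<lambda>i m. P i (Q m \<psi>)" and f="\<lambda>i. P i \<psi>", OF x _ _ cl] unfolding v_def[abs_def] Lap_def[abs_def]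
      by (simp add: smp)
    then show ?thesis using det_nz[OF x] by simp
  qed
  also have "(\<Sum>i\<in>UNIV. \<Sum>l\<in>UNIV. h i l x * Q l (w i) x) =
     (\<Sum>i\<in>UNIV. \<Sum>l\<in>UNIV. h i l x * (\<Sum>k\<in>UNIV. A i k x * Q l (X k) x)) + (\<Sum>k\<in>UNIV. X k x * (\<Sum>i\<in>UNIV. \<Sum>l\<in>UNIV. h i l x * Q l (A i k) x))"
  proof -
    have "(\<Sum>i\<in>UNIV. \<Sum>l\<in>UNIV. h i l x * Q l (w i) x) = (\<Sum>i\<in>UNIV. \<Sum>l\<in>UNIV. h i l x * (\<Sum>k\<in>UNIV. A i k x * Q l (X k) x))
       + (\<Sum>i\<in>UNIV. \<Sum>l\<in>UNIV. \<Sum>k\<in>UNIV. X k x * (h i l x * Q l (A i k) x))"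
      unfolding w_def[abs_def] by (simp add: cds smp x sum.distrib sum_distrib_left distrib_left mult_ac)
    also have "(\<Sum>i\<in>UNIV. \<Sum>l\<in>UNIV. \<Sum>k\<in>UNIV. X k x * (h i l x * Q l (A i k) x)) =
        (\<Sum>k\<in>UNIV. \<Sum>i\<in>UNIV. \<Sum>l\<in>UNIV. X k x * (h i l x * Q l (A i k) x))"
      by (rule sum_rotate[symmetric])
    finally show ?thesis unfolding sum_distrib_left .
  qed
  also have "(\<Sum>k\<in>UNIV. X k x * (\<Sum>i\<in>UNIV. \<Sum>l\<in>UNIV. h i l x * Q l (A i k) x)) = ?E + ?R"
  proof -
    have E: "(\<Sum>k\<in>UNIV. X k x * P k (Lap \<psi>) x) = ?E"
      unfolding X_def sum_distrib_right by (simp add: mult_ac)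
    have "(\<Sum>k\<in>UNIV. X k x * (\<Sum>m\<in>UNIV. Y m x * Ric k m x)) =
       (\<Sum>k\<in>UNIV. \<Sum>m\<in>UNIV. \<Sum>l\<in>UNIV. \<Sum>j\<in>UNIV. h k l x * h j m x * Ric k m x * P j \<psi> x * Q l \<psi> x)"
      unfolding X_def Y_def sum_distrib_right sum_distrib_left
      by (rule sum.cong[OF refl], rule sum.cong[OF refl], rule trans[OF sum.swap],
          rule sum.cong[OF refl], rule sum.cong[OF refl], simp add: mult_ac)
    also have "\<dots> = ?R" by (intro sum.cong refl sum_rotate)
    finally show ?thesis unfolding h_Q_A[OF x] distrib_left sum.distrib E by simp
  qed
  finally have "Lap Gam x - ?D - ?E - ?R = (\<Sum>i\<in>UNIV. \<Sum>l\<in>UNIV. h i l x * (\<Sum>k\<in>UNIV. A i k x * Q l (X k) x))"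
    by simp
  then show ?thesis using bochner_T[OF x] by simp
qed

end

section \<open>Complex linear change of variables\<close>

text \<open>The change of variables theorem is stated on spaces \<open>real^'m\<close>. The type
  \<open>'n bit0\<close> has twice as many elements as \<open>'n\<close>, hence as many as the real
  basis of \<open>complex^'n\<close>; any bijection between them will do.\<close>

definition basis_enum :: "'n::finite bit0 \<Rightarrow> complex^'n" where
  "basis_enum = (SOME f. bij_betw f UNIV Basis)"

lemma bij_basis_enum: "bij_betw (basis_enum :: 'n::finite bit0 \<Rightarrow> _) UNIV Basis"
proof -
  have "card (UNIV :: 'n bit0 set) = card (Basis :: (complex^'n) set)" by simp
  then have "\<exists>f :: 'n bit0 \<Rightarrow> complex^'n. bij_betw f UNIV Basis"
    by (intro finite_same_card_bij) auto
  then show ?thesis unfolding basis_enum_def by (rule someI_ex)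
qed

lemma basis_enum_in: "basis_enum k \<in> Basis"
  using bij_basis_enum unfolding bij_betw_def by blast

lemma basis_enum_eq_iff [simp]: "basis_enum k = basis_enum l \<longleftrightarrow> k = l"
  using bij_basis_enum unfolding bij_betw_def by (auto dest: injD)

lemma basis_enum_inner: "basis_enum k \<bullet> basis_enum l = (if k = l then 1 else 0)"
  by (simp add: inner_Basis basis_enum_in)

definition real_to_cvec :: "real^('n::finite bit0) \<Rightarrow> complex^'n" where
  "real_to_cvec x = (\<Sum>k\<in>UNIV. x $ k *\<^sub>R basis_enum k)"

definition cvec_to_real :: "complex^'n::finite \<Rightarrow> real^('n bit0)" where
  "cvec_to_real z = (\<chi> k. z \<bullet> basis_enum k)"

lemma cvec_to_real_inverse [simp]: "cvec_to_real (real_to_cvec x) = x"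
  by (simp add: cvec_to_real_def real_to_cvec_def vec_eq_iff inner_sum_left basis_enum_inner
      if_distrib[of "\<lambda>a. _ * a"] cong: if_cong)

lemma real_to_cvec_inverse [simp]: "real_to_cvec (cvec_to_real z) = z"
proof -
  have "(\<Sum>k\<in>UNIV. (z \<bullet> basis_enum k) *\<^sub>R basis_enum k) = (\<Sum>b\<in>Basis. (z \<bullet> b) *\<^sub>R b)"
    by (rule sum.reindex_bij_betw[OF bij_basis_enum])
  then show ?thesis by (simp add: cvec_to_real_def real_to_cvec_def euclidean_representation)
qed

lemma linear_real_to_cvec: "linear real_to_cvec"
  by (rule linearI) (auto simp: real_to_cvec_def scaleR_add_left sum.distrib scaleR_sum_right)

lemma linear_cvec_to_real: "linear cvec_to_real"
  by (rule linearI) (auto simp: cvec_to_real_def vec_eq_iff inner_add_left)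

lemma continuous_real_to_cvec: "continuous_on A real_to_cvec"
  by (rule linear_continuous_on) (use linear_real_to_cvec in \<open>simp add: linear_conv_bounded_linear\<close>)

lemma borel_real_to_cvec [measurable]: "real_to_cvec \<in> borel_measurable borel"
  by (rule borel_measurable_continuous_onI[OF continuous_real_to_cvec])

text \<open>Both spaces carry the same coordinates in different enumerations, so boxes correspond to
  boxes with equal edge lengths, and these determine Lebesgue measure.\<close>

lemma distr_cvec_to_real: "distr lborel borel real_to_cvec = (lborel :: (complex^'n::finite) measure)"
proof (rule lborel_eqI[symmetric])
  fix l u :: "complex^'n" assume lu: "\<And>b. b \<in> Basis \<Longrightarrow> l \<bullet> b \<le> u \<bullet> b"
  have inn: "real_to_cvec x \<bullet> basis_enum k = x $ k" for x :: "real^('n bit0)" and k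
    by (metis cvec_to_real_def cvec_to_real_inverse vec_lambda_beta)
  have ball: "(\<forall>b\<in>Basis. Pr b) \<longleftrightarrow> (\<forall>k. Pr (basis_enum k :: complex^'n))" for Pr
    using bij_basis_enum unfolding bij_betw_def by (metis imageE rangeI)
  have box: "real_to_cvec -` box l u = box (cvec_to_real l) (cvec_to_real u)"
  proof (rule set_eqI)
    fix x
    have "x \<in> real_to_cvec -` box l u \<longleftrightarrow> (\<forall>k. l \<bullet> basis_enum k < x $ k \<and> x $ k < u \<bullet> basis_enum k)"
      by (simp add: mem_box ball inn)
    also have "\<dots> \<longleftrightarrow> x \<in> box (cvec_to_real l) (cvec_to_real u)"
      by (simp add: mem_box_cart cvec_to_real_def)
    finally show "x \<in> real_to_cvec -` box l u \<longleftrightarrow> x \<in> box (cvec_to_real l) (cvec_to_real u)" .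
  qed
  have le: "cvec_to_real l \<bullet> b \<le> cvec_to_real u \<bullet> b" if "b \<in> Basis" for b
  proof -
    from that obtain k where "b = axis k 1" by (auto simp: Basis_vec_def)
    then show ?thesis using lu[OF basis_enum_in[of k]] by (simp add: inner_axis cvec_to_real_def)
  qed
  have "emeasure (distr lborel borel real_to_cvec) (box l u) = emeasure lborel (box (cvec_to_real l) (cvec_to_real u))"
    by (subst emeasure_distr) (auto simp: box)
  also have "\<dots> = (\<Prod>b\<in>Basis. (cvec_to_real u - cvec_to_real l) \<bullet> b)"
    by (rule emeasure_lborel_box[OF le])
  also have "(\<Prod>b\<in>Basis. (cvec_to_real u - cvec_to_real l) \<bullet> b) = (\<Prod>k\<in>UNIV. (cvec_to_real u - cvec_to_real l) \<bullet> axis k 1)"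
    unfolding Basis_vec_def by (subst prod.reindex[symmetric, of "\<lambda>k. axis k 1", simplified comp_def])
       (auto simp: inj_on_def axis_eq_axis intro!: prod.cong)
  also have "\<dots> = (\<Prod>k\<in>UNIV. (u - l) \<bullet> basis_enum k)"
    by (simp add: inner_axis cvec_to_real_def inner_diff_left)
  also have "\<dots> = (\<Prod>b\<in>Basis. (u - l) \<bullet> b)" by (rule prod.reindex_bij_betw[OF bij_basis_enum])
  finally show "emeasure (distr lborel borel real_to_cvec) (box l u) = (\<Prod>b\<in>Basis. (u - l) \<bullet> b)" .
qed simp

section \<open>The real determinant of a complex linear map\<close>

definition real_det :: "complex^'n::finite^'n \<Rightarrow> real" where
  "real_det A = \<bar>det (matrix (\<lambda>x. cvec_to_real (A *v real_to_cvec x)))\<bar>"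

lemma linear_matrix_vector_real: "linear ((*v) (A :: complex^'n::finite^'m::finite))"
  by (rule linearI) (auto simp: matrix_vector_right_distrib matrix_vector_mult_def vec_eq_iff scaleR_sum_right distrib_left sum.distrib)

lemma linear_conj: "linear (\<lambda>x. cvec_to_real (A *v real_to_cvec x))"
  using linear_compose[OF linear_compose[OF linear_real_to_cvec linear_matrix_vector_real] linear_cvec_to_real]
  by (simp add: comp_def)

lemma real_det_mult: "real_det (A ** B) = real_det A * real_det B"
proof -
  have "(\<lambda>x. cvec_to_real ((A ** B) *v real_to_cvec x)) =
     (\<lambda>x. cvec_to_real (A *v real_to_cvec x)) \<circ> (\<lambda>x. cvec_to_real (B *v real_to_cvec x))"
    by (auto simp: fun_eq_iff matrix_vector_mul_assoc)
  then show ?thesis unfolding real_det_def by (simp add: matrix_compose linear_conj det_mul abs_mult)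
qed

lemma real_det_1: "real_det (mat 1) = 1"
proof -
  have "(\<lambda>x. cvec_to_real (mat 1 *v real_to_cvec x)) = id" by auto
  then show ?thesis unfolding real_det_def by simp
qed

definition diag_mat :: "'n::finite \<Rightarrow> complex \<Rightarrow> complex^'n^'n" where
  "diag_mat k c = (\<chi> a b. if a = b then (if a = k then c else 1) else 0)"

text \<open>Multiplication from the left adds \<open>v a\<close> times row \<open>k\<close> to row
  \<open>a\<close> for every \<open>a\<close>: a whole column of elementary row operations at
  once.\<close>

definition col_mat :: "'n::finite \<Rightarrow> ('n \<Rightarrow> complex) \<Rightarrow> complex^'n^'n" where
  "col_mat k v = (\<chi> a b. (if a = b then 1 else 0) + (if b = k then v a else 0))"

lemma sum_delta_mult:
  "(\<Sum>k\<in>UNIV. (if a = k then c k else 0) * f k) = c a * (f a :: complex)"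
  "(\<Sum>k\<in>UNIV. (if k = a then c k else 0) * f k) = c a * (f a :: complex)"
  for a :: "'n::finite"
  by (simp_all add: if_distrib[of "\<lambda>x. x * _"] cong: if_cong)

lemma diag_mat_mult: "(diag_mat k c ** A) $ a $ b = (if a = k then c else 1) * A $ a $ b"
  by (simp add: matrix_matrix_mult_def diag_mat_def sum_delta_mult)

lemma col_mat_mult: "(col_mat k v ** A) $ a $ b = A $ a $ b + v a * A $ k $ b"
  by (simp add: matrix_matrix_mult_def col_mat_def distrib_right sum.distrib sum_delta_mult)

lemma col_mat_add: "v k = 0 \<Longrightarrow> w k = 0 \<Longrightarrow> col_mat k v ** col_mat k w = col_mat k (\<lambda>a. v a + w a)"
  by (auto simp: vec_eq_iff col_mat_mult) (auto simp: col_mat_def)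

lemma diag_mat_mult_diag: "diag_mat k c ** diag_mat k d = diag_mat k (c * d)"
  by (auto simp: vec_eq_iff diag_mat_mult) (auto simp: diag_mat_def)

lemma diag_mat_1: "diag_mat k 1 = mat 1" by (simp add: diag_mat_def mat_def vec_eq_iff)
lemma col_mat_0: "col_mat k (\<lambda>_. 0) = mat 1" by (simp add: col_mat_def mat_def vec_eq_iff)

lemma col_mat_conj: assumes "v k = 0"
  shows "diag_mat k (1/2) ** (col_mat k v ** diag_mat k 2) = col_mat k (\<lambda>a. v a + v a)"
  using assms by (auto simp: vec_eq_iff diag_mat_mult col_mat_mult) (auto simp: diag_mat_def col_mat_def)

text \<open>Conjugating the shear by a diagonal matrix squares it, so a multiplicative function is 1 on it.\<close>

lemma multiplicative_col_mat:
  fixes d :: "complex^'n::finite^'n \<Rightarrow> 'b::field"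
  assumes mult: "\<And>A B. d (A ** B) = d A * d B" and 1: "d (mat 1) = 1" and v: "v k = 0"
  shows "d (col_mat k v) = 1"
proof -
  have "col_mat k v ** col_mat k (\<lambda>a. - v a) = mat 1" using v by (simp add: col_mat_add col_mat_0)
  then have nz: "d (col_mat k v) \<noteq> 0" using mult 1 by (metis mult_zero_left zero_neq_one)
  have "d (diag_mat k (1/2)) * d (diag_mat k 2) = 1" using mult[of "diag_mat k (1/2)" "diag_mat k 2"]
    by (simp add: diag_mat_mult_diag diag_mat_1 1)
  then have "d (col_mat k (\<lambda>a. v a + v a)) = d (col_mat k v)"
    by (subst col_mat_conj[where v=v and k=k, OF v, symmetric]) (simp add: mult mult_ac)
  then have "d (col_mat k v) * d (col_mat k v) = d (col_mat k v)"
    using col_mat_add[where v=v and w=v and k=k, OF v v] mult by metis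
  then show ?thesis using nz by simp
qed

lemma det_diag_mat: "det (diag_mat k c) = c"
  by (subst det_diagonal) (auto simp: diag_mat_def)

lemma diag_mat_vec: "diag_mat k c *v z = (\<chi> a. (if a = k then c else 1) * z $ a)"
  by (simp add: vec_eq_iff matrix_vector_mult_def diag_mat_def sum_delta_mult)

text \<open>Multiplying one coordinate by a unit complex number is an isometry of the underlying
  real space, so its real matrix is orthogonal.\<close>

lemma real_det_diag_unit:
  fixes k :: "'n::finite"
  assumes "cmod c = 1" shows "real_det (diag_mat k c) = 1"
proof -
  let ?f = "\<lambda>x :: real^('n bit0). cvec_to_real (diag_mat k c *v real_to_cvec x)"
  have nr: "norm (real_to_cvec x) = norm x" for x :: "real^('n bit0)"
  proof -
    have "real_to_cvec x \<bullet> real_to_cvec x = (\<Sum>l\<in>UNIV. x $ l * x $ l)"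
      unfolding real_to_cvec_def
      by (simp add: inner_sum_left inner_sum_right basis_enum_inner if_distrib[of "\<lambda>a. _ * a"] cong: if_cong)
    also have "\<dots> = x \<bullet> x" by (simp add: inner_vec_def)
    finally show ?thesis by (simp add: norm_eq_sqrt_inner)
  qed
  have nc: "norm (cvec_to_real z) = norm z" for z :: "complex^'n"
    using nr[of "cvec_to_real z"] by simp
  have "norm (?f x) = norm x" for x
  proof -
    have "norm (diag_mat k c *v z) = norm z" for z :: "complex^'n"
      unfolding norm_vec_def diag_mat_vec by (intro L2_set_cong) (auto simp: norm_mult assms)
    then show ?thesis by (simp add: nr nc)
  qed
  then have "orthogonal_transformation ?f"
    unfolding orthogonal_transformation using linear_conj by blast
  then have "orthogonal_matrix (matrix ?f)" by (simp add: orthogonal_transformation_matrix)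
  from det_orthogonal_matrix[OF this] show ?thesis unfolding real_det_def by auto
qed

text \<open>A real factor acts diagonally on the real basis and scales exactly two of its vectors,
  the real and the imaginary axis of coordinate \<open>k\<close>; hence the square.\<close>

lemma real_det_diag_real:
  fixes k :: "'n::finite"
  shows "real_det (diag_mat k (of_real r)) = r\<^sup>2"
proof -
  let ?B = "{axis k 1, axis k \<i>} :: (complex^'n) set"
  let ?d = "\<lambda>l. if basis_enum l \<in> ?B then r else 1"
  let ?f = "\<lambda>x :: real^('n bit0). cvec_to_real (diag_mat k (of_real r) *v real_to_cvec x)"
  have B: "?B \<subseteq> Basis" by (auto simp: Basis_vec_def Basis_complex_def)
  have scale: "diag_mat k (of_real r) *v b = (if b \<in> ?B then r else 1) *\<^sub>R b" if b: "b \<in> Basis" for b :: "complex^'n"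
  proof -
    from b obtain i c where ic: "b = axis i c" "c = 1 \<or> c = \<i>" by (auto simp: Basis_vec_def Basis_complex_def)
    then have "b \<in> ?B \<longleftrightarrow> i = k" by (auto simp: axis_eq_axis)
    then show ?thesis unfolding diag_mat_vec ic(1) by (auto simp: vec_eq_iff axis_def scaleR_conv_of_real[where 'a=complex])
  qed
  have f_ax: "?f (axis l 1) = ?d l *\<^sub>R axis l 1" for l
  proof -
    have "real_to_cvec (axis l 1) = basis_enum l"
      by (simp add: real_to_cvec_def axis_def if_distrib[of "\<lambda>a. a *\<^sub>R _"] cong: if_cong)
    moreover have "cvec_to_real (basis_enum l) = axis l 1"
      by (simp add: cvec_to_real_def basis_enum_inner vec_eq_iff axis_def)
    ultimately show ?thesis
      by (simp only: scale[OF basis_enum_in[of l]] linear_scale[OF linear_cvec_to_real])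
  qed
  have mat: "matrix ?f $ a $ b = (if a = b then ?d b else 0)" for a b
    unfolding matrix_def by (simp only: vec_lambda_beta f_ax) (simp add: axis_def)
  have "det (matrix ?f) = (\<Prod>l\<in>UNIV. matrix ?f $ l $ l)" by (rule det_diagonal) (simp add: mat)
  also have "\<dots> = (\<Prod>l\<in>UNIV. ?d l)" by (simp only: mat) simp
  also have "\<dots> = (\<Prod>b\<in>Basis. if b \<in> ?B then r else 1)" by (rule prod.reindex_bij_betw[OF bij_basis_enum])
  also have "\<dots> = (\<Prod>b\<in>?B. r)" using B by (simp only: prod.inter_restrict[symmetric] finite_Basis) (simp add: Int_absorb1)
  also have "\<dots> = r\<^sup>2" by (simp add: axis_eq_axis power2_eq_square complex_eq_iff)
  finally show ?thesis unfolding real_det_def by simp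
qed

text \<open>Polar decomposition of \<open>c\<close> reduces to the positive and to the unit
  case.\<close>

lemma real_det_diag: "real_det (diag_mat k c) = (cmod c)\<^sup>2"
proof (cases "c = 0")
  case True
  then show ?thesis using real_det_diag_real[of k 0] by simp
next
  case False
  then have "c = of_real (cmod c) * sgn c" by (simp add: sgn_div_norm scaleR_conv_of_real)
  then have "diag_mat k c = diag_mat k (of_real (cmod c)) ** diag_mat k (sgn c)"
    by (simp add: diag_mat_mult_diag)
  then show ?thesis using False by (simp add: real_det_mult real_det_diag_real real_det_diag_unit norm_sgn)
qed

text \<open>Both sides are multiplicative and agree on diagonal matrices and shears, so Gaussian
  elimination reduces the claim to the identity matrix. The induction runs over the set
  \<open>K\<close> of columns that are not yet known to be unit vectors.\<close>

lemma real_det_eq: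
  fixes A :: "complex^'n::finite^'n"
  assumes "det A \<noteq> 0" shows "real_det A = (cmod (det A))\<^sup>2"
proof -
  let ?good = "\<lambda>A :: complex^'n^'n. real_det A = (cmod (det A))\<^sup>2"
  have col: "?good (col_mat k v ** A) \<longleftrightarrow> ?good A" "det (col_mat k v ** A) = det A" if "v k = 0" for k v A
    using multiplicative_col_mat[of real_det v k] multiplicative_col_mat[of det v k] that
    by (auto simp: real_det_mult real_det_1 det_mul)
  have dia: "?good (diag_mat k c ** A) \<longleftrightarrow> ?good A" if "c \<noteq> 0" for k c A
    using that by (simp add: real_det_mult real_det_diag det_mul det_diag_mat norm_mult power_mult_distrib)
  have "?good A" if "det A \<noteq> 0" "\<forall>j. j \<notin> K \<longrightarrow> (\<forall>a. A $ a $ j = (if a = j then 1 else 0))" for A K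
    using finite[of K] that
  proof (induction K arbitrary: A rule: finite_induct)
    case empty
    then have "A = mat 1" by (auto simp: vec_eq_iff mat_def)
    then show ?case by (simp add: real_det_1)
  next
    case (insert k K)
    note colA = insert.prems(2)[rule_format]
    have "\<exists>i\<in>insert k K. A $ i $ k \<noteq> 0"
    proof (rule ccontr)
      assume n: "\<not> ?thesis"
      \<comment> \<open>Column \<open>k\<close> would be supported on rows outside
        \<open>insert k K\<close>, where the columns of \<open>A\<close> are already unit vectors.
        Subtracting these from it gives zero, and \<open>v\<close> lists the coefficients.\<close>
      define v :: "complex^'n" where "v = (\<chi> b. if b = k then 1 else if b \<in> K then 0 else - A $ b $ k)"
      have "(A *v v) $ a = 0" for a
      proof -
        have "A $ a $ b * v $ b = (if b = k then A $ a $ k else 0) + (if b = a then (if a \<in> insert k K then 0 else - A $ a $ k) else 0)" for b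
          using colA[of b a] n insert.hyps by (auto simp: v_def)
        then have "(A *v v) $ a = A $ a $ k + (if a \<in> insert k K then 0 else - A $ a $ k)"
          unfolding matrix_vector_mult_def by (simp add: sum.distrib)
        then show ?thesis using n by auto
      qed
      then have "A *v v = 0" by (simp add: vec_eq_iff)
      moreover have "v \<noteq> 0" by (auto simp: v_def vec_eq_iff intro!: exI[of _ k])
      moreover have "invertible A" using insert.prems(1) by (simp add: invertible_det_nz)
      ultimately show False using matrix_left_invertible_ker[of A] invertible_left_inverse by metis
    qed
    then obtain i where i: "i \<in> insert k K" "A $ i $ k \<noteq> 0" by blast
    \<comment> \<open>A vanishing pivot is repaired by adding row \<open>i\<close> to row
      \<open>k\<close>. This is a shear, so row exchanges need no treatment of their own.\<close>
    have "\<exists>A'. (?good A' \<longleftrightarrow> ?good A) \<and> det A' \<noteq> 0 \<and> A' $ k $ k \<noteq> 0 \<and> (\<forall>j. j \<notin> insert k K \<longrightarrow> (\<forall>a. A' $ a $ j = (if a = j then 1 else 0)))"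
    proof (cases "A $ k $ k = 0")
      case True
      then have ik: "i \<noteq> k" using i by auto
      let ?v = "\<lambda>a. if a = k then 1 else 0 :: complex"
      show ?thesis
        using col[of ?v i A] ik i True insert.prems(1) colA
        by (intro exI[of _ "col_mat i ?v ** A"]) (auto simp: col_mat_mult)
    qed (use insert.prems in blast)
    then obtain A' where A': "?good A' \<longleftrightarrow> ?good A" "det A' \<noteq> 0" "A' $ k $ k \<noteq> 0"
      "\<And>j a. j \<notin> insert k K \<Longrightarrow> A' $ a $ j = (if a = j then 1 else 0)" by blast
    define B where "B = diag_mat k (1 / A' $ k $ k) ** A'"
    have B: "?good B \<longleftrightarrow> ?good A'" "det B \<noteq> 0" "B $ k $ k = 1"
      "\<And>j a. j \<notin> insert k K \<Longrightarrow> B $ a $ j = (if a = j then 1 else 0)"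
      using dia[of "1 / A' $ k $ k" k A'] A' by (auto simp: B_def diag_mat_mult det_mul det_diag_mat)
    let ?w = "\<lambda>a. if a = k then 0 else - B $ a $ k"
    have "?good (col_mat k ?w ** B)"
    proof (rule insert.IH)
      show "det (col_mat k ?w ** B) \<noteq> 0" using col[of ?w k B] B by simp
      show "\<forall>j. j \<notin> K \<longrightarrow> (\<forall>a. (col_mat k ?w ** B) $ a $ j = (if a = j then 1 else 0))"
      proof (intro allI impI)
        fix j a assume "j \<notin> K"
        then show "(col_mat k ?w ** B) $ a $ j = (if a = j then 1 else 0)"
          using B(3) B(4)[of j a] B(4)[of j k] by (cases "j = k") (auto simp: col_mat_mult)
      qed
    qed
    then show ?case using col[of ?w k B] B(1) A'(1) by simp
  qed
  from this[OF assms, of UNIV] show ?thesis by simp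
qed

section \<open>Measures of images under differentiable and holomorphic maps\<close>

lemma emeasure_image_real:
  fixes f :: "real^'m::{finite,wellorder} \<Rightarrow> real^'m::_"
  assumes B: "B \<in> sets borel" and fB: "f ` B \<in> sets borel"
    and der: "\<And>x. x \<in> B \<Longrightarrow> (f has_derivative f' x) (at x)" and inj: "inj_on f B"
    and meas: "(\<lambda>x. indicator B x * \<bar>det (matrix (f' x))\<bar>) \<in> borel_measurable borel"
  shows "emeasure lborel (f ` B) = (\<integral>\<^sup>+x\<in>B. ennreal \<bar>det (matrix (f' x))\<bar> \<partial>lborel)"
proof -
  let ?d = "\<lambda>x. \<bar>det (matrix (f' x))\<bar>"
  have Bl: "B \<in> sets lebesgue" using B by simp
  note iff = has_measure_differentiable_image[OF Bl has_derivative_at_withinI[OF der] inj]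
  have I: "(\<integral>\<^sup>+x\<in>B. ennreal (?d x) \<partial>lborel) = (\<integral>\<^sup>+x. ennreal (indicator B x * ?d x) \<partial>lborel)"
    by (intro nn_integral_cong) (auto simp: indicator_def)
  show ?thesis
  \<comment> \<open>\<open>has_measure_differentiable_image\<close> speaks of finite measures. If
    both sides are infinite nothing remains to be shown; otherwise the finite side makes the
    Jacobian integrable over \<open>B\<close>, and the equality follows.\<close>
  proof (cases "(\<integral>\<^sup>+x\<in>B. ennreal (?d x) \<partial>lborel) = \<infinity> \<and> emeasure lborel (f ` B) = \<infinity>")
    case False
    have "\<exists>m. (?d has_integral m) B"
    proof (cases "emeasure lborel (f ` B) = \<infinity>")
      case True
      with False have fin: "(\<integral>\<^sup>+x. ennreal (indicator B x * ?d x) \<partial>lborel) < \<infinity>" unfolding I by (simp add: less_top)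
      have "integrable lborel (\<lambda>x. indicator B x * ?d x)"
        by (rule integrableI_nonneg) (use meas fin in \<open>auto simp: indicator_def\<close>)
      then have "(\<lambda>x. indicator B x * ?d x) integrable_on UNIV"
        using has_integral_integral_lborel by blast
      then have "(\<lambda>x. if x \<in> B then ?d x else 0) integrable_on UNIV"
        by (rule integrable_eq) (auto simp: indicator_def)
      then have "?d integrable_on B" unfolding integrable_restrict_UNIV .
      then show ?thesis by blast
    next
      case False
      have "f ` B \<in> fmeasurable lebesgue"
        by (rule fmeasurableI) (use fB False in \<open>auto simp: less_top emeasure_completion\<close>)
      then show ?thesis using iff by blast
    qed
    then obtain m where m: "(?d has_integral m) B" by blast
    then have fm: "f ` B \<in> lmeasurable" "measure lebesgue (f ` B) = m" using iff by auto
    have "emeasure lebesgue (f ` B) = ennreal (measure lebesgue (f ` B))"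
      using fm(1) by (simp add: emeasure_eq_measure2)
    then have "emeasure lborel (f ` B) = ennreal m" using fm(2) fB by (simp add: emeasure_completion)
    moreover have "(\<integral>\<^sup>+x. ennreal (indicator B x * ?d x) \<partial>lborel) = ennreal m"
      using nn_integral_has_integral_lebesgue[OF _ m] by simp
    ultimately show ?thesis unfolding I by simp
  qed auto
qed

lemma emeasure_cvec: "B \<in> sets borel \<Longrightarrow> emeasure lborel (cvec_to_real ` B) = emeasure lborel (B :: (complex^'n::finite) set)"
proof -
  assume B: "B \<in> sets borel"
  have "cvec_to_real ` B = real_to_cvec -` B"
    by (auto intro!: image_eqI[of _ cvec_to_real "real_to_cvec x" for x])
  moreover have "emeasure lborel (real_to_cvec -` B) = emeasure (distr lborel borel real_to_cvec) B"
    using B by (subst emeasure_distr) auto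
  ultimately show ?thesis by (simp add: distr_cvec_to_real)
qed

text \<open>Conjugation by \<open>cvec_to_real\<close>, which preserves Lebesgue measure, leads to
  the real case, and \<open>real_det_eq\<close> identifies the real Jacobian determinant as the
  squared modulus of the complex one.\<close>

lemma emeasure_image_complex:
  fixes \<tau> :: "complex^'n::finite \<Rightarrow> complex^'n"
  assumes B: "B \<in> sets borel" and fB: "\<tau> ` B \<in> sets borel"
    and der: "\<And>z. z \<in> B \<Longrightarrow> (\<tau> has_derivative (\<lambda>v. J z *v v)) (at z)" and inj: "inj_on \<tau> B"
    and nz: "\<And>z. z \<in> B \<Longrightarrow> det (J z) \<noteq> 0"
    and meas: "(\<lambda>z. indicator B z * (cmod (det (J z)))\<^sup>2) \<in> borel_measurable borel"
  shows "emeasure lborel (\<tau> ` B) = (\<integral>\<^sup>+z\<in>B. ennreal ((cmod (det (J z)))\<^sup>2) \<partial>lborel)"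
proof -
  let ?f = "\<lambda>x. cvec_to_real (\<tau> (real_to_cvec x))"
  let ?B = "real_to_cvec -` B"
  let ?f' = "\<lambda>x v. cvec_to_real (J (real_to_cvec x) *v real_to_cvec v)"
  have img: "?f ` ?B = cvec_to_real ` \<tau> ` B"
  proof -
    have "real_to_cvec ` ?B = B" by (metis surj_image_vimage_eq real_to_cvec_inverse surjI)
    moreover have "?f ` ?B = cvec_to_real ` \<tau> ` (real_to_cvec ` ?B)" unfolding image_image ..
    ultimately show ?thesis by simp
  qed
  have Bm: "?B \<in> sets borel" using measurable_sets[OF borel_real_to_cvec B] by simp
  have vim: "cvec_to_real ` C = real_to_cvec -` C" for C :: "(complex^'n) set"
    by (auto intro!: image_eqI[of _ cvec_to_real "real_to_cvec x" for x])
  have d: "\<bar>det (matrix (?f' x))\<bar> = (cmod (det (J (real_to_cvec x))))\<^sup>2" if "x \<in> ?B" for x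
    using real_det_eq[OF nz] that by (simp add: real_det_def)
  have "emeasure lborel (\<tau> ` B) = emeasure lborel (?f ` ?B)"
    unfolding img using emeasure_cvec[OF fB] by simp
  also have "\<dots> = (\<integral>\<^sup>+x\<in>?B. ennreal \<bar>det (matrix (?f' x))\<bar> \<partial>lborel)"
  proof (rule emeasure_image_real[OF Bm])
    show "?f ` ?B \<in> sets borel" unfolding img vim using measurable_sets[OF borel_real_to_cvec fB] by simp
    show "(?f has_derivative ?f' x) (at x)" if "x \<in> ?B" for x
    proof -
      have 1: "(real_to_cvec has_derivative real_to_cvec) (at x)"
        using linear_real_to_cvec by (intro bounded_linear_imp_has_derivative) (simp add: linear_conv_bounded_linear)
      have 2: "((\<lambda>x. \<tau> (real_to_cvec x)) has_derivative (\<lambda>v. J (real_to_cvec x) *v real_to_cvec v)) (at x)"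
        by (rule has_derivative_compose[OF 1 der]) (use that in simp)
      show ?thesis
        by (rule bounded_linear.has_derivative[OF _ 2]) (use linear_cvec_to_real in \<open>simp add: linear_conv_bounded_linear\<close>)
    qed
    show "inj_on ?f ?B"
    proof (rule inj_onI)
      fix x y assume xy: "x \<in> ?B" "y \<in> ?B" "?f x = ?f y"
      then have "\<tau> (real_to_cvec x) = \<tau> (real_to_cvec y)" by (metis real_to_cvec_inverse)
      then have "real_to_cvec x = real_to_cvec y" using inj xy by (auto dest: inj_onD)
      then show "x = y" by (metis cvec_to_real_inverse)
    qed
    have "(\<lambda>x. indicator B (real_to_cvec x) * (cmod (det (J (real_to_cvec x))))\<^sup>2) \<in> borel_measurable borel"
      using measurable_compose[OF borel_real_to_cvec meas] by simp
    moreover have "(\<lambda>x. indicator B (real_to_cvec x) * (cmod (det (J (real_to_cvec x))))\<^sup>2) = (\<lambda>x. indicator ?B x * \<bar>det (matrix (?f' x))\<bar>)"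
      using d by (auto simp: fun_eq_iff indicator_def)
    ultimately show "(\<lambda>x. indicator ?B x * \<bar>det (matrix (?f' x))\<bar>) \<in> borel_measurable borel" by simp
  qed
  also have "\<dots> = (\<integral>\<^sup>+x. ennreal (indicator B (real_to_cvec x) * (cmod (det (J (real_to_cvec x))))\<^sup>2) \<partial>lborel)"
    by (intro nn_integral_cong) (auto simp: indicator_def d)
  also have "\<dots> = (\<integral>\<^sup>+z. ennreal (indicator B z * (cmod (det (J z)))\<^sup>2) \<partial>distr lborel borel real_to_cvec)"
    using meas by (subst nn_integral_distr) auto
  also have "\<dots> = (\<integral>\<^sup>+z\<in>B. ennreal ((cmod (det (J z)))\<^sup>2) \<partial>lborel)"
    unfolding distr_cvec_to_real by (intro nn_integral_cong) (auto simp: indicator_def)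
  finally show ?thesis .
qed

section \<open>Charts and tensors\<close>

text \<open>In the encoding of \<open>cd\<close>, the pair \<open>(wp i, wq i)\<close> is half of
  the x-direction minus \<i> times half of the y-direction, so \<open>cd\<close> yields
  \<open>del i\<close>; with \<open>- wq i\<close> it yields \<open>delbar i\<close>.\<close>

definition wp :: "'n::finite \<Rightarrow> complex^'n" where "wp i = axis i (1/2)"
definition wq :: "'n::finite \<Rightarrow> complex^'n" where "wq i = axis i (- \<i>/2)"

lemma axis_scaleR: "axis i (r *\<^sub>R c) = r *\<^sub>R (axis i c :: complex^'n::finite)"
  by (simp add: vec_eq_iff axis_def)

lemma real_linear_wirtinger:
  fixes D :: "complex^'n::finite \<Rightarrow> complex"
  assumes "linear D"
  shows "D w = (\<Sum>k\<in>UNIV. (D (axis k 1) - \<i> * D (axis k \<i>)) / 2 * w $ k + (D (axis k 1) + \<i> * D (axis k \<i>)) / 2 * cnj (w $ k))"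
proof -
  have w: "w = (\<Sum>k\<in>UNIV. Re (w $ k) *\<^sub>R axis k 1 + Im (w $ k) *\<^sub>R axis k \<i>)"
    by (simp add: vec_eq_iff axis_def sum.distrib if_distrib[of "\<lambda>x. _ *\<^sub>R x"] complex_eq_iff cong: if_cong)
  have "D w = (\<Sum>k\<in>UNIV. of_real (Re (w $ k)) * D (axis k 1) + of_real (Im (w $ k)) * D (axis k \<i>))"
    by (subst w) (simp add: linear_sum[OF assms] linear_add[OF assms] linear_scale[OF assms] scaleR_conv_of_real[where 'a=complex])
  also have "\<dots> = (\<Sum>k\<in>UNIV. (D (axis k 1) - \<i> * D (axis k \<i>)) / 2 * w $ k + (D (axis k 1) + \<i> * D (axis k \<i>)) / 2 * cnj (w $ k))"
    by (intro sum.cong refl) (simp add: complex_eq_iff field_simps)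
  finally show ?thesis .
qed

lemma has_derivative_wirtinger:
  fixes f :: "complex^'n::finite \<Rightarrow> complex"
  assumes "(f has_derivative D) (at z)"
  shows "D w = (\<Sum>k\<in>UNIV. del k f z * w $ k + delbar k f z * cnj (w $ k))"
  using real_linear_wirtinger[OF has_derivative_linear[OF assms], of w] frechet_derivative_at[OF assms]
  unfolding del_def delbar_def by simp

lemma del_has_derivative:
  assumes "(f has_derivative D) (at z)"
  shows "del i f z = (D (axis i 1) - \<i> * D (axis i \<i>)) / 2" "delbar i f z = (D (axis i 1) + \<i> * D (axis i \<i>)) / 2"
  using frechet_derivative_at[OF assms] unfolding del_def delbar_def by auto

lemma del_eq_cd:
  assumes W: "open W" "z \<in> W" and f: "f differentiable (at z)"
  shows "del i f z = cd W (wp i, wq i) f z" "delbar i f z = cd W (wp i, - wq i) f z"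
proof -
  let ?D = "frechet_derivative f (at z)"
  have lin: "linear ?D" using f by (rule linear_frechet_derivative)
  have at: "at z within W = at z" by (rule at_within_open[OF W(2,1)])
  have 1: "?D (axis i (1/2)) = ?D (axis i 1) / 2"
    using linear_scale[OF lin, of "1/2" "axis i 1"] axis_scaleR[of i "1/2" "1::complex"] by (simp add: scaleR_conv_of_real)
  have 2: "?D (axis i (- (\<i>/2))) = - ?D (axis i \<i>) / 2"
    using linear_scale[OF lin, of "-1/2" "axis i \<i>"] axis_scaleR[of i "-1/2" "\<i>"] by (simp add: scaleR_conv_of_real[where 'a=complex])
  show "del i f z = cd W (wp i, wq i) f z" "delbar i f z = cd W (wp i, - wq i) f z"
    unfolding del_def delbar_def cd_def dd_def at wp_def wq_def
    by (simp_all add: 1 2 linear_neg[OF lin] field_simps)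
qed

lemma smooth_on_differentiable: "open W \<Longrightarrow> smooth_on W f \<Longrightarrow> z \<in> W \<Longrightarrow> f differentiable (at z)"
  using smooth_onD(1)[OF good_domain_open, of W f z] at_within_open[of z W] unfolding differentiable_def by metis

lemma del_smooth:
  assumes "open W" "smooth_on W f" "z \<in> W"
  shows "del i f z = cd W (wp i, wq i) f z" "delbar i f z = cd W (wp i, - wq i) f z"
  using del_eq_cd[OF assms(1,3) smooth_on_differentiable[OF assms]] by auto

lemma smooth_del:
  assumes "open W" "smooth_on W f"
  shows "smooth_on W (del i f)" "smooth_on W (delbar i f)"
  using smooth_on_cong[OF smooth_cd[OF good_domain_open[OF assms(1)] assms(2)]] del_smooth[OF assms] by metis+

lemma del_cong:
  assumes "open W" "z \<in> W" "\<And>w. w \<in> W \<Longrightarrow> f w = g w"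
  shows "del i f z = del i g z" "delbar i f z = delbar i g z"
proof -
  have at: "at z within W = at z" by (rule at_within_open[OF assms(2,1)])
  have "dd W v f z = dd W v g z" for v using dd_cong[OF assms(3,2)] .
  then show "del i f z = del i g z" "delbar i f z = delbar i g z"
    unfolding del_def delbar_def dd_def at by auto
qed

lemma delbar_cnj: "f differentiable (at z) \<Longrightarrow> delbar i (\<lambda>z. cnj (f z)) z = cnj (del i f z)"
  "f differentiable (at z) \<Longrightarrow> del i (\<lambda>z. cnj (f z)) z = cnj (delbar i f z)"
proof -
  assume "f differentiable (at z)"
  then obtain D where D: "(f has_derivative D) (at z)" unfolding differentiable_def by blast
  note D' = bounded_linear.has_derivative[OF bounded_linear_cnj D]
  show "delbar i (\<lambda>z. cnj (f z)) z = cnj (del i f z)" "del i (\<lambda>z. cnj (f z)) z = cnj (delbar i f z)"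
    unfolding del_has_derivative[OF D] del_has_derivative[OF D'] by auto
qed

text \<open>Complex linearity of the derivative of \<tau> keeps the two types of derivative apart:
  no \<open>delbar\<close> of \<open>f\<close> enters the first formula and no \<open>del\<close>
  the second.\<close>

lemma del_chain:
  fixes f :: "complex^'n::finite \<Rightarrow> complex" and \<tau> :: "complex^'n \<Rightarrow> complex^'n"
  assumes \<tau>: "(\<tau> has_derivative (\<lambda>v. J *v v)) (at z)" and f: "f differentiable (at (\<tau> z))"
  shows "del i (\<lambda>w. f (\<tau> w)) z = (\<Sum>k\<in>UNIV. J $ k $ i * del k f (\<tau> z))"
    "delbar i (\<lambda>w. f (\<tau> w)) z = (\<Sum>k\<in>UNIV. cnj (J $ k $ i) * delbar k f (\<tau> z))"
proof -
  obtain D where D: "(f has_derivative D) (at (\<tau> z))" using f unfolding differentiable_def by blast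
  have c: "((\<lambda>w. f (\<tau> w)) has_derivative (\<lambda>v. D (J *v v))) (at z)"
    by (rule has_derivative_compose[OF \<tau> D])
  have "D (J *v axis i c) = (\<Sum>k\<in>UNIV. del k f (\<tau> z) * (J $ k $ i * c) + delbar k f (\<tau> z) * cnj (J $ k $ i * c))" for c
    by (subst has_derivative_wirtinger[OF D]) (simp add: matrix_vector_mult_def axis_def if_distrib[of "\<lambda>x. _ * x"] cong: if_cong)
  then have Dw: "D (J *v axis i c) = c * (\<Sum>k\<in>UNIV. J $ k $ i * del k f (\<tau> z)) + cnj c * (\<Sum>k\<in>UNIV. cnj (J $ k $ i) * delbar k f (\<tau> z))" for c
    by (simp add: sum.distrib sum_distrib_left mult_ac)
  show "del i (\<lambda>w. f (\<tau> w)) z = (\<Sum>k\<in>UNIV. J $ k $ i * del k f (\<tau> z))"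
    "delbar i (\<lambda>w. f (\<tau> w)) z = (\<Sum>k\<in>UNIV. cnj (J $ k $ i) * delbar k f (\<tau> z))"
    unfolding del_has_derivative[OF c] Dw by (simp_all add: algebra_simps)
qed

section \<open>Charts, transition maps and their Jacobians\<close>

locale complex_manifold =
  fixes A :: "('a::{t2_space, second_countable_topology}, 'n::finite) chart set"
  assumes compact_M: "compact (UNIV :: 'a set)" and atlas: "holomorphic_atlas A"
begin

abbreviation "R \<equiv> chart_range"

definition overlap :: "('a, 'n) chart \<Rightarrow> ('a, 'n) chart \<Rightarrow> (complex^'n) set" where
  "overlap c c' = snd c ` (fst c \<inter> fst c')"

definition jac :: "('a, 'n) chart \<Rightarrow> ('a, 'n) chart \<Rightarrow> complex^'n \<Rightarrow> complex^'n^'n" where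
  "jac c c' z = (\<chi> k i. del i (\<lambda>w. transition c c' w $ k) z)"

lemma chart_props:
  assumes "c \<in> A"
  shows "open (fst c)" "open (R c)" "homeomorphism (fst c) (R c) (snd c) (chart_inv c)"
  using atlas assms unfolding holomorphic_atlas_def by auto

lemma chart_inv_chart [simp]: "c \<in> A \<Longrightarrow> p \<in> fst c \<Longrightarrow> chart_inv c (snd c p) = p"
  using chart_props(3) homeomorphism_apply1 by blast

lemma chart_chart_inv [simp]: "c \<in> A \<Longrightarrow> z \<in> R c \<Longrightarrow> snd c (chart_inv c z) = z"
  using chart_props(3) homeomorphism_apply2 by blast

lemma chart_inv_in [simp]: "c \<in> A \<Longrightarrow> z \<in> R c \<Longrightarrow> chart_inv c z \<in> fst c"
  using chart_props(3) homeomorphism_image2 by blast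

lemma chart_in_range [simp]: "p \<in> fst c \<Longrightarrow> snd c p \<in> R c"
  unfolding chart_range_def by blast

lemma continuous_chart: "c \<in> A \<Longrightarrow> continuous_on (fst c) (snd c)"
  "c \<in> A \<Longrightarrow> continuous_on (R c) (chart_inv c)"
  using chart_props(3) unfolding homeomorphism_def by blast+

lemma chart_at_props: "chart_at A p \<in> A" "p \<in> fst (chart_at A p)"
proof -
  have "\<exists>c. c \<in> A \<and> p \<in> fst c" using atlas unfolding holomorphic_atlas_def by blast
  then show "chart_at A p \<in> A" "p \<in> fst (chart_at A p)"
    unfolding chart_at_def using someI_ex by (metis (mono_tags, lifting))+
qed

lemma open_chart_image: "c \<in> A \<Longrightarrow> open U \<Longrightarrow> U \<subseteq> fst c \<Longrightarrow> open (snd c ` U)"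
  using homeomorphism_imp_open_map[OF chart_props(3), of c U] chart_props(1,2)[of c]
  by (metis openin_open_eq openin_open_trans open_subset openin_subtopology_self)

lemma open_chart_inv_image: "c \<in> A \<Longrightarrow> open U \<Longrightarrow> U \<subseteq> R c \<Longrightarrow> open (chart_inv c ` U)"
  using homeomorphism_imp_open_map[OF homeomorphism_symD[OF chart_props(3)], of c U] chart_props(1,2)[of c]
  by (metis openin_open_eq openin_open_trans open_subset openin_subtopology_self)

lemma overlap_subset: "overlap c c' \<subseteq> R c"
  unfolding overlap_def chart_range_def by blast

lemma open_overlap: "c \<in> A \<Longrightarrow> c' \<in> A \<Longrightarrow> open (overlap c c')"
  unfolding overlap_def using chart_props(1)[of c] chart_props(1)[of c'] by (intro open_chart_image) auto

lemma overlap_iff: "c \<in> A \<Longrightarrow> z \<in> overlap c c' \<longleftrightarrow> z \<in> R c \<and> chart_inv c z \<in> fst c'"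
  unfolding overlap_def chart_range_def by (force simp: image_iff)

lemma transition_in: "c \<in> A \<Longrightarrow> c' \<in> A \<Longrightarrow> z \<in> overlap c c' \<Longrightarrow> transition c c' z \<in> overlap c' c"
  unfolding overlap_def transition_def by auto

lemma transition_inverse: "c \<in> A \<Longrightarrow> c' \<in> A \<Longrightarrow> z \<in> overlap c c' \<Longrightarrow> transition c' c (transition c c' z) = z"
  unfolding overlap_def transition_def by auto

lemma chart_inv_transition: "c \<in> A \<Longrightarrow> c' \<in> A \<Longrightarrow> z \<in> overlap c c' \<Longrightarrow> chart_inv c' (transition c c' z) = chart_inv c z"
  unfolding overlap_def transition_def by auto

lemma transition_holomorphic:
  assumes "c \<in> A" "c' \<in> A"
  shows "smooth_on (overlap c c') (transition c c')"
    "\<And>z. z \<in> overlap c c' \<Longrightarrow> delbar i (\<lambda>w. transition c c' w $ k) z = 0"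
  using atlas assms unfolding holomorphic_atlas_def holomorphic_map_on_def overlap_def by auto

text \<open>The real derivative exists by smoothness, and the Cauchy-Riemann equations remove its
  conjugate-linear part.\<close>

lemma transition_deriv:
  assumes c: "c \<in> A" "c' \<in> A" and z: "z \<in> overlap c c'"
  shows "(transition c c' has_derivative (\<lambda>v. jac c c' z *v v)) (at z)"
proof -
  obtain D where D: "(transition c c' has_derivative D) (at z)"
    using smooth_on_differentiable[OF open_overlap[OF c] transition_holomorphic(1)[OF c] z] unfolding differentiable_def by blast
  have "D v $ k = (jac c c' z *v v) $ k" for v k
  proof -
    have "((\<lambda>w. transition c c' w $ k) has_derivative (\<lambda>v. D v $ k)) (at z)"
      by (rule bounded_linear.has_derivative[OF bounded_linear_vec_nth D])
    from has_derivative_wirtinger[OF this, of v] show ?thesis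
      by (simp add: transition_holomorphic(2)[OF c z] jac_def matrix_vector_mult_def)
  qed
  then have "D = (\<lambda>v. jac c c' z *v v)" by (auto simp: vec_eq_iff)
  with D show ?thesis by simp
qed

lemma jac_inverse:
  assumes c: "c \<in> A" "c' \<in> A" and z: "z \<in> overlap c c'"
  shows "jac c' c (transition c c' z) ** jac c c' z = mat 1"
proof -
  let ?w = "transition c c' z"
  have 1: "((\<lambda>z. transition c' c (transition c c' z)) has_derivative (\<lambda>v. jac c' c ?w *v (jac c c' z *v v))) (at z)"
    by (rule has_derivative_compose[OF transition_deriv[OF c z] transition_deriv[OF c(2,1) transition_in[OF c z]]])
  have 2: "((\<lambda>z. transition c' c (transition c c' z)) has_derivative (\<lambda>v. v)) (at z)"
    by (rule has_derivative_transform_within_open[OF has_derivative_ident open_overlap[OF c] z])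
       (simp add: transition_inverse[OF c])
  have "(jac c' c ?w ** jac c c' z) *v v = mat 1 *v v" for v
    using fun_cong[OF has_derivative_unique[OF 1 2], of v] by (simp add: matrix_vector_mul_assoc)
  then show ?thesis by (metis matrix_eq)
qed

lemma jac_det_nz:
  assumes "c \<in> A" "c' \<in> A" "z \<in> overlap c c'"
  shows "det (jac c c' z) \<noteq> 0"
  using jac_inverse[OF assms] by (metis det_I det_mul mult_zero_right zero_neq_one)

lemma smooth_jac:
  assumes "c \<in> A" "c' \<in> A"
  shows "smooth_on (overlap c c') (\<lambda>z. jac c c' z $ k $ i)"
  unfolding jac_def by simp (intro smooth_del open_overlap smooth_on_nth transition_holomorphic assms)

text \<open>Derivatives of a holomorphic map are holomorphic, because the two Wirtinger operators
  commute.\<close>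

lemma delbar_jac:
  assumes c: "c \<in> A" "c' \<in> A" and z: "z \<in> overlap c c'"
  shows "delbar j (\<lambda>z. jac c c' z $ k $ i) z = 0"
proof -
  let ?W = "overlap c c'" and ?t = "\<lambda>w. transition c c' w $ k"
  note W = open_overlap[OF c]
  have s: "smooth_on ?W ?t" by (intro smooth_on_nth transition_holomorphic c)
  have "delbar j (\<lambda>z. jac c c' z $ k $ i) z = delbar j (del i ?t) z" by (simp add: jac_def)
  also have "\<dots> = cd ?W (wp j, - wq j) (del i ?t) z" by (rule del_smooth[OF W smooth_del(1)[OF W s] z])
  also have "\<dots> = cd ?W (wp j, - wq j) (cd ?W (wp i, wq i) ?t) z" by (rule cd_cong[OF del_smooth(1)[OF W s] z])
  also have "\<dots> = cd ?W (wp i, wq i) (cd ?W (wp j, - wq j) ?t) z" by (rule cd_commute[OF good_domain_open[OF W] s z])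
  also have "\<dots> = cd ?W (wp i, wq i) (\<lambda>z. 0) z"
    by (rule cd_cong[OF _ z]) (simp add: del_smooth(2)[OF W s, symmetric] transition_holomorphic(2)[OF c])
  finally show ?thesis by (simp add: cd_const[OF good_domain_open[OF W] z])
qed

section \<open>Tensors of type (1,1), their contractions and their changes of charts\<close>

text \<open>The transformation law of (1,1)-forms, in matrix form \<open>\<alpha>\<^sub>c = J\<^sup>T \<alpha>\<^sub>c\<^sub>' cnj J\<close>.\<close>

definition tensor11 :: "('a, 'n) form11 \<Rightarrow> bool" where
  "tensor11 \<alpha> \<longleftrightarrow> (\<forall>c\<in>A. \<forall>c'\<in>A. \<forall>z\<in>overlap c c'. \<forall>i j.
     \<alpha> c z $ i $ j = (\<Sum>k\<in>UNIV. \<Sum>l\<in>UNIV. jac c c' z $ k $ i * cnj (jac c c' z $ l $ j) * \<alpha> c' (transition c c' z) $ k $ l))"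

definition cmat :: "complex^'n^'n \<Rightarrow> complex^'n^'n" where "cmat J = (\<chi> i j. cnj (J $ i $ j))"

lemma tensor11_matrix:
  assumes "tensor11 \<alpha>" "c \<in> A" "c' \<in> A" "z \<in> overlap c c'"
  shows "\<alpha> c z = transpose (jac c c' z) ** (\<alpha> c' (transition c c' z) ** cmat (jac c c' z))"
  using assms unfolding tensor11_def
  by (simp add: vec_eq_iff matrix_matrix_mult_def transpose_def cmat_def sum_distrib_left mult_ac)

lemma det_cmat: "det (cmat J) = cnj (det J)"
  using det_cnj[of J] by (simp add: cmat_def)

text \<open>Contractions with the inverse metric are traces of matrices which a change of charts
  replaces by similar ones.\<close>

lemma upper_contraction1: "(\<Sum>i\<in>UNIV. \<Sum>j\<in>UNIV. upper_metric g $ i $ j * \<alpha> $ i $ j) = trace (matrix_inv g ** \<alpha>)"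
  unfolding trace_def upper_metric_nth matrix_matrix_mult_def by (subst sum.swap) simp

lemma upper_contraction2:
  "(\<Sum>i\<in>UNIV. \<Sum>l\<in>UNIV. \<Sum>j\<in>UNIV. \<Sum>m\<in>UNIV. upper_metric g $ i $ l * upper_metric g $ j $ m * \<alpha> $ i $ m * \<beta> $ j $ l)
    = trace ((matrix_inv g ** \<alpha>) ** (matrix_inv g ** \<beta>))"
proof -
  have "trace ((matrix_inv g ** \<alpha>) ** (matrix_inv g ** \<beta>)) =
     (\<Sum>l\<in>UNIV. \<Sum>m\<in>UNIV. \<Sum>i\<in>UNIV. \<Sum>j\<in>UNIV. upper_metric g $ i $ l * upper_metric g $ j $ m * \<alpha> $ i $ m * \<beta> $ j $ l)"
    unfolding trace_def upper_metric_nth matrix_matrix_mult_def by (simp add: sum_product mult_ac)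
  also have "\<dots> = (\<Sum>l\<in>UNIV. \<Sum>i\<in>UNIV. \<Sum>m\<in>UNIV. \<Sum>j\<in>UNIV. upper_metric g $ i $ l * upper_metric g $ j $ m * \<alpha> $ i $ m * \<beta> $ j $ l)"
    by (intro sum.cong refl sum.swap)
  also have "\<dots> = (\<Sum>i\<in>UNIV. \<Sum>l\<in>UNIV. \<Sum>m\<in>UNIV. \<Sum>j\<in>UNIV. upper_metric g $ i $ l * upper_metric g $ j $ m * \<alpha> $ i $ m * \<beta> $ j $ l)"
    by (rule sum.swap)
  also have "\<dots> = (\<Sum>i\<in>UNIV. \<Sum>l\<in>UNIV. \<Sum>j\<in>UNIV. \<Sum>m\<in>UNIV. upper_metric g $ i $ l * upper_metric g $ j $ m * \<alpha> $ i $ m * \<beta> $ j $ l)"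
    by (intro sum.cong refl sum.swap)
  finally show ?thesis by simp
qed

lemma trace_similar:
  fixes K :: "complex^'n^'n"
  assumes "K ** L = mat 1" shows "trace (L ** (X ** K)) = trace X"
proof -
  have "trace (L ** (X ** K)) = trace ((X ** K) ** L)" by (rule trace_mul_sym)
  also have "\<dots> = trace (X ** (K ** L))" by (simp add: matrix_mul_assoc)
  finally show ?thesis by (simp add: assms)
qed

lemma matrix_inv_unique:
  fixes G :: "complex^'n^'n"
  assumes "G ** B = mat 1" shows "matrix_inv G = B"
proof -
  have "det G \<noteq> 0" using assms by (metis det_I det_mul mult_zero_left zero_neq_one)
  then show ?thesis using assms by (metis matrix_inv_left_right(1) matrix_mul_assoc matrix_mul_lid matrix_mul_rid)
qed

definition metric11 :: "('a, 'n) form11 \<Rightarrow> bool" where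
  "metric11 g \<longleftrightarrow> tensor11 g \<and> (\<forall>c\<in>A. \<forall>z\<in>R c. hermitian_pos (g c z))
      \<and> (\<forall>c\<in>A. \<forall>i j. smooth_on (R c) (\<lambda>z. g c z $ i $ j))"

text \<open>The transposed Jacobian from \<alpha> cancels against the one from the inverse metric,
  and the conjugate Jacobian remains on both sides: the product is an endomorphism.\<close>

lemma metric_inv_tensor:
  assumes g: "metric11 g" and \<alpha>: "tensor11 \<alpha>" and c: "c \<in> A" "c' \<in> A" "z \<in> overlap c c'"
  shows "matrix_inv (g c z) ** \<alpha> c z =
    matrix_inv (cmat (jac c c' z)) ** ((matrix_inv (g c' (transition c c' z)) ** \<alpha> c' (transition c c' z)) ** cmat (jac c c' z))"
proof -
  let ?J = "jac c c' z" and ?g = "g c' (transition c c' z)" and ?\<alpha> = "\<alpha> c' (transition c c' z)"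
  have dJ: "det ?J \<noteq> 0" using jac_det_nz[OF c] .
  then have dJ': "det (cmat ?J) \<noteq> 0" "det (transpose ?J) \<noteq> 0" by (auto simp: det_cmat)
  have "transition c c' z \<in> R c'" using transition_in[OF c] overlap_subset by blast
  then have dg: "det ?g \<noteq> 0" using g c unfolding metric11_def by (auto intro!: hermitian_det_nz)
  have tg: "tensor11 g" using g unfolding metric11_def by blast
  have inv: "matrix_inv (g c z) = matrix_inv (cmat ?J) ** (matrix_inv ?g ** matrix_inv (transpose ?J))"
  proof (rule matrix_inv_unique)
    have "g c z ** (matrix_inv (cmat ?J) ** (matrix_inv ?g ** matrix_inv (transpose ?J))) =
      transpose ?J ** ((?g ** ((cmat ?J ** matrix_inv (cmat ?J)) ** matrix_inv ?g)) ** matrix_inv (transpose ?J))"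
      unfolding tensor11_matrix[OF tg c] by (simp add: matrix_mul_assoc)
    then show "g c z ** (matrix_inv (cmat ?J) ** (matrix_inv ?g ** matrix_inv (transpose ?J))) = mat 1"
      by (simp add: matrix_inv_left_right dJ dJ' dg)
  qed
  have "matrix_inv (g c z) ** \<alpha> c z = matrix_inv (cmat ?J) ** (matrix_inv ?g ** ((matrix_inv (transpose ?J) ** transpose ?J) ** (?\<alpha> ** cmat ?J)))"
    unfolding inv tensor11_matrix[OF \<alpha> c] by (simp add: matrix_mul_assoc)
  then show ?thesis by (simp add: matrix_inv_left_right dJ dJ' matrix_mul_assoc)
qed

definition scalar_field :: "(('a, 'n) chart \<Rightarrow> complex^'n \<Rightarrow> complex) \<Rightarrow> bool" where
  "scalar_field F \<longleftrightarrow> (\<forall>c\<in>A. \<forall>c'\<in>A. \<forall>z\<in>overlap c c'. F c z = F c' (transition c c' z))"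

definition contr1 :: "('a, 'n) form11 \<Rightarrow> ('a, 'n) form11 \<Rightarrow> ('a, 'n) chart \<Rightarrow> complex^'n \<Rightarrow> complex" where
  "contr1 g \<alpha> c z = (\<Sum>i\<in>UNIV. \<Sum>j\<in>UNIV. upper_metric (g c z) $ i $ j * \<alpha> c z $ i $ j)"

definition contr2 :: "('a, 'n) form11 \<Rightarrow> ('a, 'n) form11 \<Rightarrow> ('a, 'n) form11 \<Rightarrow> ('a, 'n) chart \<Rightarrow> complex^'n \<Rightarrow> complex" where
  "contr2 g \<alpha> \<beta> c z = (\<Sum>i\<in>UNIV. \<Sum>l\<in>UNIV. \<Sum>j\<in>UNIV. \<Sum>m\<in>UNIV.
     upper_metric (g c z) $ i $ l * upper_metric (g c z) $ j $ m * \<alpha> c z $ i $ m * \<beta> c z $ j $ l)"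

lemma scalar_contr1:
  assumes g: "metric11 g" and \<alpha>: "tensor11 \<alpha>" shows "scalar_field (contr1 g \<alpha>)"
  unfolding scalar_field_def contr1_def upper_contraction1
proof (intro ballI)
  fix c c' z assume c: "c \<in> A" "c' \<in> A" "z \<in> overlap c c'"
  have "det (cmat (jac c c' z)) \<noteq> 0" using jac_det_nz[OF c] by (simp add: det_cmat)
  then show "trace (matrix_inv (g c z) ** \<alpha> c z) = trace (matrix_inv (g c' (transition c c' z)) ** \<alpha> c' (transition c c' z))"
    unfolding metric_inv_tensor[OF g \<alpha> c] by (intro trace_similar matrix_inv_left_right)
qed

lemma scalar_contr2:
  assumes g: "metric11 g" and \<alpha>: "tensor11 \<alpha>" and \<beta>: "tensor11 \<beta>" shows "scalar_field (contr2 g \<alpha> \<beta>)"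
  unfolding scalar_field_def contr2_def upper_contraction2
proof (intro ballI)
  fix c c' z assume c: "c \<in> A" "c' \<in> A" "z \<in> overlap c c'"
  let ?K = "cmat (jac c c' z)" and ?X = "matrix_inv (g c' (transition c c' z)) ** \<alpha> c' (transition c c' z)"
  let ?Y = "matrix_inv (g c' (transition c c' z)) ** \<beta> c' (transition c c' z)"
  have nz: "det ?K \<noteq> 0" using jac_det_nz[OF c] by (simp add: det_cmat)
  have "(matrix_inv (g c z) ** \<alpha> c z) ** (matrix_inv (g c z) ** \<beta> c z) =
     matrix_inv ?K ** ((?X ** ((?K ** matrix_inv ?K) ** ?Y)) ** ?K)"
    unfolding metric_inv_tensor[OF g \<alpha> c] metric_inv_tensor[OF g \<beta> c] by (simp add: matrix_mul_assoc)
  also have "\<dots> = matrix_inv ?K ** ((?X ** ?Y) ** ?K)" by (simp add: matrix_inv_left_right nz)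
  finally show "trace ((matrix_inv (g c z) ** \<alpha> c z) ** (matrix_inv (g c z) ** \<beta> c z)) = trace (?X ** ?Y)"
    using trace_similar matrix_inv_left_right(2)[OF nz] by metis
qed

lemma local_rep_transition:
  "c \<in> A \<Longrightarrow> c' \<in> A \<Longrightarrow> w \<in> overlap c c' \<Longrightarrow> local_rep f c w = local_rep f c' (transition c c' w)"
  by (simp add: local_rep_def chart_inv_transition)

lemma del_transition:
  assumes c: "c \<in> A" "c' \<in> A" "z \<in> overlap c c'"
    and f: "\<And>w. w \<in> overlap c c' \<Longrightarrow> f w = f' (transition c c' w)" and d: "f' differentiable (at (transition c c' z))"
  shows "del i f z = (\<Sum>k\<in>UNIV. jac c c' z $ k $ i * del k f' (transition c c' z))"
    "delbar i f z = (\<Sum>k\<in>UNIV. cnj (jac c c' z $ k $ i) * delbar k f' (transition c c' z))"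
  using del_cong[OF open_overlap[OF c(1,2)] c(3) f] del_chain[OF transition_deriv[OF c] d] by auto

text \<open>The mixed second derivatives of a function transform as a tensor because the conjugate
  Jacobian is antiholomorphic.\<close>

lemma ddbar_transition:
  assumes c: "c \<in> A" "c' \<in> A" "z \<in> overlap c c'"
    and f': "smooth_on (R c') f'" and h: "smooth_on (overlap c c') h" "\<And>w. w \<in> overlap c c' \<Longrightarrow> del i h w = 0"
    and db: "\<And>w. w \<in> overlap c c' \<Longrightarrow> delbar j f w = (\<Sum>l\<in>UNIV. cnj (jac c c' w $ l $ j) * delbar l f' (transition c c' w)) + h w"
  shows "del i (delbar j f) z = (\<Sum>k\<in>UNIV. \<Sum>l\<in>UNIV. jac c c' z $ k $ i * cnj (jac c c' z $ l $ j) * del k (delbar l f') (transition c c' z))"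
proof -
  let ?W = "overlap c c'" and ?\<tau> = "transition c c'"
  note W = open_overlap[OF c(1,2)]
  have \<tau>z: "?\<tau> z \<in> R c'" using transition_in[OF c] overlap_subset by blast
  have dJ: "\<exists>D. ((\<lambda>w. cnj (jac c c' w $ l $ j)) has_derivative D) (at z) \<and> (D (axis i 1) - \<i> * D (axis i \<i>)) / 2 = 0" for l
  proof -
    have dif: "(\<lambda>w. jac c c' w $ l $ j) differentiable (at z)"
      by (rule smooth_on_differentiable[OF W smooth_jac[OF c(1,2)] c(3)])
    then obtain D where D: "((\<lambda>w. jac c c' w $ l $ j) has_derivative D) (at z)" unfolding differentiable_def by blast
    note D' = bounded_linear.has_derivative[OF bounded_linear_cnj D]
    have "del i (\<lambda>w. cnj (jac c c' w $ l $ j)) z = 0" using delbar_cnj(2)[OF dif] delbar_jac[OF c] by simp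
    then show ?thesis using D' del_has_derivative(1)[OF D'] by auto
  qed
  then obtain E where E: "\<And>l. ((\<lambda>w. cnj (jac c c' w $ l $ j)) has_derivative E l) (at z)"
     "\<And>l. (E l (axis i 1) - \<i> * E l (axis i \<i>)) / 2 = 0" by metis
  have dif: "delbar l f' differentiable (at (?\<tau> z))" for l
    by (rule smooth_on_differentiable[OF chart_props(2)[OF c(2)] smooth_del(2)[OF chart_props(2)[OF c(2)] f'] \<tau>z])
  then have "(\<lambda>w. delbar l f' (?\<tau> w)) differentiable (at z)" for l
    using differentiable_chain_at[OF differentiableI[OF transition_deriv[OF c]], of "delbar l f'"] by (simp add: comp_def)
  then obtain F where F: "\<And>l. ((\<lambda>w. delbar l f' (?\<tau> w)) has_derivative F l) (at z)" unfolding differentiable_def by metis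
  obtain H where H: "(h has_derivative H) (at z)"
    using smooth_on_differentiable[OF W h(1) c(3)] unfolding differentiable_def by blast
  have "((\<lambda>w. (\<Sum>l\<in>UNIV. cnj (jac c c' w $ l $ j) * delbar l f' (?\<tau> w)) + h w) has_derivative
     (\<lambda>v. (\<Sum>l\<in>UNIV. cnj (jac c c' z $ l $ j) * F l v + E l v * delbar l f' (?\<tau> z)) + H v)) (at z)"
    by (intro has_derivative_add has_derivative_sum has_derivative_mult E F H)
  from del_has_derivative(1)[OF this, of i]
  have "del i (\<lambda>w. (\<Sum>l\<in>UNIV. cnj (jac c c' w $ l $ j) * delbar l f' (?\<tau> w)) + h w) z =
     (\<Sum>l\<in>UNIV. cnj (jac c c' z $ l $ j) * ((F l (axis i 1) - \<i> * F l (axis i \<i>)) / 2) + ((E l (axis i 1) - \<i> * E l (axis i \<i>)) / 2) * delbar l f' (?\<tau> z))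
      + (H (axis i 1) - \<i> * H (axis i \<i>)) / 2"
    by (simp add: sum.distrib sum_subtractf sum_distrib_left sum_divide_distrib algebra_simps add_divide_distrib diff_divide_distrib)
  also have "(H (axis i 1) - \<i> * H (axis i \<i>)) / 2 = 0" using h(2)[OF c(3)] del_has_derivative(1)[OF H] by simp
  also have "(\<Sum>l\<in>UNIV. cnj (jac c c' z $ l $ j) * ((F l (axis i 1) - \<i> * F l (axis i \<i>)) / 2) + ((E l (axis i 1) - \<i> * E l (axis i \<i>)) / 2) * delbar l f' (?\<tau> z)) + 0
    = (\<Sum>l\<in>UNIV. cnj (jac c c' z $ l $ j) * (\<Sum>k\<in>UNIV. jac c c' z $ k $ i * del k (delbar l f') (?\<tau> z)))"
    using del_chain(1)[OF transition_deriv[OF c] dif] del_has_derivative(1)[OF F] by (simp only: E(2)) simp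
  also have "\<dots> = (\<Sum>k\<in>UNIV. \<Sum>l\<in>UNIV. jac c c' z $ k $ i * cnj (jac c c' z $ l $ j) * del k (delbar l f') (?\<tau> z))"
    unfolding sum_distrib_left by (subst sum.swap) (simp add: mult_ac)
  finally show ?thesis using del_cong(1)[OF W c(3) db] by simp
qed

lemma smooth_local_rep: "smooth_function A f \<Longrightarrow> c \<in> A \<Longrightarrow> smooth_on (R c) (local_rep f c)"
  unfolding smooth_function_def local_rep_def[abs_def] by (intro smooth_on_of_real) auto

lemma tensor_ddbar:
  assumes f: "smooth_function A f" shows "tensor11 (ddbar f)"
  unfolding tensor11_def
proof (intro ballI allI)
  fix c c' z i j assume c: "c \<in> A" "c' \<in> A" "z \<in> overlap c c'"
  have "del i (delbar j (local_rep f c)) z = (\<Sum>k\<in>UNIV. \<Sum>l\<in>UNIV. jac c c' z $ k $ i * cnj (jac c c' z $ l $ j) * del k (delbar l (local_rep f c')) (transition c c' z))"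
  proof (rule ddbar_transition[where h="\<lambda>_. 0", OF c smooth_local_rep[OF f c(2)]])
    fix w assume w: "w \<in> overlap c c'"
    have "transition c c' w \<in> R c'" using transition_in[OF c(1,2) w] overlap_subset by blast
    from del_transition(2)[OF c(1,2) w local_rep_transition[OF c(1,2)] smooth_on_differentiable[OF chart_props(2)[OF c(2)] smooth_local_rep[OF f c(2)] this], of j]
    show "delbar j (local_rep f c) w = (\<Sum>l\<in>UNIV. cnj (jac c c' w $ l $ j) * delbar l (local_rep f c') (transition c c' w)) + 0"
      by simp
    show "del i (\<lambda>_. 0) w = 0" using del_has_derivative(1)[of "\<lambda>_. 0", OF has_derivative_const] by simp
  qed simp
  then show "ddbar f c z $ i $ j = (\<Sum>k\<in>UNIV. \<Sum>l\<in>UNIV. jac c c' z $ k $ i * cnj (jac c c' z $ l $ j) * ddbar f c' (transition c c' z) $ k $ l)"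
    by (simp add: ddbar_def)
qed

lemma det_metric_transition:
  assumes g: "metric11 g" and c: "c \<in> A" "c' \<in> A" "z \<in> overlap c c'"
  shows "Re (det (g c z)) = (cmod (det (jac c c' z)))\<^sup>2 * Re (det (g c' (transition c c' z)))"
proof -
  have "det (g c z) = (det (jac c c' z) * cnj (det (jac c c' z))) * det (g c' (transition c c' z))"
    using g c unfolding metric11_def by (simp add: tensor11_matrix det_mul det_cmat mult_ac)
  also have "det (jac c c' z) * cnj (det (jac c c' z)) = of_real ((cmod (det (jac c c' z)))\<^sup>2)"
    by (rule complex_norm_square[symmetric])
  finally show ?thesis by simp
qed

text \<open>Under a change of charts log det g changes by the logarithm of the squared modulus of
  det J, which is pluriharmonic as det J is holomorphic without zeros. The proof works with the
  derivatives of this function and so never chooses a branch of the complex logarithm.\<close>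

lemma tensor_ricci:
  assumes g: "metric11 g" shows "tensor11 (ricci g)"
  unfolding tensor11_def
proof (intro ballI allI)
  fix c c' z i j assume c: "c \<in> A" "c' \<in> A" "z \<in> overlap c c'"
  let ?W = "overlap c c'" and ?J = "\<lambda>w. jac c c' w" and ?\<tau> = "transition c c'"
  let ?L = "\<lambda>c w. complex_of_real (ln (Re (det (g c w))))"
  note W = open_overlap[OF c(1,2)] and gW = good_domain_open[OF open_overlap[OF c(1,2)]]
  have sL: "smooth_on (R c) (?L c)" if "c \<in> A" for c
    using g that unfolding metric11_def by (intro smooth_on_of_real smooth_on_ln smooth_on_Re smooth_on_det) (auto intro: hermitian_det_pos)
  let ?D = "\<lambda>w. det (?J w)"
  have sD: "smooth_on ?W ?D" by (rule smooth_on_det[OF smooth_jac[OF c(1,2)]])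
  have nD: "?D w \<noteq> 0" if "w \<in> ?W" for w using jac_det_nz[OF c(1,2) that] .
  let ?P = "\<lambda>i. cd ?W (wp i, wq i)" and ?Q = "\<lambda>i. cd ?W (wp i, - wq i)"
  \<comment> \<open>The determinant of the Jacobian is holomorphic: its entries are, and Jacobi's
    formula expresses the antiholomorphic derivative through theirs.\<close>
  have QD: "?Q i ?D w = 0" if w: "w \<in> ?W" for i w
  proof -
    have der: "(?J has_derivative (\<lambda>v. \<chi> a b. dd ?W v (\<lambda>w. ?J w $ a $ b) w)) (at w within ?W)"
      unfolding has_derivative_componentwise_within[of ?J]
    proof
      fix b :: "complex^'n^'n" assume "b \<in> Basis"
      then obtain i j c0 where b: "b = axis i (axis j c0)" by (auto simp: Basis_vec_def)
      have "((\<lambda>y. ?J y $ i $ j \<bullet> c0) has_derivative (\<lambda>v. dd ?W v (\<lambda>w. ?J w $ i $ j) w \<bullet> c0)) (at w within ?W)"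
        by (rule bounded_linear.has_derivative[OF bounded_linear_inner_left smooth_onD(1)[OF gW smooth_jac[OF c(1,2)] w]])
      then show "((\<lambda>y. ?J y \<bullet> b) has_derivative (\<lambda>v. (\<chi> a b. dd ?W v (\<lambda>w. ?J w $ a $ b) w) \<bullet> b)) (at w within ?W)"
        by (simp add: b inner_axis)
    qed
    have "?Q i ?D w = ?D w * (\<Sum>a\<in>UNIV. \<Sum>b\<in>UNIV. upper_metric (?J w) $ a $ b * ?Q i (\<lambda>w. ?J w $ a $ b) w)"
      unfolding cd_def dd_eqI[OF gW w det_has_derivative[OF der nD[OF w]]] by (simp add: algebra_simps sum.distrib sum_distrib_left)
    moreover have "?Q i (\<lambda>w. ?J w $ a $ b) w = 0" for a b
      using del_smooth(2)[OF W smooth_jac[OF c(1,2)] w] delbar_jac[OF c(1,2) w] by simp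
    ultimately show ?thesis by simp
  qed
  \<comment> \<open>The conjugate of the logarithmic derivative of det J. It is antiholomorphic,
    which is what \<open>ddbar_transition\<close> demands of its additional term.\<close>
  define h where "h = (\<lambda>w. cnj (?P j ?D w / ?D w))"
  have sq: "smooth_on ?W (\<lambda>w. ?P j ?D w / ?D w)" by (intro smooth_on_divide smooth_cd[OF gW] sD nD)
  have "del i (delbar j (?L c)) z = (\<Sum>k\<in>UNIV. \<Sum>l\<in>UNIV. ?J z $ k $ i * cnj (?J z $ l $ j) * del k (delbar l (?L c')) (?\<tau> z))"
  proof (rule ddbar_transition[OF c sL[OF c(2)], where h=h])
    show sh: "smooth_on ?W h" unfolding h_def by (intro smooth_on_cnj sq)
    fix w assume w: "w \<in> ?W"
    have "del i h w = cnj (delbar i (\<lambda>w. ?P j ?D w / ?D w) w)"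
      unfolding h_def by (rule delbar_cnj(2)[OF smooth_on_differentiable[OF W sq w]])
    also have "delbar i (\<lambda>w. ?P j ?D w / ?D w) w = ?Q i (\<lambda>w. ?P j ?D w / ?D w) w" by (rule del_smooth(2)[OF W sq w])
    also have "?Q i (\<lambda>w. ?P j ?D w / ?D w) w = 0"
    proof -
      have "?Q i (?P j ?D) w = ?Q i (\<lambda>w. (?P j ?D w / ?D w) * ?D w) w" by (rule cd_cong[OF _ w]) (simp add: nD)
      also have "\<dots> = ?Q i (\<lambda>w. ?P j ?D w / ?D w) w * ?D w" unfolding cd_mult[OF gW sq sD w] QD[OF w] by simp
      finally have 1: "?Q i (\<lambda>w. ?P j ?D w / ?D w) w * ?D w = ?Q i (?P j ?D) w" by simp
      have "?Q i (?P j ?D) w = ?P j (?Q i ?D) w" by (rule cd_commute[OF gW sD w])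
      also have "\<dots> = ?P j (\<lambda>_. 0) w" by (rule cd_cong[OF QD w])
      also have "\<dots> = 0" by (rule cd_const[OF gW w])
      finally show ?thesis using 1 nD[OF w] by simp
    qed
    finally show "del i h w = 0" by simp
    have \<tau>w: "?\<tau> w \<in> R c'" using transition_in[OF c(1,2) w] overlap_subset by blast
    obtain D where D: "(?D has_derivative D) (at w)"
      using smooth_on_differentiable[OF W sD w] unfolding differentiable_def by blast
    \<comment> \<open>The derivative of the logarithm of the squared modulus is dD / D plus its
      conjugate.\<close>
    have lnD: "((\<lambda>w. complex_of_real (ln (Re (?D w * cnj (?D w))))) has_derivative (\<lambda>v. D v / ?D w + cnj (D v / ?D w))) (at w)"
    proof -
      have pos: "Re (?D w * cnj (?D w)) > 0" using nD[OF w] by (simp add: complex_mult_cnj sum_power2_gt_zero_iff complex_eq_iff)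
      have nz: "?D w * cnj (?D w) = of_real (Re (?D w * cnj (?D w)))" by (simp add: complex_mult_cnj)
      have "((\<lambda>w. complex_of_real (ln (Re (?D w * cnj (?D w))))) has_derivative
         (\<lambda>v. complex_of_real (Re (?D w * cnj (D v) + D v * cnj (?D w)) * inverse (Re (?D w * cnj (?D w)))))) (at w)"
        using bounded_linear.has_derivative[of complex_of_real, OF bounded_linear_of_real has_derivative_ln[OF pos
           bounded_linear.has_derivative[OF bounded_linear_Re has_derivative_mult[OF D bounded_linear.has_derivative[OF bounded_linear_cnj D]]]]]
        by simp
      moreover have "complex_of_real (Re (?D w * cnj (D v) + D v * cnj (?D w)) * inverse (Re (?D w * cnj (?D w)))) = D v / ?D w + cnj (D v / ?D w)" for v
      proof -
        have "complex_of_real (Re (?D w * cnj (D v) + D v * cnj (?D w))) = ?D w * cnj (D v) + D v * cnj (?D w)"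
          by (simp add: complex_eq_iff)
        moreover have "complex_of_real (inverse (Re (?D w * cnj (?D w)))) = inverse (?D w * cnj (?D w))"
          by (subst (2) nz) (rule of_real_inverse)
        ultimately show ?thesis using nD[OF w] by (simp add: field_simps)
      qed
      ultimately show ?thesis by simp
    qed
    have dL': "(\<lambda>w. ?L c' (?\<tau> w)) differentiable (at w)"
      using differentiable_chain_at[OF differentiableI[OF transition_deriv[OF c(1,2) w]] smooth_on_differentiable[OF chart_props(2)[OF c(2)] sL[OF c(2)] \<tau>w]]
      by (simp add: comp_def)
    then obtain E where E: "((\<lambda>w. ?L c' (?\<tau> w)) has_derivative E) (at w)" unfolding differentiable_def by blast
    have L_eq: "?L c v = ?L c' (?\<tau> v) + complex_of_real (ln (Re (?D v * cnj (?D v))))" if v: "v \<in> ?W" for v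
    proof -
      have "?\<tau> v \<in> R c'" using transition_in[OF c(1,2) v] overlap_subset by blast
      then have "Re (det (g c' (?\<tau> v))) > 0" using g c unfolding metric11_def by (auto intro: hermitian_det_pos)
      moreover have "Re (?D v * cnj (?D v)) = (cmod (?D v))\<^sup>2"
        unfolding complex_norm_square[symmetric] by (rule Re_complex_of_real)
      ultimately show ?thesis using det_metric_transition[OF g c(1,2) v] nD[OF v] by (simp add: ln_mult)
    qed
    have "delbar j (?L c) w = (E (axis j 1) + \<i> * E (axis j \<i>)) / 2 +
        ((D (axis j 1) / ?D w + cnj (D (axis j 1) / ?D w)) + \<i> * (D (axis j \<i>) / ?D w + cnj (D (axis j \<i>) / ?D w))) / 2"
      using del_cong(2)[OF W w L_eq] del_has_derivative(2)[OF has_derivative_add[OF E lnD]] by (simp add: algebra_simps add_divide_distrib)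
    also have "(E (axis j 1) + \<i> * E (axis j \<i>)) / 2 = (\<Sum>l\<in>UNIV. cnj (?J w $ l $ j) * delbar l (?L c') (?\<tau> w))"
      using del_chain(2)[OF transition_deriv[OF c(1,2) w] smooth_on_differentiable[OF chart_props(2)[OF c(2)] sL[OF c(2)] \<tau>w]] del_has_derivative(2)[OF E] by simp
    also have "((D (axis j 1) / ?D w + cnj (D (axis j 1) / ?D w)) + \<i> * (D (axis j \<i>) / ?D w + cnj (D (axis j \<i>) / ?D w))) / 2 =
       ((D (axis j 1) + \<i> * D (axis j \<i>)) / 2) / ?D w + cnj (((D (axis j 1) - \<i> * D (axis j \<i>)) / 2) / ?D w)"
      by (simp add: add_divide_distrib diff_divide_distrib algebra_simps)
    also have "\<dots> = h w"
    proof -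
      have "(D (axis j 1) + \<i> * D (axis j \<i>)) / 2 = 0" "(D (axis j 1) - \<i> * D (axis j \<i>)) / 2 = ?P j ?D w"
        using del_has_derivative[OF D, of j] del_smooth[OF W sD w, of j] QD[OF w, of j] by simp_all
      then show ?thesis unfolding h_def by (simp only: div_0 add_0)
    qed
    finally show "delbar j (?L c) w = (\<Sum>l\<in>UNIV. cnj (?J w $ l $ j) * delbar l (?L c') (?\<tau> w)) + h w" .
  qed
  then show "ricci g c z $ i $ j = (\<Sum>k\<in>UNIV. \<Sum>l\<in>UNIV. ?J z $ k $ i * cnj (?J z $ l $ j) * ricci g c' (?\<tau> z) $ k $ l)"
    by (simp add: ricci_def sum_negf)
qed

end

section \<open>The volume measure\<close>

lemma suminf_ennreal_swap: "(\<Sum>n. \<Sum>i. F n i) = (\<Sum>i. \<Sum>n. F n i :: ennreal)"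
proof -
  have "(\<Sum>n. \<Sum>i. F n i) = (\<Sum>n. \<integral>\<^sup>+i. F n i \<partial>count_space UNIV)"
    by (simp only: nn_integral_count_space_nat)
  also have "\<dots> = (\<integral>\<^sup>+i. (\<Sum>n. F n i) \<partial>count_space UNIV)"
    by (rule nn_integral_suminf[symmetric]) simp
  finally show ?thesis by (simp only: nn_integral_count_space_nat)
qed

context complex_manifold
begin

lemma chart_image_borel:
  assumes c: "c \<in> A" and B: "B \<in> sets borel" "B \<subseteq> fst c"
  shows "snd c ` B \<in> sets borel"
proof -
  have "chart_inv c \<in> borel_measurable (restrict_space borel (R c))"
    by (rule borel_measurable_continuous_on_restrict[OF continuous_chart(2)[OF c]])
  from measurable_sets[OF this B(1)] have "chart_inv c -` B \<inter> R c \<in> sets borel"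
    using chart_props(2)[OF c] by (simp add: space_restrict_space sets_restrict_space_iff)
  moreover have "snd c ` B = chart_inv c -` B \<inter> R c"
  proof
    show "snd c ` B \<subseteq> chart_inv c -` B \<inter> R c" using B(2) c by auto
    show "chart_inv c -` B \<inter> R c \<subseteq> snd c ` B" using c by (auto intro!: image_eqI[of _ _ "chart_inv c z" for z])
  qed
  ultimately show ?thesis by simp
qed

definition vdens :: "('a, 'n) form11 \<Rightarrow> ('a, 'n) chart \<Rightarrow> complex^'n \<Rightarrow> real" where
  "vdens g c z = 2 ^ CARD('n) * Re (det (g c z))"

lemma vdens_pos: "metric11 g \<Longrightarrow> c \<in> A \<Longrightarrow> z \<in> R c \<Longrightarrow> vdens g c z > 0"
  unfolding vdens_def metric11_def by (auto intro!: mult_pos_pos hermitian_det_pos)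

lemma smooth_vdens: "metric11 g \<Longrightarrow> c \<in> A \<Longrightarrow> smooth_on (R c) (vdens g c)"
  unfolding vdens_def[abs_def] metric11_def
  by (intro smooth_on_mult smooth_on_const smooth_on_Re smooth_on_det) auto

lemma borel_vdens: "metric11 g \<Longrightarrow> c \<in> A \<Longrightarrow> (\<lambda>z. indicator (R c) z * vdens g c z) \<in> borel_measurable borel"
proof -
  assume "metric11 g" "c \<in> A"
  then have "continuous_on (R c) (vdens g c)" by (intro smooth_on_continuous smooth_vdens)
  from borel_measurable_continuous_on_indicator[OF _ this] show ?thesis using chart_props(2)[OF \<open>c \<in> A\<close>] by simp
qed

lemma vdens_transition:
  assumes "metric11 g" "c \<in> A" "c' \<in> A" "z \<in> overlap c c'"
  shows "vdens g c z = vdens g c' (transition c c' z) * (cmod (det (jac c c' z)))\<^sup>2"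
  unfolding vdens_def det_metric_transition[OF assms] by simp

text \<open>The factor that det g acquires under a change of charts, the squared modulus of det J,
  is exactly the real Jacobian determinant of the transition map.\<close>

lemma vdens_change:
  assumes g: "metric11 g" and c: "c \<in> A" "c' \<in> A" and B: "B \<in> sets borel" "B \<subseteq> fst c \<inter> fst c'"
  shows "(\<integral>\<^sup>+z\<in>snd c ` B. ennreal (vdens g c z) \<partial>lborel) = (\<integral>\<^sup>+z\<in>snd c' ` B. ennreal (vdens g c' z) \<partial>lborel)"
proof -
  let ?U = "overlap c c'" and ?V = "overlap c' c" and ?\<tau> = "transition c c'"
  \<comment> \<open>\<open>t\<close> and \<open>d\<close> are set to zero off the overlap so that
    they are Borel functions on the whole space.\<close>
  define t where "t z = indicator ?U z *\<^sub>R ?\<tau> z" for z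
  define d where "d z = indicator ?U z * (cmod (det (jac c c' z)))\<^sup>2" for z
  note U = open_overlap[OF c] and V = open_overlap[OF c(2,1)]
  have tm [measurable]: "t \<in> borel_measurable borel" unfolding t_def[abs_def]
    using U by (intro borel_measurable_continuous_on_indicator smooth_on_continuous transition_holomorphic c) auto
  have "continuous_on ?U (\<lambda>z. (cmod (det (jac c c' z)))\<^sup>2)"
    by (intro continuous_intros smooth_on_continuous smooth_on_det smooth_jac c)
  from borel_measurable_continuous_on_indicator[OF _ this] have dm [measurable]: "d \<in> borel_measurable borel"
    using U unfolding d_def[abs_def] by simp
  have d0: "d z \<ge> 0" for z by (simp add: d_def)
  have inj: "inj_on ?\<tau> ?U" using transition_inverse[OF c] by (metis inj_onI)
  let ?N = "density lborel (\<lambda>z. ennreal (d z))"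
  \<comment> \<open>As an identity of measures the change of variables has to be checked on Borel
    sets only, and then holds for every measurable integrand.\<close>
  have eq: "distr ?N borel t = density lborel (indicator ?V)"
  proof (rule measure_eqI)
    fix X assume "X \<in> sets (distr ?N borel t)"
    then have X: "X \<in> sets borel" by simp
    let ?C = "?U \<inter> t -` X"
    have C: "?C \<in> sets borel" using measurable_sets[OF tm X] U by simp
    have img: "?\<tau> ` ?C = ?V \<inter> X"
    proof
      show "?\<tau> ` ?C \<subseteq> ?V \<inter> X" using transition_in[OF c] by (auto simp: t_def)
      show "?V \<inter> X \<subseteq> ?\<tau> ` ?C"
      proof
        fix w assume w: "w \<in> ?V \<inter> X"
        then have "?\<tau> (transition c' c w) = w" "transition c' c w \<in> ?U"
          using transition_inverse[OF c(2,1)] transition_in[OF c(2,1)] by auto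
        then show "w \<in> ?\<tau> ` ?C" using w by (intro image_eqI[of _ _ "transition c' c w"]) (auto simp: t_def)
      qed
    qed
    have "emeasure (distr ?N borel t) X = emeasure ?N (t -` X)"
      using X by (subst emeasure_distr) auto
    also have "\<dots> = (\<integral>\<^sup>+z. ennreal (d z) * indicator (t -` X) z \<partial>lborel)"
      using measurable_sets[OF tm X] by (subst emeasure_density) auto
    also have "\<dots> = (\<integral>\<^sup>+z\<in>?C. ennreal ((cmod (det (jac c c' z)))\<^sup>2) \<partial>lborel)"
      by (intro nn_integral_cong) (auto simp: d_def indicator_def)
    also have "\<dots> = emeasure lborel (?\<tau> ` ?C)"
    proof (rule emeasure_image_complex[symmetric])
      show "?\<tau> ` ?C \<in> sets borel" unfolding img using X V by auto
      have "(\<lambda>z. indicator (t -` X) z * d z) \<in> borel_measurable borel"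
        using measurable_sets[OF tm X] by simp
      moreover have "(\<lambda>z. indicator (t -` X) z * d z) = (\<lambda>z. indicator ?C z * (cmod (det (jac c c' z)))\<^sup>2)"
        by (auto simp: fun_eq_iff d_def indicator_def)
      ultimately show "(\<lambda>z. indicator ?C z * (cmod (det (jac c c' z)))\<^sup>2) \<in> borel_measurable borel" by simp
    qed (use C transition_deriv[OF c] jac_det_nz[OF c] inj_on_subset[OF inj] in auto)
    also have "\<dots> = emeasure (density lborel (indicator ?V)) X"
      unfolding img using X V by (subst emeasure_density) (auto simp: nn_integral_indicator[symmetric] indicator_inter_arith[symmetric] simp del: nn_integral_indicator intro!: nn_integral_cong)
    finally show "emeasure (distr ?N borel t) X = emeasure (density lborel (indicator ?V)) X" .
  qed simp
  have B': "snd c' ` B \<in> sets borel" "snd c ` B \<in> sets borel" using chart_image_borel c B by auto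
  have sub: "snd c' ` B \<subseteq> ?V" "snd c ` B \<subseteq> ?U" using B unfolding overlap_def by auto
  let ?f = "\<lambda>w. ennreal (indicator (R c') w * vdens g c' w) * indicator (snd c' ` B) w"
  have fm: "?f \<in> borel_measurable borel"
    using borel_vdens[OF g c(2)] B'(1) by simp
  have "(\<integral>\<^sup>+z\<in>snd c' ` B. ennreal (vdens g c' z) \<partial>lborel) = (\<integral>\<^sup>+w. indicator ?V w * ?f w \<partial>lborel)"
    using sub overlap_subset[of c' c] by (intro nn_integral_cong) (auto simp: indicator_def)
  also have "\<dots> = (\<integral>\<^sup>+w. ?f w \<partial>distr ?N borel t)"
    unfolding eq using fm V by (subst nn_integral_density) auto
  also have "\<dots> = (\<integral>\<^sup>+z. ennreal (d z) * ?f (t z) \<partial>lborel)"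
    using fm by (subst nn_integral_distr) (auto simp: nn_integral_density measurable_compose[OF tm fm])
  also have "\<dots> = (\<integral>\<^sup>+z\<in>snd c ` B. ennreal (vdens g c z) \<partial>lborel)"
  proof (rule nn_integral_cong)
    fix z
    show "ennreal (d z) * ?f (t z) = ennreal (vdens g c z) * indicator (snd c ` B) z"
    proof (cases "z \<in> ?U")
      case True
      then have tz: "t z = ?\<tau> z" "?\<tau> z \<in> R c'" using transition_in[OF c True] overlap_subset[of c' c] by (auto simp: t_def)
      have "?\<tau> z \<in> snd c' ` B \<longleftrightarrow> z \<in> snd c ` B"
      proof
        assume "?\<tau> z \<in> snd c' ` B"
        then obtain p where p: "p \<in> B" "?\<tau> z = snd c' p" by auto
        then have "chart_inv c z = p" using chart_inv_transition[OF c True] chart_inv_chart[OF c(2), of p] B by auto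
        then show "z \<in> snd c ` B" using p True overlap_subset c by (metis chart_chart_inv image_eqI subsetD)
      next
        assume "z \<in> snd c ` B"
        then obtain p where "p \<in> B" "z = snd c p" by auto
        then show "?\<tau> z \<in> snd c' ` B" using B c by (auto simp: transition_def)
      qed
      then show ?thesis using True tz vdens_transition[OF g c True] vdens_pos[OF g c(2) tz(2)]
        by (auto simp: d_def indicator_def ennreal_mult'' mult.commute)
    next
      case False
      then show ?thesis using sub by (auto simp: d_def indicator_def)
    qed
  qed
  finally show ?thesis by simp
qed

text \<open>The volume of a single chart domain, as a measure on the whole manifold. The default
  value off the chart range carries no mass, since the density is zero there.\<close>

definition cmeas :: "('a, 'n) form11 \<Rightarrow> ('a, 'n) chart \<Rightarrow> 'a measure" where
  "cmeas g c = distr (density lborel (\<lambda>z. ennreal (indicator (R c) z * vdens g c z))) borel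
     (\<lambda>z. if z \<in> R c then chart_inv c z else undefined)"

lemma measurable_chart_inv:
  assumes c: "c \<in> A" shows "(\<lambda>z. if z \<in> R c then chart_inv c z else undefined) \<in> borel_measurable borel"
proof -
  have "chart_inv c \<in> borel_measurable (restrict_space borel {z. z \<in> R c})"
    using borel_measurable_continuous_on_restrict[OF continuous_chart(2)[OF c]] by simp
  then show ?thesis using chart_props(2)[OF c] by (subst measurable_If_restrict_space_iff) auto
qed

lemma sets_cmeas [simp]: "sets (cmeas g c) = sets borel" "space (cmeas g c) = UNIV"
  unfolding cmeas_def by auto

lemma emeasure_cmeas:
  assumes g: "metric11 g" and c: "c \<in> A" and B: "B \<in> sets borel"
  shows "emeasure (cmeas g c) B = (\<integral>\<^sup>+z\<in>snd c ` (B \<inter> fst c). ennreal (vdens g c z) \<partial>lborel)"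
proof -
  let ?i = "\<lambda>z. if z \<in> R c then chart_inv c z else undefined"
  have "emeasure (cmeas g c) B = (\<integral>\<^sup>+z. ennreal (indicator (R c) z * vdens g c z) * indicator (?i -` B) z \<partial>lborel)"
    unfolding cmeas_def using measurable_chart_inv[OF c] B measurable_sets[OF measurable_chart_inv[OF c] B] borel_vdens[OF g c]
    by (subst emeasure_distr) (auto simp: emeasure_density)
  also have "\<dots> = (\<integral>\<^sup>+z\<in>snd c ` (B \<inter> fst c). ennreal (vdens g c z) \<partial>lborel)"
  proof (intro nn_integral_cong)
    fix z
    have "z \<in> snd c ` (B \<inter> fst c) \<longleftrightarrow> z \<in> R c \<and> chart_inv c z \<in> B"
      using c by (auto intro!: image_eqI[of _ _ "chart_inv c z"])
    then show "ennreal (indicator (R c) z * vdens g c z) * indicator (?i -` B) z = ennreal (vdens g c z) * indicator (snd c ` (B \<inter> fst c)) z"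
      by (auto simp: indicator_def)
  qed
  finally show ?thesis .
qed

definition vol_prop :: "('a, 'n) form11 \<Rightarrow> 'a measure \<Rightarrow> bool" where
  "vol_prop g \<mu> \<longleftrightarrow> sets \<mu> = sets borel \<and>
     (\<forall>c\<in>A. \<forall>B\<in>sets borel. B \<subseteq> fst c \<longrightarrow> emeasure \<mu> B = (\<integral>\<^sup>+z\<in>snd c ` B. ennreal (vdens g c z) \<partial>lborel))"

text \<open>By compactness finitely many charts suffice; they are listed, with repetitions, as a
  sequence and their domains are made disjoint.\<close>

lemma chart_partition:
  obtains cs :: "nat \<Rightarrow> ('a, 'n) chart" and D where "\<And>i. cs i \<in> A" "\<And>i. D i \<in> sets borel" "\<And>i. D i \<subseteq> fst (cs i)"
    "disjoint_family D" "(\<Union>i. D i) = UNIV"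
proof -
  have "UNIV \<subseteq> (\<Union>c\<in>A. fst c)" using chart_at_props by blast
  then obtain F where F: "F \<subseteq> A" "finite F" "UNIV \<subseteq> (\<Union>c\<in>F. fst c)"
    using compactE_image[OF compact_M, of A fst] chart_props(1) by metis
  have ne: "F \<noteq> {}" using F(3) by auto
  define cs where "cs = from_nat_into F"
  have cs: "cs i \<in> A" for i unfolding cs_def using from_nat_into[OF ne, of i] F(1) by blast
  have "range cs = F" unfolding cs_def by (rule range_from_nat_into[OF ne countable_finite[OF F(2)]])
  then have un: "(\<Union>i. fst (cs i)) = UNIV" using F(3) by blast
  show ?thesis
  proof (rule that[of cs "disjointed (\<lambda>i. fst (cs i))"])
    show "disjointed (\<lambda>i. fst (cs i)) i \<in> sets borel" for i
    proof -
      have "range (\<lambda>i. fst (cs i)) \<subseteq> sets borel" using chart_props(1)[OF cs] by auto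
      from sets.range_disjointed_sets[OF this] show ?thesis by blast
    qed
    show "disjointed (\<lambda>i. fst (cs i)) i \<subseteq> fst (cs i)" for i by (rule disjointed_subset)
  qed (simp_all add: cs un disjoint_family_disjointed UN_disjointed_eq)
qed

text \<open>The chart measures are summed over disjoint Borel pieces. That the sum has the right
  value on a set inside any other chart is \<open>vdens_change\<close>, applied on each
  piece.\<close>

lemma vol_prop_exists: assumes g: "metric11 g" shows "\<exists>\<mu>. vol_prop g \<mu>"
proof -
  obtain cs :: "nat \<Rightarrow> ('a, 'n) chart" and D where cs: "\<And>i. cs i \<in> A" and D: "\<And>i. D i \<in> sets borel" "\<And>i. D i \<subseteq> fst (cs i)"
    "disjoint_family D" "(\<Union>i. D i) = UNIV" by (rule chart_partition) blast
  let ?e = "\<lambda>X. \<Sum>i. emeasure (cmeas g (cs i)) (X \<inter> D i)"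
  define \<mu> where "\<mu> = measure_of UNIV (sets borel) ?e"
  have sets: "sets \<mu> = sets borel" unfolding \<mu>_def
    using sets.sigma_sets_eq[of "borel :: 'a measure"] by (subst sets_measure_of) auto
  have em: "emeasure \<mu> X = ?e X" if X: "X \<in> sets borel" for X
  proof (rule emeasure_measure_of[OF \<mu>_def])
    show "X \<in> sets \<mu>" using X sets by simp
    show "positive (sets \<mu>) ?e" by (simp add: positive_def)
    show "countably_additive (sets \<mu>) ?e"
      unfolding countably_additive_def sets
    proof (intro allI impI)
      fix F :: "nat \<Rightarrow> 'a set" assume F: "range F \<subseteq> sets borel" "disjoint_family F"
      have "(\<Sum>n. ?e (F n)) = (\<Sum>i. \<Sum>n. emeasure (cmeas g (cs i)) (F n \<inter> D i))"
        by (rule suminf_ennreal_swap)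
      also have "\<dots> = (\<Sum>i. emeasure (cmeas g (cs i)) (\<Union>n. F n \<inter> D i))"
        using F D(1) by (intro suminf_cong suminf_emeasure) (auto simp: disjoint_family_on_def disjoint_iff)
      finally show "(\<Sum>n. ?e (F n)) = ?e (\<Union>n. F n)" by (simp add: UN_simps)
    qed
  qed auto
  have "emeasure \<mu> B = (\<integral>\<^sup>+z\<in>snd c ` B. ennreal (vdens g c z) \<partial>lborel)" if c: "c \<in> A" and B: "B \<in> sets borel" "B \<subseteq> fst c" for c B
  proof -
    have eq: "emeasure (cmeas g (cs i)) (B \<inter> D i) = emeasure (cmeas g c) (B \<inter> D i)" for i
    proof -
      have 1: "B \<inter> D i \<inter> fst (cs i) = B \<inter> D i" "B \<inter> D i \<inter> fst c = B \<inter> D i" using D(2)[of i] B by auto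
      have 2: "B \<inter> D i \<in> sets borel" "B \<inter> D i \<subseteq> fst (cs i) \<inter> fst c" using B D(1,2)[of i] by auto
      show ?thesis unfolding emeasure_cmeas[OF g cs 2(1)] emeasure_cmeas[OF g c 2(1)] 1 by (rule vdens_change[OF g cs c 2])
    qed
    have "emeasure \<mu> B = (\<Sum>i. emeasure (cmeas g c) (B \<inter> D i))" unfolding em[OF B(1)] eq ..
    also have "\<dots> = emeasure (cmeas g c) (\<Union>i. B \<inter> D i)"
      using B D by (intro suminf_emeasure) (auto simp: disjoint_family_on_def disjoint_iff)
    also have "(\<Union>i. B \<inter> D i) = B" using D(4) by auto
    finally show ?thesis using emeasure_cmeas[OF g c B(1)] B(2) by (simp add: Int_absorb2)
  qed
  then show ?thesis unfolding vol_prop_def using sets by blast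
qed

lemma vol_prop_unique: assumes "vol_prop g \<mu>" "vol_prop g \<mu>'" shows "\<mu> = \<mu>'"
proof (rule measure_eqI)
  show s: "sets \<mu> = sets \<mu>'" using assms unfolding vol_prop_def by simp
  obtain cs :: "nat \<Rightarrow> ('a, 'n) chart" and D where cs: "\<And>i. cs i \<in> A" and D: "\<And>i. D i \<in> sets borel" "\<And>i. D i \<subseteq> fst (cs i)"
    "disjoint_family D" "(\<Union>i. D i) = UNIV" by (rule chart_partition) blast
  fix B assume "B \<in> sets \<mu>"
  then have B: "B \<in> sets borel" using assms unfolding vol_prop_def by simp
  have "emeasure m B = (\<Sum>i. \<integral>\<^sup>+z\<in>snd (cs i) ` (B \<inter> D i). ennreal (vdens g (cs i) z) \<partial>lborel)" if m: "vol_prop g m" for m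
  proof -
    have "(\<Sum>i. emeasure m (B \<inter> D i)) = emeasure m (\<Union>i. B \<inter> D i)"
      using B D m unfolding vol_prop_def by (intro suminf_emeasure) (auto simp: disjoint_family_on_def disjoint_iff)
    moreover have "(\<Union>i. B \<inter> D i) = B" using D(4) by auto
    moreover have "emeasure m (B \<inter> D i) = (\<integral>\<^sup>+z\<in>snd (cs i) ` (B \<inter> D i). ennreal (vdens g (cs i) z) \<partial>lborel)" for i
      using m cs[of i] D(1,2)[of i] B unfolding vol_prop_def by blast
    ultimately show ?thesis by simp
  qed
  from this[OF assms(1)] this[OF assms(2)] show "emeasure \<mu> B = emeasure \<mu>' B" by simp
qed

section \<open>Integration against the volume measure\<close>

abbreviation "vol \<equiv> kahler_volume A"

text \<open>Existence and uniqueness give meaning to the definite description in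
  \<open>kahler_volume\<close>.\<close>

lemma vol_prop_vol: assumes "metric11 g" shows "vol_prop g (vol g)"
proof -
  have "vol g = (THE \<mu>. vol_prop g \<mu>)" unfolding kahler_volume_def vol_prop_def vdens_def by simp
  moreover have "\<exists>!\<mu>. vol_prop g \<mu>" using vol_prop_exists[OF assms] vol_prop_unique by blast
  ultimately show ?thesis using theI' by metis
qed

lemma sets_vol [simp]: "metric11 g \<Longrightarrow> sets (vol g) = sets borel"
  using vol_prop_vol unfolding vol_prop_def by blast

lemma space_vol [simp]: "metric11 g \<Longrightarrow> space (vol g) = UNIV"
  using sets_eq_imp_space_eq[OF sets_vol] by simp

lemma measurable_vol: "metric11 g \<Longrightarrow> f \<in> borel_measurable borel \<Longrightarrow> f \<in> borel_measurable (vol g)"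
  using measurable_cong_sets[OF sets_vol refl] by blast

lemma cmeas_eq:
  assumes g: "metric11 g" and c: "c \<in> A"
  shows "density (vol g) (indicator (fst c)) = cmeas g c"
proof (rule measure_eqI)
  fix B assume "B \<in> sets (density (vol g) (indicator (fst c)))"
  then have B: "B \<in> sets borel" using g by simp
  have f: "fst c \<in> sets borel" using chart_props(1)[OF c] by simp
  have "emeasure (density (vol g) (indicator (fst c))) B = (\<integral>\<^sup>+p. indicator (fst c) p * indicator B p \<partial>vol g)"
    using B g f measurable_vol[OF g, of "indicator (fst c) :: _ \<Rightarrow> ennreal"] by (subst emeasure_density) auto
  also have "\<dots> = (\<integral>\<^sup>+p. indicator (B \<inter> fst c) p \<partial>vol g)"
    by (intro nn_integral_cong) (auto simp: indicator_def)
  also have "\<dots> = emeasure (vol g) (B \<inter> fst c)" using B g f by (subst nn_integral_indicator) auto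
  also have "\<dots> = emeasure (cmeas g c) B"
    using vol_prop_vol[OF g] c B f unfolding vol_prop_def emeasure_cmeas[OF g c B] by auto
  finally show "emeasure (density (vol g) (indicator (fst c))) B = emeasure (cmeas g c) B" .
qed (use g in simp)

lemma integral_chart:
  fixes f :: "'a \<Rightarrow> 'b::{banach, second_countable_topology}"
  assumes g: "metric11 g" and c: "c \<in> A" and f: "f \<in> borel_measurable borel" "\<And>p. p \<notin> fst c \<Longrightarrow> f p = 0"
  shows "(\<integral>p. f p \<partial>vol g) = (\<integral>z. (indicator (R c) z * vdens g c z) *\<^sub>R f (chart_inv c z) \<partial>lborel)"
proof -
  have fc: "fst c \<in> sets borel" using chart_props(1)[OF c] by simp
  let ?i = "\<lambda>z. if z \<in> R c then chart_inv c z else undefined"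
  have "(\<integral>p. f p \<partial>vol g) = (\<integral>p. indicator (fst c) p *\<^sub>R f p \<partial>vol g)"
    by (intro Bochner_Integration.integral_cong) (auto simp: indicator_def f)
  also have "\<dots> = (\<integral>p. f p \<partial>density (vol g) (\<lambda>p. ennreal (indicator (fst c) p)))"
    using measurable_vol[OF g f(1)] measurable_vol[OF g, of "indicator (fst c) :: _ \<Rightarrow> real"] fc by (subst integral_density) auto
  also have "\<dots> = (\<integral>p. f p \<partial>cmeas g c)" using cmeas_eq[OF g c] by (simp add: ennreal_indicator)
  also have "\<dots> = (\<integral>z. (indicator (R c) z * vdens g c z) *\<^sub>R f (?i z) \<partial>lborel)"
    unfolding cmeas_def using f measurable_chart_inv[OF c] borel_vdens[OF g c] vdens_pos[OF g c]
      measurable_compose[OF measurable_chart_inv[OF c] f(1)]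
    by (subst integral_distr, (simp; fail), (simp; fail), subst integral_density) (auto simp: indicator_def less_imp_le)
  also have "\<dots> = (\<integral>z. (indicator (R c) z * vdens g c z) *\<^sub>R f (chart_inv c z) \<partial>lborel)"
    by (intro Bochner_Integration.integral_cong) (auto simp: indicator_def)
  finally show ?thesis .
qed

text \<open>Around every point the density is bounded on a closed coordinate ball, and compactness
  leaves finitely many such neighbourhoods.\<close>

lemma finite_vol: assumes g: "metric11 g" shows "finite_measure (vol g)"
proof -
  have "\<exists>U. open U \<and> p \<in> U \<and> emeasure (vol g) U < \<infinity>" for p
  proof -
    let ?c = "chart_at A p"
    note c = chart_at_props(1)[of p] and p = chart_at_props(2)[of p]
    obtain r where r: "r > 0" "cball (snd ?c p) r \<subseteq> R ?c"
      using chart_props(2)[OF c] p open_contains_cball chart_in_range by metis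
    let ?U = "chart_inv ?c ` ball (snd ?c p) r"
    have sub: "ball (snd ?c p) r \<subseteq> R ?c" using r(2) ball_subset_cball by blast
    have oU: "open ?U" by (rule open_chart_inv_image[OF c open_ball sub])
    have pU: "p \<in> ?U" using r(1) c p by (intro image_eqI[of _ _ "snd ?c p"]) auto
    have UU: "?U \<subseteq> fst ?c" using sub c by auto
    have im: "snd ?c ` ?U = ball (snd ?c p) r" using sub c by (force simp: image_iff)
    have "compact (vdens g ?c ` cball (snd ?c p) r)"
      by (intro compact_continuous_image continuous_on_subset[OF smooth_on_continuous[OF smooth_vdens[OF g c]] r(2)] compact_cball)
    then obtain M where M: "\<And>z. z \<in> cball (snd ?c p) r \<Longrightarrow> \<bar>vdens g ?c z\<bar> \<le> M"
      using compact_imp_bounded bounded_iff by (metis image_eqI real_norm_def)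
    have "emeasure (vol g) ?U = (\<integral>\<^sup>+z\<in>ball (snd ?c p) r. ennreal (vdens g ?c z) \<partial>lborel)"
      using vol_prop_vol[OF g] c oU UU im unfolding vol_prop_def by simp
    also have "\<dots> \<le> (\<integral>\<^sup>+z. ennreal M * indicator (ball (snd ?c p) r) z \<partial>lborel)"
    proof (intro nn_integral_mono)
      fix z
      show "ennreal (vdens g ?c z) * indicator (ball (snd ?c p) r) z \<le> ennreal M * indicator (ball (snd ?c p) r) z"
        using M[of z] by (cases "z \<in> ball (snd ?c p) r") (auto intro!: ennreal_leI)
    qed
    also have "\<dots> = ennreal M * emeasure lborel (ball (snd ?c p) r)" by (subst nn_integral_cmult_indicator) auto
    also have "\<dots> < \<infinity>" using emeasure_bounded_finite[of "ball (snd ?c p) r"] by (simp add: ennreal_mult_less_top)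
    finally show ?thesis using oU pU by blast
  qed
  then obtain U where U: "\<And>p. open (U p)" "\<And>p. p \<in> U p" "\<And>p. emeasure (vol g) (U p) < \<infinity>" by metis
  have "UNIV \<subseteq> (\<Union>p\<in>UNIV. U p)" using U(2) by blast
  then obtain C where C: "finite C" "UNIV \<subseteq> (\<Union>p\<in>C. U p)"
    using compactE_image[OF compact_M, of UNIV U] U(1) by metis
  have "emeasure (vol g) UNIV \<le> (\<Sum>p\<in>C. emeasure (vol g) (U p))"
  proof -
    have "(\<Union>p\<in>C. U p) = UNIV" using C(2) by auto
    moreover have "U ` C \<subseteq> sets (vol g)" using U(1) g by auto
    ultimately show ?thesis using emeasure_subadditive_finite[OF C(1), of U "vol g"] by simp
  qed
  also have "\<dots> < \<infinity>" using U(3) C(1) by (simp add: less_top)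
  finally show ?thesis using g by (intro finite_measureI) auto
qed

lemma integrable_vol:
  fixes f :: "'a \<Rightarrow> 'b::{banach, second_countable_topology}"
  assumes g: "metric11 g" and f: "continuous_on UNIV f"
  shows "integrable (vol g) f"
proof -
  interpret finite_measure "vol g" by (rule finite_vol[OF g])
  have "compact (range f)" using compact_continuous_image[OF f compact_M] .
  then obtain M where "\<And>p. norm (f p) \<le> M" using compact_imp_bounded bounded_iff by (metis rangeI)
  moreover have "f \<in> borel_measurable (vol g)"
    using borel_measurable_continuous_onI[OF f] measurable_cong_sets[OF sets_vol[OF g] refl] by blast
  ultimately show ?thesis by (intro integrable_const_bound[of _ M]) auto
qed

text \<open>A chart range is open and nonempty, hence not negligible, and the density is positive on
  it; the chart around \<open>undefined\<close> is an arbitrary one. The average scalar curvature is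
  a quotient by this number.\<close>

lemma vol_pos: assumes g: "metric11 g" shows "measure (vol g) UNIV > 0"
proof -
  interpret finite_measure "vol g" by (rule finite_vol[OF g])
  let ?c = "chart_at A undefined"
  note c = chart_at_props(1)[of undefined] and p = chart_at_props(2)[of undefined]
  have "emeasure (vol g) (fst ?c) = (\<integral>\<^sup>+z. ennreal (indicator (R ?c) z * vdens g ?c z) \<partial>lborel)"
    using vol_prop_vol[OF g] c chart_props(1)[OF c] unfolding vol_prop_def chart_range_def
    by (auto intro!: nn_integral_cong simp: indicator_def)
  moreover have "\<dots> \<noteq> 0"
  proof
    assume "(\<integral>\<^sup>+z. ennreal (indicator (R ?c) z * vdens g ?c z) \<partial>lborel) = 0"
    then have "AE z in lborel. indicator (R ?c) z * vdens g ?c z \<le> 0"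
      using borel_vdens[OF g c] by (subst (asm) nn_integral_0_iff_AE) (auto simp: ennreal_eq_0_iff)
    then have "AE z in lborel. z \<notin> R ?c"
    proof eventually_elim
      case (elim z)
      then show ?case using vdens_pos[OF g c, of z] by (auto simp: indicator_def split: if_splits)
    qed
    then have "emeasure lborel (R ?c) = 0" using chart_props(2)[OF c] by (subst (asm) AE_iff_measurable[of "R ?c"]) auto
    moreover have "R ?c \<noteq> {}" using chart_in_range[OF p] by blast
    moreover have "R ?c \<in> sets lborel" using chart_props(2)[OF c] by simp
    ultimately have "negligible (R ?c)" "R ?c \<noteq> {}"
      unfolding negligible_iff_null_sets by (auto intro: null_sets_completionI)
    then show False using chart_props(2)[OF c] open_not_negligible by blast
  qed
  ultimately have "emeasure (vol g) UNIV \<noteq> 0"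
    using emeasure_mono[of "fst ?c" UNIV "vol g"] g by auto
  then show ?thesis using emeasure_eq_measure by (simp add: zero_less_measure_iff)
qed

end

section \<open>Smooth partitions of unity\<close>

text \<open>A simple bump profile: its derivative is continuous, which is the regularity that
  integration by parts asks of a test function.\<close>

lemma has_derivative_pos_part_square:
  "((\<lambda>x. (max 0 x)\<^sup>2) has_real_derivative 2 * max 0 x) (at x)"
proof -
  consider "x > 0" | "x < 0" | "x = 0" by linarith
  then show ?thesis
  proof cases
    case 1
    have "((\<lambda>x. x\<^sup>2) has_real_derivative 2 * max 0 x) (at x)" using 1 by (auto intro!: derivative_eq_intros)
    then show ?thesis by (rule has_field_derivative_transform_within[where d=x and S=UNIV]) (use 1 in \<open>auto simp: dist_real_def\<close>)
  next
    case 2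
    have "((\<lambda>x. 0) has_real_derivative 2 * max 0 x) (at x)" using 2 by (auto intro!: derivative_eq_intros)
    then show ?thesis by (rule has_field_derivative_transform_within[where d="-x" and S=UNIV]) (use 2 in \<open>auto simp: dist_real_def\<close>)
  next
    case 3
    have "((\<lambda>h. (max 0 h)\<^sup>2 / h) \<longlongrightarrow> 0) (at (0::real))"
    proof (rule Lim_null_comparison)
      show "\<forall>\<^sub>F h in at 0. norm ((max 0 h)\<^sup>2 / h) \<le> \<bar>h\<bar>"
        by (intro always_eventually allI) (auto simp: max_def power2_eq_square)
      show "((\<lambda>h::real. \<bar>h\<bar>) \<longlongrightarrow> 0) (at 0)" by (intro tendsto_eq_intros refl) auto
    qed
    then show ?thesis unfolding 3 DERIV_def by simp
  qed
qed

text \<open>At a point of an open set the derivative does not depend on the set, so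
  \<open>frechet_derivative f (at z)\<close> patches the local witnesses together.\<close>

lemma Ck_on_local:
  assumes W: "open W" and loc: "\<And>z. z \<in> W \<Longrightarrow> \<exists>U. open U \<and> z \<in> U \<and> U \<subseteq> W \<and> Ck_on (Suc 0) U f"
  shows "Ck_on (Suc 0) W f"
proof (rule Ck_on_SucI[where f'="\<lambda>z. frechet_derivative f (at z)"])
  have U: "\<exists>U. open U \<and> z \<in> U \<and> U \<subseteq> W \<and> (\<forall>w\<in>U. (f has_derivative frechet_derivative f (at w)) (at w)) \<and>
     (\<forall>v. continuous_on U (\<lambda>w. frechet_derivative f (at w) v))" if z: "z \<in> W" for z
  proof -
    obtain U where U: "open U" "z \<in> U" "U \<subseteq> W" "Ck_on (Suc 0) U f" using loc[OF z] by blast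
    obtain f' where f': "\<And>w. w \<in> U \<Longrightarrow> (f has_derivative f' w) (at w within U)" "\<And>v. Ck_on 0 U (\<lambda>w. f' w v)"
      using Ck_on_SucE[OF U(4)] by metis
    have d: "(f has_derivative f' w) (at w)" if "w \<in> U" for w using f'(1)[OF that] at_within_open[OF that U(1)] by simp
    then have eq: "frechet_derivative f (at w) = f' w" if "w \<in> U" for w using that frechet_derivative_at by metis
    have "continuous_on U (\<lambda>w. frechet_derivative f (at w) v)" for v
    proof -
      have "continuous_on U (\<lambda>w. f' w v)" using f'(2)[of v] by simp
      then show ?thesis by (rule continuous_on_eq) (simp add: eq)
    qed
    moreover have "\<forall>w\<in>U. (f has_derivative frechet_derivative f (at w)) (at w)" using d eq by simp
    ultimately show ?thesis using U by blast
  qed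
  show "(f has_derivative frechet_derivative f (at z)) (at z within W)" if "z \<in> W" for z
    using U[OF that] has_derivative_at_withinI by blast
  have "continuous (at z) (\<lambda>w. frechet_derivative f (at w) v)" if "z \<in> W" for z v
    using U[OF that] continuous_on_eq_continuous_at by blast
  then show "Ck_on 0 W (\<lambda>z. frechet_derivative f (at z) v)" for v
    by (auto intro!: continuous_at_imp_continuous_on)
qed

lemma smooth_imp_Ck: "smooth_on S f \<Longrightarrow> Ck_on k S f" by (simp add: smooth_on_def)

lemma Ck_on_pos_part:
  fixes f :: "'e::euclidean_space \<Rightarrow> real"
  assumes "Ck_on (Suc 0) S f" shows "Ck_on (Suc 0) S (\<lambda>x. (max 0 (f x))\<^sup>2)"
proof -
  obtain f' where f': "\<And>x. x \<in> S \<Longrightarrow> (f has_derivative f' x) (at x within S)" "\<And>v. Ck_on 0 S (\<lambda>x. f' x v)"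
    using Ck_on_SucE[OF assms] by metis
  have c: "continuous_on S f" using f'(1) has_derivative_continuous_on by blast
  show ?thesis
  proof (rule Ck_on_SucI[where f'="\<lambda>x v. 2 * max 0 (f x) * f' x v"])
    fix x assume x: "x \<in> S"
    show "((\<lambda>x. (max 0 (f x))\<^sup>2) has_derivative (\<lambda>v. 2 * max 0 (f x) * f' x v)) (at x within S)"
      using has_derivative_compose[OF f'(1)[OF x] has_derivative_pos_part_square[unfolded has_field_derivative_def]] by simp
  next
    show "Ck_on 0 S (\<lambda>x. 2 * max 0 (f x) * f' x v)" for v
      using f'(2)[of v] c by (auto intro!: continuous_intros)
  qed
qed

section \<open>Integration by parts with compact support\<close>

lemma integrable_compact_support:
  fixes f :: "'e::euclidean_space \<Rightarrow> 'b::euclidean_space"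
  assumes "continuous_on W f" "compact K" "K \<subseteq> W" "\<And>z. z \<in> W \<Longrightarrow> z \<notin> K \<Longrightarrow> f z = 0"
  shows "integrable lborel (\<lambda>z. indicator W z *\<^sub>R f z)"
proof -
  have "integrable lborel (\<lambda>z. indicator K z *\<^sub>R f z)"
    using borel_integrable_compact[OF assms(2) continuous_on_subset[OF assms(1,3)]] .
  moreover have "(\<lambda>z. indicator K z *\<^sub>R f z) = (\<lambda>z. indicator W z *\<^sub>R f z)"
    using assms(3,4) by (auto simp: indicator_def fun_eq_iff)
  ultimately show ?thesis by simp
qed

lemma lborel_integral_cbox:
  fixes f :: "'e::euclidean_space \<Rightarrow> 'b::euclidean_space"
  assumes f: "continuous_on UNIV f" "\<And>z. z \<notin> cbox a b \<Longrightarrow> f z = 0"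
  shows "integral (cbox a b) f = (\<integral>z. f z \<partial>lborel)"
proof -
  have "set_integrable lborel (cbox a b) f"
    unfolding set_integrable_def by (rule borel_integrable_compact) (auto intro: continuous_on_subset[OF f(1)])
  from set_borel_integral_eq_integral(2)[OF this]
  have "integral (cbox a b) f = (\<integral>z. indicator (cbox a b) z *\<^sub>R f z \<partial>lborel)" by (simp add: set_lebesgue_integral_def)
  also have "\<dots> = (\<integral>z. f z \<partial>lborel)"
    by (intro Bochner_Integration.integral_cong) (auto simp: indicator_def f(2))
  finally show ?thesis .
qed

text \<open>The integral of a derivative vanishes because translating the function does not change its
  integral.\<close>

lemma integral_derivative_zero:
  fixes F :: "'e::euclidean_space \<Rightarrow> complex"
  assumes der: "\<And>x. (F has_derivative F' x) (at x)" and cont: "continuous_on UNIV (\<lambda>x. F' x v)"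
    and K: "compact K" "\<And>x. x \<notin> K \<Longrightarrow> F x = 0"
  shows "(\<integral>x. F' x v \<partial>lborel) = 0"
proof -
  have cF: "continuous_on UNIV F" using der has_derivative_continuous_on by blast
  have F'0: "F' x v = 0" if "x \<notin> K" for x
  proof -
    have "open (- K)" using K(1) compact_imp_closed by blast
    then have "((\<lambda>_. 0) has_derivative F' x) (at x)"
      using has_derivative_transform_within_open[OF der, of "- K" x "\<lambda>_. 0"] K(2) that by auto
    from has_derivative_unique[OF this has_derivative_const] show ?thesis by simp
  qed
  \<comment> \<open>The region swept out by the translates of \<open>K\<close>. All translated
    functions with parameter in \<open>{-1..1}\<close> vanish outside one box containing it, so
    differentiation under the integral takes place over a fixed box.\<close>
  let ?K = "(\<lambda>(x, s). x - s *\<^sub>R v) ` (K \<times> {-1..1::real})"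
  have "compact ?K" using K(1) by (intro compact_continuous_image compact_Times) (auto intro!: continuous_intros simp: case_prod_unfold)
  then obtain a where a: "?K \<subseteq> cbox (- a) a" using compact_imp_bounded bounded_subset_cbox_symmetric by metis
  have in_box: "x \<in> cbox (- a) a" if "x + s *\<^sub>R v \<in> K" "s \<in> {-1..1}" for x s
    using that a by (force intro!: image_eqI[of _ _ "(x + s *\<^sub>R v, s)"])
  have I: "integral (cbox (- a) a) (\<lambda>x. F (x + s *\<^sub>R v)) = (\<integral>x. F x \<partial>lborel)" if s: "s \<in> {-1..1}" for s
  proof -
    have "integral (cbox (- a) a) (\<lambda>x. F (x + s *\<^sub>R v)) = (\<integral>x. F (x + s *\<^sub>R v) \<partial>lborel)"
    proof (rule lborel_integral_cbox)
      show "continuous_on UNIV (\<lambda>x. F (x + s *\<^sub>R v))"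
        by (rule continuous_on_compose2[OF cF]) (auto intro!: continuous_intros)
      show "F (x + s *\<^sub>R v) = 0" if "x \<notin> cbox (- a) a" for x
        using that K(2) in_box[OF _ s] by blast
    qed
    also have "\<dots> = (\<integral>x. F x \<partial>distr lborel borel (\<lambda>x. s *\<^sub>R v + x))"
      using borel_measurable_continuous_onI[OF cF] by (subst integral_distr) (auto simp: add.commute)
    finally show ?thesis by (simp add: lborel_distr_plus)
  qed
  have "((\<lambda>s. integral (cbox (- a) a) (\<lambda>x. F (x + s *\<^sub>R v))) has_vector_derivative
      integral (cbox (- a) a) (\<lambda>x. F' (x + 0 *\<^sub>R v) v)) (at 0 within {-1..1})"
  proof (rule leibniz_rule_vector_derivative)
    fix s x :: 'e and t :: real
    show "((\<lambda>s. F (x + s *\<^sub>R v)) has_vector_derivative F' (x + t *\<^sub>R v) v) (at t within {-1..1})"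
    proof -
      have "((\<lambda>s. F (x + s *\<^sub>R v)) has_derivative (\<lambda>h. F' (x + t *\<^sub>R v) (h *\<^sub>R v))) (at t within {-1..1})"
        by (rule has_derivative_compose[OF _ der]) (auto intro!: derivative_eq_intros)
      then show ?thesis unfolding has_vector_derivative_def
        using linear_scale[OF has_derivative_linear[OF der]] by simp
    qed
  next
    fix s assume "s \<in> {-1..1::real}"
    show "(\<lambda>x. F (x + s *\<^sub>R v)) integrable_on cbox (- a) a"
      by (intro integrable_continuous continuous_on_compose2[OF cF]) (auto intro!: continuous_intros)
  next
    show "continuous_on ({-1..1} \<times> cbox (- a) a) (\<lambda>(s, x). F' (x + s *\<^sub>R v) v)"
      unfolding case_prod_unfold by (rule continuous_on_compose2[OF cont]) (auto intro!: continuous_intros)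
  qed auto
  moreover have "((\<lambda>s. integral (cbox (- a) a) (\<lambda>x. F (x + s *\<^sub>R v))) has_vector_derivative 0) (at 0 within {-1..1})"
    by (rule has_vector_derivative_transform[where f="\<lambda>_. \<integral>x. F x \<partial>lborel"]) (auto simp: I)
  ultimately have "integral (cbox (- a) a) (\<lambda>x. F' (x + 0 *\<^sub>R v) v) = 0"
    by (intro vector_derivative_unique_within_closed_interval[of "-1" 1 0 "\<lambda>s. integral (cbox (- a) a) (\<lambda>x. F (x + s *\<^sub>R v))"])
       (simp_all only: cbox_interval atLeastAtMost_iff, simp_all)
  then have "integral (cbox (- a) a) (\<lambda>x. F' x v) = 0" by simp
  moreover have "integral (cbox (- a) a) (\<lambda>x. F' x v) = (\<integral>x. F' x v \<partial>lborel)"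
    by (rule lborel_integral_cbox[OF cont]) (use F'0 in_box[of _ 0] in auto)
  ultimately show ?thesis by simp
qed

lemma Ck_on_open:
  assumes "open W" "Ck_on (Suc 0) W f"
  shows "\<And>z. z \<in> W \<Longrightarrow> f differentiable (at z)" "continuous_on W (\<lambda>z. frechet_derivative f (at z) v)" "continuous_on W f"
proof -
  obtain f' where f': "\<And>w. w \<in> W \<Longrightarrow> (f has_derivative f' w) (at w within W)" "\<And>v. Ck_on 0 W (\<lambda>w. f' w v)"
    using Ck_on_SucE[OF assms(2)] by metis
  have d: "(f has_derivative f' w) (at w)" if "w \<in> W" for w using f'(1)[OF that] at_within_open[OF that assms(1)] by simp
  then show "\<And>z. z \<in> W \<Longrightarrow> f differentiable (at z)" unfolding differentiable_def by blast
  have eq: "frechet_derivative f (at w) = f' w" if "w \<in> W" for w using that d frechet_derivative_at by metis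
  show "continuous_on W (\<lambda>w. frechet_derivative f (at w) v)"
  proof -
    have "continuous_on W (\<lambda>w. f' w v)" using f'(2)[of v] by simp
    then show ?thesis by (rule continuous_on_eq) (simp add: eq)
  qed
  show "continuous_on W f" using Ck_on_imp_continuous[OF assms(2)] .
qed

lemma continuous_on_delbar:
  assumes "open W" "Ck_on (Suc 0) W f"
  shows "continuous_on W (delbar i f)" "continuous_on W (del i f)"
  unfolding delbar_def[abs_def] del_def[abs_def] by (intro continuous_intros Ck_on_open[OF assms]; simp)+

lemma delbar_mult:
  assumes "f differentiable (at z)" "g differentiable (at z)"
  shows "delbar i (\<lambda>z. f z * g z) z = f z * delbar i g z + delbar i f z * g z"
proof -
  obtain D E where D: "(f has_derivative D) (at z)" and E: "(g has_derivative E) (at z)"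
    using assms unfolding differentiable_def by blast
  show ?thesis
    unfolding del_has_derivative[OF D] del_has_derivative[OF E] del_has_derivative[OF has_derivative_mult[OF D E]]
    by (simp add: field_simps)
qed

text \<open>The product of \<eta> and \<open>V\<close>, extended by zero, is C^1 on the whole space
  because \<open>W\<close> and the complement of \<open>K\<close> are open and cover it. The
  integral of its derivative is therefore zero.\<close>

lemma integral_delbar_parts:
  fixes \<eta> V :: "complex^'n::finite \<Rightarrow> complex"
  assumes W: "open W" and \<eta>: "Ck_on (Suc 0) W \<eta>" and V: "smooth_on W V"
    and K: "compact K" "K \<subseteq> W" "\<And>z. z \<in> W \<Longrightarrow> z \<notin> K \<Longrightarrow> \<eta> z = 0"
  shows "integrable lborel (\<lambda>z. indicator W z *\<^sub>R (\<eta> z * delbar l V z))"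
    "integrable lborel (\<lambda>z. indicator W z *\<^sub>R (V z * delbar l \<eta> z))"
    "(\<integral>z. indicator W z *\<^sub>R (\<eta> z * delbar l V z) \<partial>lborel) = - (\<integral>z. indicator W z *\<^sub>R (V z * delbar l \<eta> z) \<partial>lborel)"
proof -
  define F where "F z = (if z \<in> W then \<eta> z * V z else 0)" for z
  define F' where "F' z = frechet_derivative F (at z)" for z
  have oK: "open (- K)" using K(1) compact_imp_closed by blast
  note V1 = smooth_imp_Ck[OF V, of "Suc 0"]
  have FW: "Ck_on (Suc 0) W F"
    by (rule Ck_on_cong[OF Ck_on_mult[OF \<eta> V1]]) (simp add: F_def)
  have F0: "F z = 0" if "z \<in> - K" for z using that K(3) by (auto simp: F_def)
  have "Ck_on (Suc 0) (- K) F" by (rule Ck_on_cong[OF Ck_on_const[of _ _ 0]]) (simp add: F0)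
  then have "Ck_on (Suc 0) UNIV F"
    using FW W oK K(2) by (intro Ck_on_local[OF open_UNIV]) blast
  note FU = Ck_on_open[OF open_UNIV this]
  have der: "(F has_derivative F' z) (at z)" for z unfolding F'_def
    using FU(1) frechet_derivative_works by blast
  have z0: "(\<integral>x. F' x v \<partial>lborel) = 0" for v
    by (rule integral_derivative_zero[OF der _ K(1)]) (use FU(2) F0 in \<open>auto simp: F'_def\<close>)
  have F'0: "F' z v = 0" if "z \<notin> K" for z v
  proof -
    have "((\<lambda>_. 0) has_derivative F' z) (at z)"
      using has_derivative_transform_within_open[OF der oK, of z "\<lambda>_. 0"] F0 that by auto
    from has_derivative_unique[OF this has_derivative_const] show ?thesis by simp
  qed
  have int: "integrable lborel (\<lambda>z. F' z v)" for v
    using integrable_compact_support[of UNIV "\<lambda>z. F' z v" K] FU(2)[of v] K(1) F'0 by (simp add: F'_def)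
  have dF: "delbar l F z = \<eta> z * delbar l V z + V z * delbar l \<eta> z" if z: "z \<in> W" for z
  proof -
    have "delbar l F z = delbar l (\<lambda>z. \<eta> z * V z) z" by (rule del_cong(2)[OF W z]) (simp add: F_def)
    also have "\<dots> = \<eta> z * delbar l V z + delbar l \<eta> z * V z"
      by (rule delbar_mult[OF Ck_on_open(1)[OF W \<eta> z] smooth_on_differentiable[OF W V z]])
    finally show ?thesis by (simp add: mult.commute)
  qed
  have d\<eta>: "delbar l \<eta> z = 0" if "z \<in> W" "z \<notin> K" for z
  proof -
    have "delbar l \<eta> z = delbar l (\<lambda>_. 0) z"
      by (rule del_cong(2)[of "W - K"]) (use W oK that K(3) in \<open>auto simp: Diff_eq\<close>)
    then show ?thesis using del_has_derivative(2)[OF has_derivative_const] by simp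
  qed
  show i1: "integrable lborel (\<lambda>z. indicator W z *\<^sub>R (\<eta> z * delbar l V z))"
    using K by (intro integrable_compact_support[of W _ K]) (auto intro!: continuous_on_mult Ck_on_open(3)[OF W \<eta>] continuous_on_delbar[OF W V1])
  show i2: "integrable lborel (\<lambda>z. indicator W z *\<^sub>R (V z * delbar l \<eta> z))"
    using K d\<eta> by (intro integrable_compact_support[of W _ K]) (auto intro!: continuous_on_mult Ck_on_open(3)[OF W V1] continuous_on_delbar[OF W \<eta>])
  have "(\<integral>z. indicator W z *\<^sub>R (\<eta> z * delbar l V z) \<partial>lborel) + (\<integral>z. indicator W z *\<^sub>R (V z * delbar l \<eta> z) \<partial>lborel)
     = (\<integral>z. indicator W z *\<^sub>R (\<eta> z * delbar l V z) + indicator W z *\<^sub>R (V z * delbar l \<eta> z) \<partial>lborel)"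
    by (rule Bochner_Integration.integral_add[OF i1 i2, symmetric])
  also have "\<dots> = (\<integral>z. (F' z (axis l 1) + \<i> * F' z (axis l \<i>)) / 2 \<partial>lborel)"
  proof (rule Bochner_Integration.integral_cong[OF refl])
    fix z
    have d: "delbar l F z = (F' z (axis l 1) + \<i> * F' z (axis l \<i>)) / 2" by (simp add: delbar_def F'_def)
    show "indicator W z *\<^sub>R (\<eta> z * delbar l V z) + indicator W z *\<^sub>R (V z * delbar l \<eta> z) = (F' z (axis l 1) + \<i> * F' z (axis l \<i>)) / 2"
    proof (cases "z \<in> W")
      case True then show ?thesis using dF d by simp
    next
      case False
      then have "z \<notin> K" using K(2) by blast
      then show ?thesis using False by (simp add: F'0)
    qed
  qed
  also have "\<dots> = 0" using int by (simp add: z0)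
  finally show "(\<integral>z. indicator W z *\<^sub>R (\<eta> z * delbar l V z) \<partial>lborel) = - (\<integral>z. indicator W z *\<^sub>R (V z * delbar l \<eta> z) \<partial>lborel)"
    by (simp add: add_eq_0_iff2)
qed

context complex_manifold
begin

section \<open>Functions of class C^1 on the manifold\<close>

definition C1_fun :: "('a \<Rightarrow> real) \<Rightarrow> bool" where
  "C1_fun f \<longleftrightarrow> (\<forall>c\<in>A. Ck_on (Suc 0) (R c) (\<lambda>z. f (chart_inv c z)))"

lemma smooth_C1: "smooth_function A f \<Longrightarrow> C1_fun f"
  unfolding smooth_function_def C1_fun_def smooth_on_def by blast

lemma C1_const: "C1_fun (\<lambda>_. k)" by (simp add: C1_fun_def del: Ck_on.simps)

lemma C1_mult: "C1_fun f \<Longrightarrow> C1_fun h \<Longrightarrow> C1_fun (\<lambda>p. f p * h p)"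
  unfolding C1_fun_def using Ck_on_mult by blast

lemma C1_sum: "(\<And>i. i \<in> I \<Longrightarrow> C1_fun (f i)) \<Longrightarrow> C1_fun (\<lambda>p. \<Sum>i\<in>I. f i p)"
  unfolding C1_fun_def by (intro ballI Ck_on_sum) blast

lemma C1_divide: "C1_fun f \<Longrightarrow> C1_fun h \<Longrightarrow> (\<And>p. h p \<noteq> 0) \<Longrightarrow> C1_fun (\<lambda>p. f p / h p)"
  unfolding C1_fun_def divide_inverse by (intro ballI Ck_on_mult Ck_on_inverse) auto

lemma continuous_manifold:
  fixes f :: "'a \<Rightarrow> 'b::topological_space"
  assumes "\<And>c. c \<in> A \<Longrightarrow> continuous_on (R c) (\<lambda>z. f (chart_inv c z))"
  shows "continuous_on UNIV f"
proof -
  have "continuous_on (fst c) f" if c: "c \<in> A" for c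
  proof -
    have "continuous_on (fst c) (\<lambda>p. f (chart_inv c (snd c p)))"
      by (rule continuous_on_compose2[OF assms[OF c] continuous_chart(1)[OF c]]) auto
    then show ?thesis by (rule continuous_on_eq) (simp add: c)
  qed
  then have "continuous_on (\<Union>c\<in>A. fst c) f"
    using chart_props(1) by (intro continuous_on_open_UN) auto
  then show ?thesis using atlas unfolding holomorphic_atlas_def by simp
qed

lemma continuous_C1: "C1_fun f \<Longrightarrow> continuous_on UNIV f"
  unfolding C1_fun_def by (intro continuous_manifold) (blast intro: Ck_on_imp_continuous)

definition supported :: "('a, 'n) chart \<Rightarrow> ('a \<Rightarrow> real) \<Rightarrow> bool" where
  "supported c f \<longleftrightarrow> (\<exists>K. compact K \<and> K \<subseteq> R c \<and> (\<forall>p. f p \<noteq> 0 \<longrightarrow> p \<in> fst c \<and> snd c p \<in> K))"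

text \<open>The bump is the square of the positive part of r^2 minus the squared coordinate
  distance. Extended by zero it is C^1 in any other chart: near a point of the overlap by
  composition with the transition map, and elsewhere because the compact set \<open>?S\<close>,
  closed in a Hausdorff space, stays away.\<close>

lemma bump_exists:
  "\<exists>b. C1_fun b \<and> (\<forall>q. b q \<ge> 0) \<and> b p > 0 \<and> supported (chart_at A p) b"
proof -
  define c where "c = chart_at A p"
  have c: "c \<in> A" and p: "p \<in> fst c" using chart_at_props[of p] by (auto simp: c_def)
  let ?z = "snd c p"
  obtain r where r: "r > 0" "cball ?z r \<subseteq> R c"
    using chart_props(2)[OF c] chart_in_range[OF p] open_contains_cball by metis
  define b where "b q = (if q \<in> fst c then (max 0 (r\<^sup>2 - (snd c q - ?z) \<bullet> (snd c q - ?z)))\<^sup>2 else 0)" for q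
  have nz: "q \<in> fst c \<and> snd c q \<in> cball ?z r" if "b q \<noteq> 0" for q
  proof -
    from that have q: "q \<in> fst c" "(snd c q - ?z) \<bullet> (snd c q - ?z) < r\<^sup>2" by (auto simp: b_def split: if_splits)
    then have "(norm (snd c q - ?z))\<^sup>2 < r\<^sup>2" by (simp add: power2_norm_eq_inner)
    then have "norm (snd c q - ?z) < r" using r(1) power2_less_imp_less[of _ r] by simp
    then show ?thesis using q(1) by (simp add: dist_norm norm_minus_commute)
  qed
  have C1: "C1_fun b"
    unfolding C1_fun_def
  proof
    fix c' assume c': "c' \<in> A"
    let ?S = "chart_inv c ` cball ?z r"
    have "compact ?S" using r(2) by (intro compact_continuous_image continuous_on_subset[OF continuous_chart(2)[OF c]]) auto
    then have clS: "closed ?S" using compact_imp_closed by blast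
    have bS: "b q = 0" if "q \<notin> ?S" for q
      using nz[of q] that c by (metis chart_inv_chart image_eqI)
    show "Ck_on (Suc 0) (R c') (\<lambda>z. b (chart_inv c' z))"
    proof (rule Ck_on_local[OF chart_props(2)[OF c']])
      fix z assume z: "z \<in> R c'"
      show "\<exists>U. open U \<and> z \<in> U \<and> U \<subseteq> R c' \<and> Ck_on (Suc 0) U (\<lambda>z. b (chart_inv c' z))"
      proof (cases "chart_inv c' z \<in> fst c")
        case True
        let ?U = "overlap c' c" and ?\<tau> = "transition c' c"
        note sm\<tau> = transition_holomorphic(1)[OF c' c]
        have "Ck_on (Suc 0) ?U (\<lambda>w. ?\<tau> w + - ?z)"
          by (intro Ck_on_add Ck_on_const smooth_imp_Ck[OF sm\<tau>])
        note C = Ck_on_bilinear[OF bounded_bilinear_inner this this]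
        have "Ck_on (Suc 0) ?U (\<lambda>w. r\<^sup>2 + - ((?\<tau> w + - ?z) \<bullet> (?\<tau> w + - ?z)))"
          by (intro Ck_on_add Ck_on_const Ck_on_minus C)
        note C = Ck_on_pos_part[OF this]
        have "Ck_on (Suc 0) ?U (\<lambda>z. b (chart_inv c' z))"
        proof (rule Ck_on_cong[OF C])
          fix w assume "w \<in> ?U"
          then show "(max 0 (r\<^sup>2 + - ((?\<tau> w + - ?z) \<bullet> (?\<tau> w + - ?z))))\<^sup>2 = b (chart_inv c' w)"
            using overlap_iff[OF c', of w c] by (simp add: b_def transition_def)
        qed
        moreover have "z \<in> ?U" using z True overlap_iff[OF c'] by simp
        ultimately show ?thesis using open_overlap[OF c' c] overlap_subset by blast
      next
        case False
        let ?U = "snd c' ` (fst c' - ?S)"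
        have "open ?U" using chart_props(1)[OF c'] clS by (intro open_chart_image[OF c']) auto
        moreover have "chart_inv c' z \<notin> ?S" using False r(2) c by auto
        then have "z \<in> ?U" using z c' by (intro image_eqI[of _ _ "chart_inv c' z"]) auto
        moreover have "?U \<subseteq> R c'" by (auto simp: chart_range_def)
        moreover have "Ck_on (Suc 0) ?U (\<lambda>z. b (chart_inv c' z))"
          by (rule Ck_on_cong[OF Ck_on_const[of _ _ 0]]) (use c' bS in auto)
        ultimately show ?thesis by blast
      qed
    qed
  qed
  have "supported c b" unfolding supported_def using nz r(2) by (intro exI[of _ "cball ?z r"]) auto
  moreover have "b p > 0" using p r(1) by (simp add: b_def)
  moreover have "b q \<ge> 0" for q by (simp add: b_def)
  ultimately show ?thesis using C1 unfolding c_def by blast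
qed

text \<open>Finitely many bumps with positive sum, by compactness, are divided by that sum.\<close>

lemma partition_of_unity:
  obtains I :: "'a set" and \<rho> where "finite I" "\<And>p. p \<in> I \<Longrightarrow> C1_fun (\<rho> p)" "\<And>p. p \<in> I \<Longrightarrow> supported (chart_at A p) (\<rho> p)"
    "\<And>q. (\<Sum>p\<in>I. \<rho> p q) = (1::real)"
proof -
  obtain b where b: "\<And>p. C1_fun (b p)" "\<And>p q. b p q \<ge> 0" "\<And>p. b p p > 0" "\<And>p. supported (chart_at A p) (b p)"
    using bump_exists by metis
  have op: "open {q. b p q > 0}" for p
    using open_Collect_less[OF continuous_on_const continuous_C1[OF b(1)]] by simp
  have "UNIV \<subseteq> (\<Union>p\<in>UNIV. {q. b p q > 0})" using b(3) by blast
  then obtain I where I: "finite I" "UNIV \<subseteq> (\<Union>p\<in>I. {q. b p q > 0})"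
    using compactE_image[OF compact_M, of UNIV "\<lambda>p. {q. b p q > 0}"] op by metis
  let ?s = "\<lambda>q. \<Sum>p\<in>I. b p q"
  have s: "?s q > 0" for q
  proof -
    obtain p where "p \<in> I" "b p q > 0" using I(2) by blast
    then show ?thesis using I(1) b(2) by (intro sum_pos2[of I p]) auto
  qed
  show ?thesis
  proof (rule that[of I "\<lambda>p q. b p q / ?s q"])
    show "C1_fun (\<lambda>q. b p q / ?s q)" for p using b(1) s by (intro C1_divide C1_sum) (auto simp: less_imp_neq[symmetric])
    show "supported (chart_at A p) (\<lambda>q. b p q / ?s q)" for p
      using b(4)[of p] unfolding supported_def by auto
    show "(\<Sum>p\<in>I. b p q / ?s q) = 1" for q using s[of q] by (simp add: sum_divide_distrib[symmetric])
  qed (use I in auto)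
qed

end

section \<open>The divergence theorem\<close>

lemma delbar_sum:
  assumes "finite I" "\<And>i. i \<in> I \<Longrightarrow> f i differentiable (at z)"
  shows "delbar l (\<lambda>z. \<Sum>i\<in>I. f i z) z = (\<Sum>i\<in>I. delbar l (f i) z)"
proof -
  obtain D where D: "\<And>i. i \<in> I \<Longrightarrow> (f i has_derivative D i) (at z)"
    using assms(2) unfolding differentiable_def by metis
  have "delbar l (\<lambda>z. \<Sum>i\<in>I. f i z) z = ((\<Sum>i\<in>I. D i (axis l 1)) + \<i> * (\<Sum>i\<in>I. D i (axis l \<i>))) / 2"
    by (rule del_has_derivative(2)[OF has_derivative_sum[OF D]])
  also have "\<dots> = (\<Sum>i\<in>I. delbar l (f i) z)"
    by (simp add: del_has_derivative(2)[OF D] sum.distrib sum_distrib_left sum_divide_distrib add_divide_distrib)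
  finally show ?thesis .
qed

lemma delbar_const: "delbar l (\<lambda>_. k) z = 0"
  using del_has_derivative(2)[OF has_derivative_const] by simp

lemma contraction_real:
  assumes G: "hermitian_pos G" and \<alpha>: "\<And>i j. cnj (\<alpha> $ i $ j) = \<alpha> $ j $ i"
  shows "Im (\<Sum>i\<in>UNIV. \<Sum>j\<in>UNIV. upper_metric G $ i $ j * \<alpha> $ i $ j) = 0"
proof -
  have "cnj (\<Sum>i\<in>UNIV. \<Sum>j\<in>UNIV. upper_metric G $ i $ j * \<alpha> $ i $ j) = (\<Sum>i\<in>UNIV. \<Sum>j\<in>UNIV. upper_metric G $ j $ i * \<alpha> $ j $ i)"
    by (simp add: \<alpha> hermitian_pos_upper[OF G, symmetric])
  also have "\<dots> = (\<Sum>i\<in>UNIV. \<Sum>j\<in>UNIV. upper_metric G $ i $ j * \<alpha> $ i $ j)" by (rule sum.swap)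
  finally show ?thesis by (auto dest: arg_cong[where f=Im] simp only: cnj.sel neg_equal_zero)
qed

context complex_manifold
begin

lemma scalar_at_chart:
  assumes F: "scalar_field F" and c: "c \<in> A" and p: "p \<in> fst c"
  shows "scalar_at A F p = F c (snd c p)"
proof -
  let ?c = "chart_at A p"
  have "snd ?c p \<in> overlap ?c c" using p chart_at_props[of p] unfolding overlap_def by auto
  then have "F ?c (snd ?c p) = F c (transition ?c c (snd ?c p))"
    using F chart_at_props(1) c unfolding scalar_field_def by blast
  then show ?thesis unfolding scalar_at_def by (simp add: transition_def chart_at_props)
qed

lemma scalar_at_inv:
  "scalar_field F \<Longrightarrow> c \<in> A \<Longrightarrow> z \<in> R c \<Longrightarrow> scalar_at A F (chart_inv c z) = F c z"
  by (simp add: scalar_at_chart)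

lemma continuous_scalar_at:
  assumes F: "scalar_field F" and c: "\<And>c. c \<in> A \<Longrightarrow> continuous_on (R c) (F c)"
  shows "continuous_on UNIV (scalar_at A F)"
  by (rule continuous_manifold, rule continuous_on_eq[OF c]) (simp_all add: scalar_at_inv[OF F])

lemma scalar_field_add: "scalar_field F \<Longrightarrow> scalar_field H \<Longrightarrow> scalar_field (\<lambda>c z. F c z + H c z)"
  unfolding scalar_field_def by simp

text \<open>Laplacians and squared gradients arise chart by chart, while the divergence theorem is
  stated for functions on the manifold; this lemma is the passage between the two.\<close>

lemma global_function:
  assumes F: "scalar_field F" and s: "\<And>c. c \<in> A \<Longrightarrow> smooth_on (R c) (F c)"
    and re: "\<And>c z. c \<in> A \<Longrightarrow> z \<in> R c \<Longrightarrow> Im (F c z) = 0"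
  obtains u where "smooth_function A u" "\<And>c z. c \<in> A \<Longrightarrow> z \<in> R c \<Longrightarrow> local_rep u c z = F c z"
proof (rule that[of "\<lambda>p. Re (scalar_at A F p)"])
  show "smooth_function A (\<lambda>p. Re (scalar_at A F p))"
    unfolding smooth_function_def
  proof
    fix c assume c: "c \<in> A"
    show "smooth_on (R c) (\<lambda>z. Re (scalar_at A F (chart_inv c z)))"
      by (rule smooth_on_cong[OF smooth_on_Re[OF s[OF c]]]) (simp add: scalar_at_inv[OF F c])
  qed
  show "local_rep (\<lambda>p. Re (scalar_at A F p)) c z = F c z" if "c \<in> A" "z \<in> R c" for c z
    using re[OF that] by (simp add: local_rep_def scalar_at_inv[OF F that] complex_eq_iff)
qed

text \<open>The tensor product of the (1,0)-differential of \<open>F\<close> and the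
  (0,1)-differential of \<open>T\<close>. Its contraction by \<open>contr1\<close> is the inner
  product of gradients.\<close>

definition outer :: "(('a, 'n) chart \<Rightarrow> complex^'n \<Rightarrow> complex) \<Rightarrow> (('a, 'n) chart \<Rightarrow> complex^'n \<Rightarrow> complex) \<Rightarrow> ('a, 'n) form11" where
  "outer F T c z = (\<chi> i j. del i (F c) z * delbar j (T c) z)"

lemma tensor_outer:
  assumes F: "scalar_field F" "\<And>c z. c \<in> A \<Longrightarrow> z \<in> R c \<Longrightarrow> F c differentiable (at z)"
    and T: "scalar_field T" "\<And>c z. c \<in> A \<Longrightarrow> z \<in> R c \<Longrightarrow> T c differentiable (at z)"
  shows "tensor11 (outer F T)"
  unfolding tensor11_def
proof (intro ballI allI)
  fix c c' z i j assume c: "c \<in> A" "c' \<in> A" "z \<in> overlap c c'"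
  have w: "transition c c' z \<in> R c'" using transition_in[OF c] overlap_subset by blast
  have "F c w = F c' (transition c c' w)" "T c w = T c' (transition c c' w)" if "w \<in> overlap c c'" for w
    using F(1) T(1) c that unfolding scalar_field_def by auto
  then show "outer F T c z $ i $ j = (\<Sum>k\<in>UNIV. \<Sum>l\<in>UNIV. jac c c' z $ k $ i * cnj (jac c c' z $ l $ j) * outer F T c' (transition c c' z) $ k $ l)"
    using del_transition(1)[OF c _ F(2)[OF c(2) w], of "F c" i] del_transition(2)[OF c _ T(2)[OF c(2) w], of "T c" j]
    by (simp add: outer_def sum_product mult_ac)
qed

lemma scalar_local_rep: "scalar_field (local_rep u)"
  unfolding scalar_field_def using local_rep_transition by blast

lemma C1_local_rep: "C1_fun u \<Longrightarrow> c \<in> A \<Longrightarrow> Ck_on (Suc 0) (R c) (local_rep u c)"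
  unfolding C1_fun_def local_rep_def[abs_def] by (intro Ck_on_linear[OF bounded_linear_of_real]) blast

lemma C1_local_rep_differentiable: "C1_fun u \<Longrightarrow> c \<in> A \<Longrightarrow> z \<in> R c \<Longrightarrow> local_rep u c differentiable (at z)"
  by (rule Ck_on_open(1)[OF chart_props(2) C1_local_rep])

lemma kahler_metric11: assumes "kahler_form A g" shows "metric11 g"
proof -
  have rf: "real_form11 A g" and pf: "positive_form11 A g" using assms unfolding kahler_form_def by auto
  have "tensor11 g"
    using rf unfolding real_form11_def tensor11_def overlap_def jac_def vec_lambda_beta by blast
  moreover have "hermitian_pos (g c z)" if "c \<in> A" "z \<in> R c" for c z
    unfolding hermitian_pos_def
  proof (intro conjI)
    show "\<forall>i j. g c z $ j $ i = cnj (g c z $ i $ j)" using rf that unfolding real_form11_def by blast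
    show "\<forall>v. v \<noteq> 0 \<longrightarrow> 0 < Re (\<Sum>i\<in>UNIV. \<Sum>j\<in>UNIV. g c z $ i $ j * v $ i * cnj (v $ j))"
      using pf that unfolding positive_form11_def by blast
  qed
  moreover have "smooth_on (R c) (\<lambda>z. g c z $ i $ j)" if "c \<in> A" for c i j
    using rf that unfolding real_form11_def by (intro smooth_on_nth) blast
  ultimately show ?thesis unfolding metric11_def by blast
qed

end

section \<open>Divergences of closed tensors on a Kaehler manifold\<close>

locale kahler_manifold = complex_manifold A for A :: "('a::{t2_space, second_countable_topology}, 'n::finite) chart set" +
  fixes g :: "('a, 'n) form11"
  assumes kahler: "kahler_form A g"
begin

lemma met: "metric11 g" by (rule kahler_metric11[OF kahler])

lemma field: assumes c: "c \<in> A" shows "kahler_field (R c) (g c) wp wq"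
proof
  show "good_domain (R c)" by (rule good_domain_open[OF chart_props(2)[OF c]])
  show sg: "smooth_on (R c) (\<lambda>x. g c x $ i $ j)" for i j using met c unfolding metric11_def by blast
  show "hermitian_pos (g c x)" if "x \<in> R c" for x using met c that unfolding metric11_def by blast
  show "cd (R c) (wp k, wq k) (\<lambda>x. g c x $ i $ j) x = cd (R c) (wp i, wq i) (\<lambda>x. g c x $ k $ j) x" if x: "x \<in> R c" for i j k x
    using kahler c x del_smooth(1)[OF chart_props(2)[OF c] sg x] unfolding kahler_form_def closed_form11_def by metis
qed

lemma smooth_upper: "c \<in> A \<Longrightarrow> smooth_on (R c) (\<lambda>z. upper_metric (g c z) $ i $ j)"
  using metric_field.smooth_h[OF kahler_field.axioms(1)[OF field]] .

lemma smooth_ddbar: "smooth_function A f \<Longrightarrow> c \<in> A \<Longrightarrow> smooth_on (R c) (\<lambda>z. ddbar f c z $ i $ j)"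
  unfolding ddbar_def by simp (intro smooth_del chart_props smooth_local_rep)

lemma smooth_ricci: "c \<in> A \<Longrightarrow> smooth_on (R c) (\<lambda>z. ricci g c z $ i $ j)"
  unfolding ricci_def using metric_field.smooth_L[OF kahler_field.axioms(1)[OF field]]
  by simp (intro smooth_on_minus smooth_del chart_props)

lemma smooth_contr1:
  "(\<And>i j. smooth_on (R c) (\<lambda>z. \<alpha> c z $ i $ j)) \<Longrightarrow> c \<in> A \<Longrightarrow> smooth_on (R c) (contr1 g \<alpha> c)"
  unfolding contr1_def[abs_def] by (intro smooth_on_sum smooth_on_mult smooth_upper)

lemma smooth_contr2:
  "(\<And>i j. smooth_on (R c) (\<lambda>z. \<alpha> c z $ i $ j)) \<Longrightarrow> (\<And>i j. smooth_on (R c) (\<lambda>z. \<beta> c z $ i $ j)) \<Longrightarrow> c \<in> A \<Longrightarrow> smooth_on (R c) (contr2 g \<alpha> \<beta> c)"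
  unfolding contr2_def[abs_def] by (intro smooth_on_sum smooth_on_mult smooth_upper)

lemma smooth_outer:
  "smooth_on (R c) (F c) \<Longrightarrow> smooth_on (R c) (T c) \<Longrightarrow> c \<in> A \<Longrightarrow> smooth_on (R c) (\<lambda>z. outer F T c z $ i $ j)"
  unfolding outer_def by simp (intro smooth_on_mult smooth_del chart_props)

lemma laplacian_contr1: "laplacian g f = contr1 g (ddbar f)"
  unfolding laplacian_def contr1_def by (simp add: fun_eq_iff)

text \<open>The symmetry of barred derivatives is the form of closedness that
  \<open>div_form\<close> consumes.\<close>

definition closed_tensor :: "('a, 'n) form11 \<Rightarrow> bool" where
  "closed_tensor \<alpha> \<longleftrightarrow> tensor11 \<alpha> \<and> (\<forall>c\<in>A. \<forall>i j. smooth_on (R c) (\<lambda>z. \<alpha> c z $ i $ j)) \<and>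
     (\<forall>c\<in>A. \<forall>z\<in>R c. \<forall>i j k. delbar k (\<lambda>z. \<alpha> c z $ i $ j) z = delbar j (\<lambda>z. \<alpha> c z $ i $ k) z)"

text \<open>The divergence of the field obtained by contracting \<alpha> with the gradient of
  \<open>f\<close>, as computed in \<open>div_form\<close>. For \<alpha> = g it is the Laplacian of
  \<open>f\<close>, since the trace of the metric is constant.\<close>

definition div_op where
  "div_op \<alpha> f c z = contr2 g \<alpha> (ddbar f) c z + contr1 g (outer (local_rep f) (contr1 g \<alpha>)) c z"

lemma scalar_div_op:
  assumes \<alpha>: "closed_tensor \<alpha>" and f: "smooth_function A f"
  shows "scalar_field (div_op \<alpha> f)" "c \<in> A \<Longrightarrow> smooth_on (R c) (div_op \<alpha> f c)"
proof -
  have t: "tensor11 \<alpha>" and s: "\<And>c i j. c \<in> A \<Longrightarrow> smooth_on (R c) (\<lambda>z. \<alpha> c z $ i $ j)"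
    using \<alpha> unfolding closed_tensor_def by auto
  show "scalar_field (div_op \<alpha> f)" unfolding div_op_def[abs_def]
    by (intro scalar_field_add scalar_contr1 scalar_contr2 met t tensor_ddbar f tensor_outer scalar_local_rep
         smooth_on_differentiable[OF chart_props(2) smooth_local_rep[OF f]] smooth_on_differentiable[OF chart_props(2) smooth_contr1[OF s]])
  show "smooth_on (R c) (div_op \<alpha> f c)" if "c \<in> A" unfolding div_op_def[abs_def]
    by (intro smooth_on_add smooth_contr1[where c=c] smooth_contr2[where c=c] s smooth_ddbar f smooth_outer smooth_local_rep that)
qed

text \<open>In a chart containing the support of \<eta>, the density times \<open>div_op\<close> is
  a constant multiple of a flat divergence, so \<open>integral_delbar_parts\<close> moves the
  derivatives to \<eta>.\<close>

lemma div_local: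
  assumes \<alpha>: "closed_tensor \<alpha>" and f: "smooth_function A f" and \<eta>: "C1_fun \<eta>" and c: "c \<in> A" and sup: "supported c \<eta>"
  shows "(\<integral>p. of_real (\<eta> p) * scalar_at A (div_op \<alpha> f) p \<partial>vol g) =
     - (\<integral>p. scalar_at A (contr2 g \<alpha> (outer (local_rep f) (local_rep \<eta>))) p \<partial>vol g)"
proof -
  interpret K: kahler_field "R c" "g c" wp wq by (rule field[OF c])
  have t: "tensor11 \<alpha>" and s: "\<And>c i j. c \<in> A \<Longrightarrow> smooth_on (R c) (\<lambda>z. \<alpha> c z $ i $ j)"
    and cl: "\<And>c z i j k. c \<in> A \<Longrightarrow> z \<in> R c \<Longrightarrow> delbar k (\<lambda>z. \<alpha> c z $ i $ j) z = delbar j (\<lambda>z. \<alpha> c z $ i $ k) z"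
    using \<alpha> unfolding closed_tensor_def by auto
  obtain C where C: "compact C" "C \<subseteq> R c" "\<And>p. \<eta> p \<noteq> 0 \<Longrightarrow> p \<in> fst c \<and> snd c p \<in> C"
    using sup unfolding supported_def by blast
  let ?h = "\<lambda>i j z. upper_metric (g c z) $ i $ j" and ?f = "local_rep f c" and ?\<eta> = "local_rep \<eta> c"
  note W = chart_props(2)[OF c] and sf = smooth_local_rep[OF f c]
  let ?B = "contr2 g \<alpha> (outer (local_rep f) (local_rep \<eta>))"
  \<comment> \<open>The field built from \<alpha> and the gradient of \<open>f\<close>, multiplied
    by det g so that \<open>div_form\<close> gives its flat divergence.\<close>
  define V where "V l z = det (g c z) * (\<Sum>i\<in>UNIV. ?h i l z * (\<Sum>j\<in>UNIV. \<Sum>m\<in>UNIV. ?h j m z * \<alpha> c z $ i $ m * K.P j ?f z))" for l z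
  have sV: "smooth_on (R c) (V l)" for l unfolding V_def[abs_def]
    by (intro smooth_on_mult smooth_on_sum K.smooth_u K.smooth_h smooth_cd[OF K.good] sf s c)
  have \<eta>0: "?\<eta> z = 0" if "z \<in> R c" "z \<notin> C" for z
    using C(3)[of "chart_inv c z"] that c by (auto simp: local_rep_def)
  have B0: "scalar_field ?B"
    by (intro scalar_contr2 met t tensor_outer scalar_local_rep C1_local_rep_differentiable[OF \<eta>] C1_local_rep_differentiable[OF smooth_C1[OF f]])
  have cB: "continuous_on (R d) (?B d)" if d: "d \<in> A" for d
    unfolding contr2_def[abs_def] outer_def
    by (simp, intro continuous_on_sum continuous_on_mult smooth_on_continuous[OF smooth_upper[OF d]] smooth_on_continuous[OF s[OF d]]
       continuous_on_delbar[OF chart_props(2)[OF d] C1_local_rep[OF smooth_C1[OF f] d]]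
       continuous_on_delbar[OF chart_props(2)[OF d] C1_local_rep[OF \<eta> d]])
  have div: "of_real (vdens g c z) * div_op \<alpha> f c z = 2 ^ CARD('n) * (\<Sum>l\<in>UNIV. delbar l (V l) z)" if z: "z \<in> R c" for z
  proof -
    have clQ: "K.Q k (\<lambda>z. \<alpha> c z $ i $ j) z = K.Q j (\<lambda>z. \<alpha> c z $ i $ k) z" for i j k
      using cl[OF c z] del_smooth(2)[OF W s[OF c] z] by metis
    have "(\<Sum>l\<in>UNIV. delbar l (V l) z) = (\<Sum>l\<in>UNIV. K.Q l (V l) z)" by (simp add: del_smooth(2)[OF W sV z])
    also have "\<dots> = det (g c z) * ((\<Sum>i\<in>UNIV. \<Sum>l\<in>UNIV. \<Sum>j\<in>UNIV. \<Sum>m\<in>UNIV. ?h i l z * ?h j m z * \<alpha> c z $ i $ m * K.Q l (K.P j ?f) z)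
     + (\<Sum>j\<in>UNIV. \<Sum>m\<in>UNIV. ?h j m z * K.P j ?f z * K.Q m (\<lambda>x. \<Sum>i\<in>UNIV. \<Sum>l\<in>UNIV. ?h i l x * \<alpha> c x $ i $ l) z))"
      unfolding V_def[abs_def] by (rule K.div_form[OF z, of "\<lambda>i j z. \<alpha> c z $ i $ j" "\<lambda>j. K.P j ?f"]) (intro s c smooth_cd[OF K.good] sf clQ)+
    also have "\<dots> = det (g c z) * div_op \<alpha> f c z"
    proof -
      have 1: "K.Q l (K.P j ?f) z = del j (delbar l ?f) z" for l j
      proof -
        have "K.Q l (K.P j ?f) z = K.P j (K.Q l ?f) z" by (rule cd_commute[OF K.good sf z])
        also have "\<dots> = K.P j (delbar l ?f) z" by (rule cd_cong[OF _ z]) (simp add: del_smooth(2)[OF W sf])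
        also have "\<dots> = del j (delbar l ?f) z" by (rule del_smooth(1)[OF W smooth_del(2)[OF W sf] z, symmetric])
        finally show ?thesis .
      qed
      have 2: "K.Q m (\<lambda>x. \<Sum>i\<in>UNIV. \<Sum>l\<in>UNIV. ?h i l x * \<alpha> c x $ i $ l) z = delbar m (contr1 g \<alpha> c) z" for m
        using del_smooth(2)[OF W smooth_contr1[where \<alpha>=\<alpha> and c=c, OF s[OF c] c] z] by (simp add: contr1_def[abs_def])
      show ?thesis unfolding div_op_def contr2_def contr1_def outer_def 1 2
        by (simp add: ddbar_def contr1_def[abs_def] del_smooth(1)[OF W sf z] mult.assoc)
    qed
    finally show ?thesis using K.det_real[OF z] by (simp add: vdens_def)
  qed
  have bd: "of_real (vdens g c z) * ?B c z = 2 ^ CARD('n) * (\<Sum>l\<in>UNIV. V l z * delbar l ?\<eta> z)" if z: "z \<in> R c" for z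
  proof -
    have "?B c z = (\<Sum>l\<in>UNIV. \<Sum>i\<in>UNIV. \<Sum>j\<in>UNIV. \<Sum>m\<in>UNIV. ?h i l z * ?h j m z * \<alpha> c z $ i $ m * (K.P j ?f z * delbar l ?\<eta> z))"
      unfolding contr2_def outer_def by (subst sum.swap) (simp add: del_smooth(1)[OF W sf z])
    also have "det (g c z) * \<dots> = (\<Sum>l\<in>UNIV. V l z * delbar l ?\<eta> z)"
      unfolding V_def by (simp add: sum_distrib_left sum_distrib_right mult_ac)
    finally show ?thesis using K.det_real[OF z] by (simp add: vdens_def mult.assoc)
  qed
  have parts: "integrable lborel (\<lambda>z. indicator (R c) z *\<^sub>R (?\<eta> z * delbar l (V l) z))"
    "integrable lborel (\<lambda>z. indicator (R c) z *\<^sub>R (V l z * delbar l ?\<eta> z))"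
    "(\<integral>z. indicator (R c) z *\<^sub>R (?\<eta> z * delbar l (V l) z) \<partial>lborel) = - (\<integral>z. indicator (R c) z *\<^sub>R (V l z * delbar l ?\<eta> z) \<partial>lborel)" for l
    by (rule integral_delbar_parts[OF W C1_local_rep[OF \<eta> c] sV C(1,2)], erule (1) \<eta>0)+
  have meas1: "(\<lambda>p. of_real (\<eta> p) * scalar_at A (div_op \<alpha> f) p) \<in> borel_measurable borel"
    by (intro borel_measurable_continuous_onI continuous_intros continuous_C1 \<eta> continuous_scalar_at scalar_div_op[OF \<alpha> f] smooth_on_continuous)
  have meas2: "scalar_at A ?B \<in> borel_measurable borel"
    by (intro borel_measurable_continuous_onI continuous_scalar_at B0 cB)
  have d\<eta>0: "delbar l ?\<eta> z = 0" if z: "z \<in> R c" "z \<notin> C" for l z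
  proof -
    have "open (R c - C)" using W C(1) compact_imp_closed by blast
    then have "delbar l ?\<eta> z = delbar l (\<lambda>_. 0) z" by (rule del_cong(2)) (use z \<eta>0 in auto)
    then show ?thesis by (simp add: delbar_const)
  qed
  \<comment> \<open>Outside the chart domain \<open>scalar_at\<close> uses some other chart. The
    support of \<eta> lies in the closed set \<open>?S\<close>, so \<eta> vanishes near
    \<open>p\<close> and its derivative at \<open>p\<close> is zero.\<close>
  have B_out: "scalar_at A ?B p = 0" if p: "p \<notin> fst c" for p
  proof -
    let ?d = "chart_at A p"
    note d = chart_at_props[of p]
    let ?S = "chart_inv c ` C"
    have "compact ?S" using C(1,2) by (intro compact_continuous_image continuous_on_subset[OF continuous_chart(2)[OF c]]) auto
    then have clS: "closed ?S" using compact_imp_closed by blast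
    have S: "\<eta> q = 0" if "q \<notin> ?S" for q using C(3)[of q] that c by (metis chart_inv_chart image_eqI)
    have pS: "p \<notin> ?S" using p C(2) c by auto
    let ?U = "snd ?d ` (fst ?d - ?S)"
    have U: "open ?U" using chart_props(1)[OF d(1)] clS by (intro open_chart_image[OF d(1)]) auto
    have "delbar l (local_rep \<eta> ?d) (snd ?d p) = delbar l (\<lambda>_. 0) (snd ?d p)" for l
      by (rule del_cong(2)[OF U]) (use d pS S in \<open>auto simp: local_rep_def\<close>)
    then show ?thesis unfolding scalar_at_def contr2_def outer_def by (simp add: delbar_const)
  qed
  have "(\<integral>p. of_real (\<eta> p) * scalar_at A (div_op \<alpha> f) p \<partial>vol g) =
     (\<integral>z. (indicator (R c) z * vdens g c z) *\<^sub>R (of_real (\<eta> (chart_inv c z)) * scalar_at A (div_op \<alpha> f) (chart_inv c z)) \<partial>lborel)"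
    by (rule integral_chart[OF met c meas1]) (use C(3) in auto)
  also have "\<dots> = (\<integral>z. (\<Sum>l\<in>UNIV. 2 ^ CARD('n) * (indicator (R c) z *\<^sub>R (?\<eta> z * delbar l (V l) z))) \<partial>lborel)"
  proof (rule Bochner_Integration.integral_cong[OF refl])
    fix z
    show "(indicator (R c) z * vdens g c z) *\<^sub>R (of_real (\<eta> (chart_inv c z)) * scalar_at A (div_op \<alpha> f) (chart_inv c z)) =
       (\<Sum>l\<in>UNIV. 2 ^ CARD('n) * (indicator (R c) z *\<^sub>R (?\<eta> z * delbar l (V l) z)))"
    proof (cases "z \<in> R c")
      case True
      have "of_real (vdens g c z) * (?\<eta> z * div_op \<alpha> f c z) = ?\<eta> z * (of_real (vdens g c z) * div_op \<alpha> f c z)" by (simp add: mult_ac)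
      also have "\<dots> = (\<Sum>l\<in>UNIV. 2 ^ CARD('n) * (?\<eta> z * delbar l (V l) z))"
        unfolding div[OF True] by (simp add: sum_distrib_left mult_ac)
      finally show ?thesis using True by (simp add: scalar_at_inv[OF scalar_div_op(1)[OF \<alpha> f] c True] scaleR_conv_of_real local_rep_def)
    qed simp
  qed
  also have "\<dots> = (\<Sum>l\<in>UNIV. 2 ^ CARD('n) * (\<integral>z. indicator (R c) z *\<^sub>R (?\<eta> z * delbar l (V l) z) \<partial>lborel))"
    by (rule trans[OF Bochner_Integration.integral_sum], rule integrable_mult_right, rule parts(1), rule sum.cong[OF refl], rule integral_mult_right_zero)
  also have "\<dots> = - (\<Sum>l\<in>UNIV. 2 ^ CARD('n) * (\<integral>z. indicator (R c) z *\<^sub>R (V l z * delbar l ?\<eta> z) \<partial>lborel))"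
    unfolding parts(3) by (simp add: sum_negf)
  also have "(\<Sum>l\<in>UNIV. 2 ^ CARD('n) * (\<integral>z. indicator (R c) z *\<^sub>R (V l z * delbar l ?\<eta> z) \<partial>lborel)) =
      (\<integral>z. (\<Sum>l\<in>UNIV. 2 ^ CARD('n) * (indicator (R c) z *\<^sub>R (V l z * delbar l ?\<eta> z))) \<partial>lborel)"
    by (rule trans[OF _ Bochner_Integration.integral_sum[symmetric]], rule sum.cong[OF refl], rule integral_mult_right_zero[symmetric],
        rule integrable_mult_right, rule parts(2))
  also have "\<dots> = (\<integral>z. (indicator (R c) z * vdens g c z) *\<^sub>R scalar_at A ?B (chart_inv c z) \<partial>lborel)"
  proof (rule Bochner_Integration.integral_cong[OF refl])
    fix z
    show "(\<Sum>l\<in>UNIV. 2 ^ CARD('n) * (indicator (R c) z *\<^sub>R (V l z * delbar l ?\<eta> z))) = (indicator (R c) z * vdens g c z) *\<^sub>R scalar_at A ?B (chart_inv c z)"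
    proof (cases "z \<in> R c")
      case True
      then show ?thesis using bd[OF True] by (simp add: scalar_at_inv[OF B0 c True] scaleR_conv_of_real sum_distrib_left)
    qed simp
  qed
  also have "\<dots> = (\<integral>p. scalar_at A ?B p \<partial>vol g)"
    by (rule integral_chart[OF met c meas2 B_out, symmetric])
  finally show ?thesis .
qed

text \<open>The partition of unity is applied to \<eta>, in which both sides are linear; no
  derivative of the partition functions has to be tracked, as the differentials of the pieces add up
  to that of \<eta>.\<close>

lemma div_global:
  assumes \<alpha>: "closed_tensor \<alpha>" and f: "smooth_function A f" and \<eta>: "C1_fun \<eta>"
  shows "(\<integral>p. of_real (\<eta> p) * scalar_at A (div_op \<alpha> f) p \<partial>vol g) =
     - (\<integral>p. scalar_at A (contr2 g \<alpha> (outer (local_rep f) (local_rep \<eta>))) p \<partial>vol g)"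
proof -
  have t: "tensor11 \<alpha>" and s: "\<And>c i j. c \<in> A \<Longrightarrow> smooth_on (R c) (\<lambda>z. \<alpha> c z $ i $ j)"
    using \<alpha> unfolding closed_tensor_def by auto
  obtain I :: "'a set" and \<rho> where I: "finite I" and \<rho>: "\<And>p. p \<in> I \<Longrightarrow> C1_fun (\<rho> p)" "\<And>p. p \<in> I \<Longrightarrow> supported (chart_at A p) (\<rho> p)"
    "\<And>q. (\<Sum>p\<in>I. \<rho> p q) = (1::real)" by (rule partition_of_unity) blast
  define \<chi>' where "\<chi>' p q = \<rho> p q * \<eta> q" for p q
  have C1: "C1_fun (\<chi>' p)" if "p \<in> I" for p unfolding \<chi>'_def[abs_def] by (intro C1_mult \<rho> that \<eta>)
  have sup: "supported (chart_at A p) (\<chi>' p)" if "p \<in> I" for p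
    using \<rho>(2)[OF that] unfolding supported_def \<chi>'_def by auto
  have sum: "\<eta> q = (\<Sum>p\<in>I. \<chi>' p q)" for q using \<rho>(3)[of q] by (simp add: \<chi>'_def sum_distrib_right[symmetric])
  let ?D = "scalar_at A (div_op \<alpha> f)" and ?B = "\<lambda>\<eta>. contr2 g \<alpha> (outer (local_rep f) (local_rep \<eta>))"
  have cD: "continuous_on UNIV ?D"
    by (intro continuous_scalar_at scalar_div_op[OF \<alpha> f] smooth_on_continuous)
  have intD: "integrable (vol g) (\<lambda>q. of_real (\<chi>' p q) * ?D q)" if "p \<in> I" for p
    by (intro integrable_vol met continuous_intros cD continuous_C1 C1 that)
  have cB: "continuous_on (R d) (?B \<eta> d)" if d: "d \<in> A" and \<eta>: "C1_fun \<eta>" for d \<eta>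
    unfolding contr2_def[abs_def] outer_def
    by (simp, intro continuous_on_sum continuous_on_mult smooth_on_continuous[OF smooth_upper[OF d]] smooth_on_continuous[OF s[OF d]]
       continuous_on_delbar[OF chart_props(2)[OF d] C1_local_rep[OF smooth_C1[OF f] d]]
       continuous_on_delbar[OF chart_props(2)[OF d] C1_local_rep[OF \<eta> d]])
  have intB: "integrable (vol g) (scalar_at A (?B (\<chi>' p)))" if "p \<in> I" for p
    by (intro integrable_vol met continuous_scalar_at cB C1 that scalar_contr2 t tensor_outer scalar_local_rep
        C1_local_rep_differentiable[OF C1[OF that]] C1_local_rep_differentiable[OF smooth_C1[OF f]])
  have Bsum: "scalar_at A (?B \<eta>) q = (\<Sum>p\<in>I. scalar_at A (?B (\<chi>' p)) q)" for q
  proof -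
    let ?d = "chart_at A q" and ?z = "snd (chart_at A q) q"
    have d: "?d \<in> A" "?z \<in> R ?d" using chart_at_props[of q] by auto
    have "local_rep \<eta> ?d = (\<lambda>z. \<Sum>p\<in>I. local_rep (\<chi>' p) ?d z)" by (simp add: local_rep_def sum fun_eq_iff)
    then have "delbar l (local_rep \<eta> ?d) ?z = (\<Sum>p\<in>I. delbar l (local_rep (\<chi>' p) ?d) ?z)" for l
      using delbar_sum[OF I C1_local_rep_differentiable[OF C1 d]] by simp
    then have "scalar_at A (?B \<eta>) q = (\<Sum>i\<in>UNIV. \<Sum>l\<in>UNIV. \<Sum>j\<in>UNIV. \<Sum>m\<in>UNIV. \<Sum>p\<in>I. upper_metric (g ?d ?z) $ i $ l * upper_metric (g ?d ?z) $ j $ m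
        * \<alpha> ?d ?z $ i $ m * outer (local_rep f) (local_rep (\<chi>' p)) ?d ?z $ j $ l)"
      unfolding scalar_at_def contr2_def outer_def by (simp add: sum_distrib_left)
    also have "\<dots> = (\<Sum>p\<in>I. scalar_at A (?B (\<chi>' p)) q)"
      unfolding scalar_at_def contr2_def
      by (simp only: sum.swap[of _ I])
    finally show ?thesis .
  qed
  have "(\<integral>q. of_real (\<eta> q) * ?D q \<partial>vol g) = (\<integral>q. (\<Sum>p\<in>I. of_real (\<chi>' p q) * ?D q) \<partial>vol g)"
    by (simp add: sum sum_distrib_right)
  also have "\<dots> = (\<Sum>p\<in>I. \<integral>q. of_real (\<chi>' p q) * ?D q \<partial>vol g)"
    by (rule Bochner_Integration.integral_sum[OF intD])
  also have "\<dots> = (\<Sum>p\<in>I. - (\<integral>q. scalar_at A (?B (\<chi>' p)) q \<partial>vol g))"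
    by (intro sum.cong refl div_local[OF \<alpha> f C1 chart_at_props(1) sup])
  also have "\<dots> = - (\<integral>q. (\<Sum>p\<in>I. scalar_at A (?B (\<chi>' p)) q) \<partial>vol g)"
    by (subst Bochner_Integration.integral_sum[OF intB]) (simp_all add: sum_negf)
  finally show ?thesis by (simp add: Bsum)
qed

end

section \<open>The variation of the scalar curvature\<close>

lemma ddbar_cong:
  assumes "open W" "z \<in> W" "\<And>w. w \<in> W \<Longrightarrow> f w = h w"
  shows "del i (delbar j f) z = del i (delbar j h) z"
  by (rule del_cong(1)[OF assms(1,2)]) (rule del_cong(2)[OF assms(1) _ assms(3)])

lemma ddbar_eq_cd:
  assumes W: "open W" and f: "smooth_on W f" and z: "z \<in> W"
  shows "del i (delbar j f) z = cd W (wp i, wq i) (cd W (wp j, - wq j) f) z"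
proof -
  have "del i (delbar j f) z = cd W (wp i, wq i) (delbar j f) z" by (rule del_smooth(1)[OF W smooth_del(2)[OF W f] z])
  also have "\<dots> = cd W (wp i, wq i) (cd W (wp j, - wq j) f) z" by (rule cd_cong[OF del_smooth(2)[OF W f] z])
  finally show ?thesis .
qed

lemma ddbar_closed:
  assumes W: "open W" and f: "smooth_on W f" and z: "z \<in> W"
  shows "delbar k (\<lambda>z. del i (delbar j f) z) z = delbar j (\<lambda>z. del i (delbar k f) z) z"
proof -
  let ?P = "cd W (wp i, wq i)" and ?Q = "\<lambda>i. cd W (wp i, - wq i)"
  note G = good_domain_open[OF W]
  have "delbar k (\<lambda>z. del i (delbar j f) z) z = ?P (?Q k (?Q j f)) z" for j k
  proof -
    have "delbar k (\<lambda>z. del i (delbar j f) z) z = ?Q k (\<lambda>z. del i (delbar j f) z) z"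
      by (rule del_smooth(2)[OF W smooth_del(1)[OF W smooth_del(2)[OF W f]] z])
    also have "\<dots> = ?Q k (?P (?Q j f)) z" by (rule cd_cong[OF ddbar_eq_cd[OF W f] z])
    also have "\<dots> = ?P (?Q k (?Q j f)) z" by (rule cd_commute[OF G smooth_cd[OF G f] z])
    finally show ?thesis .
  qed
  moreover have "?P (?Q k (?Q j f)) z = ?P (?Q j (?Q k f)) z" by (rule cd_cong[OF cd_commute[OF G f] z])
  ultimately show ?thesis by metis
qed

lemma ddbar_hermitian:
  assumes W: "open W" and f: "smooth_on W f" and re: "\<And>z. z \<in> W \<Longrightarrow> cnj (f z) = f z" and z: "z \<in> W"
  shows "cnj (del i (delbar j f) z) = del j (delbar i f) z"
proof -
  have d: "delbar j f differentiable (at z)" by (rule smooth_on_differentiable[OF W smooth_del(2)[OF W f] z])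
  have "cnj (del i (delbar j f) z) = delbar i (\<lambda>z. cnj (delbar j f z)) z"
    by (rule delbar_cnj(1)[OF d, symmetric])
  also have "\<dots> = delbar i (del j f) z"
  proof (rule del_cong(2)[OF W z])
    fix w assume w: "w \<in> W"
    have "cnj (delbar j f w) = del j (\<lambda>z. cnj (f z)) w"
      by (rule delbar_cnj(2)[OF smooth_on_differentiable[OF W f w], symmetric])
    also have "\<dots> = del j f w" by (rule del_cong(1)[OF W w re])
    finally show "cnj (delbar j f w) = del j f w" .
  qed
  also have "\<dots> = cd W (wp i, - wq i) (del j f) z" by (rule del_smooth(2)[OF W smooth_del(1)[OF W f] z])
  also have "\<dots> = cd W (wp i, - wq i) (cd W (wp j, wq j) f) z" by (rule cd_cong[OF del_smooth(1)[OF W f] z])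
  also have "\<dots> = cd W (wp j, wq j) (cd W (wp i, - wq i) f) z" by (rule cd_commute[OF good_domain_open[OF W] f z])
  also have "\<dots> = del j (delbar i f) z" by (rule ddbar_eq_cd[OF W f z, symmetric])
  finally show ?thesis .
qed

text \<open>The linearised scalar curvature: minus the sum of the iterated Laplacian of \<psi> and
  the contraction of the Ricci form with the complex Hessian. That it is a time derivative is shown
  for curves in \<open>DT_ST\<close>.\<close>

definition (in complex_manifold) scal_variation :: "('a, 'n) form11 \<Rightarrow> ('a \<Rightarrow> real) \<Rightarrow> ('a, 'n) chart \<Rightarrow> complex^'n \<Rightarrow> complex" where
  "scal_variation g \<psi> c z = - ((\<Sum>i\<in>UNIV. \<Sum>j\<in>UNIV. upper_metric (g c z) $ i $ j * del i (delbar j (laplacian g \<psi> c)) z)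
     + contr2 g (ricci g) (ddbar \<psi>) c z)"

context kahler_manifold
begin

lemma herm_g: "c \<in> A \<Longrightarrow> z \<in> R c \<Longrightarrow> hermitian_pos (g c z)"
  using met unfolding metric11_def by blast

lemma smooth_log_det: "c \<in> A \<Longrightarrow> smooth_on (R c) (\<lambda>z. complex_of_real (ln (Re (det (g c z)))))"
  using metric_field.smooth_L[OF kahler_field.axioms(1)[OF field]] .

lemma closed_tensor_g: "closed_tensor g"
  unfolding closed_tensor_def
proof (intro conjI ballI allI)
  show "tensor11 g" using met unfolding metric11_def by blast
  show s: "smooth_on (R c) (\<lambda>z. g c z $ i $ j)" if "c \<in> A" for c i j using met that unfolding metric11_def by blast
  show "delbar k (\<lambda>z. g c z $ i $ j) z = delbar j (\<lambda>z. g c z $ i $ k) z" if c: "c \<in> A" and z: "z \<in> R c" for c z i j k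
    using kahler_field.closed_Q[OF field[OF c] z, of k i j] del_smooth(2)[OF chart_props(2)[OF c] s[OF c] z] by simp
qed

lemma closed_tensor_ddbar:
  assumes f: "smooth_function A f" shows "closed_tensor (ddbar f)"
  unfolding closed_tensor_def
proof (intro conjI ballI allI)
  show "delbar k (\<lambda>z. ddbar f c z $ i $ j) z = delbar j (\<lambda>z. ddbar f c z $ i $ k) z" if c: "c \<in> A" and z: "z \<in> R c" for c z i j k
    using ddbar_closed[OF chart_props(2)[OF c] smooth_local_rep[OF f c] z] by (simp add: ddbar_def)
qed (use tensor_ddbar[OF f] smooth_ddbar[OF f] in auto)

lemma closed_tensor_ricci: "closed_tensor (ricci g)"
  unfolding closed_tensor_def
proof (intro conjI ballI allI)
  show "delbar k (\<lambda>z. ricci g c z $ i $ j) z = delbar j (\<lambda>z. ricci g c z $ i $ k) z" if c: "c \<in> A" and z: "z \<in> R c" for c z i j k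
  proof -
    let ?L = "\<lambda>w. complex_of_real (ln (Re (det (g c w))))"
    note W = chart_props(2)[OF c]
    have "delbar k (\<lambda>z. - del i (delbar j ?L) z) z = - delbar k (\<lambda>z. del i (delbar j ?L) z) z" for k j
    proof -
      have sm: "smooth_on (R c) (\<lambda>z. del i (delbar j ?L) z)" by (intro smooth_del W smooth_log_det c)
      show ?thesis unfolding del_smooth(2)[OF W sm z] del_smooth(2)[OF W smooth_on_minus[OF sm] z]
        by (rule cd_minus[OF good_domain_open[OF W] sm z])
    qed
    then show ?thesis using ddbar_closed[OF W smooth_log_det[OF c] z] by (simp add: ricci_def)
  qed
qed (use tensor_ricci[OF met] smooth_ricci in auto)

lemma contr2_g: assumes c: "c \<in> A" and z: "z \<in> R c" shows "contr2 g g \<beta> c z = contr1 g \<beta> c z"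
proof -
  let ?h = "\<lambda>i j. upper_metric (g c z) $ i $ j" and ?g = "\<lambda>i j. g c z $ i $ j"
  have nz: "det (g c z) \<noteq> 0" using hermitian_det_nz[OF herm_g[OF c z]] .
  have "contr2 g g \<beta> c z = (\<Sum>l\<in>UNIV. \<Sum>j\<in>UNIV. \<Sum>m\<in>UNIV. \<Sum>i\<in>UNIV. ?h i l * ?h j m * ?g i m * \<beta> c z $ j $ l)"
    unfolding contr2_def by (subst sum.swap) (intro sum.cong refl sum_rotate)
  also have "\<dots> = (\<Sum>l\<in>UNIV. \<Sum>j\<in>UNIV. \<Sum>m\<in>UNIV. (\<Sum>i\<in>UNIV. ?h i l * ?g i m) * (?h j m * \<beta> c z $ j $ l))"
    by (simp add: sum_distrib_left sum_distrib_right mult_ac)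
  also have "\<dots> = (\<Sum>l\<in>UNIV. \<Sum>j\<in>UNIV. ?h j l * \<beta> c z $ j $ l)"
    by (simp add: upper_metric_inverse[OF nz] if_distrib[of "\<lambda>a. a * _"] cong: if_cong)
  also have "\<dots> = contr1 g \<beta> c z" unfolding contr1_def by (rule sum.swap)
  finally show ?thesis .
qed

lemma contr1_g: assumes c: "c \<in> A" and z: "z \<in> R c" shows "contr1 g g c z = of_nat CARD('n)"
  using upper_metric_inverse(1)[OF hermitian_det_nz[OF herm_g[OF c z]]] by (simp add: contr1_def)

text \<open>Removes the gradient term of \<open>div_op\<close> when the trace is constant, which
  holds for the metric always and for the Ricci form at constant scalar curvature. The second
  equation covers the test function 1.\<close>

lemma contr1_outer_const:
  assumes c: "c \<in> A" and z: "z \<in> R c" and T: "\<And>z. z \<in> R c \<Longrightarrow> T c z = k"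
  shows "contr1 g (outer F T) c z = 0" "contr2 g \<alpha> (outer F T) c z = 0"
proof -
  have "delbar j (T c) z = 0" for j
  proof -
    have "delbar j (T c) z = delbar j (\<lambda>_. k) z" by (rule del_cong(2)[OF chart_props(2)[OF c] z T])
    then show ?thesis by (simp add: delbar_const)
  qed
  then show "contr1 g (outer F T) c z = 0" "contr2 g \<alpha> (outer F T) c z = 0"
    by (simp_all add: contr1_def contr2_def outer_def)
qed

lemma scalar_at_cong:
  assumes "\<And>c z. c \<in> A \<Longrightarrow> z \<in> R c \<Longrightarrow> F c z = H c z" shows "scalar_at A F = scalar_at A H"
  unfolding scalar_at_def using assms chart_at_props by (auto simp: fun_eq_iff)

text \<open>Green's formula, as the case \<alpha> = g of the divergence theorem.\<close>

lemma integral_laplacian: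
  assumes f: "smooth_function A f" and \<eta>: "C1_fun \<eta>"
  shows "(\<integral>p. of_real (\<eta> p) * scalar_at A (laplacian g f) p \<partial>vol g) =
     - (\<integral>p. scalar_at A (contr1 g (outer (local_rep f) (local_rep \<eta>))) p \<partial>vol g)"
proof -
  have "scalar_at A (div_op g f) = scalar_at A (laplacian g f)"
    by (rule scalar_at_cong) (simp add: div_op_def contr2_g contr1_outer_const(1)[where T="contr1 g g", OF _ _ contr1_g] laplacian_contr1)
  moreover have "scalar_at A (contr2 g g (outer (local_rep f) (local_rep \<eta>))) = scalar_at A (contr1 g (outer (local_rep f) (local_rep \<eta>)))"
    by (rule scalar_at_cong) (simp add: contr2_g)
  ultimately show ?thesis using div_global[OF closed_tensor_g f \<eta>] by simp
qed

lemma integral_div_op: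
  assumes "closed_tensor \<alpha>" "smooth_function A f"
  shows "(\<integral>p. scalar_at A (div_op \<alpha> f) p \<partial>vol g) = 0"
proof -
  have "scalar_at A (contr2 g \<alpha> (outer (local_rep f) (local_rep (\<lambda>_. 1)))) = scalar_at A (\<lambda>_ _. 0)"
    by (rule scalar_at_cong) (rule contr1_outer_const(2)[where k=1], auto simp: local_rep_def)
  then show ?thesis using div_global[OF assms C1_const[of 1]] by (simp add: scalar_at_def)
qed

lemma integral_laplacian_0:
  assumes "smooth_function A f" shows "(\<integral>p. scalar_at A (laplacian g f) p \<partial>vol g) = 0"
proof -
  have "scalar_at A (div_op g f) = scalar_at A (laplacian g f)"
    by (rule scalar_at_cong) (simp add: div_op_def contr2_g contr1_outer_const(1)[where T="contr1 g g", OF _ _ contr1_g] laplacian_contr1)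
  then show ?thesis using integral_div_op[OF closed_tensor_g assms] by simp
qed

lemma ricci_hermitian:
  assumes c: "c \<in> A" and z: "z \<in> R c" shows "cnj (ricci g c z $ i $ j) = ricci g c z $ j $ i"
  using ddbar_hermitian[OF chart_props(2)[OF c] smooth_log_det[OF c] _ z] by (simp add: ricci_def)

lemma scalar_curvature_chart:
  assumes c: "c \<in> A" and z: "z \<in> R c"
  shows "contr1 g (ricci g) c z = of_real (scalar_curvature A g (chart_inv c z))"
proof -
  have "scalar_curvature A g p = Re (scalar_at A (contr1 g (ricci g)) p)" for p
    unfolding scalar_curvature_def contr1_def ..
  moreover have "Im (contr1 g (ricci g) c z) = 0"
    unfolding contr1_def by (rule contraction_real[OF herm_g[OF c z] ricci_hermitian[OF c z]])
  ultimately show ?thesis using scalar_at_inv[OF scalar_contr1[OF met tensor_ricci[OF met]] c z] by (simp add: complex_eq_iff)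
qed

lemma laplacian_function:
  assumes f: "smooth_function A f"
  obtains v where "smooth_function A v" "\<And>c z. c \<in> A \<Longrightarrow> z \<in> R c \<Longrightarrow> local_rep v c z = laplacian g f c z"
proof (rule global_function)
  show "scalar_field (laplacian g f)" unfolding laplacian_contr1 by (intro scalar_contr1 met tensor_ddbar f)
  show "smooth_on (R c) (laplacian g f c)" if "c \<in> A" for c
    unfolding laplacian_contr1 by (intro smooth_contr1[where c=c] smooth_ddbar f that)
  show "Im (laplacian g f c z) = 0" if "c \<in> A" "z \<in> R c" for c z
    unfolding laplacian_def
    by (rule contraction_real[OF herm_g[OF that]])
      (use ddbar_hermitian[OF chart_props(2)[OF that(1)] smooth_local_rep[OF f that(1)] _ that(2)] in \<open>simp add: ddbar_def local_rep_def[abs_def]\<close>)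
qed (rule that, assumption, simp)

lemma gradient_function:
  assumes f: "smooth_function A f"
  obtains v where "smooth_function A v" "\<And>c z. c \<in> A \<Longrightarrow> z \<in> R c \<Longrightarrow> local_rep v c z = contr1 g (outer (local_rep f) (local_rep f)) c z"
proof (rule global_function)
  have d: "local_rep f c differentiable (at z)" if "c \<in> A" "z \<in> R c" for c z
    by (rule smooth_on_differentiable[OF chart_props(2)[OF that(1)] smooth_local_rep[OF f that(1)] that(2)])
  show "scalar_field (contr1 g (outer (local_rep f) (local_rep f)))"
    by (intro scalar_contr1 met tensor_outer scalar_local_rep d)
  show "smooth_on (R c) (contr1 g (outer (local_rep f) (local_rep f)) c)" if "c \<in> A" for c
    by (intro smooth_contr1[where c=c] smooth_outer smooth_local_rep f that)
  show "Im (contr1 g (outer (local_rep f) (local_rep f)) c z) = 0" if cz: "c \<in> A" "z \<in> R c" for c z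
    unfolding contr1_def
  proof (rule contraction_real[OF herm_g[OF cz]])
    have "(\<lambda>z. cnj (local_rep f c z)) = local_rep f c" by (simp add: local_rep_def)
    then have "delbar i (local_rep f c) z = cnj (del i (local_rep f c) z)" for i
      using delbar_cnj(1)[OF d[OF cz], of i] by simp
    then show "cnj (outer (local_rep f) (local_rep f) c z $ i $ j) = outer (local_rep f) (local_rep f) c z $ j $ i" for i j
      by (simp add: outer_def)
  qed
qed (rule that, assumption, simp)

text \<open>The coordinate Bochner inequality with each term replaced by a globally meaningful one;
  \<open>v\<close> and \<gamma> are functions on the manifold representing the Laplacian and the
  squared gradient of \<psi>.\<close>

lemma bochner_chart:
  assumes \<psi>: "smooth_function A \<psi>" and c: "c \<in> A" and z: "z \<in> R c"
    and v: "\<And>z. z \<in> R c \<Longrightarrow> local_rep v c z = laplacian g \<psi> c z"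
    and \<gamma>: "\<And>z. z \<in> R c \<Longrightarrow> local_rep \<gamma> c z = contr1 g (outer (local_rep \<psi>) (local_rep \<psi>)) c z"
  shows "0 \<le> Re (laplacian g \<gamma> c z - div_op (ddbar \<psi>) \<psi> c z - contr1 g (outer (local_rep v) (local_rep \<psi>)) c z
     - contr2 g (ricci g) (outer (local_rep \<psi>) (local_rep \<psi>)) c z)"
proof -
  interpret K: kahler_field "R c" "g c" wp wq by (rule field[OF c])
  let ?f = "local_rep \<psi> c"
  note W = chart_props(2)[OF c] and sf = smooth_local_rep[OF \<psi> c]
  interpret P: kahler_potential "R c" "g c" wp wq ?f
    by unfold_locales (rule sf, simp add: local_rep_def)
  have PQ: "K.P i (K.Q j F) w = del i (delbar j F) w" "K.P i F w = del i F w" "K.Q i F w = delbar i F w" if "smooth_on (R c) F" "w \<in> R c" for i j F w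
    using ddbar_eq_cd[OF W that] del_smooth[OF W that] by simp_all
  have Lap: "K.Lap F w = (\<Sum>i\<in>UNIV. \<Sum>j\<in>UNIV. upper_metric (g c w) $ i $ j * del i (delbar j F) w)" if "smooth_on (R c) F" "w \<in> R c" for F w
    unfolding K.Lap_def by (simp add: PQ[OF that])
  have Lf: "K.Lap ?f w = laplacian g \<psi> c w" if "w \<in> R c" for w
    using Lap[OF sf that] by (simp add: laplacian_def ddbar_def)
  have sLf: "smooth_on (R c) (K.Lap ?f)" by (rule K.smooth_Lap[OF sf])
  have Gam: "P.Gam w = local_rep \<gamma> c w" if "w \<in> R c" for w
    unfolding \<gamma>[OF that] P.Gam_def contr1_def outer_def by (simp add: PQ[OF sf that] mult.assoc)
  have 1: "K.Lap P.Gam z = laplacian g \<gamma> c z"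
    using Lap[OF P.smooth_Gam z] ddbar_cong[OF W z Gam] by (simp add: laplacian_def ddbar_def)
  have QP: "K.Q l (K.P j ?f) z = del j (delbar l ?f) z" for j l
    using cd_commute[OF K.good sf z] PQ(1)[OF sf z] by simp
  have dL: "K.Q m (K.Lap ?f) z = delbar m (contr1 g (ddbar \<psi>) c) z" "K.P m (K.Lap ?f) z = del m (local_rep v c) z" for m
    using PQ(2,3)[OF sLf z] del_cong[OF W z, of "K.Lap ?f" "laplacian g \<psi> c"] del_cong[OF W z, of "local_rep v c" "laplacian g \<psi> c"] Lf v
    by (simp_all add: laplacian_contr1)
  have 2: "(\<Sum>i\<in>UNIV. \<Sum>l\<in>UNIV. \<Sum>j\<in>UNIV. \<Sum>m\<in>UNIV. upper_metric (g c z) $ i $ l * upper_metric (g c z) $ j $ m * K.P i (K.Q m ?f) z * K.Q l (K.P j ?f) z)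
       + (\<Sum>j\<in>UNIV. \<Sum>m\<in>UNIV. upper_metric (g c z) $ j $ m * K.P j ?f z * K.Q m (K.Lap ?f) z) = div_op (ddbar \<psi>) \<psi> c z"
    unfolding div_op_def contr2_def contr1_def[of g "outer _ _"] outer_def QP dL by (simp add: PQ[OF sf z] ddbar_def mult.assoc)
  have 3: "(\<Sum>k\<in>UNIV. \<Sum>m\<in>UNIV. upper_metric (g c z) $ k $ m * K.P k (K.Lap ?f) z * K.Q m ?f z) = contr1 g (outer (local_rep v) (local_rep \<psi>)) c z"
    unfolding contr1_def outer_def dL by (simp add: PQ[OF sf z] mult.assoc)
  have ric: "K.Ric i m z = ricci g c z $ i $ m" for i m
    unfolding K.Ric_def ricci_def using PQ(1)[OF smooth_log_det[OF c] z] by simp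
  have 4: "(\<Sum>i\<in>UNIV. \<Sum>l\<in>UNIV. \<Sum>j\<in>UNIV. \<Sum>m\<in>UNIV. upper_metric (g c z) $ i $ l * upper_metric (g c z) $ j $ m * K.Ric i m z * K.P j ?f z * K.Q l ?f z)
     = contr2 g (ricci g) (outer (local_rep \<psi>) (local_rep \<psi>)) c z"
    unfolding contr2_def outer_def ric by (simp add: PQ[OF sf z] mult.assoc)
  show ?thesis using P.bochner[OF z] unfolding 1 2 3 4 .
qed

text \<open>At constant scalar curvature the variation is minus a sum of two divergences, which
  gives the second claim. For the first, the Bochner inequality is integrated: the Laplacian of the
  squared gradient and the divergence of the Hessian term contribute nothing, and the other two
  terms return by parts to the variation paired with \<psi>.\<close>

theorem scal_variation_integrals:
  assumes S: "constant_scalar_curvature A g" and \<psi>: "smooth_function A \<psi>"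
  shows "(\<integral>p. \<psi> p * Re (scalar_at A (scal_variation g \<psi>) p) \<partial>vol g) \<le> 0"
    "(\<integral>p. Re (scalar_at A (scal_variation g \<psi>) p) \<partial>vol g) = 0"
proof -
  obtain v where v: "smooth_function A v" "\<And>c z. c \<in> A \<Longrightarrow> z \<in> R c \<Longrightarrow> local_rep v c z = laplacian g \<psi> c z"
    using laplacian_function[OF \<psi>] by blast
  obtain \<gamma> where \<gamma>: "smooth_function A \<gamma>" "\<And>c z. c \<in> A \<Longrightarrow> z \<in> R c \<Longrightarrow> local_rep \<gamma> c z = contr1 g (outer (local_rep \<psi>) (local_rep \<psi>)) c z"
    using gradient_function[OF \<psi>] by blast
  obtain k where k: "\<And>p. scalar_curvature A g p = k" using S unfolding constant_scalar_curvature_def by blast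
  let ?E = "contr1 g (outer (local_rep v) (local_rep \<psi>))" and ?C = "contr2 g (ricci g) (outer (local_rep \<psi>) (local_rep \<psi>))"
  have ctg: "c \<in> A \<Longrightarrow> z \<in> R c \<Longrightarrow> contr1 g (ricci g) c z = of_real k" for c z
    using scalar_curvature_chart k by simp
  have var: "scalar_at A (scal_variation g \<psi>) = (\<lambda>p. - (scalar_at A (laplacian g v) p + scalar_at A (div_op (ricci g) \<psi>) p))"
  proof -
    have "scalar_at A (scal_variation g \<psi>) = scalar_at A (\<lambda>c z. - (laplacian g v c z + div_op (ricci g) \<psi> c z))"
    proof (rule scalar_at_cong)
      fix c z assume c: "c \<in> A" and z: "z \<in> R c"
      have "del i (delbar j (laplacian g \<psi> c)) z = ddbar v c z $ i $ j" for i j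
        using ddbar_cong[OF chart_props(2)[OF c] z, of "local_rep v c" "laplacian g \<psi> c"] v(2)[OF c] by (simp add: ddbar_def)
      \<comment> \<open>Constant scalar curvature enters here: the trace of the Ricci form has no
        gradient, so \<open>div_op\<close> for the Ricci form is its contraction with the Hessian
        alone.\<close>
      moreover have "contr1 g (outer (local_rep \<psi>) (contr1 g (ricci g))) c z = 0"
        by (rule contr1_outer_const(1)[OF c z]) (erule ctg[OF c])
      ultimately show "scal_variation g \<psi> c z = - (laplacian g v c z + div_op (ricci g) \<psi> c z)"
        unfolding scal_variation_def div_op_def by (simp add: laplacian_def)
    qed
    then show ?thesis by (simp add: scalar_at_def fun_eq_iff)
  qed
  have sL: "scalar_field (laplacian g f)" "c \<in> A \<Longrightarrow> smooth_on (R c) (laplacian g f c)" if "smooth_function A f" for f c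
    unfolding laplacian_contr1 by (intro scalar_contr1 met tensor_ddbar that) (intro smooth_contr1[where c=c] smooth_ddbar that)
  have cL: "continuous_on UNIV (scalar_at A (laplacian g f))" if "smooth_function A f" for f
    by (intro continuous_scalar_at sL that smooth_on_continuous)
  have cD: "continuous_on UNIV (scalar_at A (div_op \<alpha> \<psi>))" if "closed_tensor \<alpha>" for \<alpha>
    by (intro continuous_scalar_at scalar_div_op[OF that \<psi>] smooth_on_continuous)
  have d: "local_rep f c differentiable (at z)" if "smooth_function A f" "c \<in> A" "z \<in> R c" for f c z
    by (rule smooth_on_differentiable[OF chart_props(2)[OF that(2)] smooth_local_rep[OF that(1,2)] that(3)])
  have fE: "scalar_field ?E" by (intro scalar_contr1 met tensor_outer scalar_local_rep d v(1) \<psi>)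
  have sE: "smooth_on (R c) (?E c)" if "c \<in> A" for c
    by (intro smooth_contr1[where c=c] smooth_outer smooth_local_rep v(1) \<psi> that)
  have fC: "scalar_field ?C" by (intro scalar_contr2 met tensor_outer tensor_ricci scalar_local_rep d \<psi>)
  have sC: "smooth_on (R c) (?C c)" if "c \<in> A" for c
    by (intro smooth_contr2[where c=c] smooth_outer smooth_ricci smooth_local_rep \<psi> that)
  have cE: "continuous_on UNIV (scalar_at A ?E)" by (intro continuous_scalar_at fE smooth_on_continuous sE)
  have cC: "continuous_on UNIV (scalar_at A ?C)" by (intro continuous_scalar_at fC smooth_on_continuous sC)
  have c\<psi>: "continuous_on UNIV \<psi>" by (rule continuous_C1[OF smooth_C1[OF \<psi>]])
  note ct = closed_tensor_ricci closed_tensor_ddbar[OF \<psi>]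
  note int = integrable_vol[OF met]
  have "(\<integral>p. Re (scalar_at A (scal_variation g \<psi>) p) \<partial>vol g) = Re (\<integral>p. scalar_at A (scal_variation g \<psi>) p \<partial>vol g)"
    unfolding var by (intro integral_Re int continuous_intros cL v cD ct)
  also have "(\<integral>p. scalar_at A (scal_variation g \<psi>) p \<partial>vol g) = 0"
    unfolding var using int[OF cL[OF v(1)]] int[OF cD[OF ct(1)]]
    by (simp add: integral_laplacian_0[OF v(1)] integral_div_op[OF ct(1) \<psi>])
  finally show "(\<integral>p. Re (scalar_at A (scal_variation g \<psi>) p) \<partial>vol g) = 0" by simp
  \<comment> \<open>The pointwise Bochner inequality, evaluated in the chart that
    \<open>scalar_at\<close> selects at each point.\<close>
  have "0 \<le> (\<integral>p. Re (scalar_at A (laplacian g \<gamma>) p - scalar_at A (div_op (ddbar \<psi>) \<psi>) p - scalar_at A ?E p - scalar_at A ?C p) \<partial>vol g)"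
  proof (rule Bochner_Integration.integral_nonneg)
    fix p
    show "0 \<le> Re (scalar_at A (laplacian g \<gamma>) p - scalar_at A (div_op (ddbar \<psi>) \<psi>) p - scalar_at A ?E p - scalar_at A ?C p)"
      unfolding scalar_at_def
      by (rule bochner_chart[OF \<psi>]) (use chart_at_props[of p] v \<gamma> in auto)
  qed
  also have "\<dots> = Re (\<integral>p. scalar_at A (laplacian g \<gamma>) p - scalar_at A (div_op (ddbar \<psi>) \<psi>) p - scalar_at A ?E p - scalar_at A ?C p \<partial>vol g)"
    by (intro integral_Re int continuous_intros cL \<gamma> cD ct cE cC)
  also have "(\<integral>p. scalar_at A (laplacian g \<gamma>) p - scalar_at A (div_op (ddbar \<psi>) \<psi>) p - scalar_at A ?E p - scalar_at A ?C p \<partial>vol g)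
     = - (\<integral>p. scalar_at A ?E p \<partial>vol g) + - (\<integral>p. scalar_at A ?C p \<partial>vol g)"
    using int[OF cL[OF \<gamma>(1)]] int[OF cD[OF ct(2)]] int[OF cE] int[OF cC]
    by (simp add: integral_laplacian_0[OF \<gamma>(1)] integral_div_op[OF ct(2) \<psi>])
  \<comment> \<open>The surviving terms are integrated by parts with \<psi> itself as test function:
    Green's formula for \<open>v\<close>, and the divergence theorem for the Ricci form in the next
    step.\<close>
  also have "- (\<integral>p. scalar_at A ?E p \<partial>vol g) = (\<integral>p. of_real (\<psi> p) * scalar_at A (laplacian g v) p \<partial>vol g)"
    by (rule integral_laplacian[OF v(1) smooth_C1[OF \<psi>], symmetric])
  also have "- (\<integral>p. scalar_at A ?C p \<partial>vol g) = (\<integral>p. of_real (\<psi> p) * scalar_at A (div_op (ricci g) \<psi>) p \<partial>vol g)"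
    by (rule div_global[OF ct(1) \<psi> smooth_C1[OF \<psi>], symmetric])
  also have "(\<integral>p. of_real (\<psi> p) * scalar_at A (laplacian g v) p \<partial>vol g) + (\<integral>p. of_real (\<psi> p) * scalar_at A (div_op (ricci g) \<psi>) p \<partial>vol g)
     = (\<integral>p. of_real (\<psi> p) * scalar_at A (laplacian g v) p + of_real (\<psi> p) * scalar_at A (div_op (ricci g) \<psi>) p \<partial>vol g)"
    by (intro Bochner_Integration.integral_add[symmetric] int continuous_intros c\<psi> cL cD ct v)
  also have "Re \<dots> = (\<integral>p. Re (of_real (\<psi> p) * scalar_at A (laplacian g v) p + of_real (\<psi> p) * scalar_at A (div_op (ricci g) \<psi>) p) \<partial>vol g)"
    by (intro integral_Re[symmetric] int continuous_intros c\<psi> cL cD ct v)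
  also have "\<dots> = - (\<integral>p. \<psi> p * Re (scalar_at A (scal_variation g \<psi>) p) \<partial>vol g)"
    unfolding var by (simp add: algebra_simps flip: Bochner_Integration.integral_minus)
  finally show "(\<integral>p. \<psi> p * Re (scalar_at A (scal_variation g \<psi>) p) \<partial>vol g) \<le> 0" by simp
qed

end

section \<open>Curves of Kaehler potentials\<close>

lemma linear_axis: "bounded_linear (axis i :: 'b::euclidean_space \<Rightarrow> 'b^'n::finite)"
  unfolding linear_conv_bounded_linear[symmetric]
  by (rule linearI) (simp_all add: vec_eq_iff axis_def)

lemma smooth_on_vec:
  fixes f :: "'n::finite \<Rightarrow> 'e::euclidean_space \<Rightarrow> 'b::euclidean_space"
  assumes "\<And>i. smooth_on S (f i)" shows "smooth_on S (\<lambda>x. \<chi> i. f i x)"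
proof (rule smooth_on_cong)
  show "smooth_on S (\<lambda>x. \<Sum>i\<in>UNIV. axis i (f i x))"
    by (intro smooth_on_sum smooth_on_linear[OF linear_axis] assms)
  show "(\<Sum>i\<in>UNIV. axis i (f i x)) = (\<chi> i. f i x)" for x by (simp add: vec_eq_iff axis_def)
qed

text \<open>Lifts the time-independent background form to the product with the time
  interval.\<close>

lemma Ck_on_snd:
  fixes f :: "'e::euclidean_space \<Rightarrow> 'b::real_normed_vector"
  shows "Ck_on k W f \<Longrightarrow> Ck_on k (({0..1::real}) \<times> W) (\<lambda>x. f (snd x))"
proof (induction k arbitrary: f)
  case 0
  then show ?case by (auto intro!: continuous_on_compose2[of W f] continuous_intros)
next
  case (Suc k)
  obtain f' where f': "\<And>x. x \<in> W \<Longrightarrow> (f has_derivative f' x) (at x within W)" "\<And>v. Ck_on k W (\<lambda>x. f' x v)"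
    using Ck_on_SucE[OF Suc.prems] by metis
  show ?case
  proof (rule Ck_on_SucI[where f'="\<lambda>x v. f' (snd x) (snd v)"])
    fix x assume x: "x \<in> {0..1::real} \<times> W"
    have "snd ` ({0..1::real} \<times> W) \<subseteq> W" by auto
    then show "((\<lambda>x. f (snd x)) has_derivative (\<lambda>v. f' (snd x) (snd v))) (at x within {0..1} \<times> W)"
      using x by (intro has_derivative_in_compose[OF _ has_derivative_subset[OF f'(1)]] has_derivative_snd has_derivative_ident) auto
  qed (use Suc.IH[OF f'(2)] in simp)
qed

lemma smooth_on_snd:
  fixes f :: "'e::euclidean_space \<Rightarrow> 'b::real_normed_vector"
  shows "smooth_on W f \<Longrightarrow> smooth_on ({0..1::real} \<times> W) (\<lambda>x. f (snd x))"
  unfolding smooth_on_def using Ck_on_snd by blast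

section \<open>Functions of time and space\<close>

lemma slice_derivative:
  fixes H :: "real \<times> 'e::euclidean_space \<Rightarrow> 'b::real_normed_vector"
  assumes H: "(H has_derivative D) (at (t, z) within {0..1} \<times> W)" and t: "t \<in> {0..1}"
  shows "((\<lambda>z. H (t, z)) has_derivative (\<lambda>v. D (0, v))) (at z within W)"
proof (rule has_derivative_in_compose[where f="\<lambda>z. (t, z)"])
  show "((\<lambda>z. (t, z)) has_derivative (\<lambda>v. (0, v))) (at z within W)" by (auto intro!: derivative_eq_intros)
  show "(H has_derivative D) (at (t, z) within (\<lambda>z. (t, z)) ` W)"
    by (rule has_derivative_subset[OF H]) (use t in auto)
qed

lemma Ck_on_slice:
  fixes H :: "real \<times> 'e::euclidean_space \<Rightarrow> 'b::real_normed_vector"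
  assumes t: "t \<in> {0..1}"
  shows "Ck_on k ({0..1} \<times> W) H \<Longrightarrow> Ck_on k W (\<lambda>z. H (t, z))"
proof (induction k arbitrary: H)
  case 0
  then show ?case using t by (auto intro!: continuous_on_compose2[of "{0..1} \<times> W" H] continuous_intros)
next
  case (Suc k)
  obtain f' where f': "\<And>x. x \<in> {0..1} \<times> W \<Longrightarrow> (H has_derivative f' x) (at x within {0..1} \<times> W)" "\<And>v. Ck_on k ({0..1} \<times> W) (\<lambda>x. f' x v)"
    using Ck_on_SucE[OF Suc.prems] by metis
  show ?case
  proof (rule Ck_on_SucI[where f'="\<lambda>z v. f' (t, z) (0, v)"])
    show "((\<lambda>z. H (t, z)) has_derivative (\<lambda>v. f' (t, z) (0, v))) (at z within W)" if "z \<in> W" for z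
      by (rule slice_derivative[OF f'(1) t]) (use that t in auto)
  qed (use Suc.IH[OF f'(2)] in simp)
qed

lemma smooth_on_slice:
  fixes H :: "real \<times> 'e::euclidean_space \<Rightarrow> 'b::real_normed_vector"
  shows "smooth_on ({0..1} \<times> W) H \<Longrightarrow> t \<in> {0..1} \<Longrightarrow> smooth_on W (\<lambda>z. H (t, z))"
  unfolding smooth_on_def using Ck_on_slice by blast

lemma dd_slice:
  fixes H :: "real \<times> 'e::euclidean_space \<Rightarrow> 'b::real_normed_vector"
  assumes W: "open W" and H: "smooth_on ({0..1} \<times> W) H" and t: "t \<in> {0..1}" and z: "z \<in> W"
  shows "dd W v (\<lambda>z. H (t, z)) z = dd ({0..1} \<times> W) (0, v) H (t, z)"
  by (rule dd_eqI[OF good_domain_open[OF W] z slice_derivative[OF smooth_onD(1)[OF good_domain_time[OF W] H] t]]) (use t z in auto)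

lemma cd_slice:
  fixes H :: "real \<times> 'e::euclidean_space \<Rightarrow> complex"
  assumes "open W" "smooth_on ({0..1} \<times> W) H" "t \<in> {0..1}" "z \<in> W"
  shows "cd ({0..1} \<times> W) ((0, a), (0, b)) H (t, z) = cd W (a, b) (\<lambda>z. H (t, z)) z"
  unfolding cd_def using dd_slice[OF assms] by simp

lemma time_derivative:
  fixes H :: "real \<times> 'e::euclidean_space \<Rightarrow> 'b::real_normed_vector"
  assumes W: "open W" and H: "smooth_on ({0..1} \<times> W) H" and t: "t \<in> {0..1}" and z: "z \<in> W"
  shows "((\<lambda>s. H (s, z)) has_vector_derivative dd ({0..1} \<times> W) (1, 0) H (t, z)) (at t within {0..1})"
proof -
  note D = smooth_onD(1)[OF good_domain_time[OF W] H, of "(t, z)"]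
  have "((\<lambda>s. H (s, z)) has_derivative (\<lambda>h. dd ({0..1} \<times> W) (h, 0) H (t, z))) (at t within {0..1})"
  proof (rule has_derivative_in_compose[where f="\<lambda>s. (s, z)"])
    show "((\<lambda>s. (s, z)) has_derivative (\<lambda>h. (h, 0))) (at t within {0..1})" by (auto intro!: derivative_eq_intros)
    show "(H has_derivative (\<lambda>v. dd ({0..1} \<times> W) v H (t, z))) (at (t, z) within (\<lambda>s. (s, z)) ` {0..1})"
      by (rule has_derivative_subset[OF D]) (use t z in auto)
  qed
  moreover have "(\<lambda>h. dd ({0..1} \<times> W) (h, 0) H (t, z)) = (\<lambda>h. h *\<^sub>R dd ({0..1} \<times> W) (1, 0) H (t, z))"
  proof
    show "dd ({0..1} \<times> W) (h, 0) H (t, z) = h *\<^sub>R dd ({0..1} \<times> W) (1, 0) H (t, z)" for h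
      using linear_scale[OF has_derivative_linear[OF D], of h "(1, 0)"] t z by simp
  qed
  ultimately show ?thesis unfolding has_vector_derivative_def by (simp only:)
qed

text \<open>Extended by zero, the integrand is jointly continuous because \<open>W\<close> and the
  complement of \<open>K\<close> cover the space. All integrals can then be taken over one box,
  where differentiation under the integral sign is available, one-sidedly at the ends of the time
  interval.\<close>

lemma leibniz_compact_support:
  fixes f f' :: "real \<Rightarrow> 'e::euclidean_space \<Rightarrow> real"
  assumes W: "open W" and K: "compact K" "K \<subseteq> W"
    and cf: "continuous_on ({0..1} \<times> W) (\<lambda>(t, z). f t z)" and cf': "continuous_on ({0..1} \<times> W) (\<lambda>(t, z). f' t z)"
    and f0: "\<And>t z. z \<in> W \<Longrightarrow> z \<notin> K \<Longrightarrow> f t z = 0" and f0': "\<And>t z. z \<in> W \<Longrightarrow> z \<notin> K \<Longrightarrow> f' t z = 0"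
    and der: "\<And>t z. t \<in> {0..1} \<Longrightarrow> z \<in> W \<Longrightarrow> ((\<lambda>s. f s z) has_real_derivative f' t z) (at t within {0..1})"
    and t0: "t0 \<in> {0..1}"
  shows "((\<lambda>t. \<integral>z. indicator W z * f t z \<partial>lborel) has_real_derivative (\<integral>z. indicator W z * f' t0 z \<partial>lborel)) (at t0 within {0..1})"
proof -
  obtain a where a: "K \<subseteq> cbox (- a) a" using compact_imp_bounded[OF K(1)] bounded_subset_cbox_symmetric by metis
  define F where "F t z = indicator W z * f t z" for t z
  define F' where "F' t z = indicator W z * f' t z" for t z
  have oK: "open (- K)" using K(1) compact_imp_closed by blast
  have cont: "continuous_on ({0..1::real} \<times> (UNIV :: 'e set)) (\<lambda>(t, z). indicator W z * k t z)"
    if k: "continuous_on ({0..1} \<times> W) (\<lambda>(t, z). k t z)" and k0: "\<And>t z. z \<in> W \<Longrightarrow> z \<notin> K \<Longrightarrow> k t z = 0" for k :: "real \<Rightarrow> 'e \<Rightarrow> real"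
  proof -
    have un: "{0..1::real} \<times> (UNIV :: 'e set) = ({0..1} \<times> W) \<union> ({0..1} \<times> (- K))" using K(2) by auto
    show ?thesis
      unfolding un
    proof (rule continuous_on_Un_local_open)
      show "openin (top_of_set ({0..1} \<times> W \<union> {0..1} \<times> - K)) ({0..1::real} \<times> W)"
        unfolding un[symmetric] by (intro openin_Times) (use W in \<open>auto simp: openin_open_eq\<close>)
      show "openin (top_of_set ({0..1} \<times> W \<union> {0..1} \<times> - K)) ({0..1::real} \<times> (- K))"
        unfolding un[symmetric] by (intro openin_Times) (use oK in \<open>auto simp: openin_open_eq\<close>)
      show "continuous_on ({0..1} \<times> W) (\<lambda>(t, z). indicator W z * k t z)"
        by (rule continuous_on_eq[OF k]) auto
      show "continuous_on ({0..1} \<times> - K) (\<lambda>(t, z). indicator W z * k t z)"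
        by (rule continuous_on_eq[OF continuous_on_const[of _ 0]]) (auto simp: indicator_def k0)
    qed
  qed
  have cF: "continuous_on ({0..1} \<times> UNIV) (\<lambda>(t, z). F t z)" and cF': "continuous_on ({0..1} \<times> UNIV) (\<lambda>(t, z). F' t z)"
    unfolding F_def F'_def by (rule cont[OF cf f0], assumption+, rule cont[OF cf' f0'], assumption+)
  have slice: "continuous_on UNIV (k t)" if "continuous_on ({0..1} \<times> UNIV) (\<lambda>(t, z). k t z)" "t \<in> {0..1}" for k :: "real \<Rightarrow> 'e \<Rightarrow> real" and t
  proof -
    have "continuous_on UNIV (\<lambda>z. (\<lambda>(t, z). k t z) (t, z))"
      by (rule continuous_on_compose2[OF that(1)]) (use that(2) in \<open>auto intro!: continuous_intros\<close>)
    then show ?thesis by simp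
  qed
  have F0: "F t z = 0" "F' t z = 0" if "z \<notin> cbox (- a) a" for t z
  proof -
    have "z \<notin> K" using that a by blast
    then show "F t z = 0" "F' t z = 0" using f0[of z t] f0'[of z t] by (auto simp: F_def F'_def indicator_def)
  qed
  have "((\<lambda>t. integral (cbox (- a) a) (F t)) has_vector_derivative integral (cbox (- a) a) (F' t0)) (at t0 within {0..1})"
  proof (rule leibniz_rule_vector_derivative)
    show "((\<lambda>s. F s z) has_vector_derivative F' t z) (at t within {0..1})" if "t \<in> {0..1}" for t z
    proof (cases "z \<in> W")
      case True
      then show ?thesis using der[OF that True] by (simp add: F_def F'_def has_real_derivative_iff_has_vector_derivative)
    qed (simp add: F_def F'_def)
    show "F t integrable_on cbox (- a) a" if "t \<in> {0..1}" for t
      by (intro integrable_continuous continuous_on_subset[OF slice[OF cF that]]) auto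
    show "continuous_on ({0..1} \<times> cbox (- a) a) (\<lambda>(t, z). F' t z)" by (rule continuous_on_subset[OF cF']) auto
  qed (use t0 in auto)
  then have "((\<lambda>t. \<integral>z. F t z \<partial>lborel) has_vector_derivative (\<integral>z. F' t0 z \<partial>lborel)) (at t0 within {0..1})"
  proof (rule has_vector_derivative_transform[OF t0, rotated, OF has_vector_derivative_eq_rhs])
    show "integral (cbox (- a) a) (F' t0) = (\<integral>z. F' t0 z \<partial>lborel)" by (rule lborel_integral_cbox[OF slice[OF cF' t0] F0(2)])
    show "(\<integral>z. F t z \<partial>lborel) = integral (cbox (- a) a) (F t)" if "t \<in> {0..1}" for t
      by (rule lborel_integral_cbox[OF slice[OF cF that] F0(1), symmetric])
  qed
  then show ?thesis unfolding has_real_derivative_iff_has_vector_derivative F_def F'_def .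
qed

context complex_manifold
begin

lemma smooth_curve_chart:
  assumes u: "smooth_curve A u" and c: "c \<in> A"
  shows "smooth_on ({0..1} \<times> R c) (\<lambda>x. u (fst x) (chart_inv c (snd x)))"
  using assms unfolding smooth_curve_def by (simp add: case_prod_unfold)

lemma smooth_curve_derivative:
  assumes u: "smooth_curve A u" and c: "c \<in> A" and t: "t \<in> {0..1}" and z: "z \<in> R c"
  shows "((\<lambda>s. u s (chart_inv c z)) has_real_derivative time_deriv u t (chart_inv c z)) (at t within {0..1})"
    "time_deriv u t (chart_inv c z) = dd ({0..1} \<times> R c) (1, 0) (\<lambda>x. u (fst x) (chart_inv c (snd x))) (t, z)"
proof -
  have v: "((\<lambda>s. u s (chart_inv c z)) has_vector_derivative dd ({0..1} \<times> R c) (1, 0) (\<lambda>x. u (fst x) (chart_inv c (snd x))) (t, z)) (at t within {0..1})"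
    using time_derivative[OF chart_props(2)[OF c] smooth_curve_chart[OF u c] t z] by simp
  then show eq: "time_deriv u t (chart_inv c z) = dd ({0..1} \<times> R c) (1, 0) (\<lambda>x. u (fst x) (chart_inv c (snd x))) (t, z)"
    unfolding time_deriv_def cbox_interval[symmetric] using t
    by (intro vector_derivative_within_cbox) auto
  show "((\<lambda>s. u s (chart_inv c z)) has_real_derivative time_deriv u t (chart_inv c z)) (at t within {0..1})"
    using v unfolding eq has_real_derivative_iff_has_vector_derivative .
qed

lemma smooth_curve_derivative_at:
  assumes u: "smooth_curve A u" and t: "t \<in> {0..1}"
  shows "((\<lambda>s. u s p) has_real_derivative time_deriv u t p) (at t within {0..1})"
  using smooth_curve_derivative(1)[OF u chart_at_props(1)[of p] t, of "snd (chart_at A p) p"] chart_at_props[of p] by simp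

lemma smooth_curve_time_deriv:
  assumes u: "smooth_curve A u" shows "smooth_curve A (time_deriv u)"
  unfolding smooth_curve_def case_prod_unfold
proof
  fix c assume c: "c \<in> A"
  show "smooth_on ({0..1} \<times> R c) (\<lambda>x. time_deriv u (fst x) (chart_inv c (snd x)))"
    by (rule smooth_on_cong[OF smooth_onD(2)[OF good_domain_time[OF chart_props(2)[OF c]] smooth_curve_chart[OF u c], of "(1, 0)"]])
       (use smooth_curve_derivative(2)[OF u c] in auto)
qed

lemma smooth_curve_slice: "smooth_curve A u \<Longrightarrow> t \<in> {0..1} \<Longrightarrow> smooth_function A (u t)"
  unfolding smooth_function_def using smooth_on_slice[OF smooth_curve_chart] by fastforce

lemma smooth_curve_mult: "smooth_curve A u \<Longrightarrow> smooth_curve A v \<Longrightarrow> smooth_curve A (\<lambda>t p. u t p * v t p)"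
  unfolding smooth_curve_def case_prod_unfold by (intro ballI smooth_on_mult) blast+

lemma kahler_form_kform:
  assumes \<omega>: "kahler_form A \<omega>" and u: "u \<in> kahler_potentials A \<omega>"
  shows "kahler_form A (kform \<omega> u)"
proof -
  have su: "smooth_function A u" and pos: "positive_form11 A (kform \<omega> u)" using u unfolding kahler_potentials_def by auto
  have rf: "real_form11 A \<omega>" and cf: "closed_form11 A \<omega>" using \<omega> unfolding kahler_form_def by auto
  have comp: "kform \<omega> u c z $ i $ j = \<omega> c z $ i $ j + del i (delbar j (local_rep u c)) z" for c z i j
    by (simp add: kform_def ddbar_def)
  have real: "real_form11 A (kform \<omega> u)"
    unfolding real_form11_def
  proof (intro conjI ballI allI)
    fix c assume c: "c \<in> A"
    note W = chart_props(2)[OF c] and s = smooth_local_rep[OF su c]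
    have "smooth_on (R c) (\<lambda>z. \<chi> i. \<chi> j. del i (delbar j (local_rep u c)) z)"
      by (intro smooth_on_vec smooth_del W s)
    then have "smooth_on (R c) (ddbar u c)" by (simp add: ddbar_def[abs_def])
    then show "smooth_on (R c) (kform \<omega> u c)"
      unfolding kform_def[abs_def] using rf c unfolding real_form11_def by (intro smooth_on_add) auto
    fix z i j assume z: "z \<in> R c"
    have "\<omega> c z $ j $ i = cnj (\<omega> c z $ i $ j)" using rf c z unfolding real_form11_def by blast
    moreover have "del j (delbar i (local_rep u c)) z = cnj (del i (delbar j (local_rep u c)) z)"
      by (rule ddbar_hermitian[OF W s _ z, symmetric]) (simp add: local_rep_def)
    ultimately show "kform \<omega> u c z $ j $ i = cnj (kform \<omega> u c z $ i $ j)" unfolding comp by simp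
  next
    fix c c' z i j assume c: "c \<in> A" "c' \<in> A" and z: "z \<in> snd c ` (fst c \<inter> fst c')"
    have "\<omega> c z $ i $ j = (\<Sum>k\<in>UNIV. \<Sum>l\<in>UNIV. del i (\<lambda>w. transition c c' w $ k) z * cnj (del j (\<lambda>w. transition c c' w $ l) z) * \<omega> c' (transition c c' z) $ k $ l)"
      using rf c z unfolding real_form11_def by blast
    moreover have "ddbar u c z $ i $ j = (\<Sum>k\<in>UNIV. \<Sum>l\<in>UNIV. del i (\<lambda>w. transition c c' w $ k) z * cnj (del j (\<lambda>w. transition c c' w $ l) z) * ddbar u c' (transition c c' z) $ k $ l)"
      using tensor_ddbar[OF su] c z unfolding tensor11_def overlap_def jac_def vec_lambda_beta by blast
    ultimately show "kform \<omega> u c z $ i $ j = (\<Sum>k\<in>UNIV. \<Sum>l\<in>UNIV. del i (\<lambda>w. transition c c' w $ k) z * cnj (del j (\<lambda>w. transition c c' w $ l) z) * kform \<omega> u c' (transition c c' z) $ k $ l)"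
      by (simp add: kform_def distrib_left sum.distrib)
  qed
  have "closed_form11 A (kform \<omega> u)"
    unfolding closed_form11_def
  proof (intro ballI allI)
    fix c z i j k assume c: "c \<in> A" and z: "z \<in> R c"
    note W = chart_props(2)[OF c] and s = smooth_local_rep[OF su c]
    let ?P = "\<lambda>i. cd (R c) (wp i, wq i)" and ?Q = "\<lambda>i. cd (R c) (wp i, - wq i)"
    have s\<omega>: "smooth_on (R c) (\<lambda>z. \<omega> c z $ i $ j)" for i j using rf c unfolding real_form11_def by (intro smooth_on_nth) blast
    have sdd: "smooth_on (R c) (\<lambda>z. del i (delbar j (local_rep u c)) z)" for i j by (intro smooth_del W s)
    have eq: "del k (\<lambda>w. kform \<omega> u c w $ i $ j) z = del k (\<lambda>w. \<omega> c w $ i $ j) z + ?P k (?P i (?Q j (local_rep u c))) z" for i k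
    proof -
      have "del k (\<lambda>w. kform \<omega> u c w $ i $ j) z = ?P k (\<lambda>w. \<omega> c w $ i $ j + del i (delbar j (local_rep u c)) w) z"
        unfolding comp by (rule del_smooth(1)[OF W smooth_on_add[OF s\<omega> sdd] z])
      also have "\<dots> = ?P k (\<lambda>w. \<omega> c w $ i $ j) z + ?P k (\<lambda>w. del i (delbar j (local_rep u c)) w) z"
        by (rule cd_add[OF good_domain_open[OF W] s\<omega> sdd z])
      also have "?P k (\<lambda>w. del i (delbar j (local_rep u c)) w) z = ?P k (?P i (?Q j (local_rep u c))) z"
        by (rule cd_cong[OF ddbar_eq_cd[OF W s] z])
      finally show ?thesis by (simp add: del_smooth(1)[OF W s\<omega> z])
    qed
    have "?P k (?P i (?Q j (local_rep u c))) z = ?P i (?P k (?Q j (local_rep u c))) z"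
      by (intro cd_commute good_domain_open W smooth_cd s z)
    moreover have "del k (\<lambda>w. \<omega> c w $ i $ j) z = del i (\<lambda>w. \<omega> c w $ k $ j) z" using cf c z unfolding closed_form11_def by blast
    ultimately show "del k (\<lambda>w. kform \<omega> u c w $ i $ j) z = del i (\<lambda>w. kform \<omega> u c w $ k $ j) z" unfolding eq by simp
  qed
  with real pos show ?thesis unfolding kahler_form_def by blast
qed

end

section \<open>Metric, volume density and curvature along a curve of potentials\<close>

locale kahler_curve = complex_manifold A for A :: "('a::{t2_space, second_countable_topology}, 'n::finite) chart set" +
  fixes \<omega> :: "('a, 'n) form11" and \<phi> :: "real \<Rightarrow> 'a \<Rightarrow> real"
  assumes \<omega>: "kahler_form A \<omega>" and curve: "smooth_curve_in_potentials A \<omega> \<phi>"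
begin

abbreviation "g \<equiv> \<lambda>t. kform \<omega> (\<phi> t)"
abbreviation "T c \<equiv> {0..1::real} \<times> R c"

lemma kahler_g: "t \<in> {0..1} \<Longrightarrow> kahler_form A (g t)"
  using curve kahler_form_kform[OF \<omega>] unfolding smooth_curve_in_potentials_def by blast

lemma km: "t \<in> {0..1} \<Longrightarrow> kahler_manifold A (g t)"
  by unfold_locales (rule kahler_g)

lemma metric_g: "t \<in> {0..1} \<Longrightarrow> metric11 (g t)"
  using kahler_metric11[OF kahler_g] .

lemma sc: "smooth_curve A \<phi>" using curve unfolding smooth_curve_in_potentials_def by blast

definition pot :: "('a, 'n) chart \<Rightarrow> real \<times> (complex^'n) \<Rightarrow> complex" where
  "pot c x = complex_of_real (\<phi> (fst x) (chart_inv c (snd x)))"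

text \<open>Space and time derivatives are \<open>cd\<close> operators on one common domain, so
  \<open>cd_commute\<close> exchanges them. \<open>DT\<close> is the real time direction, with
  imaginary part zero.\<close>

abbreviation "PT c i \<equiv> cd (T c) ((0, wp i), (0, wq i))"
abbreviation "QT c i \<equiv> cd (T c) ((0, wp i), (0, - wq i))"
abbreviation "DT c \<equiv> cd (T c) ((1, 0), 0)"

lemma smooth_pot: "c \<in> A \<Longrightarrow> smooth_on (T c) (pot c)"
  unfolding pot_def[abs_def] by (intro smooth_on_of_real smooth_curve_chart sc)

lemma good_T: "c \<in> A \<Longrightarrow> good_domain (T c)" by (rule good_domain_time[OF chart_props(2)])

lemma PQT_slice:
  assumes c: "c \<in> A" and F: "smooth_on (T c) F" and t: "t \<in> {0..1}" and z: "z \<in> R c"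
  shows "PT c i (QT c j F) (t, z) = del i (delbar j (\<lambda>z. F (t, z))) z"
proof -
  note W = chart_props(2)[OF c]
  have "PT c i (QT c j F) (t, z) = cd (R c) (wp i, wq i) (\<lambda>z. QT c j F (t, z)) z"
    by (rule cd_slice[OF W smooth_cd[OF good_T[OF c] F] t z])
  also have "\<dots> = cd (R c) (wp i, wq i) (cd (R c) (wp j, - wq j) (\<lambda>z. F (t, z))) z"
    by (rule cd_cong[OF cd_slice[OF W F t] z])
  also have "\<dots> = del i (delbar j (\<lambda>z. F (t, z))) z"
    by (rule ddbar_eq_cd[OF W smooth_on_slice[OF F t] z, symmetric])
  finally show ?thesis .
qed

definition GT :: "('a, 'n) chart \<Rightarrow> real \<times> (complex^'n) \<Rightarrow> complex^'n^'n" where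
  "GT c x = g (fst x) c (snd x)"

lemma GT_eq:
  assumes c: "c \<in> A" and x: "x \<in> T c"
  shows "GT c x $ i $ j = \<omega> c (snd x) $ i $ j + PT c i (QT c j (pot c)) x"
  using PQT_slice[OF c smooth_pot[OF c], of "fst x" "snd x" i j] x
  by (auto simp: GT_def kform_def ddbar_def pot_def local_rep_def[abs_def])

lemma smooth_GT: assumes c: "c \<in> A" shows "smooth_on (T c) (\<lambda>x. GT c x $ i $ j)"
proof (rule smooth_on_cong)
  have "smooth_on (R c) (\<lambda>z. \<omega> c z $ i $ j)"
    using \<omega> c unfolding kahler_form_def real_form11_def by (intro smooth_on_nth) blast
  then show "smooth_on (T c) (\<lambda>x. \<omega> c (snd x) $ i $ j + PT c i (QT c j (pot c)) x)"
    by (intro smooth_on_add smooth_on_snd smooth_cd good_T smooth_pot c)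
qed (use GT_eq[OF c] in simp)

lemma field_T: assumes c: "c \<in> A" shows "metric_field (T c) (GT c)"
proof
  show "hermitian_pos (GT c x)" if "x \<in> T c" for x
    using metric_g[of "fst x"] c that unfolding metric11_def GT_def by auto
qed (rule good_T[OF c], rule smooth_GT[OF c])

lemma DT_of_real:
  assumes c: "c \<in> A" and u: "smooth_curve A u" and x: "x \<in> T c"
  shows "DT c (\<lambda>x. complex_of_real (u (fst x) (chart_inv c (snd x)))) x = complex_of_real (time_deriv u (fst x) (chart_inv c (snd x)))"
proof -
  let ?F = "\<lambda>x. u (fst x) (chart_inv c (snd x))"
  have "dd (T c) v (\<lambda>x. complex_of_real (?F x)) x = complex_of_real (dd (T c) v ?F x)" for v
    by (rule dd_linear_comp[OF good_T[OF c] smooth_curve_chart[OF u c] x bounded_linear_of_real])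
  moreover have "dd (T c) 0 (\<lambda>x. complex_of_real (?F x)) x = 0"
    using linear_0[OF has_derivative_linear[OF smooth_onD(1)[OF good_T[OF c] smooth_on_of_real[OF smooth_curve_chart[OF u c]] x]]] .
  ultimately show ?thesis using smooth_curve_derivative(2)[OF u c, of "fst x" "snd x"] x by (auto simp: cd_def)
qed

text \<open>The background form is constant in time, and the time derivative passes through both
  space derivatives of the potential.\<close>

lemma DT_GT:
  assumes c: "c \<in> A" and t: "t \<in> {0..1}" and z: "z \<in> R c"
  shows "DT c (\<lambda>x. GT c x $ i $ j) (t, z) = ddbar (time_deriv \<phi> t) c z $ i $ j"
proof -
  have x: "(t, z) \<in> T c" using t z by auto
  note G = good_T[OF c]
  let ?w = "\<lambda>x. \<omega> c (snd x) $ i $ j"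
  have sw0: "smooth_on (R c) (\<lambda>z. \<omega> c z $ i $ j)"
    using \<omega> c unfolding kahler_form_def real_form11_def by (intro smooth_on_nth) blast
  then have sw: "smooth_on (T c) ?w" by (rule smooth_on_snd)
  have w0: "DT c ?w (t, z) = 0"
  proof -
    have d: "(?w has_derivative (\<lambda>v. dd (R c) (snd v) (\<lambda>z. \<omega> c z $ i $ j) z)) (at (t, z) within T c)"
    proof (rule has_derivative_in_compose[where f=snd])
      show "(snd has_derivative snd) (at (t, z) within T c)" by (intro has_derivative_snd has_derivative_ident)
      show "((\<lambda>z. \<omega> c z $ i $ j) has_derivative (\<lambda>v. dd (R c) v (\<lambda>z. \<omega> c z $ i $ j) z)) (at (snd (t, z)) within snd ` T c)"
        using smooth_onD(1)[OF good_domain_open[OF chart_props(2)[OF c]] sw0 z] by (auto intro: has_derivative_subset)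
    qed
    have "dd (R c) 0 (\<lambda>z. \<omega> c z $ i $ j) z = 0"
      by (rule linear_0[OF has_derivative_linear[OF smooth_onD(1)[OF good_domain_open[OF chart_props(2)[OF c]] sw0 z]]])
    then show ?thesis unfolding cd_def dd_eqI[OF G x d] by simp
  qed
  have "DT c (\<lambda>x. GT c x $ i $ j) (t, z) = DT c (\<lambda>x. ?w x + PT c i (QT c j (pot c)) x) (t, z)"
    by (rule cd_cong[OF GT_eq[OF c] x])
  also have "\<dots> = DT c (PT c i (QT c j (pot c))) (t, z)"
    using cd_add[OF G sw _ x] w0 smooth_cd[OF G smooth_cd[OF G smooth_pot[OF c]]] by simp
  also have "\<dots> = PT c i (DT c (QT c j (pot c))) (t, z)" by (rule cd_commute[OF G smooth_cd[OF G smooth_pot[OF c]] x])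
  also have "\<dots> = PT c i (QT c j (DT c (pot c))) (t, z)" by (rule cd_cong[OF cd_commute[OF G smooth_pot[OF c]] x])
  also have "\<dots> = del i (delbar j (\<lambda>z. DT c (pot c) (t, z))) z" by (rule PQT_slice[OF c smooth_cd[OF G smooth_pot[OF c]] t z])
  also have "\<dots> = del i (delbar j (local_rep (time_deriv \<phi> t) c)) z"
    by (rule ddbar_cong[OF chart_props(2)[OF c] z])
       (use DT_of_real[OF c sc] t in \<open>auto simp: pot_def[abs_def] local_rep_def\<close>)
  finally show ?thesis by (simp add: ddbar_def)
qed

definition LT :: "('a, 'n) chart \<Rightarrow> real \<times> (complex^'n) \<Rightarrow> complex" where
  "LT c x = complex_of_real (ln (Re (det (GT c x))))"

definition ST :: "('a, 'n) chart \<Rightarrow> real \<times> (complex^'n) \<Rightarrow> complex" where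
  "ST c x = - (\<Sum>i\<in>UNIV. \<Sum>j\<in>UNIV. upper_metric (GT c x) $ i $ j * PT c i (QT c j (LT c)) x)"

lemma smooth_LT: "c \<in> A \<Longrightarrow> smooth_on (T c) (LT c)"
  unfolding LT_def[abs_def] by (rule metric_field.smooth_L[OF field_T])

lemma smooth_upper_T: "c \<in> A \<Longrightarrow> smooth_on (T c) (\<lambda>x. upper_metric (GT c x) $ i $ j)"
  by (rule metric_field.smooth_h[OF field_T])

lemma smooth_ST: "c \<in> A \<Longrightarrow> smooth_on (T c) (ST c)"
  unfolding ST_def[abs_def] by (intro smooth_on_minus smooth_on_sum smooth_on_mult smooth_upper_T smooth_cd good_T smooth_LT)

lemma ricci_T: "c \<in> A \<Longrightarrow> t \<in> {0..1} \<Longrightarrow> z \<in> R c \<Longrightarrow> PT c i (QT c j (LT c)) (t, z) = - ricci (g t) c z $ i $ j"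
  using PQT_slice[OF _ smooth_LT] by (simp add: ricci_def LT_def GT_def)

lemma ST_eq: "c \<in> A \<Longrightarrow> t \<in> {0..1} \<Longrightarrow> z \<in> R c \<Longrightarrow> ST c (t, z) = contr1 (g t) (ricci (g t)) c z"
  by (simp add: ST_def contr1_def ricci_T sum_negf GT_def)

lemma scalar_curvature_T:
  assumes "c \<in> A" "t \<in> {0..1}" "z \<in> R c"
  shows "scalar_curvature A (g t) (chart_inv c z) = Re (ST c (t, z))"
  using kahler_manifold.scalar_curvature_chart[OF km[OF assms(2)] assms(1,3)] ST_eq[OF assms] by simp

lemma smooth_curve_scalar: "smooth_curve A (\<lambda>t. scalar_curvature A (g t))"
  unfolding smooth_curve_def case_prod_unfold
proof
  fix c assume c: "c \<in> A"
  show "smooth_on (T c) (\<lambda>x. scalar_curvature A (g (fst x)) (chart_inv c (snd x)))"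
    by (rule smooth_on_cong[OF smooth_on_Re[OF smooth_ST[OF c]]]) (use scalar_curvature_T[OF c] in auto)
qed

lemma DT_LT:
  assumes c: "c \<in> A" and t: "t \<in> {0..1}" and z: "z \<in> R c"
  shows "DT c (LT c) (t, z) = laplacian (g t) (time_deriv \<phi> t) c z"
  using metric_field.cd_L[OF field_T[OF c], of "(t, z)" "((1, 0), 0)"] DT_GT[OF c t z] t z
  by (simp add: LT_def[abs_def] laplacian_def GT_def)

text \<open>Differentiating log det g in time gives the Laplacian of the velocity, hence the
  iterated Laplacian; differentiating the inverse metric gives the contraction of the Ricci form
  with the Hessian.\<close>

lemma DT_ST:
  assumes c: "c \<in> A" and t: "t \<in> {0..1}" and z: "z \<in> R c"
  shows "DT c (ST c) (t, z) = scal_variation (g t) (time_deriv \<phi> t) c z"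
proof -
  have x: "(t, z) \<in> T c" using t z by auto
  note G = good_T[OF c]
  let ?h = "\<lambda>i j x. upper_metric (GT c x) $ i $ j" and ?x = "(t, z)"
  have sPQ: "smooth_on (T c) (PT c i (QT c j (LT c)))" for i j by (intro smooth_cd G smooth_LT c)
  have comm: "DT c (PT c i (QT c j (LT c))) ?x = del i (delbar j (laplacian (g t) (time_deriv \<phi> t) c)) z" for i j
  proof -
    have "DT c (PT c i (QT c j (LT c))) ?x = PT c i (DT c (QT c j (LT c))) ?x" by (intro cd_commute G smooth_cd smooth_LT c x)
    also have "\<dots> = PT c i (QT c j (DT c (LT c))) ?x" by (rule cd_cong[OF cd_commute[OF G smooth_LT[OF c]] x])
    also have "\<dots> = del i (delbar j (\<lambda>z. DT c (LT c) (t, z))) z" by (rule PQT_slice[OF c smooth_cd[OF G smooth_LT[OF c]] t z])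
    also have "\<dots> = del i (delbar j (laplacian (g t) (time_deriv \<phi> t) c)) z"
      by (rule ddbar_cong[OF chart_props(2)[OF c] z DT_LT[OF c t]])
    finally show ?thesis .
  qed
  have "DT c (ST c) ?x = - (\<Sum>i\<in>UNIV. \<Sum>j\<in>UNIV. ?h i j ?x * DT c (PT c i (QT c j (LT c))) ?x + DT c (?h i j) ?x * PT c i (QT c j (LT c)) ?x)"
    unfolding ST_def[abs_def]
    by (simp add: cd_minus[OF G _ x] cd_sum[OF G _ _ x] cd_mult[OF G _ _ x] smooth_on_sum smooth_on_mult smooth_upper_T c sPQ)
  also have "\<dots> = - ((\<Sum>i\<in>UNIV. \<Sum>j\<in>UNIV. ?h i j ?x * del i (delbar j (laplacian (g t) (time_deriv \<phi> t) c)) z)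
     + (\<Sum>i\<in>UNIV. \<Sum>j\<in>UNIV. \<Sum>a\<in>UNIV. \<Sum>b\<in>UNIV. ?h i b ?x * ?h a j ?x * ricci (g t) c z $ i $ j * ddbar (time_deriv \<phi> t) c z $ a $ b))"
    unfolding comm metric_field.cd_h[OF field_T[OF c] x] DT_GT[OF c t z] ricci_T[OF c t z]
    by (simp add: sum.distrib sum_distrib_left sum_distrib_right sum_negf mult_ac)
  also have "(\<Sum>i\<in>UNIV. \<Sum>j\<in>UNIV. \<Sum>a\<in>UNIV. \<Sum>b\<in>UNIV. ?h i b ?x * ?h a j ?x * ricci (g t) c z $ i $ j * ddbar (time_deriv \<phi> t) c z $ a $ b)
     = contr2 (g t) (ricci (g t)) (ddbar (time_deriv \<phi> t)) c z"
    unfolding contr2_def GT_def by (simp, intro sum.cong refl sum3_swap13)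
  finally show ?thesis unfolding scal_variation_def by (simp add: GT_def)
qed

lemma time_deriv_scalar:
  assumes t: "t \<in> {0..1}"
  shows "time_deriv (\<lambda>t. scalar_curvature A (g t)) t p = Re (scalar_at A (scal_variation (g t) (time_deriv \<phi> t)) p)"
proof -
  let ?c = "chart_at A p" and ?z = "snd (chart_at A p) p"
  note c = chart_at_props(1)[of p]
  have z: "?z \<in> R ?c" and x: "(t, ?z) \<in> T ?c" using chart_at_props[of p] t by auto
  have "time_deriv (\<lambda>t. scalar_curvature A (g t)) t (chart_inv ?c ?z) =
     dd (T ?c) (1, 0) (\<lambda>x. scalar_curvature A (g (fst x)) (chart_inv ?c (snd x))) (t, ?z)"
    by (rule smooth_curve_derivative(2)[OF smooth_curve_scalar c t z])
  also have "\<dots> = dd (T ?c) (1, 0) (\<lambda>x. Re (ST ?c x)) (t, ?z)"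
    by (rule dd_cong[OF _ x]) (use scalar_curvature_T[OF c] in auto)
  also have "\<dots> = Re (dd (T ?c) (1, 0) (ST ?c) (t, ?z))"
    by (rule dd_linear_comp[OF good_T[OF c] smooth_ST[OF c] x bounded_linear_Re])
  also have "dd (T ?c) (1, 0) (ST ?c) (t, ?z) = DT ?c (ST ?c) (t, ?z)"
    using linear_0[OF has_derivative_linear[OF smooth_onD(1)[OF good_T[OF c] smooth_ST[OF c] x]]] by (simp add: cd_def)
  finally show ?thesis using DT_ST[OF c t z] chart_at_props[of p] by (simp add: scalar_at_def)
qed

end

section \<open>Time derivatives of integrals and of the K-energy\<close>

context kahler_curve
begin

lemma smooth_vdens_T: assumes c: "c \<in> A" shows "smooth_on (T c) (\<lambda>x. vdens (g (fst x)) c (snd x))"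
  unfolding vdens_def GT_def[symmetric]
  by (intro smooth_on_mult smooth_on_const smooth_on_Re metric_field.smooth_u[OF field_T[OF c]])

text \<open>Jacobi's formula in the time direction: the logarithmic derivative of the density is the
  trace of the velocity of the metric.\<close>

lemma vdens_derivative:
  assumes c: "c \<in> A" and t: "t \<in> {0..1}" and z: "z \<in> R c"
  shows "((\<lambda>s. vdens (g s) c z) has_real_derivative vdens (g t) c z * Re (laplacian (g t) (time_deriv \<phi> t) c z)) (at t within {0..1})"
proof -
  have x: "(t, z) \<in> T c" using t z by auto
  interpret M: metric_field "T c" "GT c" by (rule field_T[OF c])
  let ?u = "\<lambda>x. det (GT c x)"
  have dd0: "dd (T c) 0 ?u (t, z) = 0"
    by (rule linear_0[OF has_derivative_linear[OF smooth_onD(1)[OF M.good M.smooth_u x]]])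
  have "((\<lambda>s. ?u (s, z)) has_vector_derivative dd (T c) (1, 0) ?u (t, z)) (at t within {0..1})"
    by (rule time_derivative[OF chart_props(2)[OF c] M.smooth_u t z])
  then have "((\<lambda>s. Re (?u (s, z))) has_real_derivative Re (dd (T c) (1, 0) ?u (t, z))) (at t within {0..1})"
    unfolding has_real_derivative_iff_has_vector_derivative by (rule bounded_linear.has_vector_derivative[OF bounded_linear_Re])
  then have "((\<lambda>s. 2 ^ CARD('n) * Re (?u (s, z))) has_real_derivative 2 ^ CARD('n) * Re (dd (T c) (1, 0) ?u (t, z))) (at t within {0..1})"
    by (rule DERIV_cmult)
  moreover have "dd (T c) (1, 0) ?u (t, z) = ?u (t, z) * laplacian (g t) (time_deriv \<phi> t) c z"
  proof -
    have "cd (T c) ((1, 0), 0) ?u (t, z) = dd (T c) (1, 0) ?u (t, z)" unfolding cd_def using dd0 by simp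
    then show ?thesis using M.cd_u[OF x, of "((1, 0), 0)"] unfolding DT_GT[OF c t z] laplacian_def by (simp add: GT_def)
  qed
  moreover have "Im (?u (t, z)) = 0" by (rule hermitian_det_Im[OF M.herm[OF x]])
  ultimately show ?thesis by (simp add: vdens_def GT_def mult.assoc)
qed

abbreviation "lap t p \<equiv> Re (scalar_at A (laplacian (g t) (time_deriv \<phi> t)) p)"

lemma lap_chart:
  assumes c: "c \<in> A" and t: "t \<in> {0..1}" and z: "z \<in> R c"
  shows "lap t (chart_inv c z) = Re (laplacian (g t) (time_deriv \<phi> t) c z)"
proof -
  interpret kahler_manifold A "g t" by (rule km[OF t])
  have "scalar_field (laplacian (g t) (time_deriv \<phi> t))"
    unfolding laplacian_contr1 by (intro scalar_contr1 met tensor_ddbar smooth_curve_slice smooth_curve_time_deriv sc t)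
  then show ?thesis by (simp add: scalar_at_inv c z)
qed

lemma continuous_curve: assumes "smooth_curve A u" "t \<in> {0..1}" shows "continuous_on UNIV (u t)"
  by (rule continuous_C1[OF smooth_C1[OF smooth_curve_slice[OF assms]]])

lemma continuous_lap: assumes t: "t \<in> {0..1}" shows "continuous_on UNIV (lap t)"
proof (rule continuous_manifold)
  fix c assume c: "c \<in> A"
  have "continuous_on (R c) (\<lambda>z. Re (DT c (LT c) (t, z)))"
    by (intro continuous_on_Re smooth_on_continuous smooth_on_slice[OF _ t] smooth_cd good_T smooth_LT c)
  then show "continuous_on (R c) (\<lambda>z. lap t (chart_inv c z))"
    by (rule continuous_on_eq) (simp add: lap_chart[OF c t] DT_LT[OF c t])
qed

text \<open>The partition of unity is independent of time, so each piece is an integral over a fixed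
  chart range with fixed compact support, to which \<open>leibniz_compact_support\<close> applies.
  The term with \<open>lap\<close> is the derivative of the volume density.\<close>

lemma integral_derivative:
  assumes u: "smooth_curve A u" and t: "t \<in> {0..1}"
  shows "((\<lambda>t. \<integral>p. u t p \<partial>vol (g t)) has_real_derivative (\<integral>p. time_deriv u t p + u t p * lap t p \<partial>vol (g t))) (at t within {0..1})"
proof -
  obtain I :: "'a set" and \<rho> where I: "finite I" and \<rho>: "\<And>p. p \<in> I \<Longrightarrow> C1_fun (\<rho> p)" "\<And>p. p \<in> I \<Longrightarrow> supported (chart_at A p) (\<rho> p)"
    "\<And>q. (\<Sum>p\<in>I. \<rho> p q) = (1::real)" by (rule partition_of_unity) blast
  let ?u' = "\<lambda>t p. time_deriv u t p + u t p * lap t p"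
  have cu': "continuous_on UNIV (?u' t)" if "t \<in> {0..1}" for t
    by (intro continuous_intros continuous_curve smooth_curve_time_deriv u continuous_lap that)
  have split: "(\<integral>q. h q \<partial>vol (g t)) = (\<Sum>p\<in>I. \<integral>q. \<rho> p q * h q \<partial>vol (g t))"
    if h: "continuous_on UNIV h" and t: "t \<in> {0..1}" for h t
  proof -
    have "(\<integral>q. h q \<partial>vol (g t)) = (\<integral>q. (\<Sum>p\<in>I. \<rho> p q * h q) \<partial>vol (g t))"
      by (simp add: sum_distrib_right[symmetric] \<rho>(3))
    also have "\<dots> = (\<Sum>p\<in>I. \<integral>q. \<rho> p q * h q \<partial>vol (g t))"
      by (rule Bochner_Integration.integral_sum) (intro integrable_vol metric_g t continuous_intros h continuous_C1 \<rho>(1))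
    finally show ?thesis .
  qed
  have piece: "((\<lambda>t. \<integral>q. \<rho> p q * u t q \<partial>vol (g t)) has_real_derivative (\<integral>q. \<rho> p q * ?u' t q \<partial>vol (g t))) (at t within {0..1})"
    if p: "p \<in> I" for p
  proof -
    let ?c = "chart_at A p"
    have c: "?c \<in> A" by (rule chart_at_props)
    note W = chart_props(2)[OF c]
    obtain K where K: "compact K" "K \<subseteq> R ?c" "\<And>q. \<rho> p q \<noteq> 0 \<Longrightarrow> q \<in> fst ?c \<and> snd ?c q \<in> K"
      using \<rho>(2)[OF p] unfolding supported_def by blast
    define f where "f t z = \<rho> p (chart_inv ?c z) * (vdens (g t) ?c z * u t (chart_inv ?c z))" for t z
    define f' where "f' t z = \<rho> p (chart_inv ?c z) * (vdens (g t) ?c z * ?u' t (chart_inv ?c z))" for t z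
    have \<rho>0: "\<rho> p (chart_inv ?c z) = 0" if "z \<in> R ?c" "z \<notin> K" for z
      using K(3)[of "chart_inv ?c z"] that c by auto
    have c\<rho>: "continuous_on (T ?c) (\<lambda>x. \<rho> p (chart_inv ?c (snd x)))"
      by (rule continuous_on_compose2[OF Ck_on_imp_continuous[OF \<rho>(1)[OF p, unfolded C1_fun_def, rule_format, OF c]]])
         (auto intro!: continuous_intros)
    have chart_int: "(\<integral>q. \<rho> p q * h q \<partial>vol (g t)) = (\<integral>z. indicator (R ?c) z * (\<rho> p (chart_inv ?c z) * (vdens (g t) ?c z * h (chart_inv ?c z))) \<partial>lborel)"
      if h: "continuous_on UNIV h" and t: "t \<in> {0..1}" for h t
    proof -
      have "(\<integral>q. \<rho> p q * h q \<partial>vol (g t)) = (\<integral>z. (indicator (R ?c) z * vdens (g t) ?c z) *\<^sub>R (\<rho> p (chart_inv ?c z) * h (chart_inv ?c z)) \<partial>lborel)"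
        by (rule integral_chart[OF metric_g[OF t] c])
           (rule borel_measurable_continuous_onI[OF continuous_on_mult[OF continuous_C1[OF \<rho>(1)[OF p]] h]], use K(3) in auto)
      then show ?thesis by (simp add: mult_ac)
    qed
    have "((\<lambda>t. \<integral>z. indicator (R ?c) z * f t z \<partial>lborel) has_real_derivative (\<integral>z. indicator (R ?c) z * f' t z \<partial>lborel)) (at t within {0..1})"
    proof (rule leibniz_compact_support[OF W K(1,2)])
      show "continuous_on (T ?c) (\<lambda>(t, z). f t z)"
        unfolding f_def case_prod_unfold
        by (intro continuous_on_mult c\<rho> smooth_on_continuous smooth_vdens_T smooth_curve_chart u c)
      have "continuous_on (T ?c) (\<lambda>x. \<rho> p (chart_inv ?c (snd x)) * (vdens (g (fst x)) ?c (snd x) *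
          (time_deriv u (fst x) (chart_inv ?c (snd x)) + u (fst x) (chart_inv ?c (snd x)) * Re (DT ?c (LT ?c) x))))"
        by (intro continuous_on_mult continuous_on_add continuous_on_Re c\<rho> smooth_on_continuous smooth_vdens_T smooth_curve_chart
            smooth_curve_time_deriv u c smooth_cd good_T smooth_LT)
      then show "continuous_on (T ?c) (\<lambda>(t, z). f' t z)"
        by (rule continuous_on_eq) (auto simp: f'_def lap_chart[OF c] DT_LT[OF c])
      show "f t z = 0" "f' t z = 0" if "z \<in> R ?c" "z \<notin> K" for t z
        using \<rho>0[OF that] by (simp_all add: f_def f'_def)
      show "((\<lambda>s. f s z) has_real_derivative f' t z) (at t within {0..1})" if t: "t \<in> {0..1}" and z: "z \<in> R ?c" for t z
      proof -
        have "((\<lambda>s. vdens (g s) ?c z * u s (chart_inv ?c z)) has_real_derivative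
           (vdens (g t) ?c z * Re (laplacian (g t) (time_deriv \<phi> t) ?c z)) * u t (chart_inv ?c z) + time_deriv u t (chart_inv ?c z) * vdens (g t) ?c z) (at t within {0..1})"
          by (rule DERIV_mult[OF vdens_derivative[OF c t z] smooth_curve_derivative(1)[OF u c t z]])
        from DERIV_cmult[OF this, of "\<rho> p (chart_inv ?c z)"] show ?thesis
          unfolding f_def by (rule DERIV_cong) (simp add: f'_def lap_chart[OF c t z] algebra_simps)
      qed
    qed (rule t)
    then have "((\<lambda>t. \<integral>z. indicator (R ?c) z * f t z \<partial>lborel) has_real_derivative (\<integral>q. \<rho> p q * ?u' t q \<partial>vol (g t))) (at t within {0..1})"
      using chart_int[OF cu'[OF t] t] by (simp add: f'_def)
    then show ?thesis
      by (rule has_field_derivative_transform_within[OF _ zero_less_one t])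
         (use chart_int[OF continuous_curve[OF u]] in \<open>simp add: f_def\<close>)
  qed
  have "((\<lambda>t. \<Sum>p\<in>I. \<integral>q. \<rho> p q * u t q \<partial>vol (g t)) has_real_derivative (\<Sum>p\<in>I. \<integral>q. \<rho> p q * ?u' t q \<partial>vol (g t))) (at t within {0..1})"
    by (rule DERIV_sum) (rule piece)
  then have "((\<lambda>t. \<Sum>p\<in>I. \<integral>q. \<rho> p q * u t q \<partial>vol (g t)) has_real_derivative (\<integral>q. ?u' t q \<partial>vol (g t))) (at t within {0..1})"
    using split[OF cu'[OF t] t] by simp
  then show ?thesis
    by (rule has_field_derivative_transform_within[OF _ zero_less_one t])
       (use split[OF continuous_curve[OF u]] in simp)
qed

text \<open>At a metric of constant scalar curvature the acceleration of the curve and the variation of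
  the volume form drop out of the second derivative.\<close>

lemma K_energy_second_derivative:
  assumes t0: "t0 \<in> {0..1}" and S: "constant_scalar_curvature A (g t0)"
  shows "((\<lambda>t. - (\<integral>p. time_deriv \<phi> t p * (scalar_curvature A (g t) p - average_scalar_curvature A (g t)) \<partial>vol (g t)))
    has_real_derivative - (\<integral>p. time_deriv \<phi> t0 p * Re (scalar_at A (scal_variation (g t0) (time_deriv \<phi> t0)) p) \<partial>vol (g t0))) (at t0 within {0..1})"
proof -
  let ?\<psi> = "time_deriv \<phi>" and ?S = "\<lambda>t. scalar_curvature A (g t)" and ?\<mu> = "\<lambda>t. vol (g t)"
  let ?V = "scalar_at A (scal_variation (g t0) (time_deriv \<phi> t0))"
  note s\<psi> = smooth_curve_time_deriv[OF sc] and sS = smooth_curve_scalar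
  have s1: "smooth_curve A (\<lambda>t p. 1)" by (simp add: smooth_curve_def case_prod_unfold)
  obtain k where k: "\<And>p. ?S t0 p = k" using S unfolding constant_scalar_curvature_def by blast
  \<comment> \<open>Writing the average as \<open>I2 / I3\<close> leaves four integrals of smooth
    curves of functions, each differentiable by \<open>integral_derivative\<close>.\<close>
  define I1 where "I1 t = (\<integral>p. ?\<psi> t p * ?S t p \<partial>?\<mu> t)" for t
  define I2 where "I2 t = (\<integral>p. ?S t p \<partial>?\<mu> t)" for t
  define I3 where "I3 t = (\<integral>p. (1::real) \<partial>?\<mu> t)" for t
  define I4 where "I4 t = (\<integral>p. ?\<psi> t p \<partial>?\<mu> t)" for t
  have I3_pos: "I3 t > 0" if "t \<in> {0..1}" for t
    using vol_pos[OF metric_g[OF that]] metric_g[OF that] by (simp add: I3_def)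
  have F: "- (\<integral>p. ?\<psi> t p * (?S t p - average_scalar_curvature A (g t)) \<partial>?\<mu> t) = - (I1 t - I2 t / I3 t * I4 t)"
    if t: "t \<in> {0..1}" for t
  proof -
    let ?a = "average_scalar_curvature A (g t)"
    have a: "?a = I2 t / I3 t" unfolding average_scalar_curvature_def I2_def I3_def using metric_g[OF t] by simp
    have i: "integrable (?\<mu> t) (\<lambda>p. ?\<psi> t p * ?S t p)" "integrable (?\<mu> t) (?\<psi> t)"
      by (intro integrable_vol metric_g t continuous_intros continuous_curve s\<psi> sS)+
    have "(\<integral>p. ?\<psi> t p * (?S t p - ?a) \<partial>?\<mu> t) = (\<integral>p. ?\<psi> t p * ?S t p - ?a * ?\<psi> t p \<partial>?\<mu> t)"
      by (simp add: algebra_simps)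
    also have "\<dots> = I1 t - ?a * I4 t" using i by (simp add: I1_def I4_def)
    finally show ?thesis unfolding a by simp
  qed
  note km = km[OF t0]
  have smooth\<psi>: "smooth_function A (?\<psi> t0)" by (rule smooth_curve_slice[OF s\<psi> t0])
  have Sdot: "time_deriv ?S t0 p = Re (?V p)" for p by (rule time_deriv_scalar[OF t0])
  \<comment> \<open>The variation of the scalar curvature has integral zero at \<open>t0\<close>, so
    there \<open>I2\<close> changes only through the volume, at \<open>k\<close> times the rate of
    \<open>I3\<close>.\<close>
  have zero: "(\<integral>p. Re (?V p) \<partial>?\<mu> t0) = 0" by (rule kahler_manifold.scal_variation_integrals(2)[OF km S smooth\<psi>])
  have cS: "continuous_on UNIV (\<lambda>p. Re (?V p))"
    using continuous_curve[OF smooth_curve_time_deriv[OF sS] t0] by (simp add: Sdot[symmetric] cong: continuous_on_cong)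
  note int = integrable_vol[OF metric_g[OF t0]]
  have c\<psi>: "continuous_on UNIV (?\<psi> t0)" "continuous_on UNIV (time_deriv ?\<psi> t0)" "continuous_on UNIV (lap t0)"
    by (intro continuous_curve s\<psi> smooth_curve_time_deriv t0 continuous_lap)+
  define D3 where "D3 = (\<integral>p. lap t0 p \<partial>?\<mu> t0)"
  define D4 where "D4 = (\<integral>p. time_deriv ?\<psi> t0 p + ?\<psi> t0 p * lap t0 p \<partial>?\<mu> t0)"
  define X where "X = (\<integral>p. ?\<psi> t0 p * Re (?V p) \<partial>?\<mu> t0)"
  have td1: "time_deriv (\<lambda>t p. ?\<psi> t p * ?S t p) t0 p = time_deriv ?\<psi> t0 p * k + ?\<psi> t0 p * Re (?V p)" for p
  proof -
    have 1: "((\<lambda>s. ?\<psi> s p * ?S s p) has_real_derivative time_deriv ?\<psi> t0 p * ?S t0 p + time_deriv ?S t0 p * ?\<psi> t0 p) (at t0 within {0..1})"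
      by (rule DERIV_mult[OF smooth_curve_derivative_at[OF s\<psi> t0] smooth_curve_derivative_at[OF sS t0]])
    have 2: "((\<lambda>s. ?\<psi> s p * ?S s p) has_real_derivative time_deriv (\<lambda>t p. ?\<psi> t p * ?S t p) t0 p) (at t0 within {0..1})"
      by (rule smooth_curve_derivative_at[OF smooth_curve_mult[OF s\<psi> sS] t0])
    have "time_deriv (\<lambda>t p. ?\<psi> t p * ?S t p) t0 p = time_deriv ?\<psi> t0 p * ?S t0 p + time_deriv ?S t0 p * ?\<psi> t0 p"
      by (rule vector_derivative_unique_within_closed_interval[of 0 1 t0 "\<lambda>s. ?\<psi> s p * ?S s p"])
         (use 1 2 t0 in \<open>simp_all add: has_real_derivative_iff_has_vector_derivative\<close>)
    then show ?thesis by (simp add: Sdot k mult.commute)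
  qed
  have td0: "time_deriv (\<lambda>t p. 1) t0 p = 0" for p :: 'a
  proof -
    have "((\<lambda>s. 1 :: real) has_real_derivative time_deriv (\<lambda>t p. 1) t0 p) (at t0 within {0..1})"
      by (rule smooth_curve_derivative_at[OF s1 t0])
    moreover have "((\<lambda>s. 1 :: real) has_real_derivative 0) (at t0 within {0..1})" by simp
    ultimately show ?thesis
      by (intro vector_derivative_unique_within_closed_interval[of 0 1 t0 "\<lambda>s. 1 :: real"])
         (use t0 in \<open>simp_all add: has_real_derivative_iff_has_vector_derivative\<close>)
  qed
  have d1: "(I1 has_real_derivative (k * D4 + X)) (at t0 within {0..1})"
  proof -
    have "(\<integral>p. time_deriv (\<lambda>t p. ?\<psi> t p * ?S t p) t0 p + ?\<psi> t0 p * ?S t0 p * lap t0 p \<partial>?\<mu> t0)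
      = (\<integral>p. k * (time_deriv ?\<psi> t0 p + ?\<psi> t0 p * lap t0 p) + ?\<psi> t0 p * Re (?V p) \<partial>?\<mu> t0)"
      by (simp add: td1 k algebra_simps)
    also have "\<dots> = (\<integral>p. k * (time_deriv ?\<psi> t0 p + ?\<psi> t0 p * lap t0 p) \<partial>?\<mu> t0) + X"
      unfolding X_def by (intro Bochner_Integration.integral_add int continuous_intros c\<psi> cS)
    also have "\<dots> = k * D4 + X" by (simp add: D4_def)
    finally show ?thesis using integral_derivative[OF smooth_curve_mult[OF s\<psi> sS] t0] by (simp add: I1_def[abs_def])
  qed
  have d2: "(I2 has_real_derivative (k * D3)) (at t0 within {0..1})"
  proof -
    have "(\<integral>p. time_deriv ?S t0 p + ?S t0 p * lap t0 p \<partial>?\<mu> t0) = (\<integral>p. Re (?V p) + k * lap t0 p \<partial>?\<mu> t0)"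
      by (simp add: Sdot k)
    also have "\<dots> = (\<integral>p. Re (?V p) \<partial>?\<mu> t0) + (\<integral>p. k * lap t0 p \<partial>?\<mu> t0)"
      by (intro Bochner_Integration.integral_add int continuous_intros c\<psi> cS)
    also have "\<dots> = k * D3" by (simp add: zero D3_def)
    finally show ?thesis using integral_derivative[OF sS t0] by (simp add: I2_def[abs_def])
  qed
  have d3: "(I3 has_real_derivative D3) (at t0 within {0..1})"
    using integral_derivative[OF s1 t0] by (simp add: I3_def[abs_def] td0 D3_def)
  have d4: "(I4 has_real_derivative D4) (at t0 within {0..1})"
    using integral_derivative[OF s\<psi> t0] by (simp add: I4_def[abs_def] D4_def)
  have I2k: "I2 t0 = k * I3 t0" by (simp add: I2_def I3_def k)
  have nz: "I3 t0 \<noteq> 0" using I3_pos[OF t0] by simp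
  have "((\<lambda>t. - (I1 t - I2 t / I3 t * I4 t)) has_real_derivative
     - ((k * D4 + X) - ((k * D3 * I3 t0 - I2 t0 * D3) / (I3 t0 * I3 t0) * I4 t0 + D4 * (I2 t0 / I3 t0)))) (at t0 within {0..1})"
    by (intro DERIV_minus DERIV_diff DERIV_mult DERIV_divide d1 d2 d3 d4 nz)
  \<comment> \<open>As \<open>I2\<close> equals \<open>k * I3\<close> at \<open>t0\<close>, the
    derivative of the quotient vanishes, and \<open>k * D4\<close>, which contains the acceleration,
    cancels against the same contribution of the average. Only \<open>X\<close> is left.\<close>
  moreover have "- ((k * D4 + X) - ((k * D3 * I3 t0 - I2 t0 * D3) / (I3 t0 * I3 t0) * I4 t0 + D4 * (I2 t0 / I3 t0))) = - X"
    using nz by (simp add: I2k)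
  ultimately have "((\<lambda>t. - (I1 t - I2 t / I3 t * I4 t)) has_real_derivative - X) (at t0 within {0..1})" by (simp only:)
  then show ?thesis unfolding X_def
    by (rule has_field_derivative_transform_within[OF _ zero_less_one t0]) (simp add: F)
qed

end

theorem proposition3p23:
  fixes A :: "('a::{t2_space, second_countable_topology}, 'n::finite) chart set"
    and \<omega> :: "('a, 'n) form11"
    and \<nu> :: "('a \<Rightarrow> real) \<Rightarrow> real"
    and \<phi> :: "real \<Rightarrow> 'a \<Rightarrow> real"
    and t0 :: real
  assumes "compact (UNIV :: 'a set)"
    and "connected (UNIV :: 'a set)"
    and "holomorphic_atlas A"
    and "kahler_form A \<omega>"
    and "K_energy A \<omega> \<nu>"
    and "dirichlet_geodesic A \<omega> \<phi>"
    and "t0 \<in> {0..1}"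
    and "constant_scalar_curvature A (kform \<omega> (\<phi> t0))"
  shows "\<exists>\<nu>' \<nu>''.
     (\<forall>t\<in>{0..1}. ((\<lambda>s. \<nu> (\<phi> s)) has_real_derivative \<nu>' t) (at t within {0..1})) \<and>
     (\<nu>' has_real_derivative \<nu>'') (at t0 within {0..1}) \<and>
     \<nu>'' \<ge> 0"
proof -
  have curve: "smooth_curve_in_potentials A \<omega> \<phi>" using assms(6) unfolding dirichlet_geodesic_def by blast
  interpret kahler_curve A \<omega> \<phi> by unfold_locales (use assms curve in auto)
  have "smooth_function A (time_deriv \<phi> t0)"
    by (rule smooth_curve_slice[OF smooth_curve_time_deriv[OF sc] assms(7)])
  then have "0 \<le> - (\<integral>p. time_deriv \<phi> t0 p * Re (scalar_at A (scal_variation (g t0) (time_deriv \<phi> t0)) p) \<partial>vol (g t0))"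
    using kahler_manifold.scal_variation_integrals(1)[OF km[OF assms(7)] assms(8)] by simp
  moreover have "\<forall>t\<in>{0..1}. ((\<lambda>s. \<nu> (\<phi> s)) has_real_derivative
      - (\<integral>p. time_deriv \<phi> t p * (scalar_curvature A (g t) p - average_scalar_curvature A (g t)) \<partial>vol (g t))) (at t within {0..1})"
    using assms(5) curve unfolding K_energy_def by blast
  ultimately show ?thesis using K_energy_second_derivative[OF assms(7,8)] by (intro exI conjI)
qed

end
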